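(* If $T\in\mathcal{D}_H'(\mathbb{R}^d)$, then $L_T$ is a Hadamard operator on $\mathcal{D}'(\mathbb{R}^d)$, i.e. $L_T\in\mathcal{M}(\mathbb{R}^d)$, and its eigenvalues, defined by $L_T(x^\alpha)=m_\alpha x^\alpha$, are $m_\alpha=T_x\Big(\frac{\sigma(x)}{x^{\alpha+\mathbf 1}}\Big)$ for $\alpha\in\mathbb{N}_0^d$.
   Context: $\mathbb{R}_*=\mathbb{R}\setminus\{0\}$; $xy$ is the coordinatewise product; $\mathbf 1=(1,\dots,1)$; $\sigma(x)=\prod_j x_j/|x_j|$ for $x\in\mathbb{R}_*^d$. $\mathcal{D}_H'(\mathbb{R}^d)$ is the set of $T\in\mathcal{D}'(\mathbb{R}^d)$ such that for every $\varphi\in\mathcal{D}(\mathbb{R}^d)$ the function $y\mapsto T_\xi\varphi(\xi y)$, $y\in\mathbb{R}_*^d$, is the restriction of a function $M_T\varphi\in\mathcal{D}(\mathbb{R}^d)$; for such $T$, $L_T(S)=S\star T$, $(S\star T)\varphi=S(M_T\varphi)$. Every $T\in\mathcal{D}_H'(\mathbb{R}^d)$ has support in some $W_\varepsilon=\{x:\min_j|x_j|\ge\varepsilon\}$ and can be written as a finite sum of Euler derivatives $\theta^\beta t_\beta$ ($\theta_j=x_j\partial_j$) of functions $t_\beta$ with $(1+|x|^2)^{k/2}t_\beta$ bounded for arbitrary prescribed $k$; the pairing $T_x(\sigma(x)x^{-\alpha-\mathbf 1})$ is understood via such a representation, i.e. $\sum_\beta\int t_\beta(x)\,(\theta^{\beta})^*\big(\sigma(x)x^{-\alpha-\mathbf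 1}\big)\,dx$. $\mathcal{M}(\mathbb{R}^d)$ is the set of continuous linear operators on $\mathcal{D}'(\mathbb{R}^d)$ admitting every monomial $x^\alpha$ as eigenvector. *)

theory Defs
  imports "HOL-Analysis.Analysis"
begin

type_synonym 'd tfun = "real^'d \<Rightarrow> complex"
type_synonym 'd distr = "'d tfun \<Rightarrow> complex"

definition pd :: "'d::finite \<Rightarrow> 'd tfun \<Rightarrow> 'd tfun" where
  "pd j f = (\<lambda>x. vector_derivative (\<lambda>s::real. f (x + s *\<^sub>R axis j 1)) (at 0))"

definition dl :: "'d::finite list \<Rightarrow> 'd tfun \<Rightarrow> 'd tfun" where
  "dl js f = foldr pd js f"

definition smooth_fun :: "'d::finite tfun \<Rightarrow> bool" where
  "smooth_fun f \<longleftrightarrow> (\<forall>js. continuous_on UNIV (dl js f) \<and>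
      (\<forall>j x. (\<lambda>s::real. dl js f (x + s *\<^sub>R axis j 1)) differentiable (at 0)))"

definition test :: "'d::finite tfun \<Rightarrow> bool" where
  "test f \<longleftrightarrow> smooth_fun f \<and> bounded {x. f x \<noteq> 0}"

definition dconv :: "(nat \<Rightarrow> 'd::finite tfun) \<Rightarrow> 'd tfun \<Rightarrow> bool" where
  "dconv fs f \<longleftrightarrow> (\<forall>n. test (fs n)) \<and> test f \<and>
     (\<exists>K. compact K \<and> (\<forall>n. {x. fs n x \<noteq> 0} \<subseteq> K)) \<and>
     (\<forall>js. uniform_limit UNIV (\<lambda>n. dl js (fs n)) (dl js f) sequentially)"

text \<open>Distributions: (sequentially) continuous linear functionals on D(R^d),
  normalised to be 0 outside the test functions.\<close>
definition distr :: "'d::finite distr \<Rightarrow> bool" where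
  "distr T \<longleftrightarrow> (\<forall>f. \<not> test f \<longrightarrow> T f = 0) \<and>
     (\<forall>f g a b. test f \<longrightarrow> test g \<longrightarrow> T (\<lambda>x. a * f x + b * g x) = a * T f + b * T g) \<and>
     (\<forall>fs f. dconv fs f \<longrightarrow> (\<lambda>n. T (fs n)) \<longlonglongrightarrow> T f)"

definition Rstar :: "(real^'d::finite) set" where
  "Rstar = {y. \<forall>j. y $ j \<noteq> 0}"

definition dil :: "real^'d::finite \<Rightarrow> real^'d \<Rightarrow> real^'d" where
  "dil x y = (\<chi> j. x $ j * y $ j)"

definition DH :: "'d::finite distr \<Rightarrow> bool" where
  "DH T \<longleftrightarrow> distr T \<and> (\<forall>f. test f \<longrightarrow>
      (\<exists>g. test g \<and> (\<forall>y\<in>Rstar. g y = T (\<lambda>\<xi>. f (dil \<xi> y)))))"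

definition MT :: "'d::finite distr \<Rightarrow> 'd tfun \<Rightarrow> 'd tfun" where
  "MT T f = (SOME g. test g \<and> (\<forall>y\<in>Rstar. g y = T (\<lambda>\<xi>. f (dil \<xi> y))))"

definition mconv :: "'d::finite distr \<Rightarrow> 'd distr \<Rightarrow> 'd distr" where
  "mconv S T = (\<lambda>f. if test f then S (MT T f) else 0)"

definition LT :: "'d::finite distr \<Rightarrow> 'd distr \<Rightarrow> 'd distr" where
  "LT T = (\<lambda>S. mconv S T)"

definition mono :: "('d::finite \<Rightarrow> nat) \<Rightarrow> 'd distr" where
  "mono \<alpha> = (\<lambda>f. if test f then
      (LINT x|lborel. complex_of_real (\<Prod>j\<in>UNIV. (x $ j) ^ (\<alpha> j)) * f x) else 0)"

text \<open>Hadamard operators: continuous (weak-star topology of D', realised as the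
  subspace topology of the product topology) linear operators on D' having every
  monomial as eigenvector.\<close>
definition hadamard :: "('d::finite distr \<Rightarrow> 'd distr) \<Rightarrow> bool" where
  "hadamard L \<longleftrightarrow> (\<forall>S. distr S \<longrightarrow> distr (L S)) \<and>
     (\<forall>S R a b. distr S \<longrightarrow> distr R \<longrightarrow>
        L (\<lambda>f. a * S f + b * R f) = (\<lambda>f. a * L S f + b * L R f)) \<and>
     continuous_on {S. distr S} L \<and>
     (\<forall>\<alpha>. \<exists>m. L (mono \<alpha>) = (\<lambda>f. m * mono \<alpha> f))"

text \<open>Euler operators theta_j = x_j d_j and their formal adjoints -d_j(x_j . ).\<close>
definition euler_adj :: "'d::finite \<Rightarrow> 'd tfun \<Rightarrow> 'd tfun" where
  "euler_adj j f = (\<lambda>x. - pd j (\<lambda>y. complex_of_real (y $ j) * f y) x)"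

text \<open>Adjoint of theta^bs = theta_{b1} ... theta_{bn}.\<close>
definition euler_adj_list :: "'d::finite list \<Rightarrow> 'd tfun \<Rightarrow> 'd tfun" where
  "euler_adj_list bs f = foldr euler_adj (rev bs) f"

definition sgx :: "('d::finite \<Rightarrow> nat) \<Rightarrow> 'd tfun" where
  "sgx \<alpha> = (\<lambda>x. complex_of_real (\<Prod>j\<in>UNIV. sgn (x $ j) / (x $ j) ^ (\<alpha> j + 1)))"

text \<open>Admissible representation T = sum of theta^bs t, t supported in some W_eps,
  with (1+|x|^2)^(k/2) t bounded for k = d+1.\<close>
definition admissible_rep :: "'d::finite distr \<Rightarrow> ('d list \<times> 'd tfun) list \<Rightarrow> bool" where
  "admissible_rep T R \<longleftrightarrow>
     (\<exists>\<epsilon>>0. \<forall>(bs, t)\<in>set R. t \<in> borel_measurable lborel \<and>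
        (\<forall>x. (\<exists>j. \<bar>x $ j\<bar> < \<epsilon>) \<longrightarrow> t x = 0) \<and>
        (\<exists>C. \<forall>x. (1 + (norm x)\<^sup>2) powr (real (CARD('d) + 1) / 2) * cmod (t x) \<le> C)) \<and>
     (\<forall>f. test f \<longrightarrow>
        T f = sum_list (map (\<lambda>(bs, t). LINT x|lborel. t x * euler_adj_list bs f x) R))"

definition rep_val :: "('d::finite list \<times> 'd tfun) list \<Rightarrow> 'd tfun \<Rightarrow> complex" where
  "rep_val R g = sum_list (map (\<lambda>(bs, t). LINT x|lborel. t x * euler_adj_list bs g x) R)"

definition hpair :: "'d::finite distr \<Rightarrow> 'd tfun \<Rightarrow> complex" where
  "hpair T g = (SOME c. \<exists>R. admissible_rep T R \<and> c = rep_val R g)"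

end

theory Submission
  imports Defs
begin

text \<open>
  Uniform boundedness for test functions supported in a fixed bounded set shows that \<open>MT T\<close> is
  sequentially continuous, which makes \<open>LT T\<close> a continuous operator on distributions, and that \<open>T\<close>
  vanishes on test functions supported near a coordinate hyperplane.

  If \<open>f\<close> is supported away from the coordinate hyperplanes, then \<open>MT T f\<close> is flat on them: \<open>MT T\<close>
  commutes with the Euler operator in direction \<open>j\<close>, the l-th derivative at \<open>y $ j = 0\<close> annihilates
  the range of that operator minus \<open>l\<close>, and up to parity \<open>f\<close> lies in this range. Hence
  \<open>MT T f (1/x)\<close> decays faster than any power of \<open>x\<close>.

  The point mass at \<open>1\<close> is a finite sum of Euler derivatives of kernels supported in the cube
  \<open>[1,2]^d\<close> and as often differentiable as desired. Applying it to \<open>MT T h\<close>, whose value at \<open>1\<close> is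
  \<open>T h\<close>, and moving \<open>MT T\<close> from \<open>h\<close> to the kernel by Fubini turns every kernel into a decaying
  function, so \<open>T\<close> has an admissible representation. For any such representation, Fubini and the
  substitution \<open>y \<mapsto> y / x\<close> evaluate \<open>LT T\<close> on monomials; in particular the pairing with
  \<open>sgx \<alpha>\<close> does not depend on the representation.
\<close>

subsection \<open>Smooth functions and test functions\<close>

text \<open>The obstacle is a mismatch of regularity. The point mass cannot be a finite sum of Euler
  derivatives of smooth compactly supported kernels, since such a sum would be a smooth function;
  but \<open>MT T\<close> acts only on test functions. It therefore has to be extended by continuity
  to kernels with finitely many derivatives. This is not circular because of the order of the
  choices: integrability fixes the decay exponent d + 1, uniform boundedness turns that exponent
  into an order m of a C^m norm, and only then is the parametrix chosen, with kernels that are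
  limits in C^m of test functions. The cube \<open>[1,2]^d\<close> is convenient because inversion
  maps it to \<open>[1/2,1]^d\<close>: no signs occur in the kernels, and their inverted forms live
  away from the hyperplanes, where flatness of the image is available. Parity enters the flatness
  proof because a compactly supported primitive along a line exists only if the integral over the
  line vanishes, and oddness guarantees this.\<close>

lemma dl_Nil [simp]: "dl [] f = f" by (simp add: dl_def)
lemma dl_Cons: "dl (j # js) f = pd j (dl js f)" by (simp add: dl_def)
lemma dl_append: "dl (is @ js) f = dl is (dl js f)" by (simp add: dl_def)

lemma pd_eqI:
  assumes "((\<lambda>s::real. f (x + s *\<^sub>R axis j 1)) has_vector_derivative v) (at 0)"
  shows "pd j f x = v"
  using assms by (simp add: pd_def vector_derivative_at)

text \<open>Partial derivatives of members of \<open>S\<close> stay in \<open>S\<close>, so every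
  \<open>dl js f\<close> does, and all clauses of \<open>smooth_fun\<close> can be read off from
  \<open>S\<close>. Proving smoothness then means naming a family closed under differentiation; no
  formula for higher derivatives is required.\<close>

lemma smooth_coinduct:
  assumes "f \<in> S" and cont: "\<And>g. g \<in> S \<Longrightarrow> continuous_on UNIV g"
    and der: "\<And>g j. g \<in> S \<Longrightarrow> \<exists>g'\<in>S. \<forall>x. ((\<lambda>s::real. g (x + s *\<^sub>R axis j 1)) has_vector_derivative g' x) (at 0)"
  shows "smooth_fun f"
proof -
  have pdS: "pd j g \<in> S" if gS: "g \<in> S" for g j
  proof -
    obtain g' where g': "g' \<in> S" "\<forall>x. ((\<lambda>s::real. g (x + s *\<^sub>R axis j 1)) has_vector_derivative g' x) (at 0)"
      using der[OF gS] by blast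
    have "pd j g = g'" using g'(2) by (auto intro!: pd_eqI)
    with g' show ?thesis by simp
  qed
  have dlS: "dl js f \<in> S" for js
    by (induction js) (auto simp: dl_Cons \<open>f \<in> S\<close> pdS)
  have "(\<lambda>s::real. g (x + s *\<^sub>R axis j 1)) differentiable (at 0)" if "g \<in> S" for g j x
    using der[OF that, of j] by (meson differentiableI_vector)
  then show ?thesis unfolding smooth_fun_def using dlS cont by blast
qed

lemma smooth_cont: "smooth_fun f \<Longrightarrow> continuous_on UNIV f"
  unfolding smooth_fun_def by (metis dl_Nil)

lemma smooth_dl: "smooth_fun f \<Longrightarrow> smooth_fun (dl js f)"
  unfolding smooth_fun_def by (metis dl_append)

lemma smooth_pd: "smooth_fun f \<Longrightarrow> smooth_fun (pd j f)"
  using smooth_dl[of f "[j]"] by (simp add: dl_Cons)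

lemma smooth_deriv0:
  assumes "smooth_fun f"
  shows "((\<lambda>s::real. f (x + s *\<^sub>R axis j 1)) has_vector_derivative pd j f x) (at 0)"
proof -
  have "(\<lambda>s::real. dl [] f (x + s *\<^sub>R axis j 1)) differentiable (at 0)"
    using assms unfolding smooth_fun_def by blast
  then show ?thesis unfolding pd_def by (simp add: vector_derivative_works)
qed

text \<open>\<open>smooth_fun\<close> speaks of coordinate lines at parameter 0 only; recentring the
  line gives the other parameters.\<close>

lemma smooth_deriv:
  assumes "smooth_fun f"
  shows "((\<lambda>s::real. f (x + s *\<^sub>R axis j 1)) has_vector_derivative pd j f (x + a *\<^sub>R axis j 1)) (at a)"
proof -
  let ?g = "\<lambda>s::real. f ((x + a *\<^sub>R axis j 1) + s *\<^sub>R axis j 1)"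
  have "(?g has_vector_derivative pd j f (x + a *\<^sub>R axis j 1)) (at (a - a))"
    using smooth_deriv0[OF assms, of "x + a *\<^sub>R axis j 1" j] by simp
  moreover have "((\<lambda>s. s - a) has_vector_derivative 1) (at a)"
    by (auto intro!: derivative_eq_intros simp: has_real_derivative_iff_has_vector_derivative[symmetric])
  ultimately have "((?g \<circ> (\<lambda>s. s - a)) has_vector_derivative 1 *\<^sub>R pd j f (x + a *\<^sub>R axis j 1)) (at a)"
    by (intro vector_diff_chain_at) auto
  then show ?thesis by (simp add: o_def algebra_simps)
qed

lemma smooth_funI:
  assumes "continuous_on UNIV f"
    and "\<And>j. \<exists>g. smooth_fun g \<and> (\<forall>x. ((\<lambda>s::real. f (x + s *\<^sub>R axis j 1)) has_vector_derivative g x) (at 0))"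
  shows "smooth_fun f"
proof (rule smooth_coinduct[of f "insert f {g. smooth_fun g}"], simp)
  fix g j assume g: "g \<in> insert f {g. smooth_fun g}"
  show "continuous_on UNIV g" using g assms(1) smooth_cont by auto
  show "\<exists>g'\<in>insert f {g. smooth_fun g}. \<forall>x. ((\<lambda>s::real. g (x + s *\<^sub>R axis j 1)) has_vector_derivative g' x) (at 0)"
  proof (cases "g = f")
    case True then show ?thesis using assms(2)[of j] by auto
  next
    case False
    then have "smooth_fun g" using g by auto
    then show ?thesis by (intro bexI[of _ "pd j g"]) (auto simp: smooth_deriv0 smooth_pd)
  qed
qed

lemma smooth_const [simp]: "smooth_fun (\<lambda>x. c)"
proof (rule smooth_coinduct[of _ "range (\<lambda>c x. c)"])
  fix g :: "'a tfun" and j assume "g \<in> range (\<lambda>c x. c)"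
  then obtain c where g: "g = (\<lambda>x. c)" by auto
  show "\<exists>g'\<in>range (\<lambda>c x. c). \<forall>x. ((\<lambda>s::real. g (x + s *\<^sub>R axis j 1)) has_vector_derivative g' x) (at 0)"
    by (rule bexI[of _ "\<lambda>x. 0"]) (auto simp: g)
qed auto

text \<open>The product rule leads out of the set of products but not out of finite sums of
  products. This closure is the family given to \<open>smooth_coinduct\<close>.\<close>

inductive_set sum_of_products :: "('d::finite tfun) set" where
  prods_mult: "smooth_fun f \<Longrightarrow> smooth_fun g \<Longrightarrow> (\<lambda>x. f x * g x) \<in> sum_of_products"
| prods_add: "u \<in> sum_of_products \<Longrightarrow> v \<in> sum_of_products \<Longrightarrow> (\<lambda>x. u x + v x) \<in> sum_of_products"

lemma pd_mult_deriv:
  assumes "smooth_fun f" "smooth_fun g"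
  shows "((\<lambda>s::real. f (x + s *\<^sub>R axis j 1) * g (x + s *\<^sub>R axis j 1)) has_vector_derivative
     (pd j f x * g x + f x * pd j g x)) (at 0)"
  using has_vector_derivative_mult[OF smooth_deriv0[OF assms(1), of x j] smooth_deriv0[OF assms(2), of x j]]
  by (simp add: algebra_simps)

lemma smooth_prods: assumes u: "u \<in> sum_of_products" shows "smooth_fun u"
proof (rule smooth_coinduct[OF u])
  fix g :: "'a tfun" assume "g \<in> sum_of_products"
  then show "continuous_on UNIV g"
    by induction (auto intro: continuous_on_mult continuous_on_add smooth_cont)
next
  fix g :: "'a tfun" and j assume "g \<in> sum_of_products"
  then show "\<exists>g'\<in>sum_of_products. \<forall>x. ((\<lambda>s::real. g (x + s *\<^sub>R axis j 1)) has_vector_derivative g' x) (at 0)"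
  proof induction
    case (prods_mult f g)
    show ?case
      by (rule bexI[of _ "\<lambda>x. pd j f x * g x + f x * pd j g x"])
        (auto intro!: pd_mult_deriv sum_of_products.intros smooth_pd prods_mult)
  next
    case (prods_add u v)
    then obtain u' v' where "u' \<in> sum_of_products" "v' \<in> sum_of_products" and
      "\<forall>x. ((\<lambda>s::real. u (x + s *\<^sub>R axis j 1)) has_vector_derivative u' x) (at 0)"
      "\<forall>x. ((\<lambda>s::real. v (x + s *\<^sub>R axis j 1)) has_vector_derivative v' x) (at 0)" by blast
    then show ?case
      by (intro bexI[of _ "\<lambda>x. u' x + v' x"]) (auto intro!: sum_of_products.intros has_vector_derivative_add)
  qed
qed

lemma smooth_mult: "smooth_fun f \<Longrightarrow> smooth_fun g \<Longrightarrow> smooth_fun (\<lambda>x. f x * g x)"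
  by (rule smooth_prods[OF prods_mult])

text \<open>Sums come from the same family, with the constant 1 as second factor.\<close>

lemma smooth_add: "smooth_fun f \<Longrightarrow> smooth_fun g \<Longrightarrow> smooth_fun (\<lambda>x. f x + g x)"
  using smooth_prods[OF prods_add[OF prods_mult[of f "\<lambda>x. 1"] prods_mult[of g "\<lambda>x. 1"]]] by simp

lemma smooth_cmul: "smooth_fun f \<Longrightarrow> smooth_fun (\<lambda>x. c * f x)"
  using smooth_mult[of "\<lambda>x. c" f] by simp

lemma smooth_minus: "smooth_fun f \<Longrightarrow> smooth_fun (\<lambda>x. - f x)"
  using smooth_cmul[of f "-1"] by simp

lemma smooth_diff: "smooth_fun f \<Longrightarrow> smooth_fun g \<Longrightarrow> smooth_fun (\<lambda>x. f x - g x)"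
  using smooth_add[of f "\<lambda>x. - g x"] smooth_minus[of g] by simp

lemma smooth_prod:
  assumes "\<And>i. i \<in> I \<Longrightarrow> smooth_fun (f i)"
  shows "smooth_fun (\<lambda>x. \<Prod>i\<in>I. f i x)"
proof (cases "finite I")
  case True
  then show ?thesis using assms by (induction I) (auto intro!: smooth_mult)
qed simp

lemma axis_nth_if: "axis j (1::real) $ k = (if k = j then 1 else 0)"
  by (auto simp: axis_def)

lemma coord_deriv: "((\<lambda>s::real. complex_of_real ((x + s *\<^sub>R axis j 1) $ k)) has_vector_derivative (if k = j then 1 else 0)) (at a)"
  by (auto simp: axis_nth_if intro!: derivative_eq_intros has_vector_derivative_of_real)

lemma smooth_coord: "smooth_fun (\<lambda>x. complex_of_real (x $ k))"
proof (rule smooth_funI)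
  show "continuous_on UNIV (\<lambda>x::real^'a. complex_of_real (x $ k))" by (intro continuous_intros)
  fix j
  show "\<exists>g. smooth_fun g \<and> (\<forall>x. ((\<lambda>s::real. complex_of_real ((x + s *\<^sub>R axis j 1) $ k)) has_vector_derivative g x) (at 0))"
    by (rule exI[of _ "\<lambda>x. if k = j then 1 else 0"]) (intro conjI allI coord_deriv smooth_const)
qed

lemma pd_coord: "pd j (\<lambda>x. complex_of_real (x $ k)) x = (if k = j then 1 else 0)"
  by (rule pd_eqI[OF coord_deriv])

lemma pd_const [simp]: "pd j (\<lambda>x. c) = (\<lambda>x. 0)"
  by (auto intro!: pd_eqI)

lemma pd_mult: "smooth_fun f \<Longrightarrow> smooth_fun g \<Longrightarrow>
   pd j (\<lambda>x. f x * g x) = (\<lambda>x. pd j f x * g x + f x * pd j g x)"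
  by (intro ext pd_eqI pd_mult_deriv)

lemma pd_add: "smooth_fun f \<Longrightarrow> smooth_fun g \<Longrightarrow>
   pd j (\<lambda>x. f x + g x) = (\<lambda>x. pd j f x + pd j g x)"
  by (intro ext pd_eqI has_vector_derivative_add smooth_deriv0)

lemma pd_cmul: "smooth_fun f \<Longrightarrow> pd j (\<lambda>x. c * f x) = (\<lambda>x. c * pd j f x)"
  by (subst pd_mult) auto

lemma dl_lin:
  assumes "smooth_fun f" "smooth_fun g"
  shows "dl js (\<lambda>x. a * f x + b * g x) = (\<lambda>x. a * dl js f x + b * dl js g x)"
proof (induction js)
  case (Cons j js)
  then show ?case
    by (simp add: dl_Cons pd_add pd_cmul smooth_cmul smooth_dl assms)
qed simp

lemma dl_cmul: "smooth_fun f \<Longrightarrow> dl js (\<lambda>x. a * f x) = (\<lambda>x. a * dl js f x)"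
  using dl_lin[of f f js a 0] by simp

lemma dl_diff: "smooth_fun f \<Longrightarrow> smooth_fun g \<Longrightarrow> dl js (\<lambda>x. f x - g x) = (\<lambda>x. dl js f x - dl js g x)"
  using dl_lin[of f g js 1 "-1"] by simp

lemma dl_zero [simp]: "dl js (\<lambda>x. 0) = (\<lambda>x. 0)"
  using dl_cmul[of "\<lambda>x. 0" js 0] by simp

lemma smooth_mean_value:
  assumes f: "smooth_fun f" and B: "\<And>t. t \<in> closed_segment 0 s \<Longrightarrow> cmod (pd j f (x + t *\<^sub>R axis j 1)) \<le> B"
  shows "cmod (f (x + s *\<^sub>R axis j 1) - f x) \<le> B * \<bar>s\<bar>"
proof -
  have "norm (f (x + s *\<^sub>R axis j 1) - f (x + 0 *\<^sub>R axis j 1)) \<le> B * norm (s - 0)"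
  proof (rule differentiable_bound[of "closed_segment 0 s" _ "\<lambda>t h. h *\<^sub>R pd j f (x + t *\<^sub>R axis j 1)"])
    fix t assume t: "t \<in> closed_segment 0 s"
    show "((\<lambda>a. f (x + a *\<^sub>R axis j 1)) has_derivative (\<lambda>h. h *\<^sub>R pd j f (x + t *\<^sub>R axis j 1))) (at t within closed_segment 0 s)"
      using smooth_deriv[OF f, of x j t] has_derivative_at_withinI unfolding has_vector_derivative_def by blast
    show "onorm (\<lambda>h::real. h *\<^sub>R pd j f (x + t *\<^sub>R axis j 1)) \<le> B"
      by (rule onorm_le) (use B[OF t] in \<open>auto simp: mult.commute[of B] intro: mult_left_mono\<close>)
  qed auto
  then show ?thesis by simp
qed

text \<open>Termwise differentiation along coordinate lines, applied to each pair \<open>js\<close>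
  and \<open>j # js\<close>. The limits \<open>g js\<close> are assumed without any relation to each
  other; that they turn out to be the derivatives of \<open>g []\<close> is what completeness and
  the computation of \<open>dl js (euler j f)\<close> rest on.\<close>

lemma smooth_limit:
  assumes sm: "\<And>n. smooth_fun (fs n)"
    and lim: "\<And>js. uniform_limit UNIV (\<lambda>n. dl js (fs n)) (g js) sequentially"
  shows "smooth_fun (g [])" "dl js (g []) = g js"
proof -
  have cont: "continuous_on UNIV (g js)" for js
    by (rule uniform_limit_theorem[OF _ lim]) (auto intro!: always_eventually smooth_cont smooth_dl sm)
  have der: "((\<lambda>s::real. g js (x + s *\<^sub>R axis j 1)) has_vector_derivative g (j # js) x) (at 0)" for js j x
  proof -
    let ?e = "axis j 1 :: real^'a"
    have "\<exists>h. \<forall>s\<in>UNIV. (\<lambda>n. dl js (fs n) (x + s *\<^sub>R ?e)) \<longlonglongrightarrow> h s \<and>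
       (h has_derivative (\<lambda>t. t *\<^sub>R g (j # js) (x + s *\<^sub>R ?e))) (at s within UNIV)"
    proof (rule has_derivative_sequence[where f' = "\<lambda>n s t. t *\<^sub>R dl (j # js) (fs n) (x + s *\<^sub>R ?e)"])
      fix n s
      show "((\<lambda>s. dl js (fs n) (x + s *\<^sub>R ?e)) has_derivative (\<lambda>t. t *\<^sub>R dl (j # js) (fs n) (x + s *\<^sub>R ?e))) (at s within UNIV)"
        using smooth_deriv[OF smooth_dl[OF sm], of js n x j s] unfolding has_vector_derivative_def dl_Cons by simp
    next
      fix e :: real assume "e > 0"
      have "\<forall>\<^sub>F n in sequentially. \<forall>z\<in>UNIV. dist (dl (j # js) (fs n) z) (g (j # js) z) < e"
        using lim[of "j # js"] \<open>e > 0\<close> unfolding uniform_limit_iff by blast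
      then show "\<forall>\<^sub>F n in sequentially. \<forall>s\<in>UNIV. \<forall>h. norm (h *\<^sub>R dl (j # js) (fs n) (x + s *\<^sub>R ?e) - h *\<^sub>R g (j # js) (x + s *\<^sub>R ?e)) \<le> e * norm h"
      proof (rule eventually_mono)
        fix n assume a: "\<forall>z\<in>UNIV. dist (dl (j # js) (fs n) z) (g (j # js) z) < e"
        show "\<forall>s\<in>UNIV. \<forall>h. norm (h *\<^sub>R dl (j # js) (fs n) (x + s *\<^sub>R ?e) - h *\<^sub>R g (j # js) (x + s *\<^sub>R ?e)) \<le> e * norm h"
        proof (intro ballI allI)
          fix s h
          have "norm (h *\<^sub>R dl (j # js) (fs n) (x + s *\<^sub>R ?e) - h *\<^sub>R g (j # js) (x + s *\<^sub>R ?e)) = \<bar>h\<bar> * dist (dl (j # js) (fs n) (x + s *\<^sub>R ?e)) (g (j # js) (x + s *\<^sub>R ?e))"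
            by (metis dist_norm norm_scaleR scaleR_right_diff_distrib)
          also have "\<dots> \<le> \<bar>h\<bar> * e" using a by (intro mult_left_mono) (auto intro: less_imp_le)
          finally show "norm (h *\<^sub>R dl (j # js) (fs n) (x + s *\<^sub>R ?e) - h *\<^sub>R g (j # js) (x + s *\<^sub>R ?e)) \<le> e * norm h"
            by (simp add: mult.commute)
        qed
      qed
    next
      show "(\<lambda>n. dl js (fs n) (x + 0 *\<^sub>R ?e)) \<longlonglongrightarrow> g js (x + 0 *\<^sub>R ?e)"
        by (rule tendsto_uniform_limitI[OF lim]) simp
    qed auto
    then obtain h where h: "\<And>s. (\<lambda>n. dl js (fs n) (x + s *\<^sub>R ?e)) \<longlonglongrightarrow> h s"
       "\<And>s. (h has_derivative (\<lambda>t. t *\<^sub>R g (j # js) (x + s *\<^sub>R ?e))) (at s)" by auto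
    \<comment> \<open>The theorem on sequences only provides some limit function \<open>h\<close> on
      the line; uniqueness of pointwise limits identifies it.\<close>
    have "h s = g js (x + s *\<^sub>R ?e)" for s
      using h(1)[of s] tendsto_uniform_limitI[OF lim[of js], of "x + s *\<^sub>R ?e"] LIMSEQ_unique by blast
    then have "h = (\<lambda>s. g js (x + s *\<^sub>R ?e))" by auto
    with h(2)[of 0] show ?thesis by (simp add: has_vector_derivative_def)
  qed
  show "smooth_fun (g [])"
  proof (rule smooth_coinduct[of _ "range g"])
    fix h j assume "h \<in> range g"
    then obtain js where h: "h = g js" by blast
    show "continuous_on UNIV h" by (simp add: h cont)
    show "\<exists>g'\<in>range g. \<forall>x. ((\<lambda>s. h (x + s *\<^sub>R axis j 1)) has_vector_derivative g' x) (at 0)"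
      by (rule bexI[of _ "g (j # js)"]) (auto simp: h der)
  qed simp
  show "dl js (g []) = g js"
    by (induction js) (auto simp: dl_Cons intro!: pd_eqI der)
qed

text \<open>The complement of \<open>K\<close> is open, so a coordinate line through a point outside
  \<open>K\<close> stays outside for small parameters, and there the previous derivative is
  constantly 0.\<close>

lemma dl_zero_outside:
  assumes "closed K" "\<And>x. x \<notin> K \<Longrightarrow> f x = 0" "x \<notin> K"
  shows "dl js f x = 0"
  using assms(3)
proof (induction js arbitrary: x)
  case Nil then show ?case using assms by simp
next
  case (Cons j js)
  have "open (-K)" using assms(1) by auto
  have c: "continuous (at 0) (\<lambda>s::real. x + s *\<^sub>R axis j 1)" by (intro continuous_intros)
  have "((\<lambda>s::real. x + s *\<^sub>R axis j 1) \<longlongrightarrow> x + 0 *\<^sub>R axis j 1) (at 0)" by (intro tendsto_intros)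
  then have "\<forall>\<^sub>F s::real in at 0. x + s *\<^sub>R axis j 1 \<in> -K"
    by (rule topological_tendstoD[OF _ \<open>open (-K)\<close>]) (use Cons.prems in simp)
  then have "\<forall>\<^sub>F s::real in nhds 0. x + s *\<^sub>R axis j 1 \<in> -K"
    using Cons.prems by (simp add: eventually_nhds_conv_at)
  then have ev: "\<forall>\<^sub>F s::real in nhds 0. dl js f (x + s *\<^sub>R axis j 1) = 0"
    by eventually_elim (use Cons.IH in auto)
  have "((\<lambda>s::real. dl js f (x + s *\<^sub>R axis j 1)) has_vector_derivative 0) (at 0)"
    using has_vector_derivative_cong_ev[where S = UNIV and f = "\<lambda>s::real. dl js f (x + s *\<^sub>R axis j 1)" and g = "\<lambda>s. 0" and x = 0 and f' = 0]
      ev eventually_nhds_x_imp_x[OF ev] by (auto elim: eventually_mono)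
  then show ?case by (simp add: dl_Cons pd_eqI)
qed

section \<open>Cubes, supports and boundedness of test functions\<close>

definition cbx :: "real \<Rightarrow> (real^'d::finite) set" where
  "cbx R = {x. \<forall>j. \<bar>x $ j\<bar> \<le> R}"

lemma cbx_eq: "cbx R = cbox (\<chi> j. - R) (\<chi> j. R)"
  by (auto simp: cbx_def mem_box_cart abs_le_iff) (metis minus_le_iff)+

lemma compact_cbx [simp]: "compact (cbx R)" and closed_cbx [simp]: "closed (cbx R)"
  by (simp_all only: cbx_eq compact_cbox closed_cbox)

lemma bounded_subset_cbx:
  assumes "bounded S" shows "\<exists>R>0. S \<subseteq> cbx R"
proof -
  obtain R where R: "\<forall>x\<in>S. norm x \<le> R" using assms bounded_iff by blast
  have "S \<subseteq> cbx (max R 1)"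
  proof
    fix x assume x: "x \<in> S"
    have "\<bar>x $ j\<bar> \<le> max R 1" for j
      using component_le_norm_cart[of x j] R x by (smt (verit))
    then show "x \<in> cbx (max R 1)" by (simp add: cbx_def)
  qed
  then show ?thesis by (intro exI[of _ "max R 1"]) auto
qed

lemma test_smooth: "test f \<Longrightarrow> smooth_fun f" by (simp add: test_def)

lemma testI: "smooth_fun f \<Longrightarrow> bounded K \<Longrightarrow> (\<And>x. x \<notin> K \<Longrightarrow> f x = 0) \<Longrightarrow> test f"
  unfolding test_def by (metis (mono_tags, lifting) bounded_subset mem_Collect_eq subsetI)

lemma test_supp: "test f \<Longrightarrow> \<exists>R>0. \<forall>x. x \<notin> cbx R \<longrightarrow> f x = 0"
  unfolding test_def using bounded_subset_cbx by blast

lemma test_dl: "test f \<Longrightarrow> test (dl js f)"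
  by (metis closed_cbx compact_cbx compact_imp_bounded dl_zero_outside smooth_dl testI test_smooth test_supp)

lemma test_pd: "test f \<Longrightarrow> test (pd j f)"
  using test_dl[of f "[j]"] by (simp add: dl_Cons)

lemma test_mult: "smooth_fun f \<Longrightarrow> test g \<Longrightarrow> test (\<lambda>x. f x * g x)"
  by (rule testI[of _ "{x. g x \<noteq> 0}"]) (auto simp: test_def smooth_mult)

lemma test_lin: assumes "test f" "test g" shows "test (\<lambda>x. a * f x + b * g x)"
  by (rule testI[of _ "{x. f x \<noteq> 0} \<union> {x. g x \<noteq> 0}"]) (use assms in \<open>auto simp: test_def smooth_add smooth_cmul\<close>)

lemma test_diff: "test f \<Longrightarrow> test g \<Longrightarrow> test (\<lambda>x. f x - g x)"
  using test_lin[of f g 1 "-1"] by simp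
lemma test_zero [simp]: "test (\<lambda>x. 0)"
  by (simp add: test_def)

lemma test_cont: "test f \<Longrightarrow> continuous_on UNIV f"
  by (simp add: smooth_cont test_smooth)

lemma test_bounded: assumes "test f" shows "\<exists>B\<ge>0. \<forall>x. cmod (f x) \<le> B"
proof -
  obtain R where R: "\<forall>x. x \<notin> cbx R \<longrightarrow> f x = 0" using test_supp[OF assms] by blast
  have "compact (f ` cbx R)"
    by (intro compact_continuous_image continuous_on_subset[OF test_cont[OF assms]]) auto
  then obtain B where B: "\<forall>y\<in>f ` cbx R. norm y \<le> B" using compact_imp_bounded bounded_iff by metis
  have "\<forall>x. cmod (f x) \<le> max B 0"
  proof
    fix x show "cmod (f x) \<le> max B 0"
      using R B by (cases "x \<in> cbx R") (auto simp: le_max_iff_disj)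
  qed
  then show ?thesis by (intro exI[of _ "max B 0"]) auto
qed

text \<open>The usual C^m norm, in the form of a relation between a function and an upper bound, so
  that no supremum has to be shown finite before estimates can be stated.\<close>

definition derivs_le :: "nat \<Rightarrow> 'd::finite tfun \<Rightarrow> real \<Rightarrow> bool" where
  "derivs_le m f B \<longleftrightarrow> (\<forall>js. length js \<le> m \<longrightarrow> (\<forall>x. cmod (dl js f x) \<le> B))"

lemma derivs_leD: "derivs_le m f B \<Longrightarrow> length js \<le> m \<Longrightarrow> cmod (dl js f x) \<le> B"
  by (simp add: derivs_le_def)
lemma derivs_leD0: "derivs_le m f B \<Longrightarrow> cmod (f x) \<le> B"
  using derivs_leD[of m f B "[]"] by simp
lemma derivs_le_mono: "derivs_le m f B \<Longrightarrow> m' \<le> m \<Longrightarrow> B \<le> B' \<Longrightarrow> derivs_le m' f B'"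
  unfolding derivs_le_def by (meson order_trans)
lemma derivs_le_ge0: "derivs_le m f B \<Longrightarrow> 0 \<le> B"
  using derivs_leD0[of m f B] norm_ge_zero order_trans by blast

lemma derivs_le_lin:
  assumes "derivs_le m f B" "derivs_le m g C" "smooth_fun f" "smooth_fun g"
  shows "derivs_le m (\<lambda>x. a * f x + b * g x) (cmod a * B + cmod b * C)"
  unfolding derivs_le_def
proof (intro allI impI)
  fix js :: "'a list" and x assume "length js \<le> m"
  then have "cmod (dl js f x) \<le> B" "cmod (dl js g x) \<le> C" using derivs_leD[OF assms(1)] derivs_leD[OF assms(2)] by auto
  then show "cmod (dl js (\<lambda>x. a * f x + b * g x) x) \<le> cmod a * B + cmod b * C"
    unfolding dl_lin[OF assms(3,4)]
    by (intro norm_triangle_le add_mono) (auto simp: norm_mult mult_left_mono)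
qed

lemma derivs_le_cmul: "derivs_le m f B \<Longrightarrow> smooth_fun f \<Longrightarrow> derivs_le m (\<lambda>x. a * f x) (cmod a * B)"
  using derivs_le_lin[of m f B f B a 0] by simp
lemma derivs_le_add: "derivs_le m f B \<Longrightarrow> derivs_le m g C \<Longrightarrow> smooth_fun f \<Longrightarrow> smooth_fun g \<Longrightarrow> derivs_le m (\<lambda>x. f x + g x) (B + C)"
  using derivs_le_lin[of m f B g C 1 1] by simp
lemma derivs_le_diff: "derivs_le m f B \<Longrightarrow> derivs_le m g C \<Longrightarrow> smooth_fun f \<Longrightarrow> smooth_fun g \<Longrightarrow> derivs_le m (\<lambda>x. f x - g x) (B + C)"
  using derivs_le_lin[of m f B g C 1 "-1"] by simp
lemma derivs_le_zero: "0 \<le> B \<Longrightarrow> derivs_le m (\<lambda>x. 0) B"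
  by (simp add: derivs_le_def)

lemma derivs_le_ex: assumes "test f" shows "\<exists>B\<ge>0. derivs_le m f B"
proof -
  have "\<forall>js. \<exists>B\<ge>0. \<forall>x. cmod (dl js f x) \<le> B" using test_bounded[OF test_dl[OF assms]] by blast
  then obtain B where B: "\<And>js. B js \<ge> 0" "\<And>js x. cmod (dl js f x) \<le> B js" by metis
  let ?L = "{js::'a list. length js \<le> m}"
  have fin: "finite ?L" using finite_lists_length_le[of "UNIV::'a set" m] by simp
  have "derivs_le m f (\<Sum>js\<in>?L. B js)" unfolding derivs_le_def
  proof (intro allI impI)
    fix js :: "'a list" and x assume "length js \<le> m"
    then have "B js \<le> (\<Sum>js\<in>?L. B js)" by (intro member_le_sum) (auto simp: B fin)
    then show "cmod (dl js f x) \<le> (\<Sum>js\<in>?L. B js)" using B(2) order_trans by blast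
  qed
  then show ?thesis using B(1) by (meson sum_nonneg)
qed

section \<open>Dilations and the multiplicative group \<open>Rstar\<close>\<close>

lemma pd_fdil_deriv:
  assumes "smooth_fun f"
  shows "((\<lambda>s::real. f (dil (x + s *\<^sub>R axis j 1) y)) has_vector_derivative complex_of_real (y $ j) * pd j f (dil x y)) (at 0)"
proof -
  have "dil (x + s *\<^sub>R axis j 1) y = dil x y + (y $ j * s) *\<^sub>R axis j 1" for s
    by (auto simp: dil_def vec_eq_iff axis_nth_if algebra_simps)
  moreover have "(((\<lambda>s::real. f (dil x y + s *\<^sub>R axis j 1)) \<circ> (\<lambda>s. y $ j * s)) has_vector_derivative (y $ j) *\<^sub>R pd j f (dil x y)) (at 0)"
    by (rule vector_diff_chain_at)
      (use smooth_deriv0[OF assms, of "dil x y" j] in \<open>auto intro!: derivative_eq_intros simp: has_real_derivative_iff_has_vector_derivative[symmetric]\<close>)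
  ultimately show ?thesis by (simp add: o_def scaleR_conv_of_real)
qed

lemma continuous_on_dil [continuous_intros]:
  assumes "continuous_on S f" "continuous_on S g"
  shows "continuous_on S (\<lambda>x. dil (f x) (g x))"
  unfolding dil_def using assms by (intro continuous_intros)

definition fdil :: "real^'d::finite \<Rightarrow> 'd tfun \<Rightarrow> 'd tfun" where
  "fdil y f = (\<lambda>\<xi>. f (dil \<xi> y))"

lemma smooth_fdil:
  assumes "smooth_fun f" shows "smooth_fun (fdil y f)"
\<comment> \<open>The constant \<open>c\<close> absorbs the factors \<open>y $ j\<close> that the
  chain rule brings out.\<close>
proof (rule smooth_coinduct[of _ "{\<lambda>\<xi>. c * f (dil \<xi> y) | c f. smooth_fun f}"])
  show "fdil y f \<in> {\<lambda>\<xi>. c * f (dil \<xi> y) | c f. smooth_fun f}"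
    using assms by (auto simp: fdil_def intro!: exI[of _ 1] exI[of _ f])
next
  fix g j assume "g \<in> {\<lambda>\<xi>. c * f (dil \<xi> y) | c f. smooth_fun f}"
  then obtain c f where g: "g = (\<lambda>\<xi>. c * f (dil \<xi> y))" "smooth_fun f" by blast
  show "continuous_on UNIV g" unfolding g(1)
    by (intro continuous_intros continuous_on_compose2[OF smooth_cont[OF g(2)]]) auto
  show "\<exists>g'\<in>{\<lambda>\<xi>. c * f (dil \<xi> y) | c f. smooth_fun f}. \<forall>x. ((\<lambda>s::real. g (x + s *\<^sub>R axis j 1)) has_vector_derivative g' x) (at 0)"
  proof (rule bexI[of _ "\<lambda>\<xi>. (c * complex_of_real (y $ j)) * pd j f (dil \<xi> y)"])
    show "\<forall>x. ((\<lambda>s::real. g (x + s *\<^sub>R axis j 1)) has_vector_derivative c * complex_of_real (y $ j) * pd j f (dil x y)) (at 0)"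
      unfolding g(1) mult.assoc by (intro allI has_vector_derivative_mult_right pd_fdil_deriv g(2))
  qed (use smooth_pd[OF g(2)] in blast)
qed

lemma dl_fdil:
  assumes "smooth_fun f"
  shows "dl js (fdil y f) = (\<lambda>x. complex_of_real (prod_list (map (\<lambda>j. y $ j) js)) * dl js f (dil x y))"
proof (induction js)
  case (Cons j js)
  have "pd j (\<lambda>x. complex_of_real (prod_list (map (\<lambda>j. y $ j) js)) * dl js f (dil x y)) x =
    complex_of_real (prod_list (map (\<lambda>j. y $ j) js)) * (complex_of_real (y $ j) * pd j (dl js f) (dil x y))" for x
    by (intro pd_eqI has_vector_derivative_mult_right pd_fdil_deriv smooth_dl assms)
  then show ?case by (simp add: dl_Cons Cons.IH mult_ac fun_eq_iff)
qed (simp add: fdil_def)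

text \<open>Inverse in the multiplicative group \<open>Rstar\<close>. At a zero coordinate the value
  is the default 1 / 0 = 0, which lies outside \<open>[1/2,1]\<close>; this matters for the kernels
  supported there.\<close>

definition ivec :: "real^'d::finite \<Rightarrow> real^'d" where
  "ivec y = (\<chi> j. 1 / y $ j)"

lemma dil_commute: "dil x y = dil y x" and dil_assoc: "dil (dil x y) z = dil x (dil y z)"
  by (simp_all add: dil_def vec_eq_iff mult_ac)
lemma dil_nth [simp]: "dil x y $ j = x $ j * y $ j" by (simp add: dil_def)
lemma ivec_nth [simp]: "ivec y $ j = 1 / y $ j" by (simp add: ivec_def)
lemma dil_ivec [simp]: "y \<in> Rstar \<Longrightarrow> dil y (ivec y) = 1" "y \<in> Rstar \<Longrightarrow> dil (ivec y) y = 1"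
  by (auto simp: vec_eq_iff Rstar_def)
lemma dil_one [simp]: "dil x 1 = x" "dil 1 x = x" by (simp_all add: vec_eq_iff)
lemma ivec_Rstar: "y \<in> Rstar \<Longrightarrow> ivec y \<in> Rstar" by (simp add: Rstar_def)
lemma dil_Rstar: "x \<in> Rstar \<Longrightarrow> y \<in> Rstar \<Longrightarrow> dil x y \<in> Rstar" by (simp add: Rstar_def)
lemma one_Rstar [simp]: "1 \<in> Rstar" by (simp add: Rstar_def)
lemma fdil_fdil: "fdil y (fdil z f) = fdil (dil y z) f"
  by (simp add: fdil_def dil_assoc)
lemma fdil_one [simp]: "fdil 1 f = f" by (simp add: fdil_def)

lemma bounded_dil: assumes "bounded K" shows "bounded ((\<lambda>x. dil x z) ` K)"
proof -
  obtain R where R: "K \<subseteq> cbx R" "R > 0" using bounded_subset_cbx[OF assms] by blast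
  have "compact ((\<lambda>x. dil x z) ` cbx R)" by (intro compact_continuous_image continuous_intros) auto
  then show ?thesis using R bounded_subset compact_imp_bounded by (metis image_mono)
qed

lemma fdil_supp:
  assumes "y \<in> Rstar" "\<And>x. x \<notin> K \<Longrightarrow> f x = 0" "x \<notin> (\<lambda>x. dil x (ivec y)) ` K"
  shows "fdil y f x = 0"
proof -
  have "x = dil (dil x y) (ivec y)" using assms(1) by (simp add: dil_assoc)
  then have "dil x y \<notin> K" using assms(3) by blast
  then show ?thesis using assms(2) by (simp add: fdil_def)
qed

text \<open>For \<open>y\<close> in \<open>Rstar\<close> the support is the image of a bounded set
  under the inverse dilation. A zero coordinate of \<open>y\<close> would make the function constant
  in that direction.\<close>

lemma test_fdil:
  assumes "test f" "y \<in> Rstar" shows "test (fdil y f)"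
proof -
  obtain R where R: "\<forall>x. x \<notin> cbx R \<longrightarrow> f x = 0" using test_supp[OF assms(1)] by blast
  show ?thesis
    by (rule testI[of _ "(\<lambda>x. dil x (ivec y)) ` cbx R"])
      (use R assms fdil_supp[of y "cbx R" f] bounded_dil[OF compact_imp_bounded[OF compact_cbx]] in \<open>auto intro: smooth_fdil test_smooth\<close>)
qed

subsection \<open>Uniform boundedness\<close>

definition DK :: "(real^'d::finite) set \<Rightarrow> 'd tfun \<Rightarrow> bool" where
  "DK K f \<longleftrightarrow> test f \<and> (\<forall>x. x \<notin> K \<longrightarrow> f x = 0)"

text \<open>A continuous linear functional on the Frechet space of test functions vanishing outside
  \<open>K\<close>, with nothing required elsewhere. Dilated copies of \<open>T\<close> and point
  evaluations of derivatives of \<open>MT T\<close> are the two kinds of instances.\<close>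

definition seq_cont_lin :: "(real^'d::finite) set \<Rightarrow> 'd distr \<Rightarrow> bool" where
  "seq_cont_lin K G \<longleftrightarrow>
    (\<forall>f g a b. DK K f \<longrightarrow> DK K g \<longrightarrow> G (\<lambda>x. a * f x + b * g x) = a * G f + b * G g) \<and>
    (\<forall>fs f. (\<forall>n. DK K (fs n)) \<longrightarrow> DK K f \<longrightarrow>
       (\<forall>js. uniform_limit UNIV (\<lambda>n. dl js (fs n)) (dl js f) sequentially) \<longrightarrow> (\<lambda>n. G (fs n)) \<longlonglongrightarrow> G f)"

lemma DK_test: "DK K f \<Longrightarrow> test f" by (simp add: DK_def)
lemma DK_smooth: "DK K f \<Longrightarrow> smooth_fun f" by (simp add: DK_def test_smooth)
lemma DK_lin: "DK K f \<Longrightarrow> DK K g \<Longrightarrow> DK K (\<lambda>x. a * f x + b * g x)"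
  by (simp add: DK_def test_lin)
lemma DK_cmul: "DK K f \<Longrightarrow> DK K (\<lambda>x. a * f x)"
  using DK_lin[of K f f a 0] by simp
lemma DK_add: "DK K f \<Longrightarrow> DK K g \<Longrightarrow> DK K (\<lambda>x. f x + g x)"
  using DK_lin[of K f g 1 1] by simp
lemma DK_diff: "DK K f \<Longrightarrow> DK K g \<Longrightarrow> DK K (\<lambda>x. f x - g x)"
  using DK_lin[of K f g 1 "-1"] by simp
lemma DK_zero: "DK K (\<lambda>x. 0)" by (simp add: DK_def)
lemma seq_cont_lin_lin: "seq_cont_lin K G \<Longrightarrow> DK K f \<Longrightarrow> DK K g \<Longrightarrow> G (\<lambda>x. a * f x + b * g x) = a * G f + b * G g"
  unfolding seq_cont_lin_def by blast
lemma seq_cont_lin_cmul: "seq_cont_lin K G \<Longrightarrow> DK K f \<Longrightarrow> G (\<lambda>x. a * f x) = a * G f"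
  using seq_cont_lin_lin[of K G f f a 0] by simp
lemma seq_cont_lin_add: "seq_cont_lin K G \<Longrightarrow> DK K f \<Longrightarrow> DK K g \<Longrightarrow> G (\<lambda>x. f x + g x) = G f + G g"
  using seq_cont_lin_lin[of K G f g 1 1] by simp
lemma seq_cont_lin_diff: "seq_cont_lin K G \<Longrightarrow> DK K f \<Longrightarrow> DK K g \<Longrightarrow> G (\<lambda>x. f x - g x) = G f - G g"
  using seq_cont_lin_lin[of K G f g 1 "-1"] by simp
lemma seq_cont_lin_zero: "seq_cont_lin K G \<Longrightarrow> G (\<lambda>x. 0) = 0"
  using seq_cont_lin_cmul[of K G "\<lambda>x. 0" 0] DK_zero[of K] by simp
lemma seq_cont_lin_conv: "seq_cont_lin K G \<Longrightarrow> (\<And>n. DK K (fs n)) \<Longrightarrow> DK K f \<Longrightarrow>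
   (\<And>js. uniform_limit UNIV (\<lambda>n. dl js (fs n)) (dl js f) sequentially) \<Longrightarrow> (\<lambda>n. G (fs n)) \<longlonglongrightarrow> G f"
  unfolding seq_cont_lin_def by blast

lemma uniform_limit_derivs_le:
  assumes sm: "\<And>n. smooth_fun (fs n)" "smooth_fun f"
    and lim: "\<And>m e. e > 0 \<Longrightarrow> \<exists>N. \<forall>n\<ge>N. derivs_le m (\<lambda>x. fs n x - f x) e"
  shows "uniform_limit UNIV (\<lambda>n. dl js (fs n)) (dl js f) sequentially"
  unfolding uniform_limit_iff
proof (intro allI impI)
  fix e :: real assume "e > 0"
  then obtain N where N: "\<forall>n\<ge>N. derivs_le (length js) (\<lambda>x. fs n x - f x) (e/2)" using lim[OF half_gt_zero[OF \<open>e > 0\<close>], of "length js"] by blast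
  have "dist (dl js (fs n) x) (dl js f x) < e" if "n \<ge> N" for n x
    using derivs_leD[of "length js" "\<lambda>x. fs n x - f x" "e/2" js x] N that \<open>e > 0\<close>
    by (auto simp: dl_diff[OF sm] dist_norm)
  then show "\<forall>\<^sub>F n in sequentially. \<forall>x\<in>UNIV. dist (dl js (fs n) x) (dl js f x) < e"
    by (auto simp: eventually_sequentially)
qed

lemma finite_lists_le: "finite {js::'d::finite list. length js \<le> m}"
  using finite_lists_length_le[of "UNIV::'d set" m] by simp

lemma derivs_le_of_uniform_limit:
  assumes sm: "\<And>n. smooth_fun (fs n)" "smooth_fun f"
    and lim: "\<And>js. uniform_limit UNIV (\<lambda>n. dl js (fs n)) (dl js f) sequentially"
    and "e > 0"
  shows "\<exists>N. \<forall>n\<ge>N. derivs_le m (\<lambda>x. fs n x - f x) e"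
proof -
  have "\<forall>js\<in>{js::'a list. length js \<le> m}. \<forall>\<^sub>F n in sequentially. \<forall>x. cmod (dl js (fs n) x - dl js f x) < e"
    using lim \<open>e > 0\<close> by (simp add: uniform_limit_iff dist_norm)
  then have "\<forall>\<^sub>F n in sequentially. \<forall>js\<in>{js::'a list. length js \<le> m}. \<forall>x. cmod (dl js (fs n) x - dl js f x) < e"
    by (rule eventually_ball_finite[OF finite_lists_le])
  then obtain N where N: "\<forall>n\<ge>N. \<forall>js\<in>{js::'a list. length js \<le> m}. \<forall>x. cmod (dl js (fs n) x - dl js f x) < e"
    by (auto simp: eventually_sequentially)
  show ?thesis
    by (rule exI[of _ N]) (use N in \<open>simp add: derivs_le_def dl_diff[OF sm] less_imp_le\<close>)
qed

text \<open>If no C^m norm dominates \<open>G\<close>, there is for every m a function on which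
  \<open>G\<close> exceeds m times the C^m bound. Rescaled to \<open>G = 1\<close>, these functions
  tend to 0 with all derivatives, against continuity.\<close>

lemma seq_cont_lin_bound:
  assumes G: "seq_cont_lin K G"
  shows "\<exists>m C. C \<ge> 0 \<and> (\<forall>f B. DK K f \<longrightarrow> derivs_le m f B \<longrightarrow> cmod (G f) \<le> C * B)"
proof (rule ccontr)
  assume "\<not> ?thesis"
  then have "\<forall>m::nat. \<exists>f B. DK K f \<and> derivs_le m f B \<and> cmod (G f) > real m * B"
    by (metis not_le of_nat_0_le_iff)
  then obtain f B where f: "\<And>m. DK K (f m)" "\<And>m. derivs_le m (f m) (B m)" "\<And>m. cmod (G (f m)) > real m * B m"
    by metis
  have pos: "cmod (G (f m)) > 0" for m
    using f(3)[of m] derivs_le_ge0[OF f(2)[of m]] by (meson le_less_trans mult_nonneg_nonneg of_nat_0_le_iff)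
  \<comment> \<open>Normalised so that \<open>G (g m) = 1\<close>; the C^m bound becomes at most 1 /
    m.\<close>
  define g where "g m = (\<lambda>x. inverse (G (f m)) * f m x)" for m
  have gK: "DK K (g m)" for m unfolding g_def by (rule DK_cmul[OF f(1)])
  have G1: "G (g m) = 1" for m
    using seq_cont_lin_cmul[OF G f(1)] pos[of m] by (simp add: g_def)
  have nbg: "derivs_le m (g m) (1 / real m)" if "m > 0" for m
  proof -
    have "derivs_le m (g m) (cmod (inverse (G (f m))) * B m)" unfolding g_def
      by (rule derivs_le_cmul[OF f(2) DK_smooth[OF f(1)]])
    moreover have "cmod (inverse (G (f m))) * B m \<le> 1 / real m"
      unfolding norm_inverse using f(3)[of m] pos[of m] that
      by (simp add: divide_simps mult.commute)
    ultimately show ?thesis using derivs_le_mono by blast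
  qed
  have "(\<lambda>n. G (g n)) \<longlonglongrightarrow> G (\<lambda>x. 0)"
  proof (rule seq_cont_lin_conv[OF G gK DK_zero uniform_limit_derivs_le])
    fix m and e :: real assume "e > 0"
    then obtain N where N: "N > 0" "1 / real N < e" using nat_approx_posE[of e] by (metis zero_less_Suc)
    have "derivs_le m (\<lambda>x. g n x - 0) e" if n: "n \<ge> max m N" for n
    proof -
      have "1 / real n \<le> 1 / real N" using n N by (simp add: frac_le)
      then show ?thesis using derivs_le_mono[OF nbg[of n], of m e] n N by simp
    qed
    then show "\<exists>N. \<forall>n\<ge>N. derivs_le m (\<lambda>x. g n x - 0) e" by blast
  qed (auto intro: DK_smooth[OF gK])
  then show False using seq_cont_lin_zero[OF G] G1 by (simp add: LIMSEQ_const_iff)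
qed

text \<open>Converse of \<open>seq_cont_lin_bound\<close>: it turns an estimate that is uniform
  along a sequence of functionals back into continuity of their limit.\<close>

lemma seq_cont_linI:
  assumes lin: "\<And>f g a b. DK K f \<Longrightarrow> DK K g \<Longrightarrow> G (\<lambda>x. a * f x + b * g x) = a * G f + b * G g"
    and bd: "\<And>f B. DK K f \<Longrightarrow> derivs_le m f B \<Longrightarrow> cmod (G f) \<le> C * B"
  shows "seq_cont_lin K G"
  unfolding seq_cont_lin_def
proof (intro conjI allI impI)
  fix fs f assume fs: "\<forall>n. DK K (fs n)" and f: "DK K f"
    and lim: "\<forall>js. uniform_limit UNIV (\<lambda>n. dl js (fs n)) (dl js f) sequentially"
  have sub: "G (\<lambda>x. fs n x - f x) = G (fs n) - G f" for n
    using lin[of "fs n" f 1 "-1"] fs f by simp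
  have "\<exists>N. \<forall>n\<ge>N. norm (G (fs n) - G f) < e" if "e > 0" for e
  proof -
    let ?e = "e / (\<bar>C\<bar> + 1)"
    have "?e > 0" using that by simp
    obtain N where N: "\<forall>n\<ge>N. derivs_le m (\<lambda>x. fs n x - f x) ?e"
      using derivs_le_of_uniform_limit[where fs = fs and f = f and e = ?e and m = m] DK_smooth fs f lim \<open>?e > 0\<close> by blast
    have "norm (G (fs n) - G f) < e" if "n \<ge> N" for n
    proof -
      have "cmod (G (fs n) - G f) \<le> C * ?e" using bd[OF DK_diff] N fs f that sub by metis
      also have "\<dots> < e"
      proof -
        have "C * ?e \<le> \<bar>C\<bar> * ?e" using \<open>?e > 0\<close> by (intro mult_right_mono) auto
        also have "\<dots> < (\<bar>C\<bar> + 1) * ?e" using \<open>?e > 0\<close> by (intro mult_strict_right_mono) auto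
        also have "\<dots> = e" by simp
        finally show ?thesis .
      qed
      finally show ?thesis .
    qed
    then show ?thesis by blast
  qed
  then show "(\<lambda>n. G (fs n)) \<longlonglongrightarrow> G f" by (simp add: LIMSEQ_iff)
qed (use lin in blast)

lemma derivs_le_limit:
  assumes sm: "smooth_fun h" "\<And>n. smooth_fun (s n)" "smooth_fun f"
    and lim: "\<And>js x. (\<lambda>n. dl js (s n) x) \<longlonglongrightarrow> dl js f x"
    and derivs_le: "\<And>n. n \<ge> N \<Longrightarrow> derivs_le m (\<lambda>x. s n x - h x) B"
  shows "derivs_le m (\<lambda>x. f x - h x) B"
  unfolding derivs_le_def
proof (intro allI impI)
  fix js :: "'a list" and x assume l: "length js \<le> m"
  have "(\<lambda>n. cmod (dl js (s n) x - dl js h x)) \<longlonglongrightarrow> cmod (dl js f x - dl js h x)"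
    by (intro tendsto_intros lim)
  moreover have "\<forall>n\<ge>N. cmod (dl js (s n) x - dl js h x) \<le> B"
    using derivs_leD[OF derivs_le l] by (simp add: dl_diff sm)
  ultimately show "cmod (dl js (\<lambda>x. f x - h x) x) \<le> B"
    by (auto simp: dl_diff sm intro: LIMSEQ_le_const2)
qed

lemma DK_complete_dl:
  assumes K: "bounded K" and s: "\<And>n. DK K (s n)"
    and cau: "\<And>js. uniformly_Cauchy_on UNIV (\<lambda>n. dl js (s n))"
  shows "\<exists>f. DK K f \<and> (\<forall>js. uniform_limit UNIV (\<lambda>n. dl js (s n)) (dl js f) sequentially)"
proof -
  note sm = DK_smooth[OF s]
  have "\<exists>l. uniform_limit UNIV (\<lambda>n. dl js (s n)) l sequentially" for js
    using Cauchy_uniformly_convergent[OF cau] uniformly_convergent_on_def by blast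
  then obtain g where g: "\<And>js. uniform_limit UNIV (\<lambda>n. dl js (s n)) (g js) sequentially" by metis
  have sg: "smooth_fun (g [])" and dg: "dl js (g []) = g js" for js
    using smooth_limit[OF sm g] by auto
  have z: "g [] x = 0" if "x \<notin> K" for x
  proof -
    have "(\<lambda>n. dl [] (s n) x) \<longlonglongrightarrow> g [] x" by (rule tendsto_uniform_limitI[OF g]) simp
    then show ?thesis using s that by (simp add: DK_def LIMSEQ_const_iff)
  qed
  have "test (g [])" by (rule testI[OF sg K z])
  then show ?thesis using z g dg unfolding DK_def by (intro exI[of _ "g []"]) auto
qed

lemma DK_complete:
  assumes K: "bounded K" and s: "\<And>n. DK K (s n)"
    and cau: "\<And>m e. e > 0 \<Longrightarrow> \<exists>N. \<forall>n\<ge>N. \<forall>k\<ge>N. derivs_le m (\<lambda>x. s n x - s k x) e"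
  shows "\<exists>f. DK K f \<and> (\<forall>js. uniform_limit UNIV (\<lambda>n. dl js (s n)) (dl js f) sequentially)"
proof (rule DK_complete_dl[OF K s])
  note sm = DK_smooth[OF s]
  fix js
    show "uniformly_Cauchy_on UNIV (\<lambda>n. dl js (s n))"
    proof (rule uniformly_Cauchy_onI)
      fix e :: real assume "e > 0"
      then obtain N where N: "\<forall>n\<ge>N. \<forall>k\<ge>N. derivs_le (length js) (\<lambda>x. s n x - s k x) (e/2)" using cau[OF half_gt_zero[OF \<open>e > 0\<close>], of "length js"] by blast
      have "dist (dl js (s n) x) (dl js (s k) x) < e" if "n \<ge> N" "k \<ge> N" for n k x
        using derivs_leD[of "length js" "\<lambda>x. s n x - s k x" "e/2" js x] N that \<open>e > 0\<close>
        by (auto simp: dl_diff[OF sm sm] dist_norm)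
      then show "\<exists>M. \<forall>x\<in>UNIV. \<forall>m\<ge>M. \<forall>n\<ge>M. dist (dl js (s m) x) (dl js (s n) x) < e" by blast
    qed
qed

text \<open>A Baire argument with nested balls. If no common estimate exists, one finds balls with
  centres \<open>s n\<close>, orders \<open>m n\<close> and radii \<open>r n\<close>, each inside
  the previous one, such that on the ball of index \<open>Suc n\<close> some member of the family
  has modulus at least \<open>n\<close>. A point common to all balls violates pointwise
  boundedness.\<close>

lemma uniform_boundedness:
  fixes G :: "'i \<Rightarrow> 'd::finite distr"
  assumes K: "bounded K" and G: "\<And>i. i \<in> I \<Longrightarrow> seq_cont_lin K (G i)"
    and bd: "\<And>f. DK K f \<Longrightarrow> \<exists>B. \<forall>i\<in>I. cmod (G i f) \<le> B"
  shows "\<exists>m C. C \<ge> 0 \<and> (\<forall>i\<in>I. \<forall>f B. DK K f \<longrightarrow> derivs_le m f B \<longrightarrow> cmod (G i f) \<le> C * B)"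
proof (rule ccontr)
  assume "\<not> ?thesis"
  then have H: "\<exists>i\<in>I. \<exists>f B. DK K f \<and> derivs_le m f B \<and> cmod (G i f) > C * B" if "C \<ge> 0" for m C
    using that by (meson not_le)
  \<comment> \<open>One shrinking step: inside the ball around \<open>s\<close> there is a smaller
    one, of higher order, on which a single member of the family is at least \<open>k\<close> in
    modulus.\<close>
  have step: "\<exists>s' m' r' i. i \<in> I \<and> DK K s' \<and> m < m' \<and> 0 < r' \<and> r' \<le> r/2 \<and> derivs_le m (\<lambda>x. s' x - s x) (r/2) \<and>
      (\<forall>f. DK K f \<longrightarrow> derivs_le m' (\<lambda>x. f x - s' x) r' \<longrightarrow> cmod (G i f) \<ge> real k)"
    if s: "DK K s" and r: "r > 0" for s m r k
  proof -
    \<comment> \<open>Chosen so that the multiple \<open>h\<close> of \<open>f\<close> with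
      \<open>cmod (G i h) = k + 1\<close> has C^m size at most \<open>r / 2\<close>.\<close>
    let ?C = "2 * (real k + 1) / r"
    obtain i f B where i: "i \<in> I" and f: "DK K f" "derivs_le m f B" "cmod (G i f) > ?C * B"
      using H[of ?C m] r by auto
    note Gi = G[OF i]
    have B: "B \<ge> 0" by (rule derivs_le_ge0[OF f(2)])
    have pos: "cmod (G i f) > 0" using f(3) B r
      by (smt (verit) divide_nonneg_pos mult_nonneg_nonneg of_nat_0_le_iff)
    define c where "c = complex_of_real ((real k + 1) / cmod (G i f))"
    define h where "h = (\<lambda>x. c * f x)"
    have h: "DK K h" unfolding h_def by (rule DK_cmul[OF f(1)])
    have Gh: "cmod (G i h) = real k + 1"
    proof -
      have "cmod c = (real k + 1) / cmod (G i f)" unfolding c_def norm_of_real by simp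
      then show ?thesis using pos seq_cont_lin_cmul[OF Gi f(1), of c] by (simp add: h_def norm_mult)
    qed
    have "cmod c * B \<le> r/2"
      using f(3) pos r by (simp add: c_def field_simps del: of_real_divide of_real_add)
    then have nbh: "derivs_le m h (r/2)"
      using derivs_le_mono[OF derivs_le_cmul[OF f(2) DK_smooth[OF f(1)], of c], of m "r/2"] by (simp add: h_def)
    \<comment> \<open>Nothing is known about the value at \<open>s\<close> itself, but the values at
      \<open>s + h\<close> and \<open>s - h\<close> differ by \<open>2 * G i h\<close>, so one of
      them is at least \<open>k + 1\<close> in modulus.\<close>
    have "2 * G i h = G i (\<lambda>x. s x + h x) - G i (\<lambda>x. s x - h x)"
      by (simp add: seq_cont_lin_add[OF Gi s h] seq_cont_lin_diff[OF Gi s h])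
    then have "2 * (real k + 1) = cmod (G i (\<lambda>x. s x + h x) - G i (\<lambda>x. s x - h x))"
      using Gh by (metis norm_mult norm_numeral)
    also have "\<dots> \<le> cmod (G i (\<lambda>x. s x + h x)) + cmod (G i (\<lambda>x. s x - h x))"
      by (rule norm_triangle_ineq4)
    finally have le: "2 * (real k + 1) \<le> cmod (G i (\<lambda>x. s x + h x)) + cmod (G i (\<lambda>x. s x - h x))" .
    have aux: "c \<le> a \<or> c \<le> b" if "2 * c \<le> a + b" for a b c :: real
      using that by (cases "c \<le> a") auto
    have "cmod (G i (\<lambda>x. s x + h x)) \<ge> real k + 1 \<or> cmod (G i (\<lambda>x. s x - h x)) \<ge> real k + 1"
      using aux[OF le] .
    then have "\<exists>s'. DK K s' \<and> derivs_le m (\<lambda>x. s' x - s x) (r/2) \<and> cmod (G i s') \<ge> real k + 1"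
    proof
      assume "cmod (G i (\<lambda>x. s x + h x)) \<ge> real k + 1"
      then show ?thesis using DK_add[OF s h] nbh by (intro exI[of _ "\<lambda>x. s x + h x"]) simp
    next
      assume "cmod (G i (\<lambda>x. s x - h x)) \<ge> real k + 1"
      then show ?thesis using DK_diff[OF s h] derivs_le_cmul[OF nbh DK_smooth[OF h], of "-1"]
        by (intro exI[of _ "\<lambda>x. s x - h x"]) simp
    qed
    then obtain s' where s': "DK K s'" "derivs_le m (\<lambda>x. s' x - s x) (r/2)" "cmod (G i s') \<ge> real k + 1" by blast
    \<comment> \<open>Continuity of the one functional \<open>G i\<close> keeps its value within 1
      of \<open>G i s'\<close> on a sufficiently small ball of order at least
      \<open>m1\<close>.\<close>
    obtain m1 C1 where C1: "C1 \<ge> 0" "\<And>f B. DK K f \<Longrightarrow> derivs_le m1 f B \<Longrightarrow> cmod (G i f) \<le> C1 * B"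
      using seq_cont_lin_bound[OF Gi] by blast
    define r' where "r' = min (r/2) (1 / (C1 + 1))"
    \<comment> \<open>The order strictly increases along the construction, so that in the limit
      derivatives of all orders are controlled.\<close>
    define m' where "m' = max (Suc m) m1"
    have r': "0 < r'" "r' \<le> r/2" "C1 * r' \<le> 1"
    proof -
      show "0 < r'" "r' \<le> r/2" using r C1(1) by (auto simp: r'_def)
      have "C1 * r' \<le> C1 * (1 / (C1 + 1))" using C1(1) by (intro mult_left_mono) (auto simp: r'_def)
      also have "\<dots> \<le> 1" using C1(1) by simp
      finally show "C1 * r' \<le> 1" .
    qed
    have "cmod (G i f) \<ge> real k" if f: "DK K f" and n: "derivs_le m' (\<lambda>x. f x - s' x) r'" for f
    proof -
      have "derivs_le m1 (\<lambda>x. f x - s' x) r'" using derivs_le_mono[OF n] by (simp add: m'_def)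
      then have "cmod (G i f - G i s') \<le> C1 * r'"
        using C1(2)[OF DK_diff[OF f s'(1)]] seq_cont_lin_diff[OF Gi f s'(1)] by simp
      then have "cmod (G i s' - G i f) \<le> 1" using r'(3) by (simp add: norm_minus_commute)
      then show ?thesis using s'(3) norm_triangle_ineq2[of "G i s'" "G i f"] by linarith
    qed
    then show ?thesis using i s' r' unfolding m'_def
      by (intro exI[of _ s'] exI[of _ "max (Suc m) m1"] exI[of _ r'] exI[of _ i]) (auto simp: m'_def)
  qed
  define P where "P k st \<longleftrightarrow> (case st of (s, m, r) \<Rightarrow> DK K s \<and> (0::real) < r)" for k :: nat and st :: "'d tfun \<times> nat \<times> real"
  define Q where "Q k st st' \<longleftrightarrow> (case st of (s, m, r) \<Rightarrow> case st' of (s', m', r') \<Rightarrow>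
     m < m' \<and> r' \<le> r/2 \<and> derivs_le m (\<lambda>x. s' x - s x) (r/2) \<and>
     (\<exists>i\<in>I. \<forall>f. DK K f \<longrightarrow> derivs_le m' (\<lambda>x. f x - s' x) r' \<longrightarrow> cmod (G i f) \<ge> real k))"
    for k and st st' :: "'d tfun \<times> nat \<times> real"
  have "\<exists>F. \<forall>n. P n (F n) \<and> Q n (F n) (F (Suc n))"
  proof (rule dependent_nat_choice)
    show "\<exists>st. P 0 st" by (rule exI[of _ "(\<lambda>x. 0, 0, 1)"]) (simp add: P_def DK_zero)
    fix st n assume "P n st"
    then obtain s m r where st: "st = (s, m, r)" "DK K s" "0 < r" by (auto simp: P_def split: prod.splits)
    obtain s' m' r' i where "i \<in> I" "DK K s'" "m < m'" "0 < r'" "r' \<le> r/2" "derivs_le m (\<lambda>x. s' x - s x) (r/2)"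
      "\<forall>f. DK K f \<longrightarrow> derivs_le m' (\<lambda>x. f x - s' x) r' \<longrightarrow> cmod (G i f) \<ge> real n"
      using step[OF st(2,3), of m n] by blast
    then show "\<exists>y. P (Suc n) y \<and> Q n st y"
      by (intro exI[of _ "(s', m', r')"]) (auto simp: P_def Q_def st(1))
  qed
  then obtain F where F: "\<And>n. P n (F n)" "\<And>n. Q n (F n) (F (Suc n))" by blast
  define s where "s n = fst (F n)" for n
  define m where "m n = fst (snd (F n))" for n
  define r where "r n = snd (snd (F n))" for n
  have Feq: "F n = (s n, m n, r n)" for n by (simp add: s_def m_def r_def)
  have s: "DK K (s n)" and r: "r n > 0" for n using F(1)[of n] by (auto simp: P_def Feq)
  have m: "m n < m (Suc n)" and rr: "r (Suc n) \<le> r n / 2"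
    and sn: "derivs_le (m n) (\<lambda>x. s (Suc n) x - s n x) (r n / 2)"
    and ex: "\<exists>i\<in>I. \<forall>f. DK K f \<longrightarrow> derivs_le (m (Suc n)) (\<lambda>x. f x - s (Suc n) x) (r (Suc n)) \<longrightarrow> cmod (G i f) \<ge> real n" for n
    using F(2)[of n] by (auto simp: Q_def Feq)
  note sm = DK_smooth[OF s]
  have m_mono: "m n \<le> m l" if "n \<le> l" for n l
    using that m by (metis lift_Suc_mono_le less_imp_le)
  have m_ge: "n \<le> m n" for n
    by (induction n) (use m in \<open>auto intro: Suc_leI le_less_trans\<close>)
  \<comment> \<open>The difference \<open>r n - r l\<close>, rather than a sum of radii, lets the
    induction close: \<open>r (Suc l) \<le> r l / 2\<close> is just what the next step
    consumes.\<close>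
  have nbs: "derivs_le (m n) (\<lambda>x. s l x - s n x) (r n - r l)" if "n \<le> l" for n l
    using that
  proof (induction l rule: dec_induct)
    case base then show ?case by (simp add: derivs_le_zero)
  next
    case (step l)
    have "derivs_le (m n) (\<lambda>x. s (Suc l) x - s l x) (r l / 2)" using derivs_le_mono[OF sn m_mono[OF step(1)]] by simp
    from derivs_le_add[OF this step.IH smooth_diff[OF sm sm] smooth_diff[OF sm sm]]
    have "derivs_le (m n) (\<lambda>x. s (Suc l) x - s n x) (r l / 2 + (r n - r l))" by simp
    then show ?case by (rule derivs_le_mono) (use rr[of l] in auto)
  qed
  have nbs': "derivs_le (m n) (\<lambda>x. s l x - s n x) (r n)" if "n \<le> l" for n l
    using derivs_le_mono[OF nbs[OF that]] r[of l] by simp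
  have r_small: "r n \<le> r 0 * (1/2)^n" for n
    by (induction n) (use rr in \<open>auto intro: order_trans\<close>)
  have r0: "\<exists>N. r N < e \<and> k \<le> N" if "e > 0" for e k
  proof -
    have "(\<lambda>n. r 0 * (1/2)^n) \<longlonglongrightarrow> r 0 * 0" by (intro tendsto_intros) auto
    then have "\<forall>\<^sub>F n in sequentially. r 0 * (1/2)^n < e" using that by (auto dest: order_tendstoD(2))
    then obtain N where "\<forall>n\<ge>N. r 0 * (1/2)^n < e" by (auto simp: eventually_sequentially)
    then have "r (max N k) < e" using r_small[of "max N k"] by (meson le_less_trans max.cobounded1)
    then show ?thesis by (intro exI[of _ "max N k"]) auto
  qed
  have cau: "\<exists>N. \<forall>n\<ge>N. \<forall>l\<ge>N. derivs_le k (\<lambda>x. s n x - s l x) e" if e: "e > 0" for k e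
  proof -
    obtain N where N: "r N < e/2" "k \<le> N" using r0[of "e/2" k] e by auto
    have kN: "k \<le> m N" using N(2) m_ge[of N] by simp
    have "derivs_le k (\<lambda>x. s n x - s l x) e" if "n \<ge> N" "l \<ge> N" for n l
    proof -
      have "derivs_le (m N) (\<lambda>x. (s n x - s N x) - (s l x - s N x)) (r N + r N)"
        by (intro derivs_le_diff nbs' that smooth_diff sm)
      then show ?thesis using derivs_le_mono[of "m N" _ "r N + r N" k e] kN N(1) by simp
    qed
    then show ?thesis by blast
  qed
  obtain f where f: "DK K f" "\<And>js. uniform_limit UNIV (\<lambda>n. dl js (s n)) (dl js f) sequentially"
    using DK_complete[OF K s cau] by blast
  have lim: "(\<lambda>n. dl js (s n) x) \<longlonglongrightarrow> dl js f x" for js x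
    by (rule tendsto_uniform_limitI[OF f(2)]) simp
  have nbf: "derivs_le (m n) (\<lambda>x. f x - s n x) (r n)" for n
    by (rule derivs_le_limit[OF sm sm DK_smooth[OF f(1)] lim nbs'])
  \<comment> \<open>The limit \<open>f\<close> lies in every ball, so by \<open>ex\<close> the
    values of the family at \<open>f\<close> are unbounded.\<close>
  obtain B where B: "\<And>i. i \<in> I \<Longrightarrow> cmod (G i f) \<le> B" using bd[OF f(1)] by blast
  obtain n :: nat where "real n > B" using reals_Archimedean2 by blast
  moreover obtain i where "i \<in> I" "cmod (G i f) \<ge> real n" using ex[of n] f(1) nbf by blast
  ultimately show False using B[of i] by linarith
qed

text \<open>Banach-Steinhaus for sequences: a pointwise convergent sequence is pointwise bounded,
  hence uniformly dominated by one C^m norm, and this estimate passes to the limit.\<close>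

lemma seq_cont_lin_limit:
  assumes K: "bounded K" and G: "\<And>n::nat. seq_cont_lin K (G n)"
    and lim: "\<And>f. DK K f \<Longrightarrow> (\<lambda>n. G n f) \<longlonglongrightarrow> L f"
  shows "seq_cont_lin K L"
proof -
  have "\<exists>m C. C \<ge> 0 \<and> (\<forall>i\<in>UNIV. \<forall>f B. DK K f \<longrightarrow> derivs_le m f B \<longrightarrow> cmod (G i f) \<le> C * B)"
  proof (rule uniform_boundedness[OF K G])
    fix f assume "DK K f"
    from convergent_imp_Bseq[OF convergentI[OF lim[OF this]]]
    show "\<exists>B. \<forall>i\<in>UNIV. cmod (G i f) \<le> B" by (auto simp: Bseq_def)
  qed
  then obtain m C where C: "\<And>n f B. DK K f \<Longrightarrow> derivs_le m f B \<Longrightarrow> cmod (G n f) \<le> C * B" by blast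
  show ?thesis
  proof (rule seq_cont_linI[where m = m and C = C])
    fix f g a b assume fg: "DK K f" "DK K g"
    have "(\<lambda>n. G n (\<lambda>x. a * f x + b * g x)) \<longlonglongrightarrow> a * L f + b * L g"
      unfolding seq_cont_lin_lin[OF G fg] by (intro tendsto_intros lim fg)
    then show "L (\<lambda>x. a * f x + b * g x) = a * L f + b * L g"
      using lim[OF DK_lin[OF fg]] LIMSEQ_unique by blast
  next
    fix f B assume "DK K f" "derivs_le m f B"
    then show "cmod (L f) \<le> C * B"
      using tendsto_norm[OF lim] C by (blast intro: LIMSEQ_le_const2)
  qed
qed

subsection \<open>Continuity of the transposed operator\<close>

lemma cbx_mono: "r \<le> s \<Longrightarrow> cbx r \<subseteq> cbx s"
  unfolding cbx_def by (auto intro: order_trans)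

lemma distr_seq_cont_lin:
  assumes T: "distr T" and K: "bounded K" shows "seq_cont_lin K T"
  unfolding seq_cont_lin_def
proof (intro conjI allI impI)
  fix f g a b assume "DK K f" "DK K g"
  then show "T (\<lambda>x. a * f x + b * g x) = a * T f + b * T g"
    using T unfolding distr_def DK_def by blast
next
  fix fs f assume fs: "\<forall>n. DK K (fs n)" and f: "DK K f"
    and lim: "\<forall>js. uniform_limit UNIV (\<lambda>n. dl js (fs n)) (dl js f) sequentially"
  have "\<forall>n. {x. fs n x \<noteq> 0} \<subseteq> closure K" using fs closure_subset[of K] unfolding DK_def by blast
  then have "dconv fs f" unfolding dconv_def using fs f lim K
    by (auto simp: DK_def intro!: exI[of _ "closure K"])
  then show "(\<lambda>n. T (fs n)) \<longlonglongrightarrow> T f" using T unfolding distr_def by blast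
qed

lemma seq_cont_lin_fdil:
  assumes T: "distr T" and K: "bounded K" and y: "y \<in> Rstar"
  shows "seq_cont_lin K (\<lambda>f. T (fdil y f))"
proof -
  let ?K = "(\<lambda>x. dil x (ivec y)) ` K"
  have sT: "seq_cont_lin ?K T" by (rule distr_seq_cont_lin[OF T bounded_dil[OF K]])
  have dk: "DK ?K (fdil y f)" if "DK K f" for f
    using that fdil_supp[OF y, of K f] test_fdil[OF _ y] by (auto simp: DK_def)
  show ?thesis unfolding seq_cont_lin_def
  proof (intro conjI allI impI)
    fix f g a b assume fg: "DK K f" "DK K g"
    show "T (fdil y (\<lambda>x. a * f x + b * g x)) = a * T (fdil y f) + b * T (fdil y g)"
      using seq_cont_lin_lin[OF sT dk[OF fg(1)] dk[OF fg(2)], of a b] by (simp add: fdil_def)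
  next
    fix fs f assume fs: "\<forall>n. DK K (fs n)" and f: "DK K f"
      and lim: "\<forall>js. uniform_limit UNIV (\<lambda>n. dl js (fs n)) (dl js f) sequentially"
    show "(\<lambda>n. T (fdil y (fs n))) \<longlonglongrightarrow> T (fdil y f)"
    proof (rule seq_cont_lin_conv[OF sT])
      fix js
      have l: "uniform_limit UNIV (\<lambda>n x. dl js (fs n) (dil x y)) (\<lambda>x. dl js f (dil x y)) sequentially"
        unfolding uniform_limit_iff
      proof (intro allI impI)
        fix e :: real assume "e > 0"
        then have "\<forall>\<^sub>F n in sequentially. \<forall>x\<in>UNIV. dist (dl js (fs n) x) (dl js f x) < e"
          using lim[rule_format, of js] unfolding uniform_limit_iff by blast
        then show "\<forall>\<^sub>F n in sequentially. \<forall>x\<in>UNIV. dist (dl js (fs n) (dil x y)) (dl js f (dil x y)) < e"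
          by eventually_elim auto
      qed
      have "uniform_limit UNIV (\<lambda>n x. complex_of_real (prod_list (map (\<lambda>j. y $ j) js)) * dl js (fs n) (dil x y))
          (\<lambda>x. complex_of_real (prod_list (map (\<lambda>j. y $ j) js)) * dl js f (dil x y)) sequentially"
        by (rule bounded_linear.uniform_limit[OF bounded_linear_mult_right l])
      then show "uniform_limit UNIV (\<lambda>n. dl js (fdil y (fs n))) (dl js (fdil y f)) sequentially"
        using dl_fdil[OF DK_smooth[OF fs[rule_format]], of js y] dl_fdil[OF DK_smooth[OF f], of js y] by simp
    qed (use fs f dk in auto)
  qed
qed

lemma seq_cont_lin_comb:
  assumes "seq_cont_lin K G" "seq_cont_lin K H" shows "seq_cont_lin K (\<lambda>f. a * G f + b * H f)"
  unfolding seq_cont_lin_def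
proof (intro conjI allI impI)
  fix fs f assume "\<forall>n. DK K (fs n)" "DK K f"
      "\<forall>js. uniform_limit UNIV (\<lambda>n. dl js (fs n)) (dl js f) sequentially"
  then show "(\<lambda>n. a * G (fs n) + b * H (fs n)) \<longlonglongrightarrow> a * G f + b * H f"
    by (intro tendsto_intros seq_cont_lin_conv[OF assms(1)] seq_cont_lin_conv[OF assms(2)]) auto
qed (simp add: seq_cont_lin_lin[OF assms(1)] seq_cont_lin_lin[OF assms(2)] algebra_simps)

section \<open>Elementary properties of \<open>MT\<close>\<close>

lemma Rstar_approx: "\<exists>s. (\<forall>n. s n \<in> Rstar) \<and> s \<longlonglongrightarrow> (y :: real^'d::finite)"
proof -
  define s where "s n = (\<chi> j. if y $ j = 0 then 1 / real (Suc n) else y $ j)" for n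
  have "(\<lambda>n. if y $ j = 0 then 1 / real (Suc n) else y $ j) \<longlonglongrightarrow> y $ j" for j
    by (cases "y $ j = 0") (use LIMSEQ_Suc[OF lim_inverse_n'] in simp_all)
  then have "s \<longlonglongrightarrow> (\<chi> j. y $ j)" unfolding s_def by (rule tendsto_vec_lambda)
  moreover have "s n \<in> Rstar" for n by (auto simp: Rstar_def s_def)
  ultimately show ?thesis by (auto simp: vec_nth_inverse)
qed

text \<open>\<open>Rstar\<close> is dense. In particular, the test function chosen in
  \<open>MT\<close> is the only possible one.\<close>

lemma eq_on_Rstar:
  fixes f g :: "'d::finite tfun"
  assumes "continuous_on UNIV f" "continuous_on UNIV g" "\<And>y. y \<in> Rstar \<Longrightarrow> f y = g y"
  shows "f = g"
proof
  fix y :: "real^'d"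
  obtain s where s: "\<forall>n. s n \<in> Rstar" "s \<longlonglongrightarrow> y" using Rstar_approx by blast
  have "(\<lambda>n. f (s n)) \<longlonglongrightarrow> f y" "(\<lambda>n. g (s n)) \<longlonglongrightarrow> g y"
    using s(2) assms(1,2) by (auto intro: continuous_on_tendsto_compose)
  then show "f y = g y" using assms(3) s(1) LIMSEQ_unique by auto
qed

lemma MT_spec:
  assumes "DH T" "test f"
  shows "test (MT T f)" "y \<in> Rstar \<Longrightarrow> MT T f y = T (fdil y f)"
proof -
  have "\<exists>g. test g \<and> (\<forall>y\<in>Rstar. g y = T (\<lambda>\<xi>. f (dil \<xi> y)))" using assms unfolding DH_def by blast
  from someI_ex[OF this] show "test (MT T f)" "y \<in> Rstar \<Longrightarrow> MT T f y = T (fdil y f)"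
    unfolding MT_def fdil_def by auto
qed

lemma MT_unique:
  assumes "DH T" "test f" "continuous_on UNIV g" "\<And>y. y \<in> Rstar \<Longrightarrow> g y = T (fdil y f)"
  shows "MT T f = g"
  by (rule eq_on_Rstar) (use assms MT_spec in \<open>auto intro: test_cont\<close>)

lemma DH_distr: "DH T \<Longrightarrow> distr T" by (simp add: DH_def)

lemma distr_lin: "distr T \<Longrightarrow> test f \<Longrightarrow> test g \<Longrightarrow> T (\<lambda>x. a * f x + b * g x) = a * T f + b * T g"
  unfolding distr_def by blast

lemma MT_lin:
  assumes T: "DH T" and f: "test f" and g: "test g"
  shows "MT T (\<lambda>x. a * f x + b * g x) = (\<lambda>x. a * MT T f x + b * MT T g x)"
proof (rule MT_unique[OF T test_lin[OF f g]])
  show "continuous_on UNIV (\<lambda>x. a * MT T f x + b * MT T g x)"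
    by (rule test_cont[OF test_lin[OF MT_spec(1)[OF T f] MT_spec(1)[OF T g]]])
  fix y :: "real^'a" assume y: "y \<in> Rstar"
  show "a * MT T f y + b * MT T g y = T (fdil y (\<lambda>x. a * f x + b * g x))"
    using distr_lin[OF DH_distr[OF T] test_fdil[OF f y] test_fdil[OF g y], of a b]
    by (simp add: MT_spec(2)[OF T f y] MT_spec(2)[OF T g y] fdil_def)
qed

lemma MT_diff: "DH T \<Longrightarrow> test f \<Longrightarrow> test g \<Longrightarrow> MT T (\<lambda>x. f x - g x) = (\<lambda>x. MT T f x - MT T g x)"
  using MT_lin[of T f g 1 "-1"] by simp
text \<open>At a point \<open>y\<close> of \<open>Rstar\<close> both sides equal
  \<open>T (fdil (dil y z) f)\<close>. This equivariance is the source of the commutation of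
  \<open>MT T\<close> with Euler operators.\<close>

lemma MT_fdil:
  assumes T: "DH T" and f: "test f" and z: "z \<in> Rstar"
  shows "MT T (fdil z f) = fdil z (MT T f)"
proof (rule MT_unique[OF T test_fdil[OF f z]])
  show "continuous_on UNIV (fdil z (MT T f))"
    by (intro test_cont test_fdil MT_spec T f z)
  fix y :: "real^'a" assume y: "y \<in> Rstar"
  show "fdil z (MT T f) y = T (fdil y (fdil z f))"
    using MT_spec(2)[OF T f dil_Rstar[OF y z]] by (simp add: fdil_fdil) (simp add: fdil_def)
qed

section \<open>Continuity of \<open>MT\<close> and control of supports\<close>

lemma diff_quotient_LIMSEQ:
  fixes f :: "real \<Rightarrow> complex"
  assumes "(f has_vector_derivative D) (at a)" "\<And>n. h n \<noteq> 0" "h \<longlonglongrightarrow> 0"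
  shows "(\<lambda>n. (f (a + h n) - f a) / complex_of_real (h n)) \<longlonglongrightarrow> D"
proof -
  have "((\<lambda>t. norm (f (a + t) - f a - t *\<^sub>R D) / norm t) \<longlongrightarrow> 0) (at 0)"
    using assms(1) unfolding has_vector_derivative_def has_derivative_at by simp
  moreover have "filterlim h (at 0) sequentially"
    using assms(2,3) by (simp add: filterlim_at)
  ultimately have "(\<lambda>n. norm (f (a + h n) - f a - h n *\<^sub>R D) / norm (h n)) \<longlonglongrightarrow> 0"
    by (rule filterlim_compose)
  moreover have "norm (f (a + h n) - f a - h n *\<^sub>R D) / norm (h n) = norm ((f (a + h n) - f a) / complex_of_real (h n) - D)" for n
  proof -
    have "(f (a + h n) - f a) / complex_of_real (h n) - D = (f (a + h n) - f a - h n *\<^sub>R D) / complex_of_real (h n)"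
      using assms(2)[of n] by (simp add: field_simps scaleR_conv_of_real)
    then show ?thesis by (simp add: norm_divide)
  qed
  ultimately have "(\<lambda>n. norm ((f (a + h n) - f a) / complex_of_real (h n) - D)) \<longlonglongrightarrow> 0" by simp
  then show ?thesis by (simp add: LIM_zero_iff tendsto_norm_zero_iff)
qed

text \<open>By definition only \<open>f \<mapsto> T (fdil y f)\<close> with \<open>y\<close> in
  \<open>Rstar\<close> is known to be continuous. All other points are reached through limits of
  such points, and derivatives through limits of difference quotients;
  \<open>seq_cont_lin_limit\<close> keeps continuity at each stage.\<close>

lemma MT_seq_cont_lin:
  assumes T: "DH T" and K: "bounded K"
  shows "seq_cont_lin K (\<lambda>f. dl js (MT T f) y)"
proof (induction js arbitrary: y)
  case Nil
  obtain s where s: "\<forall>n. s n \<in> Rstar" "s \<longlonglongrightarrow> y" using Rstar_approx by blast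
  show ?case
  proof (rule seq_cont_lin_limit[OF K, where G = "\<lambda>n f. T (fdil (s n) f)"])
    show "seq_cont_lin K (\<lambda>f. T (fdil (s n) f))" for n
      using seq_cont_lin_fdil[OF DH_distr[OF T] K] s by blast
    fix f assume "DK K f"
    then have f: "test f" by (rule DK_test)
    have "(\<lambda>n. MT T f (s n)) \<longlonglongrightarrow> MT T f y"
      using s(2) test_cont[OF MT_spec(1)[OF T f]] by (auto intro: continuous_on_tendsto_compose)
    then show "(\<lambda>n. T (fdil (s n) f)) \<longlonglongrightarrow> dl [] (MT T f) y"
      using MT_spec(2)[OF T f] s(1) by simp
  qed
next
  case (Cons j js)
  let ?h = "\<lambda>n. 1 / real (Suc n)"
  let ?y = "\<lambda>n. y + ?h n *\<^sub>R axis j 1"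
  show ?case
  proof (rule seq_cont_lin_limit[OF K, where G = "\<lambda>n f. complex_of_real (1 / ?h n) * dl js (MT T f) (?y n) + complex_of_real (- 1 / ?h n) * dl js (MT T f) y"])
    show "seq_cont_lin K (\<lambda>f. complex_of_real (1 / ?h n) * dl js (MT T f) (?y n) + complex_of_real (- 1 / ?h n) * dl js (MT T f) y)" for n
      by (rule seq_cont_lin_comb[OF Cons.IH Cons.IH])
    fix f assume "DK K f"
    then have f: "test f" by (rule DK_test)
    have "(\<lambda>n. (dl js (MT T f) (y + (0 + ?h n) *\<^sub>R axis j 1) - dl js (MT T f) (y + 0 *\<^sub>R axis j 1)) / complex_of_real (?h n)) \<longlonglongrightarrow> dl (j # js) (MT T f) y"
      unfolding dl_Cons
      by (rule diff_quotient_LIMSEQ[OF smooth_deriv0[OF smooth_dl[OF test_smooth[OF MT_spec(1)[OF T f]]]]])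
        (use LIMSEQ_Suc[OF lim_inverse_n'] in auto)
    moreover have "(\<lambda>n. (dl js (MT T f) (y + (0 + ?h n) *\<^sub>R axis j 1) - dl js (MT T f) (y + 0 *\<^sub>R axis j 1)) / complex_of_real (?h n))
      = (\<lambda>n. complex_of_real (1 / ?h n) * dl js (MT T f) (?y n) + complex_of_real (- 1 / ?h n) * dl js (MT T f) y)"
      by (simp add: fun_eq_iff algebra_simps)
    ultimately show "(\<lambda>n. complex_of_real (1 / ?h n) * dl js (MT T f) (?y n) + complex_of_real (- 1 / ?h n) * dl js (MT T f) y) \<longlonglongrightarrow> dl (j # js) (MT T f) y"
      by simp
  qed
qed

text \<open>Uniform boundedness for the evaluations of all derivatives up to order \<open>l\<close>
  at all points. For fixed \<open>f\<close> they are bounded because \<open>MT T f\<close> is a test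
  function.\<close>

lemma MT_bound:
  assumes T: "DH T" and K: "bounded K"
  shows "\<exists>m C. C \<ge> 0 \<and> (\<forall>f B. DK K f \<longrightarrow> derivs_le m f B \<longrightarrow> derivs_le l (MT T f) (C * B))"
proof -
  have "\<exists>m C. C \<ge> 0 \<and> (\<forall>i\<in>{(js,y). length js \<le> l}. \<forall>f B. DK K f \<longrightarrow> derivs_le m f B \<longrightarrow>
     cmod ((\<lambda>(js,y) f. dl js (MT T f) y) i f) \<le> C * B)"
  proof (rule uniform_boundedness[OF K])
    show "seq_cont_lin K (case i of (js, y) \<Rightarrow> \<lambda>f. dl js (MT T f) y)" for i
      by (cases i) (simp add: MT_seq_cont_lin[OF T K])
    fix f assume "DK K f"
    then obtain B where "derivs_le l (MT T f) B" using derivs_le_ex[OF MT_spec(1)[OF T DK_test]] by blast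
    then show "\<exists>B. \<forall>i\<in>{(js, y). length js \<le> l}. cmod ((case i of (js, y) \<Rightarrow> \<lambda>f. dl js (MT T f) y) f) \<le> B"
      unfolding derivs_le_def by (intro exI[of _ B]) auto
  qed
  then obtain m C where C: "C \<ge> 0" "\<forall>i\<in>{(js,y). length js \<le> l}. \<forall>f B. DK K f \<longrightarrow> derivs_le m f B \<longrightarrow>
     cmod ((\<lambda>(js,y) f. dl js (MT T f) y) i f) \<le> C * B" by blast
  have "derivs_le l (MT T f) (C * B)" if "DK K f" "derivs_le m f B" for f B
    unfolding derivs_le_def
  proof (intro allI impI)
    fix js :: "'a list" and y assume "length js \<le> l"
    then show "cmod (dl js (MT T f) y) \<le> C * B"
      using C(2)[THEN bspec, of "(js, y)"] that by simp
  qed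
  then show ?thesis using C(1) by blast
qed

text \<open>If the supports were not contained in one cube, there would be points \<open>y n\<close>
  leaving every cube at which some \<open>MT T (f n)\<close> is nonzero. Evaluations at these
  points, with arbitrarily large weights, are pointwise bounded, because a fixed
  \<open>MT T g\<close> sees only finitely many of the points; the weights are chosen to contradict
  the resulting uniform estimate.\<close>

lemma MT_support:
  assumes T: "DH T" and K: "bounded K"
  shows "\<exists>r>0. \<forall>f. DK K f \<longrightarrow> DK (cbx r) (MT T f)"
proof (rule ccontr)
  assume H: "\<not> ?thesis"
  have "\<exists>f y. DK K f \<and> y \<notin> cbx (real (Suc n)) \<and> MT T f y \<noteq> 0" for n
  proof (rule ccontr)
    assume "\<not> ?thesis"
    then have "\<forall>f. DK K f \<longrightarrow> DK (cbx (real (Suc n))) (MT T f)"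
      using MT_spec(1)[OF T DK_test] unfolding DK_def by blast
    with H show False by (metis of_nat_0_less_iff zero_less_Suc)
  qed
  then obtain f y where f: "\<And>n. DK K (f n)" and y: "\<And>n. y n \<notin> cbx (real (Suc n))"
     and nz: "\<And>n::nat. MT T (f n) (y n) \<noteq> 0" by metis
  have "\<forall>n. \<exists>B>0. derivs_le n (f n) B"
  proof
    fix n
    obtain B where "B \<ge> 0" "derivs_le n (f n) B" using derivs_le_ex[OF DK_test[OF f]] by blast
    then show "\<exists>B>0. derivs_le n (f n) B" using derivs_le_mono[of n "f n" B n "B + 1"] by (intro exI[of _ "B + 1"]) auto
  qed
  then obtain B where B: "\<And>n. B n > 0" "\<And>n. derivs_le n (f n) (B n)" by metis
  \<comment> \<open>This weight makes the value at \<open>f n\<close> equal to \<open>Suc n\<close>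
    times the bound \<open>B n\<close> for the derivatives of \<open>f n\<close>.\<close>
  define w where "w n = complex_of_real (real (Suc n) * B n / cmod (MT T (f n) (y n)))" for n
  have "\<exists>m C. C \<ge> 0 \<and> (\<forall>n\<in>UNIV. \<forall>f B. DK K f \<longrightarrow> derivs_le m f B \<longrightarrow> cmod (w n * MT T f (y n)) \<le> C * B)"
  proof (rule uniform_boundedness[OF K])
    fix n
    have "seq_cont_lin K (\<lambda>f. w n * dl [] (MT T f) (y n) + 0 * dl [] (MT T f) (y n))"
      by (rule seq_cont_lin_comb[OF MT_seq_cont_lin[OF T K] MT_seq_cont_lin[OF T K]])
    then show "seq_cont_lin K (\<lambda>f. w n * MT T f (y n))" by simp
  next
    fix g assume g: "DK K g"
    obtain r where r: "\<forall>x. x \<notin> cbx r \<longrightarrow> MT T g x = 0"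
      using test_supp[OF MT_spec(1)[OF T DK_test[OF g]]] by blast
    obtain N :: nat where N: "real N \<ge> r" using real_arch_simple by blast
    have z: "MT T g (y n) = 0" if "n \<ge> N" for n
    proof -
      have "r \<le> real (Suc n)" using N that by linarith
      then have "cbx r \<subseteq> cbx (real (Suc n))" by (rule cbx_mono)
      then show ?thesis using y[of n] r by blast
    qed
    have "cmod (w n * MT T g (y n)) \<le> (\<Sum>n<N. cmod (w n * MT T g (y n)))" for n
    proof (cases "n < N")
      case True
      then show ?thesis using member_le_sum[of n "{..<N}" "\<lambda>n. cmod (w n * MT T g (y n))"] by simp
    next
      case False then show ?thesis using z[of n] by (simp add: sum_nonneg)
    qed
    then show "\<exists>B. \<forall>n\<in>UNIV. cmod (w n * MT T g (y n)) \<le> B" by blast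
  qed
  then obtain m C where mC: "\<And>n f B. DK K f \<Longrightarrow> derivs_le m f B \<Longrightarrow> cmod (w n * MT T f (y n)) \<le> C * B" by blast
  have le: "real (Suc n) \<le> C" if "n \<ge> m" for n
  proof -
    have "cmod (w n * MT T (f n) (y n)) = real (Suc n) * B n"
      unfolding norm_mult w_def norm_of_real using nz[of n] B(1)[of n] by simp
    then have "real (Suc n) * B n \<le> C * B n" using mC[OF f derivs_le_mono[OF B(2) that order_refl], of n] by simp
    then show ?thesis using B(1)[of n] by simp
  qed
  obtain n :: nat where "real n > C" using reals_Archimedean2 by blast
  moreover have "real n \<le> C" using le[of "max n m"] by simp
  ultimately show False by simp
qed

lemma MT_conv:
  assumes T: "DH T" and K: "bounded K" and fs: "\<And>n. DK K (fs n)" and f: "DK K f"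
    and lim: "\<And>js. uniform_limit UNIV (\<lambda>n. dl js (fs n)) (dl js f) sequentially"
  shows "uniform_limit UNIV (\<lambda>n. dl js (MT T (fs n))) (dl js (MT T f)) sequentially"
proof (rule uniform_limit_derivs_le)
  show "smooth_fun (MT T (fs n))" "smooth_fun (MT T f)" for n
    using MT_spec(1)[OF T DK_test] fs f test_smooth by blast+
  fix m and e :: real assume e: "e > 0"
  obtain m' C where C: "C \<ge> 0" "\<And>f B. DK K f \<Longrightarrow> derivs_le m' f B \<Longrightarrow> derivs_le m (MT T f) (C * B)"
    using MT_bound[OF T K, of m] by blast
  have "e / (C + 1) > 0" using e C by simp
  then obtain N where N: "\<forall>n\<ge>N. derivs_le m' (\<lambda>x. fs n x - f x) (e / (C + 1))"
    using derivs_le_of_uniform_limit[where fs = fs and f = f and m = m'] lim DK_smooth fs f by blast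
  have "derivs_le m (\<lambda>x. MT T (fs n) x - MT T f x) e" if "n \<ge> N" for n
  proof -
    have "derivs_le m (MT T (\<lambda>x. fs n x - f x)) (C * (e / (C + 1)))" using C(2) N that DK_diff fs f by blast
    moreover have "C * (e / (C + 1)) \<le> e" using C(1) e by (simp add: field_simps)
    ultimately have "derivs_le m (MT T (\<lambda>x. fs n x - f x)) e"
      using derivs_le_mono[of m "MT T (\<lambda>x. fs n x - f x)" "C * (e / (C + 1))" m e] by simp
    then show ?thesis by (simp add: MT_diff[OF T DK_test[OF fs] DK_test[OF f]])
  qed
  then show "\<exists>N. \<forall>n\<ge>N. derivs_le m (\<lambda>x. MT T (fs n) x - MT T f x) e" by blast
qed

lemma LT_distr:
  assumes T: "DH T" and S: "distr S" shows "distr (LT T S)"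
  unfolding distr_def
proof (intro conjI allI impI)
  fix f :: "'a tfun" assume "\<not> test f" then show "LT T S f = 0" by (simp add: LT_def mconv_def)
next
  fix f g :: "'a tfun" and a b assume fg: "test f" "test g"
  then show "LT T S (\<lambda>x. a * f x + b * g x) = a * LT T S f + b * LT T S g"
    by (simp add: LT_def mconv_def test_lin MT_lin[OF T] distr_lin[OF S] MT_spec(1)[OF T])
next
  fix fs and f :: "'a tfun" assume d: "dconv fs f"
  then obtain K where K: "compact K" "\<forall>n. {x. fs n x \<noteq> 0} \<subseteq> K" and t: "\<And>n. test (fs n)" "test f"
    and lim: "\<And>js. uniform_limit UNIV (\<lambda>n. dl js (fs n)) (dl js f) sequentially"
    unfolding dconv_def by blast
  have bK: "bounded K" using K(1) compact_imp_bounded by blast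
  have fs: "DK K (fs n)" for n using K(2) t by (auto simp: DK_def)
  \<comment> \<open>\<open>dconv\<close> restricts the supports of the sequence only; that the limit
    vanishes outside \<open>K\<close> follows from pointwise convergence.\<close>
  have "f x = 0" if "x \<notin> K" for x
  proof -
    have "(\<lambda>n. dl [] (fs n) x) \<longlonglongrightarrow> dl [] f x" by (rule tendsto_uniform_limitI[OF lim]) simp
    then show ?thesis using fs that by (simp add: DK_def LIMSEQ_const_iff)
  qed
  then have f: "DK K f" using t by (simp add: DK_def)
  obtain r where r: "\<And>f. DK K f \<Longrightarrow> DK (cbx r) (MT T f)" using MT_support[OF T bK] by blast
  have "(\<lambda>n. S (MT T (fs n))) \<longlonglongrightarrow> S (MT T f)"
    by (rule seq_cont_lin_conv[OF distr_seq_cont_lin[OF S, of "cbx r"]])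
      (use r fs f MT_conv[OF T bK fs f lim] in \<open>auto intro: compact_imp_bounded\<close>)
  then show "(\<lambda>n. LT T S (fs n)) \<longlonglongrightarrow> LT T S f" by (simp add: LT_def mconv_def t)
qed

text \<open>Weak-star continuity is immediate: for a test function \<open>f\<close> the value
  \<open>LT T S f\<close> is \<open>S\<close> evaluated at the fixed function \<open>MT T f\<close>,
  that is, a coordinate projection of the product topology.\<close>

lemma hadamard_LT:
  assumes T: "DH T" and ev: "\<And>\<alpha>. \<exists>m. LT T (mono \<alpha>) = (\<lambda>f. m * mono \<alpha> f)"
  shows "hadamard (LT T)"
  unfolding hadamard_def
proof (intro conjI allI impI)
  show "distr (LT T S)" if "distr S" for S by (rule LT_distr[OF T that])
  show "LT T (\<lambda>f. a * S f + b * R f) = (\<lambda>f. a * LT T S f + b * LT T R f)" for S R a b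
    by (auto simp: LT_def mconv_def)
  show "continuous_on {S. distr S} (LT T)"
  proof (rule continuous_on_coordinatewise_then_product)
    fix f :: "'a tfun"
    show "continuous_on {S. distr S} (\<lambda>S. LT T S f)"
      by (cases "test f") (auto simp: LT_def mconv_def intro: continuous_on_subset[OF continuous_on_product_coordinates])
  qed
qed (use ev in blast)

text \<open>A function supported in the thin slab \<open>|x $ j| \<le> \<epsilon>\<close> can be
  dilated into the unit cube by a vector whose entry at \<open>j\<close> is larger than
  \<open>r\<close>. Its value under \<open>T\<close> is then a value of some \<open>MT T g\<close>
  outside the cube \<open>cbx r\<close>, where all these functions vanish.\<close>

lemma T_zero_near_axis:
  assumes T: "DH T"
  shows "\<exists>\<epsilon>>0. \<forall>f j. test f \<longrightarrow> (\<forall>x. \<bar>x $ j\<bar> > \<epsilon> \<longrightarrow> f x = 0) \<longrightarrow> T f = 0"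
proof -
  obtain r where r: "r > 0" "\<And>f. DK (cbx 1) f \<Longrightarrow> DK (cbx r) (MT T f)"
    using MT_support[OF T, of "cbx 1"] compact_imp_bounded[OF compact_cbx] by blast
  define \<epsilon> where "\<epsilon> = 1 / (r + 1)"
  have "T f = 0" if f: "test f" and z: "\<forall>x. \<bar>x $ j\<bar> > \<epsilon> \<longrightarrow> f x = 0" for f j
  proof -
    obtain R where R: "R > 0" "\<forall>x. x \<notin> cbx R \<longrightarrow> f x = 0" using test_supp[OF f] by blast
    \<comment> \<open>The entry \<open>r + 1\<close> stretches the slab exactly to width 1, and
      \<open>1 / R\<close> compresses the other directions into the unit cube.\<close>
    define y :: "real^'a" where "y = (\<chi> i. if i = j then r + 1 else 1 / R)"
    have y: "y \<in> Rstar" using r(1) R(1) by (auto simp: y_def Rstar_def)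
    have yr: "y \<notin> cbx r" using r(1) by (auto simp: y_def cbx_def intro!: exI[of _ j])
    define g where "g = fdil (ivec y) f"
    have "DK (cbx 1) g" unfolding DK_def
    proof (intro conjI allI impI)
      show "test g" unfolding g_def by (rule test_fdil[OF f ivec_Rstar[OF y]])
      fix x :: "real^'a" assume "x \<notin> cbx 1"
      then obtain i where i: "\<bar>x $ i\<bar> > 1" by (auto simp: cbx_def not_le)
      show "g x = 0"
      proof (cases "i = j")
        case True
        then have "\<bar>dil x (ivec y) $ j\<bar> > \<epsilon>" using i r(1) by (simp add: y_def \<epsilon>_def abs_mult divide_strict_right_mono)
        then show ?thesis using z by (simp add: g_def fdil_def)
      next
        case False
        then have "\<bar>dil x (ivec y) $ i\<bar> > R" using i R(1) by (simp add: y_def abs_mult)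
        then have "dil x (ivec y) \<notin> cbx R" by (auto simp: cbx_def not_le intro!: exI[of _ i])
        then show ?thesis using R by (simp add: g_def fdil_def)
      qed
    qed
    then have "MT T g y = 0" using r(2) yr unfolding DK_def by blast
    moreover have "MT T g y = T (fdil y g)"
      by (rule MT_spec(2)[OF T _ y]) (simp add: g_def test_fdil[OF f ivec_Rstar[OF y]])
    moreover have "fdil y g = f" by (simp add: g_def fdil_fdil y)
    ultimately show ?thesis by simp
  qed
  moreover have "\<epsilon> > 0" using r(1) by (simp add: \<epsilon>_def)
  ultimately show ?thesis by blast
qed

subsection \<open>Smooth functions of one variable and cutoffs\<close>

text \<open>All derivatives are carried along as one sequence, so that the order of differentiation
  is an index.\<close>

definition jet :: "(nat \<Rightarrow> real \<Rightarrow> real) \<Rightarrow> bool" where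
  "jet D \<longleftrightarrow> (\<forall>n x. (D n has_real_derivative D (Suc n) x) (at x))"

definition smooth_real :: "(real \<Rightarrow> real) \<Rightarrow> bool" where
  "smooth_real f \<longleftrightarrow> (\<exists>D. jet D \<and> D 0 = f)"

lemma jetD: "jet D \<Longrightarrow> (D n has_real_derivative D (Suc n) x) (at x)"
  by (simp add: jet_def)

lemma jet_shift: "jet D \<Longrightarrow> jet (\<lambda>n. D (n + k))"
  by (simp add: jet_def)

lemma jet_cont: "jet D \<Longrightarrow> continuous_on S (D n)"
  by (intro continuous_at_imp_continuous_on ballI DERIV_isCont[OF jetD])

lemma smooth_real_coinduct:
  assumes "f \<in> S" and der: "\<And>g. g \<in> S \<Longrightarrow> \<exists>g'\<in>S. \<forall>x. (g has_real_derivative g' x) (at x)"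
  shows "smooth_real f"
proof -
  obtain F where F: "\<And>g. g \<in> S \<Longrightarrow> F g \<in> S \<and> (\<forall>x. (g has_real_derivative F g x) (at x))"
    using der by metis
  have S: "(F ^^ n) f \<in> S" for n by (induction n) (use F \<open>f \<in> S\<close> in auto)
  show ?thesis unfolding smooth_real_def jet_def
    by (rule exI[of _ "\<lambda>n. (F ^^ n) f"]) (use F S in auto)
qed

lemma smooth_real_deriv: assumes "smooth_real f" shows "\<exists>f'. smooth_real f' \<and> (\<forall>x. (f has_real_derivative f' x) (at x))"
proof -
  obtain D where D: "jet D" "D 0 = f" using assms by (auto simp: smooth_real_def)
  have "smooth_real (D 1)" using jet_shift[OF D(1), of 1] unfolding smooth_real_def by (intro exI[of _ "\<lambda>n. D (n + 1)"]) auto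
  then show ?thesis using jetD[OF D(1), of 0] D(2) by (intro exI[of _ "D 1"]) auto
qed

lemma smooth_real_cont: "smooth_real f \<Longrightarrow> continuous_on S f"
  using jet_cont by (auto simp: smooth_real_def)

lemma smooth_realI: assumes "smooth_real f'" "\<And>x. (f has_real_derivative f' x) (at x)" shows "smooth_real f"
proof (rule smooth_real_coinduct[of f "insert f {g. smooth_real g}"])
  fix g assume "g \<in> insert f {g. smooth_real g}"
  then show "\<exists>g'\<in>insert f {g. smooth_real g}. \<forall>x. (g has_real_derivative g' x) (at x)"
    using assms smooth_real_deriv by auto
qed simp

lemma smooth_real_const [simp]: "smooth_real (\<lambda>x. c)"
  unfolding smooth_real_def by (intro exI[of _ "\<lambda>n x. if n = 0 then c else 0"]) (auto simp: jet_def)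

lemma smooth_real_id [simp]: "smooth_real (\<lambda>x. x)"
  by (rule smooth_realI[of "\<lambda>x. 1"]) (auto intro!: derivative_eq_intros)

inductive_set sum_of_products_real :: "(real \<Rightarrow> real) set" where
  prods1_mult: "smooth_real f \<Longrightarrow> smooth_real g \<Longrightarrow> (\<lambda>x. f x * g x) \<in> sum_of_products_real"
| prods1_add: "u \<in> sum_of_products_real \<Longrightarrow> v \<in> sum_of_products_real \<Longrightarrow> (\<lambda>x. u x + v x) \<in> sum_of_products_real"

lemma smooth_real_prods: assumes u: "u \<in> sum_of_products_real" shows "smooth_real u"
proof (rule smooth_real_coinduct[OF u])
  fix g assume "g \<in> sum_of_products_real"
  then show "\<exists>g'\<in>sum_of_products_real. \<forall>x. (g has_real_derivative g' x) (at x)"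
  proof induction
    case (prods1_mult f g)
    obtain f' g' where d: "smooth_real f'" "smooth_real g'" "\<forall>x. (f has_real_derivative f' x) (at x)" "\<forall>x. (g has_real_derivative g' x) (at x)"
      using smooth_real_deriv prods1_mult by meson
    show ?case
    proof (rule bexI[of _ "\<lambda>x. f' x * g x + f x * g' x"])
      show "\<forall>x. ((\<lambda>x. f x * g x) has_real_derivative f' x * g x + f x * g' x) (at x)"
        using d by (auto intro!: derivative_eq_intros)
    qed (intro sum_of_products_real.intros d prods1_mult)
  next
    case (prods1_add u v)
    then obtain u' v' where "u' \<in> sum_of_products_real" "v' \<in> sum_of_products_real"
      "\<forall>x. (u has_real_derivative u' x) (at x)" "\<forall>x. (v has_real_derivative v' x) (at x)" by blast
    then show ?case
      by (intro bexI[of _ "\<lambda>x. u' x + v' x"]) (auto intro!: sum_of_products_real.intros DERIV_add)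
  qed
qed

lemma smooth_real_mult: "smooth_real f \<Longrightarrow> smooth_real g \<Longrightarrow> smooth_real (\<lambda>x. f x * g x)"
  by (rule smooth_real_prods[OF prods1_mult])
lemma smooth_real_add: "smooth_real f \<Longrightarrow> smooth_real g \<Longrightarrow> smooth_real (\<lambda>x. f x + g x)"
  using smooth_real_prods[OF prods1_add[OF prods1_mult[of f "\<lambda>x. 1"] prods1_mult[of g "\<lambda>x. 1"]]] by simp
lemma smooth_real_cmul: "smooth_real f \<Longrightarrow> smooth_real (\<lambda>x. c * f x)"
  using smooth_real_mult[of "\<lambda>x. c" f] by simp
lemma smooth_real_minus: "smooth_real f \<Longrightarrow> smooth_real (\<lambda>x. - f x)"
  using smooth_real_cmul[of f "-1"] by simp

lemma smooth_real_affine: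
  assumes "smooth_real f" shows "smooth_real (\<lambda>x. f (a * x + b))"
proof (rule smooth_real_coinduct[of _ "{\<lambda>x. c * g (a * x + b) | c g. smooth_real g}"])
  show "(\<lambda>x. f (a * x + b)) \<in> {\<lambda>x. c * g (a * x + b) | c g. smooth_real g}"
    using assms by (auto intro!: exI[of _ 1] exI[of _ f])
  fix h assume "h \<in> {\<lambda>x. c * g (a * x + b) | c g. smooth_real g}"
  then obtain c g where h: "h = (\<lambda>x. c * g (a * x + b))" "smooth_real g" by blast
  obtain g' where g': "smooth_real g'" "\<And>x. (g has_real_derivative g' x) (at x)" using smooth_real_deriv[OF h(2)] by blast
  have "(h has_real_derivative (c * a) * g' (a * x + b)) (at x)" for x
    unfolding h(1) by (auto intro!: derivative_eq_intros DERIV_chain2[OF g'(2)])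
  then show "\<exists>g'\<in>{\<lambda>x. c * g (a * x + b) | c g. smooth_real g}. \<forall>x. (h has_real_derivative g' x) (at x)"
    using g'(1) by (intro bexI[of _ "\<lambda>x. (c * a) * g' (a * x + b)"]) blast+
qed

lemma DERIV_zero_open:
  fixes f :: "real \<Rightarrow> real"
  assumes "\<And>s. s < a \<Longrightarrow> f s = 0" "\<And>x. (f has_real_derivative f' x) (at x)" "s < a"
  shows "f' s = 0"
proof -
  have "\<forall>\<^sub>F x in nhds s. x < a" using assms(3) by (intro eventually_nhds_in_open[of "{..<a}", simplified]) auto
  then have "\<forall>\<^sub>F x in nhds s. f x = 0" by eventually_elim (use assms(1) in auto)
  then have "(f has_real_derivative f' s) (at s) \<longleftrightarrow> ((\<lambda>_. 0) has_real_derivative f' s) (at s)"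
    by (intro DERIV_cong_ev) auto
  then have "((\<lambda>_. 0) has_real_derivative f' s) (at s)" using assms(2) by simp
  then show ?thesis using DERIV_unique DERIV_const by blast
qed

text \<open>Since \<open>b\<close> vanishes to the left of \<open>a > 0\<close>, the singularity at
  0 is never met. The quotients of such functions by powers of \<open>s\<close> form a family closed
  under differentiation.\<close>

lemma smooth_real_div:
  assumes "smooth_real b" "\<And>s. s < a \<Longrightarrow> b s = 0" "a > 0"
  shows "smooth_real (\<lambda>s. b s / s)"
proof (rule smooth_real_coinduct[of _ "{\<lambda>s. b s / s ^ p | b p. smooth_real b \<and> (\<forall>s<a. b s = 0)}"])
  show "(\<lambda>s. b s / s) \<in> {\<lambda>s. b s / s ^ p | b p. smooth_real b \<and> (\<forall>s<a. b s = 0)}"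
    using assms by (auto intro!: exI[of _ b] exI[of _ 1])
  fix h assume "h \<in> {\<lambda>s. b s / s ^ p | b p. smooth_real b \<and> (\<forall>s<a. b s = 0)}"
  then obtain b p where h: "h = (\<lambda>s. b s / s ^ p)" "smooth_real b" "\<forall>s<a. b s = 0" by blast
  obtain b' where b': "smooth_real b'" "\<And>x. (b has_real_derivative b' x) (at x)" using smooth_real_deriv[OF h(2)] by blast
  have b'0: "b' s = 0" if "s < a" for s
    using DERIV_zero_open[of a b b' s] h(3) b'(2) that by blast
  let ?g = "\<lambda>s. (s * b' s + (- real p) * b s) / s ^ (Suc p)"
  have hd: "(h has_real_derivative ?g s) (at s)" for s
  proof (cases "s < a")
    case True
    have "\<forall>\<^sub>F x in nhds s. x < a" using True by (intro eventually_nhds_in_open[of "{..<a}", simplified]) auto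
    then have "\<forall>\<^sub>F x in nhds s. h x = 0" by eventually_elim (use h in auto)
    then have "(h has_real_derivative 0) (at s) \<longleftrightarrow> ((\<lambda>_. 0) has_real_derivative 0) (at s)"
      by (intro DERIV_cong_ev) auto
    then show ?thesis using True h(3) b'0 by simp
  next
    case False
    then have s: "s > 0" using assms(3) by simp
    have d: "((\<lambda>s. s ^ p) has_real_derivative real p * s ^ (p - Suc 0)) (at s)" by (rule DERIV_pow)
    have "(b' s * s ^ p - b s * (real p * s ^ (p - Suc 0))) / (s ^ p * s ^ p) = ?g s"
      using s by (cases p) (auto simp: field_simps)
    then show ?thesis unfolding h(1) using DERIV_divide[OF b'(2) d] s by simp
  qed
  have "smooth_real (\<lambda>s. s * b' s + (- real p) * b s)"
    by (intro smooth_real_add smooth_real_mult smooth_real_cmul smooth_real_id b' h)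
  moreover have "\<forall>s<a. s * b' s + (- real p) * b s = 0" using b'0 h(3) by simp
  ultimately have "?g \<in> {\<lambda>s. b s / s ^ p | b p. smooth_real b \<and> (\<forall>s<a. b s = 0)}"
    unfolding mem_Collect_eq
    by (intro exI[of _ "\<lambda>s. s * b' s + (- real p) * b s"] exI[of _ "Suc p"] conjI refl)
  with hd
  show "\<exists>g'\<in>{\<lambda>s. b s / s ^ p | b p. smooth_real b \<and> (\<forall>s<a. b s = 0)}. \<forall>x. (h has_real_derivative g' x) (at x)"
    by (intro bexI[of _ ?g] allI)
qed

lemma smooth_real_primitive:
  assumes f: "smooth_real f" and z: "\<And>u. u \<le> 0 \<Longrightarrow> f u = 0"
  shows "\<exists>F. smooth_real F \<and> (\<forall>u. (F has_real_derivative f u) (at u)) \<and> (\<forall>u\<le>0. F u = 0)"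
proof -
  \<comment> \<open>Starting at -1 makes 0 an interior point, so that the fundamental theorem also
    applies there; the added piece contributes nothing because \<open>f\<close> vanishes on
    it.\<close>
  define F where "F u = integral {-1..u} f" for u
  have cont: "continuous_on A f" for A by (rule smooth_real_cont[OF f])
  have F0: "F u = 0" if "u \<le> 0" for u
    using integral_cong[of "{-1..u}" f "\<lambda>_. 0"] z that by (auto simp: F_def)
  have D: "(F has_real_derivative f u) (at u)" for u
  proof (cases "u < 0")
    case True
    have "\<forall>\<^sub>F x in nhds u. x < 0" using True by (intro eventually_nhds_in_open[of "{..<0}", simplified]) auto
    then have "\<forall>\<^sub>F x in nhds u. F x = 0" by eventually_elim (use F0 in auto)
    then have "(F has_real_derivative 0) (at u) \<longleftrightarrow> ((\<lambda>_. 0) has_real_derivative 0) (at u)"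
      by (intro DERIV_cong_ev) auto
    then show ?thesis using True z by simp
  next
    case False
    have "((\<lambda>u. integral {-1..u} f) has_vector_derivative f u) (at u within {-1..u+1})"
      by (rule integral_has_vector_derivative[OF cont]) (use False in auto)
    moreover have "at u within {-1..u+1} = at u" using False by (intro at_within_interior) auto
    ultimately show ?thesis by (simp add: F_def[abs_def] has_real_derivative_iff_has_vector_derivative)
  qed
  show ?thesis using smooth_realI[OF f D] D F0 by blast
qed

text \<open>The span of \<open>exp (- 1/u)\<close> times powers of \<open>1/u\<close>, extended by
  0: the smallest convenient family that contains the classical flat function and is closed under
  differentiation.\<close>

inductive_set flat_exp :: "(real \<Rightarrow> real) set" where
  flat_exp_base: "(\<lambda>u. if u > 0 then c * (1/u)^p * exp (- (1/u)) else 0) \<in> flat_exp"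
| flat_exp_add: "f \<in> flat_exp \<Longrightarrow> g \<in> flat_exp \<Longrightarrow> (\<lambda>u. f u + g u) \<in> flat_exp"

lemma power_le_fact_exp: assumes "0 \<le> (x::real)" shows "x ^ n \<le> fact n * exp x"
proof -
  have "(\<Sum>k\<in>{n}. x^k /\<^sub>R fact k) \<le> (\<Sum>k. x^k /\<^sub>R fact k)"
    by (rule sum_le_suminf) (use assms summable_exp_generic[of x] in auto)
  then show ?thesis by (simp add: exp_def field_simps)
qed

lemma flat_exp_base_deriv:
  "((\<lambda>u. if u > 0 then c * (1/u)^p * exp (- (1/u)) else 0) has_real_derivative
    (if x > 0 then (- c * real p) * (1/x)^(p+1) * exp (- (1/x)) else 0) + (if x > 0 then c * (1/x)^(p+2) * exp (- (1/x)) else 0)) (at x)"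
  (is "(?f has_real_derivative ?g) _")
proof -
  consider "x > 0" | "x < 0" | "x = 0" by linarith
  then show ?thesis
  proof cases
    case 1
    have d1: "((\<lambda>u. c * (1/u)^p * exp (- (1/u))) has_real_derivative ?g) (at x)"
    proof -
      have d: "((\<lambda>u. (1/u)^p) has_real_derivative real p * (- ((1/x)^2) * (1/x)^(p - Suc 0))) (at x)"
        by (rule DERIV_power) (use 1 in \<open>auto intro!: derivative_eq_intros simp: power2_eq_square\<close>)
      have e: "((\<lambda>u. exp (- (1/u))) has_real_derivative (1/x)^2 * exp (- (1/x))) (at x)"
        using 1 by (auto intro!: derivative_eq_intros simp: power2_eq_square)
      have "c * (real p * (- ((1/x)^2) * (1/x)^(p - Suc 0))) * exp (- (1/x)) + (1/x)^2 * exp (- (1/x)) * (c * (1/x)^p) = ?g"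
      proof -
        have "c * (real p * (- (w^2) * w^(p - Suc 0))) * E + w^2 * E * (c * w^p)
           = (- c * real p) * w^(p+1) * E + c * w^(p+2) * E" for w E :: real
          by (cases p) (auto simp: algebra_simps power2_eq_square)
        from this[of "1/x" "exp (- (1/x))"] show ?thesis using 1 by simp
      qed
      then show ?thesis using DERIV_mult[OF DERIV_cmult[OF d, of c] e] by simp
    qed
    have d2: "\<forall>\<^sub>F u in nhds x. ?f u = c * (1/u)^p * exp (- (1/u))"
    proof -
      have "\<forall>\<^sub>F u in nhds x. u > 0" using 1 by (intro eventually_nhds_in_open[of "{0<..}", simplified]) auto
      then show ?thesis by eventually_elim auto
    qed
    show ?thesis using d1 DERIV_cong_ev[OF refl d2 refl, of ?g] by simp
  next
    case 2
    have "\<forall>\<^sub>F u in nhds x. ?f u = 0"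
    proof -
      have "\<forall>\<^sub>F u in nhds x. u < 0" using 2 by (intro eventually_nhds_in_open[of "{..<0}", simplified]) auto
      then show ?thesis by eventually_elim auto
    qed
    then show ?thesis using DERIV_cong_ev[OF refl _ refl, of ?f "\<lambda>_. 0" x 0] 2 by simp
  next
    case 3
    \<comment> \<open>Two spare powers of \<open>1/u\<close> in \<open>power_le_fact_exp\<close>
      give a quadratic bound, hence derivative 0 at the origin.\<close>
    have b: "\<bar>?f u\<bar> \<le> (\<bar>c\<bar> * fact (p+2)) * u^2" for u
    proof (cases "u > 0")
      case True
      have "(1/u)^(p+2) \<le> fact (p+2) * exp (1/u)" using power_le_fact_exp[of "1/u" "p+2"] True by simp
      from mult_right_mono[OF this, of "exp (- (1/u))"]
      have e: "(1/u)^(p+2) * exp (-(1/u)) \<le> fact (p+2)"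
        by (simp only: mult.assoc exp_minus_inverse mult_1_right exp_ge_zero)
      have "(1/u)^p * exp (-(1/u)) = ((1/u)^(p+2) * exp (-(1/u))) * u^2"
        using True by (simp add: power_add power2_eq_square)
      also have "\<dots> \<le> fact (p+2) * u^2" by (rule mult_right_mono[OF e]) simp
      finally have "(1/u)^p * exp (-(1/u)) \<le> fact (p+2) * u^2" .
      then have "\<bar>c\<bar> * ((1/u)^p * exp (-(1/u))) \<le> \<bar>c\<bar> * (fact (p+2) * u^2)" by (intro mult_left_mono) auto
      then show ?thesis using True by (simp add: abs_mult mult.assoc)
    qed (auto intro!: mult_nonneg_nonneg)
    have "((\<lambda>h. (?f (0 + h) - ?f 0) / h) \<longlongrightarrow> 0) (at 0)"
    proof (rule Lim_null_comparison)
      show "\<forall>\<^sub>F h in at 0. norm ((?f (0 + h) - ?f 0) / h) \<le> (\<bar>c\<bar> * fact (p+2)) * \<bar>h\<bar>"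
      proof (rule always_eventually, rule allI)
        fix h :: real
        show "norm ((?f (0 + h) - ?f 0) / h) \<le> (\<bar>c\<bar> * fact (p+2)) * \<bar>h\<bar>"
        proof (cases "h = 0")
          case False
          have "norm ((?f (0 + h) - ?f 0) / h) = \<bar>?f h\<bar> / \<bar>h\<bar>" by (simp add: abs_divide)
          also have "\<dots> \<le> ((\<bar>c\<bar> * fact (p+2)) * h^2) / \<bar>h\<bar>" by (rule divide_right_mono[OF b]) simp
          also have "\<dots> = (\<bar>c\<bar> * fact (p+2)) * \<bar>h\<bar>"
          proof -
            have h2: "h^2 = \<bar>h\<bar> * \<bar>h\<bar>" by (simp add: power2_eq_square)
            show ?thesis unfolding h2 using False by (simp del: fact_Suc add_2_eq_Suc' add_2_eq_Suc abs_mult_self_eq)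
          qed
          finally show ?thesis .
        qed simp
      qed
      show "((\<lambda>h. (\<bar>c\<bar> * fact (p+2)) * \<bar>h\<bar>) \<longlongrightarrow> 0) (at (0::real))" by (auto intro!: tendsto_eq_intros)
    qed
    then have "(?f has_real_derivative 0) (at 0)" unfolding DERIV_def .
    then show ?thesis unfolding 3 by simp
  qed
qed

lemma flat_exp_smooth_real: assumes "f \<in> flat_exp" shows "smooth_real f"
proof (rule smooth_real_coinduct[OF assms])
  fix g assume "g \<in> flat_exp"
  then show "\<exists>g'\<in>flat_exp. \<forall>x. (g has_real_derivative g' x) (at x)"
  proof induction
    case (flat_exp_base c p)
    show ?case
      by (rule bexI[of _ "\<lambda>x. (if x > 0 then (- c * real p) * (1/x)^(p+1) * exp (- (1/x)) else 0) + (if x > 0 then c * (1/x)^(p+2) * exp (- (1/x)) else 0)"])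
        (intro allI flat_exp_base_deriv flat_exp.intros)+
  next
    case (flat_exp_add f g)
    then obtain u' v' where "u' \<in> flat_exp" "v' \<in> flat_exp"
      "\<forall>x. (f has_real_derivative u' x) (at x)" "\<forall>x. (g has_real_derivative v' x) (at x)" by blast
    then show ?case
      by (intro bexI[of _ "\<lambda>x. u' x + v' x"]) (auto intro!: flat_exp.intros DERIV_add)
  qed
qed

text \<open>The normalised primitive of the bump \<open>h u * h (1 - u)\<close>, whose support is
  \<open>[0,1]\<close>.\<close>

lemma smooth_step: "\<exists>\<eta>. smooth_real \<eta> \<and> (\<forall>u\<le>0. \<eta> u = 0) \<and> (\<forall>u\<ge>1. \<eta> u = 1) \<and> (\<forall>u. 0 \<le> \<eta> u \<and> \<eta> u \<le> 1)"
proof -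
  define h where "h = (\<lambda>u::real. if u > 0 then 1 * (1/u)^0 * exp (- (1/u)) else 0)"
  have h: "smooth_real h" unfolding h_def by (rule flat_exp_smooth_real[OF flat_exp_base])
  define B where "B u = h u * h (- 1 * u + 1)" for u
  have B: "smooth_real B" unfolding B_def[abs_def] by (intro smooth_real_mult h smooth_real_affine)
  have Bnn: "B u \<ge> 0" for u by (simp add: B_def h_def)
  have B0: "B u = 0" if "u \<le> 0 \<or> u \<ge> 1" for u using that by (auto simp: B_def h_def)
  obtain F where F: "smooth_real F" "\<And>u. (F has_real_derivative B u) (at u)" "\<And>u. u \<le> 0 \<Longrightarrow> F u = 0"
    using smooth_real_primitive[OF B] B0 by blast
  have mono: "F u \<le> F v" if "u \<le> v" for u v
    by (rule DERIV_nonneg_imp_nondecreasing[OF that]) (use F(2) Bnn in blast)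
  have F1: "F u = F 1" if "u \<ge> 1" for u
  proof (rule antisym)
    show "F u \<le> F 1" by (rule DERIV_nonpos_imp_nonincreasing[OF that]) (use F(2) B0 in force)
  qed (rule mono[OF that])
  have ge: "0 \<le> F u" for u
    by (cases "u \<le> 0") (use F(3)[of u] F(3)[of 0] mono[of 0 u] in auto)
  have le: "F u \<le> F 1" for u
    by (cases "u \<le> 1") (use F1[of u] mono[of u 1] in auto)
  \<comment> \<open>Otherwise \<open>F\<close>, lying between 0 and \<open>F 1\<close>, would vanish
    identically, whereas its derivative at 1/2 is positive.\<close>
  have "F 1 > 0"
  proof (rule ccontr)
    assume "\<not> F 1 > 0"
    then have "F u = 0" for u using ge[of u] le[of u] by linarith
    then have "F = (\<lambda>_. 0)" by blast
    then have "(F has_real_derivative 0) (at (1/2))" by simp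
    then have "B (1/2) = 0" using F(2) DERIV_unique by blast
    then show False by (simp add: B_def h_def)
  qed
  show ?thesis
  proof (intro exI[of _ "\<lambda>u. (1 / F 1) * F u"] conjI smooth_real_cmul F(1) allI impI)
    fix u
    show "0 \<le> 1 / F 1 * F u" "1 / F 1 * F u \<le> 1" using ge[of u] le[of u] \<open>F 1 > 0\<close> by (simp_all add: field_simps)
    show "u \<le> 0 \<Longrightarrow> 1 / F 1 * F u = 0" by (simp add: F(3))
    show "u \<ge> 1 \<Longrightarrow> 1 / F 1 * F u = 1" using F1[of u] \<open>F 1 > 0\<close> by simp
  qed
qed

section \<open>Tensor products of functions of one variable and cutoffs\<close>

definition tensor :: "('d::finite \<Rightarrow> real \<Rightarrow> real) \<Rightarrow> 'd tfun" where
  "tensor f = (\<lambda>x. complex_of_real (\<Prod>j\<in>UNIV. f j (x $ j)))"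

lemma tensor_deriv:
  assumes "\<And>u. (f i has_real_derivative g u) (at u)"
  shows "((\<lambda>s::real. tensor f (x + s *\<^sub>R axis i 1)) has_vector_derivative tensor (f(i := g)) x) (at 0)"
proof -
  let ?c = "\<Prod>j\<in>UNIV - {i}. f j (x $ j)"
  have eq: "tensor f (x + s *\<^sub>R axis i 1) = complex_of_real (f i (x $ i + s) * ?c)" for s
    unfolding tensor_def by (subst prod.remove[of UNIV i]) (auto simp: axis_nth_if intro!: prod.cong)
  have eq': "tensor (f(i := g)) x = complex_of_real (g (x $ i) * ?c)"
    unfolding tensor_def by (subst prod.remove[of UNIV i]) (auto intro!: prod.cong)
  have "((\<lambda>s. f i (x $ i + s)) has_real_derivative g (x $ i)) (at 0)"
    using assms[of "x $ i"] DERIV_at_within_shift[of "f i" _ "x $ i" 0 UNIV] by simp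
  then have "((\<lambda>s. f i (x $ i + s) * ?c) has_real_derivative g (x $ i) * ?c) (at 0)"
    by (rule DERIV_cmult_right)
  then show ?thesis unfolding eq eq' by (rule has_vector_derivative_of_real)
qed

lemma smooth_tensor: assumes "\<And>j. smooth_real (f j)" shows "smooth_fun (tensor f)"
proof (rule smooth_coinduct[of _ "{tensor f | f. \<forall>j. smooth_real (f j)}"])
  fix g :: "'a tfun" and j assume "g \<in> {tensor f | f. \<forall>j. smooth_real (f j)}"
  then obtain f where f: "g = tensor f" "\<And>j. smooth_real (f j)" by blast
  show "continuous_on UNIV g" unfolding f(1) tensor_def
    by (intro continuous_intros continuous_on_compose2[OF smooth_real_cont[OF f(2)]]) auto
  obtain h where h: "smooth_real h" "\<And>u. (f j has_real_derivative h u) (at u)" using smooth_real_deriv[OF f(2)] by blast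
  show "\<exists>g'\<in>{tensor f | f. \<forall>j. smooth_real (f j)}. \<forall>x. ((\<lambda>s. g (x + s *\<^sub>R axis j 1)) has_vector_derivative g' x) (at 0)"
    unfolding f(1) using tensor_deriv[of f j h] h f(2)
    by (intro bexI[of _ "tensor (f(j := h))"]) auto
qed (use assms in auto)

lemma dl_tensor:
  assumes "\<And>j. jet (D j)"
  shows "dl js (tensor (\<lambda>j. D j 0)) = tensor (\<lambda>j. D j (count_list js j))"
proof (induction js)
  case (Cons i js)
  have "pd i (tensor (\<lambda>j. D j (count_list js j))) x = tensor ((\<lambda>j. D j (count_list js j))(i := D i (Suc (count_list js i)))) x" for x
    by (intro pd_eqI tensor_deriv jetD assms)
  moreover have "(\<lambda>j. D j (count_list js j))(i := D i (Suc (count_list js i))) = (\<lambda>j. D j (count_list (i # js) j))"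
    by (auto simp: fun_eq_iff)
  ultimately show ?case by (auto simp: dl_Cons Cons.IH)
qed simp

lemma smooth_coordfun: assumes "smooth_real g" shows "smooth_fun (\<lambda>x. complex_of_real (g (x $ j)))"
proof -
  have "(\<lambda>x. complex_of_real (g (x $ j))) = tensor (\<lambda>k. if k = j then g else (\<lambda>_. 1))"
  proof
    fix x :: "real^'a"
    have "(\<Prod>k\<in>UNIV. (if k = j then g else (\<lambda>_. 1)) (x $ k)) = (\<Prod>k\<in>UNIV. if k = j then g (x $ j) else 1)"
      by (intro prod.cong) auto
    also have "\<dots> = g (x $ j)" by simp
    finally show "complex_of_real (g (x $ j)) = tensor (\<lambda>k. if k = j then g else (\<lambda>_. 1)) x"
      by (simp only: tensor_def)
  qed
  then show ?thesis using smooth_tensor[of "\<lambda>k. if k = j then g else (\<lambda>_. 1)"] assms by simp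
qed

lemma cutoff_exists:
  assumes "(\<epsilon>::real) > 0"
  shows "\<exists>X. smooth_real X \<and> (\<forall>s. \<bar>s\<bar> \<le> \<epsilon>/2 \<longrightarrow> X s = 0) \<and> (\<forall>s. \<bar>s\<bar> \<ge> \<epsilon> \<longrightarrow> X s = 1)"
proof -
  obtain \<eta> where \<eta>: "smooth_real \<eta>" "\<And>u. u \<le> 0 \<Longrightarrow> \<eta> u = 0" "\<And>u. u \<ge> 1 \<Longrightarrow> \<eta> u = 1" using smooth_step by blast
  define X where "X s = \<eta> ((2/\<epsilon>) * s + (-1)) + \<eta> ((-2/\<epsilon>) * s + (-1))" for s
  have "smooth_real X" unfolding X_def[abs_def] by (intro smooth_real_add smooth_real_affine \<eta>)
  moreover have "X s = 0" if "\<bar>s\<bar> \<le> \<epsilon>/2" for s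
  proof -
    have "(2/\<epsilon>) * s \<le> 1" "(-2/\<epsilon>) * s \<le> 1" using that assms by (simp_all add: field_simps abs_le_iff)
    then show ?thesis by (simp add: X_def \<eta>)
  qed
  moreover have "X s = 1" if "\<bar>s\<bar> \<ge> \<epsilon>" for s
  proof (cases "s \<ge> 0")
    case True
    then have "(2/\<epsilon>) * s \<ge> 2" "(-2/\<epsilon>) * s \<le> 0" using that assms by (simp_all add: field_simps)
    then show ?thesis by (simp add: X_def \<eta>)
  next
    case False
    then have "(2/\<epsilon>) * s \<le> 0" "(-2/\<epsilon>) * s \<ge> 2" using that assms by (simp_all add: field_simps)
    then show ?thesis by (simp add: X_def \<eta>)
  qed
  ultimately show ?thesis by blast
qed

lemma distr_diff: "distr T \<Longrightarrow> test f \<Longrightarrow> test g \<Longrightarrow> T (\<lambda>x. f x - g x) = T f - T g"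
  using distr_lin[of T f g 1 "-1"] by simp

text \<open>Now the support may meet all slabs at once. Cutoff factors are inserted one coordinate
  at a time; each insertion changes the function only inside a single slab, which \<open>T\<close>
  ignores, and with all factors inserted nothing is left. Half of the single-slab width is taken
  because the cutoff vanishes only there.\<close>

lemma T_zero_near_axes:
  assumes T: "DH T"
  shows "\<exists>\<delta>>0. \<forall>f. test f \<longrightarrow> (\<forall>x. (\<forall>j. \<bar>x $ j\<bar> > \<delta>) \<longrightarrow> f x = 0) \<longrightarrow> T f = 0"
proof -
  obtain \<epsilon> where \<epsilon>: "\<epsilon> > 0" "\<And>f j. test f \<Longrightarrow> (\<And>x. \<bar>x $ j\<bar> > \<epsilon> \<Longrightarrow> f x = 0) \<Longrightarrow> T f = 0"
    using T_zero_near_axis[OF T] by blast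
  obtain X where X: "smooth_real X" "\<And>s. \<bar>s\<bar> \<le> \<epsilon>/2 \<Longrightarrow> X s = 0" "\<And>s. \<bar>s\<bar> \<ge> \<epsilon> \<Longrightarrow> X s = 1"
    using cutoff_exists[OF \<epsilon>(1)] by blast
  have "T f = 0" if f: "test f" and z: "\<And>x. (\<forall>j. \<bar>x $ j\<bar> > \<epsilon>/2) \<Longrightarrow> f x = 0" for f
  proof -
    define F where "F J = (\<lambda>x. (\<Prod>j\<in>J. complex_of_real (X (x $ j))) * f x)" for J
    have tF: "test (F J)" for J unfolding F_def
      by (intro test_mult smooth_prod smooth_coordfun X f)
    have "T (F J) = T f" if "finite J" for J using that
    proof induction
      case empty then show ?case by (simp add: F_def)
    next
      case (insert j J)
      have "T (\<lambda>x. F J x - F (insert j J) x) = 0"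
        by (rule \<epsilon>(2)[of _ j, OF test_diff[OF tF tF]]) (use insert X(3) in \<open>simp add: F_def\<close>)
      then show ?case using insert distr_diff[OF DH_distr[OF T] tF tF] by simp
    qed
    moreover have "F UNIV = (\<lambda>x. 0)"
    proof
      fix x
      show "F UNIV x = 0"
      proof (cases "\<forall>j. \<bar>x $ j\<bar> > \<epsilon>/2")
        case True then show ?thesis using z by (simp add: F_def)
      next
        case False
        then obtain j where "X (x $ j) = 0" using X(2) by (meson not_le)
        then have "(\<Prod>j\<in>UNIV. complex_of_real (X (x $ j))) = 0" by (intro prod_zero) auto
        then show ?thesis by (simp add: F_def)
      qed
    qed
    moreover have "T (\<lambda>x. 0) = 0" using distr_lin[OF DH_distr[OF T] test_zero test_zero, of 0 0] by simp
    ultimately show ?thesis by (metis finite)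
  qed
  then show ?thesis using \<epsilon>(1) by (intro exI[of _ "\<epsilon>/2"]) auto
qed

subsection \<open>Smooth approximation of truncated powers\<close>

text \<open>The interval \<open>[1/2,1]\<close> is the image of \<open>[1,2]\<close> under
  inversion. The sequences in view approximate truncated powers, which are not smooth on the line; a
  Cauchy condition avoids naming the limit. The common bound is there for products.\<close>

definition unif_cauchy :: "(nat \<Rightarrow> real \<Rightarrow> real) \<Rightarrow> bool" where
  "unif_cauchy f \<longleftrightarrow> (\<forall>n. smooth_real (f n)) \<and> (\<exists>B. \<forall>n. \<forall>s\<in>{1/2..1}. \<bar>f n s\<bar> \<le> B) \<and>
     (\<forall>e>0. \<exists>N. \<forall>n\<ge>N. \<forall>k\<ge>N. \<forall>s\<in>{1/2..1}. \<bar>f n s - f k s\<bar> \<le> e)"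

text \<open>Convergence in C^m on \<open>[1/2,1]\<close>, with a derivative sequence supplied at
  each level so that the sum and product rules go through by recursion.\<close>

primrec unif_cauchy_derivs :: "nat \<Rightarrow> (nat \<Rightarrow> real \<Rightarrow> real) \<Rightarrow> bool" where
  "unif_cauchy_derivs 0 f = unif_cauchy f"
| "unif_cauchy_derivs (Suc m) f = (unif_cauchy f \<and> (\<exists>f'. (\<forall>n u. (f n has_real_derivative f' n u) (at u)) \<and> unif_cauchy_derivs m f'))"

lemma unif_cauchy_derivs_unif_cauchy: "unif_cauchy_derivs m f \<Longrightarrow> unif_cauchy f" by (cases m) auto

lemma unif_cauchy_add: assumes "unif_cauchy f" "unif_cauchy g" shows "unif_cauchy (\<lambda>n s. f n s + g n s)"
proof -
  obtain B C where BC: "\<And>n s. s\<in>{1/2..1} \<Longrightarrow> \<bar>f n s\<bar> \<le> B" "\<And>n s. s\<in>{1/2..1} \<Longrightarrow> \<bar>g n s\<bar> \<le> C"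
    using assms unfolding unif_cauchy_def by meson
  show ?thesis unfolding unif_cauchy_def
  proof (intro conjI allI impI)
    show "smooth_real (\<lambda>s. f n s + g n s)" for n using assms by (auto simp: unif_cauchy_def intro: smooth_real_add)
    show "\<exists>B. \<forall>n. \<forall>s\<in>{1/2..1}. \<bar>f n s + g n s\<bar> \<le> B"
    proof (intro exI[of _ "B + C"] allI ballI)
      fix n s assume "s \<in> {1/2..1::real}"
      then show "\<bar>f n s + g n s\<bar> \<le> B + C" using BC(1)[of s n] BC(2)[of s n] by linarith
    qed
    fix e :: real assume "e > 0"
    then obtain N M where *: "\<forall>n\<ge>N. \<forall>k\<ge>N. \<forall>s\<in>{1/2..1}. \<bar>f n s - f k s\<bar> \<le> e/2"
      "\<forall>n\<ge>M. \<forall>k\<ge>M. \<forall>s\<in>{1/2..1}. \<bar>g n s - g k s\<bar> \<le> e/2"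
      using assms half_gt_zero unfolding unif_cauchy_def by meson
    have "\<bar>f n s + g n s - (f k s + g k s)\<bar> \<le> e" if "n \<ge> max N M" "k \<ge> max N M" "s \<in> {1/2..1}" for n k s
    proof -
      have "\<bar>f n s - f k s\<bar> \<le> e/2" "\<bar>g n s - g k s\<bar> \<le> e/2" using * that by auto
      then show ?thesis by linarith
    qed
    then show "\<exists>N. \<forall>n\<ge>N. \<forall>k\<ge>N. \<forall>s\<in>{1/2..1}. \<bar>f n s + g n s - (f k s + g k s)\<bar> \<le> e" by blast
  qed
qed

lemma unif_cauchy_mult: assumes "unif_cauchy f" "unif_cauchy g" shows "unif_cauchy (\<lambda>n s. f n s * g n s)"
proof -
  obtain B0 C0 where BC0: "\<And>n s. s\<in>{1/2..1} \<Longrightarrow> \<bar>f n s\<bar> \<le> B0" "\<And>n s. s\<in>{1/2..1} \<Longrightarrow> \<bar>g n s\<bar> \<le> C0"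
    using assms unfolding unif_cauchy_def by meson
  define B where "B = max (max B0 C0) 1"
  have BC: "B > 0" "\<And>n s. s\<in>{1/2..1} \<Longrightarrow> \<bar>f n s\<bar> \<le> B" "\<And>n s. s\<in>{1/2..1} \<Longrightarrow> \<bar>g n s\<bar> \<le> B"
    using BC0 unfolding B_def by (force simp: le_max_iff_disj)+
  show ?thesis unfolding unif_cauchy_def
  proof (intro conjI allI impI)
    show "smooth_real (\<lambda>s. f n s * g n s)" for n using assms by (auto simp: unif_cauchy_def intro: smooth_real_mult)
    show "\<exists>B. \<forall>n. \<forall>s\<in>{1/2..1}. \<bar>f n s * g n s\<bar> \<le> B"
      by (rule exI[of _ "B * B"]) (use BC in \<open>auto simp: abs_mult intro!: mult_mono\<close>)
    fix e :: real assume "e > 0"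
    then have e': "e / (2 * B) > 0" using BC(1) by simp
    obtain N where N: "\<forall>n\<ge>N. \<forall>k\<ge>N. \<forall>s\<in>{1/2..1}. \<bar>f n s - f k s\<bar> \<le> e / (2 * B)"
      using assms(1) e' unfolding unif_cauchy_def by meson
    obtain M where M: "\<forall>n\<ge>M. \<forall>k\<ge>M. \<forall>s\<in>{1/2..1}. \<bar>g n s - g k s\<bar> \<le> e / (2 * B)"
      using assms(2) e' unfolding unif_cauchy_def by meson
    have "\<bar>f n s * g n s - f k s * g k s\<bar> \<le> e" if "n \<ge> max N M" "k \<ge> max N M" "s \<in> {1/2..1}" for n k s
    proof -
      have "f n s * g n s - f k s * g k s = f n s * (g n s - g k s) + (f n s - f k s) * g k s" by (simp add: algebra_simps)
      then have "\<bar>f n s * g n s - f k s * g k s\<bar> \<le> \<bar>f n s\<bar> * \<bar>g n s - g k s\<bar> + \<bar>f n s - f k s\<bar> * \<bar>g k s\<bar>"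
        using abs_triangle_ineq[of "f n s * (g n s - g k s)" "(f n s - f k s) * g k s"] by (simp only: abs_mult)
      also have "\<dots> \<le> B * (e / (2 * B)) + (e / (2 * B)) * B"
        by (intro add_mono mult_mono) (use BC that N M e' in auto)
      also have "\<dots> = e" using BC(1) by (simp add: field_simps)
      finally show ?thesis .
    qed
    then show "\<exists>N. \<forall>n\<ge>N. \<forall>k\<ge>N. \<forall>s\<in>{1/2..1}. \<bar>f n s * g n s - f k s * g k s\<bar> \<le> e" by blast
  qed
qed

lemma unif_cauchy_derivs_add: "unif_cauchy_derivs m f \<Longrightarrow> unif_cauchy_derivs m g \<Longrightarrow> unif_cauchy_derivs m (\<lambda>n s. f n s + g n s)"
proof (induction m arbitrary: f g)
  case (Suc m)
  then obtain f' g' where d: "\<And>n u. (f n has_real_derivative f' n u) (at u)" "unif_cauchy_derivs m f'"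
    "\<And>n u. (g n has_real_derivative g' n u) (at u)" "unif_cauchy_derivs m g'" by auto
  have u: "unif_cauchy f" "unif_cauchy g" using Suc.prems by simp_all
  show ?case unfolding unif_cauchy_derivs.simps
    by (intro conjI unif_cauchy_add u exI[of _ "\<lambda>n s. f' n s + g' n s"] allI DERIV_add d Suc.IH)
qed (auto intro: unif_cauchy_add)

lemma unif_cauchy_derivs_less: "unif_cauchy_derivs (Suc m) f \<Longrightarrow> unif_cauchy_derivs m f"
proof (induction m arbitrary: f)
  case (Suc m) then show ?case by (metis unif_cauchy_derivs.simps(2))
qed auto

lemma unif_cauchy_derivs_mult: "unif_cauchy_derivs m f \<Longrightarrow> unif_cauchy_derivs m g \<Longrightarrow> unif_cauchy_derivs m (\<lambda>n s. f n s * g n s)"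
proof (induction m arbitrary: f g)
  case (Suc m)
  then obtain f' g' where d: "\<And>n u. (f n has_real_derivative f' n u) (at u)" "unif_cauchy_derivs m f'"
    "\<And>n u. (g n has_real_derivative g' n u) (at u)" "unif_cauchy_derivs m g'" by auto
  have u: "unif_cauchy f" "unif_cauchy g" using Suc.prems by simp_all
  have "unif_cauchy_derivs m (\<lambda>n s. f' n s * g n s + g' n s * f n s)"
    by (intro unif_cauchy_derivs_add Suc.IH d unif_cauchy_derivs_less[OF Suc.prems(1)] unif_cauchy_derivs_less[OF Suc.prems(2)])
  then show ?case unfolding unif_cauchy_derivs.simps
    by (intro conjI unif_cauchy_mult u exI[of _ "\<lambda>n s. f' n s * g n s + g' n s * f n s"] allI DERIV_mult d)
qed (auto intro: unif_cauchy_mult)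

lemma unif_cauchy_const: assumes "smooth_real b" shows "unif_cauchy (\<lambda>n. b)"
proof -
  have "compact (b ` {1/2..1})" by (intro compact_continuous_image smooth_real_cont assms) auto
  then obtain B where "\<forall>y\<in>b ` {1/2..1}. norm y \<le> B" using compact_imp_bounded bounded_iff by metis
  then show ?thesis unfolding unif_cauchy_def using assms by (auto intro!: exI[of _ B])
qed

lemma unif_cauchy_derivs_const: "smooth_real b \<Longrightarrow> unif_cauchy_derivs m (\<lambda>n. b)"
proof (induction m arbitrary: b)
  case (Suc m)
  obtain b' where "smooth_real b'" "\<And>u. (b has_real_derivative b' u) (at u)" using smooth_real_deriv[OF Suc.prems] by blast
  then show ?case unfolding unif_cauchy_derivs.simps
    by (intro conjI unif_cauchy_const Suc.prems exI[of _ "\<lambda>n. b'"] allI Suc.IH)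
qed (auto intro: unif_cauchy_const)

text \<open>Derivatives are unique, so the sequences hidden in the recursion agree with the members
  of any given jet.\<close>

lemma unif_cauchy_derivs_jet:
  assumes "unif_cauchy_derivs m f" "\<And>n. jet (D n)" "\<And>n. D n 0 = f n" "l \<le> m"
  shows "unif_cauchy (\<lambda>n. D n l)"
  using assms
proof (induction l arbitrary: m f D)
  case 0 then show ?case using unif_cauchy_derivs_unif_cauchy[of m f] by simp
next
  case (Suc l)
  then obtain m' where m: "m = Suc m'" "l \<le> m'" by (cases m) auto
  obtain f' where f': "\<And>n u. (f n has_real_derivative f' n u) (at u)" "unif_cauchy_derivs m' f'" using Suc.prems m by auto
  have "D n (Suc 0) = f' n" for n
  proof
    fix u show "D n (Suc 0) u = f' n u"
      using DERIV_unique[OF jetD[OF Suc.prems(2), of n 0 u]] f'(1) Suc.prems(3) by simp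
  qed
  then show ?case
    using Suc.IH[OF f'(2), of "\<lambda>n l. D n (Suc l)"] m(2) Suc.prems(2) by (simp add: jet_def)
qed

text \<open>\<open>P n k\<close> approximates the truncated power \<open>u^k / k!\<close>.\<close>
definition ramps :: "(nat \<Rightarrow> nat \<Rightarrow> real \<Rightarrow> real) \<Rightarrow> bool" where
  "ramps P \<longleftrightarrow> (\<forall>n k. smooth_real (P n k)) \<and> (\<forall>n k u. (P n (Suc k) has_real_derivative P n k u) (at u)) \<and>
    (\<forall>n k u. u \<le> 0 \<longrightarrow> P n k u = 0) \<and> (\<forall>n k u. 0 \<le> u \<longrightarrow> u \<le> 1 \<longrightarrow> 0 \<le> P n k u \<and> P n k u \<le> 1) \<and>
    (\<forall>n k u. 0 \<le> u \<longrightarrow> u \<le> 1 \<longrightarrow> \<bar>P n (Suc k) u - u ^ Suc k / fact (Suc k)\<bar> \<le> 1 / real (Suc n))"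

lemma deriv_bound_from_0:
  fixes f :: "real \<Rightarrow> real"
  assumes "\<And>u. 0 \<le> u \<Longrightarrow> u \<le> a \<Longrightarrow> (f has_real_derivative f' u) (at u)" "\<And>u. 0 \<le> u \<Longrightarrow> u \<le> a \<Longrightarrow> \<bar>f' u\<bar> \<le> B"
    "0 \<le> u" "u \<le> a" "f 0 = 0"
  shows "\<bar>f u\<bar> \<le> B * u"
proof -
  have "norm (f u - f 0) \<le> B * norm (u - 0)"
    by (rule field_differentiable_bound[of "{0..a}" f f'])
      (use assms in \<open>auto intro: has_field_derivative_at_within\<close>)
  then show ?thesis using assms by simp
qed

lemma ramps_exist: "\<exists>P. ramps P"
proof -
  obtain \<eta> where \<eta>: "smooth_real \<eta>" "\<And>u. u \<le> 0 \<Longrightarrow> \<eta> u = 0" "\<And>u. u \<ge> 1 \<Longrightarrow> \<eta> u = 1" "\<And>u. 0 \<le> \<eta> u" "\<And>u. \<eta> u \<le> 1"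
    using smooth_step by blast
  define ok where "ok f \<longleftrightarrow> smooth_real f \<and> (\<forall>u\<le>0. f u = 0)" for f :: "real \<Rightarrow> real"
  have "\<forall>f. \<exists>F. ok f \<longrightarrow> ok F \<and> (\<forall>u. (F has_real_derivative f u) (at u))"
    using smooth_real_primitive unfolding ok_def by meson
  then obtain I where I: "\<And>f. ok f \<Longrightarrow> ok (I f)" "\<And>f u. ok f \<Longrightarrow> (I f has_real_derivative f u) (at u)"
    by metis
  \<comment> \<open>The \<open>k\<close>-fold primitive of a smoothed Heaviside function that climbs
    from 0 to 1 on \<open>[0, 1 / Suc n]\<close>; repeated primitives of the Heaviside function
    itself are the truncated powers.\<close>
  define P where "P n k = (I ^^ k) (\<lambda>u. \<eta> (real (Suc n) * u + 0))" for n k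
  have ok0: "ok (P n 0)" for n
    using smooth_real_affine[OF \<eta>(1), of "real (Suc n)" 0] \<eta>(2) unfolding ok_def P_def by (simp add: mult_nonneg_nonpos)
  have okP: "ok (P n k)" for n k
    by (induction k) (use ok0 I in \<open>auto simp: P_def\<close>)
  have D: "(P n (Suc k) has_real_derivative P n k u) (at u)" for n k u
    using I(2)[OF okP[of n k]] by (simp add: P_def)
  have Z: "P n k u = 0" if "u \<le> 0" for n k u using okP that by (auto simp: ok_def)
  have nn: "0 \<le> P n k u" for n k u
  proof (induction k arbitrary: u)
    case 0 then show ?case by (simp add: P_def \<eta>)
  next
    case (Suc k)
    show ?case
    proof (cases "u \<le> 0")
      case False
      have "P n (Suc k) 0 \<le> P n (Suc k) u"
      proof (rule DERIV_nonneg_imp_nondecreasing[of 0 u "P n (Suc k)"])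
        fix x show "\<exists>y. (P n (Suc k) has_real_derivative y) (at x) \<and> 0 \<le> y" using D Suc.IH by blast
      qed (use False in simp)
      then show ?thesis by (simp add: Z)
    qed (simp add: Z)
  qed
  have le1: "P n k u \<le> 1" if "0 \<le> u" "u \<le> 1" for n k u using that
  proof (induction k arbitrary: u)
    case 0 then show ?case by (simp add: P_def \<eta>)
  next
    case (Suc k)
    have "\<bar>P n (Suc k) u\<bar> \<le> 1 * u"
      by (rule deriv_bound_from_0[of 1 _ "P n k"]) (use Suc nn in \<open>auto simp: D Z\<close>)
    then show ?case using Suc.prems by simp
  qed
  \<comment> \<open>For the first primitive the error builds up only while the step climbs, hence is
    at most the length of that interval. Further integration over parts of \<open>[0,1]\<close> does
    not enlarge it.\<close>
  have dd: "\<bar>P n (Suc k) u - u ^ Suc k / fact (Suc k)\<bar> \<le> 1 / real (Suc n)" if "0 \<le> u" "u \<le> 1" for n k u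
    using that
  proof (induction k arbitrary: u)
    case 0
    let ?a = "1 / real (Suc n)"
    have small: "\<bar>P n (Suc 0) u - u\<bar> \<le> 1 * u" if "0 \<le> u" "u \<le> 1" for u
    proof (rule deriv_bound_from_0[of 1 _ "\<lambda>u. P n 0 u - 1"])
      fix v :: real assume v: "0 \<le> v" "v \<le> 1"
      show "\<bar>P n 0 v - 1\<bar> \<le> 1" using nn[of n 0 v] le1[of v n 0] v by linarith
      show "((\<lambda>u. P n (Suc 0) u - u) has_real_derivative P n 0 v - 1) (at v)"
        by (auto intro!: derivative_eq_intros D)
    qed (use that Z in auto)
    show ?case
    proof (cases "u \<le> ?a")
      case True then show ?thesis using small[of u] 0 by simp
    next
      case False
      have d: "((\<lambda>u. P n (Suc 0) u - u) has_real_derivative 0) (at v)" if "?a \<le> v" for v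
      proof -
        have "real (Suc n) * v \<ge> 1" using that by (simp add: field_simps)
        then have "P n 0 v = 1" by (simp add: P_def \<eta>)
        then show ?thesis by (auto intro!: derivative_eq_intros D)
      qed
      have "P n (Suc 0) u - u \<le> P n (Suc 0) ?a - ?a"
        using DERIV_nonpos_imp_nonincreasing[of ?a u "\<lambda>u. P n (Suc 0) u - u"] False d by force
      moreover have "P n (Suc 0) u - u \<ge> P n (Suc 0) ?a - ?a"
        using DERIV_nonneg_imp_nondecreasing[of ?a u "\<lambda>u. P n (Suc 0) u - u"] False d by force
      ultimately have "P n (Suc 0) u - u = P n (Suc 0) ?a - ?a" by simp
      then show ?thesis using small[of ?a] by simp
    qed
  next
    case (Suc k)
    have "\<bar>P n (Suc (Suc k)) u - u ^ Suc (Suc k) / fact (Suc (Suc k))\<bar> \<le> (1 / real (Suc n)) * u"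
    proof (rule deriv_bound_from_0[of 1 _ "\<lambda>u. P n (Suc k) u - u ^ Suc k / fact (Suc k)"])
      fix v :: real assume v: "0 \<le> v" "v \<le> 1"
      show "\<bar>P n (Suc k) v - v ^ Suc k / fact (Suc k)\<bar> \<le> 1 / real (Suc n)" by (rule Suc.IH[OF v])
      have "((\<lambda>u. u ^ Suc (Suc k) / fact (Suc (Suc k))) has_real_derivative (1 + real (Suc k)) * (1 * v ^ Suc k) / fact (Suc (Suc k))) (at v)"
        by (intro DERIV_cdivide DERIV_power_Suc DERIV_ident)
      moreover have "(1 + real (Suc k)) * (1 * v ^ Suc k) / fact (Suc (Suc k)) = v ^ Suc k / fact (Suc k)"
      proof -
        have nz: "1 + real (Suc k) \<noteq> 0" by linarith
        show ?thesis unfolding fact_Suc[of "Suc k"] of_nat_Suc[of "Suc k"] mult_1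
          by (rule mult_divide_mult_cancel_left[OF nz])
      qed
      ultimately show "((\<lambda>u. P n (Suc (Suc k)) u - u ^ Suc (Suc k) / fact (Suc (Suc k))) has_real_derivative P n (Suc k) v - v ^ Suc k / fact (Suc k)) (at v)"
        using DERIV_diff[OF D] by metis
    qed (use Suc.prems Z in auto)
    also have "\<dots> \<le> 1 / real (Suc n)" using Suc.prems by (intro mult_left_le) auto
    finally show ?case .
  qed
  show ?thesis unfolding ramps_def using okP D Z nn le1 dd by (intro exI[of _ P]) (auto simp: ok_def)
qed

text \<open>For \<open>K = 0\<close> the functions tend to a step that is discontinuous at
  \<open>s = 1\<close>. From the first primitive on, the convergence is uniform.\<close>

lemma unif_cauchy_ramp:
  assumes P: "ramps P" and K: "K \<ge> 1"
  shows "unif_cauchy (\<lambda>n s. c * P n K (1 - s))"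
proof -
  obtain k where k: "K = Suc k" using K by (cases K) auto
  show ?thesis unfolding unif_cauchy_def
  proof (intro conjI allI impI)
    fix n
    have "smooth_real (\<lambda>s. P n K (- 1 * s + 1))" by (intro smooth_real_affine) (use P in \<open>auto simp: ramps_def\<close>)
    then show "smooth_real (\<lambda>s. c * P n K (1 - s))" by (intro smooth_real_cmul) simp
  next
    have "\<bar>c * P n K (1 - s)\<bar> \<le> \<bar>c\<bar> * 1" if "s \<in> {1/2..1}" for n s
      unfolding abs_mult by (intro mult_left_mono) (use P that in \<open>auto simp: ramps_def\<close>)
    then show "\<exists>B. \<forall>n. \<forall>s\<in>{1/2..1}. \<bar>c * P n K (1 - s)\<bar> \<le> B" by blast
  next
    fix e :: real assume e: "e > 0"
    define e' where "e' = e / (2 * (\<bar>c\<bar> + 1))"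
    have "e' > 0" using e by (auto simp: e'_def intro!: divide_pos_pos)
    then obtain N where N: "1 / real (Suc N) < e'" using nat_approx_posE by blast
    have "\<bar>c * P n K (1 - s) - c * P l K (1 - s)\<bar> \<le> e" if "n \<ge> N" "l \<ge> N" "s \<in> {1/2..1}" for n l s
    proof -
      have b: "\<bar>P i K (1 - s) - (1 - s) ^ K / fact K\<bar> \<le> e'" if "i \<ge> N" for i
      proof -
        have "\<bar>P i K (1 - s) - (1 - s) ^ K / fact K\<bar> \<le> 1 / real (Suc i)"
          unfolding k using P \<open>s \<in> {1/2..1}\<close> unfolding ramps_def by simp
        also have "\<dots> \<le> 1 / real (Suc N)" using that by (intro divide_left_mono) auto
        finally show ?thesis using N by simp
      qed
      have "\<bar>P n K (1 - s) - P l K (1 - s)\<bar> \<le> 2 * e'" using b[OF that(1)] b[OF that(2)] by linarith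
      then have "\<bar>c\<bar> * \<bar>P n K (1 - s) - P l K (1 - s)\<bar> \<le> \<bar>c\<bar> * (2 * e')" by (intro mult_left_mono) auto
      also have "\<dots> \<le> (\<bar>c\<bar> + 1) * (2 * e')" using \<open>e' > 0\<close> by (intro mult_right_mono) auto
      also have "\<dots> = e" by (simp add: e'_def field_simps)
      finally show ?thesis by (simp add: abs_mult[symmetric] right_diff_distrib)
    qed
    then show "\<exists>N. \<forall>n\<ge>N. \<forall>k\<ge>N. \<forall>s\<in>{1/2..1}. \<bar>c * P n K (1 - s) - c * P k K (1 - s)\<bar> \<le> e" by blast
  qed
qed

text \<open>Each derivative lowers the index by one and flips the sign, so
  \<open>K \<ge> Suc m\<close> leaves index at least 1 after \<open>m\<close> derivatives.\<close>

lemma unif_cauchy_derivs_ramp: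
  assumes P: "ramps P"
  shows "K \<ge> Suc m \<Longrightarrow> unif_cauchy_derivs m (\<lambda>n s. c * P n K (1 - s))"
proof (induction m arbitrary: K c)
  case 0 then show ?case using unif_cauchy_ramp[OF P] by simp
next
  case (Suc m)
  then obtain k where k: "K = Suc k" "k \<ge> Suc m" by (cases K) auto
  have d: "((\<lambda>s. c * P n K (1 - s)) has_real_derivative (- c) * P n k (1 - u)) (at u)" for n u
  proof -
    have "(P n K has_real_derivative P n k (1 - u)) (at (1 - u))" using P k(1) by (simp add: ramps_def)
    then have "((\<lambda>s. P n K (1 - s)) has_real_derivative P n k (1 - u) * (- 1)) (at u)"
      by (rule DERIV_chain2) (auto intro!: derivative_eq_intros)
    then show ?thesis using DERIV_cmult[of _ _ _ _ c] by fastforce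
  qed
  have u: "unif_cauchy (\<lambda>n s. c * P n K (1 - s))" by (rule unif_cauchy_ramp[OF P]) (use Suc.prems in simp)
  show ?case unfolding unif_cauchy_derivs.simps
    by (intro conjI u exI[of _ "\<lambda>n s. (- c) * P n k (1 - s)"] allI d Suc.IH[OF k(2)])
qed

text \<open>The image of the cube \<open>[1,2]^d\<close> under coordinatewise inversion.\<close>
definition half_box :: "(real^'d::finite) set" where
  "half_box = {x. \<forall>j. 1/2 \<le> x $ j \<and> x $ j \<le> 1}"

lemma half_box_eq: "half_box = cbox (\<chi> j. 1/2) (\<chi> j. 1)"
  by (auto simp: half_box_def mem_box_cart)

lemma compact_half_box [simp]: "compact half_box" and closed_half_box [simp]: "closed half_box" and bounded_half_box [simp]: "bounded half_box"
  unfolding half_box_eq by (rule compact_cbox closed_cbox bounded_cbox)+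

text \<open>Dividing all factors by \<open>B\<close> brings them into the unit ball, where products
  differ by at most the sum of the differences of the factors.\<close>

lemma prod_diff_bound:
  fixes a b :: "'d::finite \<Rightarrow> real"
  assumes "\<And>j. \<bar>a j\<bar> \<le> B" "\<And>j. \<bar>b j\<bar> \<le> B" "\<And>j. \<bar>a j - b j\<bar> \<le> e" "B \<ge> 1"
  shows "\<bar>(\<Prod>j\<in>UNIV. a j) - (\<Prod>j\<in>UNIV. b j)\<bar> \<le> B ^ CARD('d) * real CARD('d) * e"
proof -
  have eq: "(\<Prod>j\<in>UNIV. c j) = B ^ CARD('d) * (\<Prod>j\<in>UNIV. c j / B)" for c :: "'d \<Rightarrow> real"
    using assms(4) by (simp add: prod_dividef)
  have "norm ((\<Prod>j\<in>UNIV. a j / B) - (\<Prod>j\<in>UNIV. b j / B)) \<le> (\<Sum>j\<in>UNIV. norm (a j / B - b j / B))"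
    by (rule norm_prod_diff) (use assms in \<open>auto simp: abs_divide divide_le_eq_1\<close>)
  also have "\<dots> \<le> (\<Sum>j\<in>(UNIV::'d set). e)"
  proof (rule sum_mono)
    fix j
    have "norm (a j / B - b j / B) = \<bar>a j - b j\<bar> / B"
      using assms(4) by (simp add: diff_divide_distrib[symmetric])
    also have "\<dots> \<le> \<bar>a j - b j\<bar> / 1" using assms(4) by (intro divide_left_mono) auto
    finally show "norm (a j / B - b j / B) \<le> e" using assms(3)[of j] by simp
  qed
  finally have "\<bar>(\<Prod>j\<in>UNIV. a j / B) - (\<Prod>j\<in>UNIV. b j / B)\<bar> \<le> real CARD('d) * e" by simp
  then have "B ^ CARD('d) * \<bar>(\<Prod>j\<in>UNIV. a j / B) - (\<Prod>j\<in>UNIV. b j / B)\<bar> \<le> B ^ CARD('d) * (real CARD('d) * e)"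
    using assms(4) by (intro mult_left_mono) auto
  then show ?thesis unfolding eq[of a] eq[of b] using assms(4)
    by (simp add: right_diff_distrib[symmetric] abs_mult mult.assoc)
qed

text \<open>Derivatives of a tensor product are tensor products of derivatives of the factors, so
  C^m control of the factors on \<open>[1/2,1]\<close> gives C^m control on \<open>half_box\<close>.
  Outside, all derivatives vanish.\<close>

lemma tensor_unif_cauchy_derivs:
  fixes f :: "'d::finite \<Rightarrow> nat \<Rightarrow> real \<Rightarrow> real"
  assumes a: "\<And>j. unif_cauchy_derivs m (f j)" and z: "\<And>j n s. s < 1/2 \<or> s > 1 \<Longrightarrow> f j n s = 0"
  shows "DK half_box (tensor (\<lambda>j. f j n))"
    and "\<exists>B. \<forall>n. derivs_le m (tensor (\<lambda>j. f j n)) B"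
    and "e > 0 \<Longrightarrow> \<exists>N. \<forall>n\<ge>N. \<forall>k\<ge>N. derivs_le m (\<lambda>x. tensor (\<lambda>j. f j n) x - tensor (\<lambda>j. f j k) x) e"
proof -
  have sm: "smooth_real (f j n)" for j n using unif_cauchy_derivs_unif_cauchy[OF a] by (simp add: unif_cauchy_def)
  have smt: "smooth_fun (tensor (\<lambda>j. f j n))" for n by (rule smooth_tensor[OF sm])
  have z0: "tensor (\<lambda>j. f j n) x = 0" if "x \<notin> half_box" for n x
  proof -
    obtain j where "f j n (x $ j) = 0" using \<open>x \<notin> half_box\<close> z by (auto simp: half_box_def not_le)
    then have "(\<Prod>j\<in>UNIV. f j n (x $ j)) = 0" by (intro prod_zero) auto
    then show ?thesis by (simp add: tensor_def)
  qed
  show DKt: "DK half_box (tensor (\<lambda>j. f j n))" for n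
    unfolding DK_def using testI[OF smt bounded_half_box z0] z0 by blast
  obtain D where D: "\<And>j n. jet (D j n)" "\<And>j n. D j n 0 = f j n" using sm unfolding smooth_real_def by metis
  have u: "unif_cauchy (\<lambda>n. D j n l)" if "l \<le> m" for j l
    by (rule unif_cauchy_derivs_jet[OF a D that])
  have dlt: "dl js (tensor (\<lambda>j. f j n)) = tensor (\<lambda>j. D j n (count_list js j))" for js n
    using dl_tensor[of "\<lambda>j. D j n" js] D by simp
  have "\<forall>j l. \<exists>B. l \<le> m \<longrightarrow> (\<forall>n. \<forall>s\<in>{1/2..1}. \<bar>D j n l s\<bar> \<le> B)" using u unfolding unif_cauchy_def by meson
  then obtain B0 where B0: "\<And>j l n s. l \<le> m \<Longrightarrow> s\<in>{1/2..1} \<Longrightarrow> \<bar>D j n l s\<bar> \<le> B0 j l" by metis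
  define B where "B = 1 + (\<Sum>j\<in>UNIV. \<Sum>l\<le>m. \<bar>B0 j l\<bar>)"
  have B: "B \<ge> 1" unfolding B_def by (auto intro!: sum_nonneg)
  have Bb: "\<bar>D j n l s\<bar> \<le> B" if "l \<le> m" "s\<in>{1/2..1}" for j n l s
  proof -
    have "\<bar>B0 j l\<bar> \<le> (\<Sum>l\<le>m. \<bar>B0 j l\<bar>)" using that by (intro member_le_sum) auto
    also have "\<dots> \<le> (\<Sum>j\<in>UNIV. \<Sum>l\<le>m. \<bar>B0 j l\<bar>)"
      by (rule member_le_sum[of j UNIV "\<lambda>j. \<Sum>l\<le>m. \<bar>B0 j l\<bar>"]) (auto intro: sum_nonneg)
    finally show ?thesis using B0[OF that, of j n] unfolding B_def by linarith
  qed
  have cl: "count_list js j \<le> m" if "length js \<le> m" for js :: "'d list" and j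
    using count_le_length[of js j] that by linarith
  have "derivs_le m (tensor (\<lambda>j. f j n)) (B ^ CARD('d))" for n
    unfolding derivs_le_def
  proof (intro allI impI)
    fix js :: "'d list" and x assume l: "length js \<le> m"
    show "cmod (dl js (tensor (\<lambda>j. f j n)) x) \<le> B ^ CARD('d)"
    proof (cases "x \<in> half_box")
      case False
      then have "dl js (tensor (\<lambda>j. f j n)) x = 0"
        using dl_zero_outside[OF closed_half_box, of "tensor (\<lambda>j. f j n)" x js] z0 by blast
      then show ?thesis using B by simp
    next
      case True
      have "\<bar>\<Prod>j\<in>UNIV. D j n (count_list js j) (x $ j)\<bar> \<le> (\<Prod>j\<in>(UNIV::'d set). B)"
        unfolding abs_prod by (rule prod_mono) (use Bb cl[OF l] True in \<open>auto simp: half_box_def\<close>)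
      also have "\<dots> = B ^ CARD('d)" by simp
      finally show ?thesis unfolding dlt by (simp only: tensor_def norm_of_real)
    qed
  qed
  then show "\<exists>B. \<forall>n. derivs_le m (tensor (\<lambda>j. f j n)) B" by blast
  assume e: "e > 0"
  define e' where "e' = e / (B ^ CARD('d) * real CARD('d))"
  have e': "e' > 0" using e B by (simp add: e'_def)
  have "\<forall>j l. \<exists>N. l \<le> m \<longrightarrow> (\<forall>n\<ge>N. \<forall>k\<ge>N. \<forall>s\<in>{1/2..1}. \<bar>D j n l s - D j k l s\<bar> \<le> e')"
    using u e' unfolding unif_cauchy_def by meson
  then obtain N0 where N0: "\<And>j l n k s. l \<le> m \<Longrightarrow> n \<ge> N0 j l \<Longrightarrow> k \<ge> N0 j l \<Longrightarrow> s\<in>{1/2..1} \<Longrightarrow> \<bar>D j n l s - D j k l s\<bar> \<le> e'" by metis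
  define N where "N = (\<Sum>j\<in>UNIV. \<Sum>l\<le>m. N0 j l)"
  have N: "N0 j l \<le> N" if "l \<le> m" for j l
  proof -
    have "N0 j l \<le> (\<Sum>l\<le>m. N0 j l)" using that by (intro member_le_sum) auto
    also have "\<dots> \<le> N" unfolding N_def
      by (rule member_le_sum[of j UNIV "\<lambda>j. \<Sum>l\<le>m. N0 j l"]) auto
    finally show ?thesis .
  qed
  have "derivs_le m (\<lambda>x. tensor (\<lambda>j. f j n) x - tensor (\<lambda>j. f j k) x) e" if nk: "n \<ge> N" "k \<ge> N" for n k
    unfolding derivs_le_def
  proof (intro allI impI)
    fix js :: "'d list" and x assume l: "length js \<le> m"
    have eq: "dl js (\<lambda>x. tensor (\<lambda>j. f j n) x - tensor (\<lambda>j. f j k) x) x = dl js (tensor (\<lambda>j. f j n)) x - dl js (tensor (\<lambda>j. f j k)) x"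
      by (simp add: dl_diff smt)
    show "cmod (dl js (\<lambda>x. tensor (\<lambda>j. f j n) x - tensor (\<lambda>j. f j k) x) x) \<le> e"
    proof (cases "x \<in> half_box")
      case False
      then have "dl js (tensor (\<lambda>j. f j i)) x = 0" for i
        using dl_zero_outside[OF closed_half_box, of "tensor (\<lambda>j. f j i)" x js] z0 by blast
      then show ?thesis unfolding eq using e by simp
    next
      case True
      have "\<bar>(\<Prod>j\<in>UNIV. D j n (count_list js j) (x $ j)) - (\<Prod>j\<in>UNIV. D j k (count_list js j) (x $ j))\<bar> \<le> B ^ CARD('d) * real CARD('d) * e'"
      proof (rule prod_diff_bound)
        fix j
        have xj: "x $ j \<in> {1/2..1}" using True by (simp add: half_box_def)
        show "\<bar>D j n (count_list js j) (x $ j)\<bar> \<le> B" "\<bar>D j k (count_list js j) (x $ j)\<bar> \<le> B"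
          by (rule Bb[OF cl[OF l] xj])+
        show "\<bar>D j n (count_list js j) (x $ j) - D j k (count_list js j) (x $ j)\<bar> \<le> e'"
          by (rule N0[OF cl[OF l] _ _ xj]) (use N[OF cl[OF l], of j j] nk in linarith)+
      qed (rule B)
      also have "\<dots> = e" using B by (simp add: e'_def)
      finally show ?thesis unfolding eq dlt by (simp only: tensor_def of_real_diff[symmetric] norm_of_real)
    qed
  qed
  then show "\<exists>N. \<forall>n\<ge>N. \<forall>k\<ge>N. derivs_le m (\<lambda>x. tensor (\<lambda>j. f j n) x - tensor (\<lambda>j. f j k) x) e" by blast
qed

subsection \<open>Euler operators\<close>

definition euler :: "'d::finite \<Rightarrow> 'd tfun \<Rightarrow> 'd tfun" where
  "euler j f = (\<lambda>x. complex_of_real (x $ j) * pd j f x)"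

lemma smooth_euler: "smooth_fun f \<Longrightarrow> smooth_fun (euler j f)"
  unfolding euler_def by (intro smooth_mult smooth_coord smooth_pd)
lemma test_euler: "test f \<Longrightarrow> test (euler j f)"
  unfolding euler_def by (intro test_mult smooth_coord test_pd)

lemma euler_adj_eq: "smooth_fun f \<Longrightarrow> euler_adj j f = (\<lambda>x. - (f x + euler j f x))"
  unfolding euler_adj_def by (subst pd_mult) (auto simp: smooth_coord pd_coord euler_def)

lemma euler_adj_lin: "smooth_fun f \<Longrightarrow> euler_adj j f = (\<lambda>x. (-1) * f x + (-1) * euler j f x)"
  by (simp add: euler_adj_eq)

lemma test_euler_adj: assumes "test f" shows "test (euler_adj j f)"
  unfolding euler_adj_lin[OF test_smooth[OF assms]] by (intro test_lin test_euler assms)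

text \<open>Dilation by the number \<open>a\<close> in direction \<open>j\<close> alone. For
  positive \<open>a\<close> these dilations form a one-parameter group, and its generator at
  \<open>a = 1\<close> is \<open>euler j\<close>.\<close>

definition coord_vec :: "'d::finite \<Rightarrow> real \<Rightarrow> real^'d" where
  "coord_vec j a = (\<chi> i. if i = j then a else 1)"

lemma coord_vec_nth [simp]: "coord_vec j a $ i = (if i = j then a else 1)" by (simp add: coord_vec_def)
lemma coord_vec_Rstar: "a \<noteq> 0 \<Longrightarrow> coord_vec j a \<in> Rstar" by (simp add: Rstar_def)
lemma dil_coord_vec: "dil x (coord_vec j (1 + t)) = x + (t * x $ j) *\<^sub>R axis j 1"
  by (auto simp: vec_eq_iff axis_nth_if algebra_simps)
lemma prod_list_coord_vec: "prod_list (map (\<lambda>i. coord_vec j a $ i) js) = a ^ count_list js j"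
  by (induction js) auto

lemma taylor2:
  assumes f: "smooth_fun f" and B: "\<And>x. cmod (pd j (pd j f) x) \<le> B"
  shows "cmod (f (x + y *\<^sub>R axis j 1) - f x - y *\<^sub>R pd j f x) \<le> B * y\<^sup>2"
proof -
  let ?e = "axis j 1 :: real^'a"
  let ?S = "closed_segment 0 y"
  let ?F = "\<lambda>t. f (x + t *\<^sub>R ?e) - t *\<^sub>R pd j f x"
  have B0: "B \<ge> 0" using B[of x] norm_ge_zero order_trans by blast
  have "norm (?F y - ?F 0) \<le> (B * \<bar>y\<bar>) * norm (y - 0)"
  proof (rule differentiable_bound[of ?S _ "\<lambda>t h. h *\<^sub>R (pd j f (x + t *\<^sub>R ?e) - pd j f x)"])
    fix t assume t: "t \<in> ?S"
    have "(?F has_vector_derivative (pd j f (x + t *\<^sub>R ?e) - 1 *\<^sub>R pd j f x)) (at t)"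
      by (intro has_vector_derivative_diff smooth_deriv f) (auto intro!: derivative_eq_intros)
    then show "(?F has_derivative (\<lambda>h. h *\<^sub>R (pd j f (x + t *\<^sub>R ?e) - pd j f x))) (at t within ?S)"
      unfolding has_vector_derivative_def using has_derivative_at_withinI by fastforce
    have "cmod (pd j f (x + t *\<^sub>R ?e) - pd j f x) \<le> B * \<bar>t\<bar>"
      by (rule smooth_mean_value[OF smooth_pd[OF f] B])
    also have "\<dots> \<le> B * \<bar>y\<bar>" using t B0 by (intro mult_left_mono) (auto simp: closed_segment_eq_real_ivl split: if_splits)
    finally have le: "cmod (pd j f (x + t *\<^sub>R ?e) - pd j f x) \<le> B * \<bar>y\<bar>" .
    show "onorm (\<lambda>h. h *\<^sub>R (pd j f (x + t *\<^sub>R ?e) - pd j f x)) \<le> B * \<bar>y\<bar>"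
    proof (rule onorm_le)
      fix h show "norm (h *\<^sub>R (pd j f (x + t *\<^sub>R ?e) - pd j f x)) \<le> B * \<bar>y\<bar> * norm h"
        using mult_right_mono[OF le, of "\<bar>h\<bar>"] by (simp add: mult.commute)
    qed
  qed auto
  then show ?thesis by (simp add: power2_eq_square algebra_simps abs_mult_self_eq)
qed

text \<open>With \<open>F = dl js f\<close> and \<open>c = count_list js j\<close>, the derivative
  of the quotient's first term is \<open>(1 + t) ^ c\<close> times \<open>F\<close> at the point
  \<open>x\<close> shifted by \<open>t * x $ j\<close> in direction \<open>j\<close>;
  differentiating in \<open>t\<close> at 0 gives the two summands of \<open>G js\<close>. Support
  and uniformity are controlled well enough for convergence in the space of test functions.\<close>

lemma dil_quotient:
  fixes f :: "'d::finite tfun" and j :: 'd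
  assumes f: "test f"
  defines "h \<equiv> \<lambda>n::nat. 1 / real (n + 2)"
  defines "q \<equiv> \<lambda>n x. complex_of_real (1 / h n) * fdil (coord_vec j (1 + h n)) f x + complex_of_real (- 1 / h n) * f x"
  defines "G \<equiv> \<lambda>js x. of_nat (count_list js j) * dl js f x + complex_of_real (x $ j) * pd j (dl js f) x"
  shows "\<exists>R. \<forall>n. DK (cbx R) (q n)"
    and "uniform_limit UNIV (\<lambda>n. dl js (q n)) (G js) sequentially"
proof -
  have h: "h n > 0" "h n \<le> 1/2" for n by (auto simp: h_def)
  have h0: "h \<longlonglongrightarrow> 0"
    using LIMSEQ_ignore_initial_segment[OF lim_inverse_n', of 2] by (simp add: h_def)
  have sR: "coord_vec j (1 + h n) \<in> Rstar" for n using h(1)[of n] by (intro coord_vec_Rstar) simp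
  obtain R where R: "R > 0" "\<forall>x. x \<notin> cbx R \<longrightarrow> f x = 0" using test_supp[OF f] by blast
  have tq: "test (q n)" for n unfolding q_def by (intro test_lin test_fdil f sR)
  \<comment> \<open>The factor \<open>1 + h n\<close> exceeds 1, so the dilation moves points
    outward and all quotients vanish outside the cube that contains the support of
    \<open>f\<close>.\<close>
  have dil_out: "dil x (coord_vec j (1 + h n)) \<notin> cbx R" if out: "x \<notin> cbx R" for x n
  proof -
    obtain i where i: "\<bar>x $ i\<bar> > R" using out by (auto simp: cbx_def not_le)
    have "\<bar>x $ i\<bar> \<le> \<bar>dil x (coord_vec j (1 + h n)) $ i\<bar>"
      using h(1)[of n] by (auto simp: abs_mult intro!: mult_left_le[of "\<bar>x $ i\<bar>", simplified] simp: algebra_simps)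
    then show ?thesis using i by (auto simp: cbx_def not_le intro!: exI[of _ i])
  qed
  show "\<exists>R. \<forall>n. DK (cbx R) (q n)"
    using tq R dil_out by (intro exI[of _ R]) (auto simp: DK_def q_def fdil_def)
  let ?c = "count_list js j"
  let ?F = "dl js f"
  note smF = smooth_dl[OF test_smooth[OF f], of js]
  have dlq: "dl js (q n) x = ((1 + h n) ^ ?c *\<^sub>R ?F (dil x (coord_vec j (1 + h n))) - ?F x) /\<^sub>R h n" for n x
    unfolding q_def dl_lin[OF smooth_fdil[OF test_smooth[OF f]] test_smooth[OF f]] dl_fdil[OF test_smooth[OF f]] prod_list_coord_vec
    by (simp add: scaleR_conv_of_real algebra_simps divide_inverse)
  have Fz: "?F x = 0" if "x \<notin> cbx R" for x using dl_zero_outside[OF closed_cbx _ that, of f js] R by blast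
  have Fpz: "pd j ?F x = 0" if "x \<notin> cbx R" for x
    using dl_zero_outside[OF closed_cbx _ that, of f "j # js"] R by (simp add: dl_Cons)
  obtain B0 where B0: "B0 \<ge> 0" "\<And>x. cmod (?F x) \<le> B0" using test_bounded[OF test_dl[OF f]] by blast
  obtain B1 where B1: "B1 \<ge> 0" "\<And>x. cmod (pd j ?F x) \<le> B1" using test_bounded[OF test_pd[OF test_dl[OF f]]] by blast
  obtain B2 where B2: "B2 \<ge> 0" "\<And>x. cmod (pd j (pd j ?F) x) \<le> B2" using test_bounded[OF test_pd[OF test_pd[OF test_dl[OF f]]]] by blast
  \<comment> \<open>The summands bound, uniformly in \<open>x\<close>, the quotient of powers
    against its derivative, the effect of the shift on the term with factor \<open>c\<close>, and
    the second-order Taylor remainder divided by \<open>h n\<close>.\<close>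
  define \<epsilon> where "\<epsilon> n = \<bar>((1 + h n) ^ ?c - 1) / h n - real ?c\<bar> * B0 + real ?c * (B1 * (h n * R)) + B2 * R\<^sup>2 * h n" for n
  have "(\<lambda>n. ((0 + h n + 1) ^ ?c - (0 + 1) ^ ?c) / h n) \<longlonglongrightarrow> real ?c * 1"
  proof -
    have d: "((\<lambda>t. (t + 1) ^ ?c) has_real_derivative real ?c) (at 0)"
      by (auto intro!: derivative_eq_intros)
    have "(\<lambda>t. ((0 + t + 1) ^ ?c - (0 + 1) ^ ?c) / t) \<midarrow>0\<rightarrow> real ?c" using d unfolding DERIV_def .
    moreover have "filterlim h (at 0) sequentially" using h0 h(1) by (auto simp: filterlim_at intro!: always_eventually less_imp_neq[symmetric])
    ultimately show ?thesis using filterlim_compose by force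
  qed
  then have l1: "(\<lambda>n. \<bar>((1 + h n) ^ ?c - 1) / h n - real ?c\<bar>) \<longlonglongrightarrow> \<bar>real ?c - real ?c\<bar>"
    by (intro tendsto_rabs tendsto_diff tendsto_const) (simp add: add.commute)
  have "\<epsilon> \<longlonglongrightarrow> \<bar>real ?c - real ?c\<bar> * B0 + real ?c * (B1 * (0 * R)) + B2 * R\<^sup>2 * 0"
    unfolding \<epsilon>_def by (intro tendsto_add tendsto_mult tendsto_const l1 h0)
  then have e0: "\<epsilon> \<longlonglongrightarrow> 0" by simp
  have e_nn: "\<epsilon> n \<ge> 0" for n unfolding \<epsilon>_def using B0(1) B1(1) B2(1) R(1) h(1)[of n] by (intro add_nonneg_nonneg mult_nonneg_nonneg) auto
  have est: "cmod (dl js (q n) x - G js x) \<le> \<epsilon> n" for n x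
  proof (cases "x \<in> cbx R")
    case False
    then show ?thesis using Fz Fpz dil_out[OF False, of n] e_nn by (simp add: dlq G_def)
  next
    case True
    then have xj: "\<bar>x $ j\<bar> \<le> R" by (simp add: cbx_def)
    let ?a = "(1 + h n) ^ ?c" and ?Fa = "?F (x + (h n * x $ j) *\<^sub>R axis j 1)"
    have t1: "cmod (?Fa - ?F x) \<le> B1 * (h n * R)"
    proof -
      have "cmod (?Fa - ?F x) \<le> B1 * \<bar>h n * x $ j\<bar>" by (rule smooth_mean_value[OF smF B1(2)])
      also have "\<dots> \<le> B1 * (h n * R)" using xj h(1)[of n] B1(1) by (auto simp: abs_mult intro!: mult_left_mono)
      finally show ?thesis .
    qed
    have t2: "cmod (?Fa - ?F x - (h n * x $ j) *\<^sub>R pd j ?F x) \<le> (B2 * R\<^sup>2 * h n) * h n"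
    proof -
      have "cmod (?Fa - ?F x - (h n * x $ j) *\<^sub>R pd j ?F x) \<le> B2 * (h n * x $ j)\<^sup>2" by (rule taylor2[OF smF B2(2)])
      also have "\<dots> \<le> B2 * (h n * R)\<^sup>2"
        using xj h(1)[of n] B2(1) R(1) by (intro mult_left_mono) (auto simp: abs_le_square_iff[symmetric] abs_mult)
      finally show ?thesis by (simp add: power2_eq_square mult_ac)
    qed
    have eq: "dl js (q n) x - G js x = (((?a - 1) / h n - real ?c) *\<^sub>R ?Fa + real ?c *\<^sub>R (?Fa - ?F x))
       + (?Fa - ?F x - (h n * x $ j) *\<^sub>R pd j ?F x) /\<^sub>R h n"
      unfolding dlq G_def dil_coord_vec using h(1)[of n]
      by (simp add: scaleR_conv_of_real field_simps)
    have "cmod (dl js (q n) x - G js x) \<le> cmod (((?a - 1) / h n - real ?c) *\<^sub>R ?Fa) + cmod (real ?c *\<^sub>R (?Fa - ?F x))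
       + cmod ((?Fa - ?F x - (h n * x $ j) *\<^sub>R pd j ?F x) /\<^sub>R h n)"
      unfolding eq by (intro norm_triangle_le add_right_mono norm_triangle_ineq)
    also have "\<dots> \<le> \<epsilon> n" unfolding \<epsilon>_def
    proof (intro add_mono)
      show "cmod (((?a - 1) / h n - real ?c) *\<^sub>R ?Fa) \<le> \<bar>(?a - 1) / h n - real ?c\<bar> * B0"
        unfolding norm_scaleR by (intro mult_left_mono B0) auto
      show "cmod (real ?c *\<^sub>R (?Fa - ?F x)) \<le> real ?c * (B1 * (h n * R))"
        unfolding norm_scaleR abs_of_nat by (intro mult_left_mono t1) auto
      show "cmod ((?Fa - ?F x - (h n * x $ j) *\<^sub>R pd j ?F x) /\<^sub>R h n) \<le> B2 * R\<^sup>2 * h n"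
        unfolding norm_scaleR using t2 h(1)[of n] by (simp add: field_simps)
    qed
    finally show ?thesis .
  qed
  show "uniform_limit UNIV (\<lambda>n. dl js (q n)) (G js) sequentially"
    unfolding uniform_limit_iff
  proof (intro allI impI)
    fix e :: real assume "e > 0"
    then have "\<forall>\<^sub>F n in sequentially. \<epsilon> n < e" using order_tendstoD(2)[OF e0] by blast
    then show "\<forall>\<^sub>F n in sequentially. \<forall>x\<in>UNIV. dist (dl js (q n) x) (G js x) < e"
      by eventually_elim (auto simp: dist_norm intro: le_less_trans[OF est])
  qed
qed

text \<open>Limits of difference quotients along dilations commute with all partial derivatives;
  this replaces the symmetry of second derivatives.\<close>
lemma dl_euler:
  assumes f: "test f"
  shows "dl js (euler j f) x = of_nat (count_list js j) * dl js f x + complex_of_real (x $ j) * pd j (dl js f) x"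
proof -
  let ?h = "\<lambda>n::nat. 1 / real (n + 2)"
  let ?q = "\<lambda>n x. complex_of_real (1 / ?h n) * fdil (coord_vec j (1 + ?h n)) f x + complex_of_real (- 1 / ?h n) * f x"
  let ?G = "\<lambda>js x. of_nat (count_list js j) * dl js f x + complex_of_real (x $ j) * pd j (dl js f) x"
  obtain R where "\<forall>n. DK (cbx R) (?q n)" using dil_quotient(1)[OF f, of j] by blast
  then have sm: "smooth_fun (?q n)" for n using DK_smooth by blast
  have "dl js (?G []) = ?G js" by (rule smooth_limit(2)[where fs = ?q and g = ?G, OF sm dil_quotient(2)[OF f]])
  moreover have "?G [] = euler j f" by (simp add: euler_def)
  ultimately show ?thesis by simp
qed

text \<open>\<open>MT T\<close> is linear and commutes with dilations, hence with the quotients of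
  \<open>dil_quotient\<close>. By continuity of \<open>MT T\<close> the limits can be compared: one
  is the image of \<open>euler j f\<close>, the other is \<open>euler j\<close> of the
  image.\<close>

lemma MT_euler:
  assumes T: "DH T" and f: "test f"
  shows "MT T (euler j f) = euler j (MT T f)"
proof
  fix y :: "real^'a"
  let ?h = "\<lambda>n::nat. 1 / real (n + 2)"
  let ?q = "\<lambda>f n x. complex_of_real (1 / ?h n) * fdil (coord_vec j (1 + ?h n)) f x + complex_of_real (- 1 / ?h n) * f x"
  let ?G = "\<lambda>f js x. of_nat (count_list js j) * dl js f x + complex_of_real (x $ j) * pd j (dl js f) x"
  have sR: "coord_vec j (1 + ?h n) \<in> Rstar" for n by (intro coord_vec_Rstar) (simp add: add_nonneg_eq_0_iff)
  obtain R where R: "\<And>n. DK (cbx R) (?q f n)" using dil_quotient(1)[OF f, of j] by blast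
  have bR: "bounded (cbx R :: (real^'a) set)" using compact_imp_bounded[OF compact_cbx] .
  have lim: "uniform_limit UNIV (\<lambda>n. dl js (?q f n)) (dl js (euler j f)) sequentially" for js
  proof -
    have "dl js (euler j f) = ?G f js" by (rule ext) (rule dl_euler[OF f])
    then show ?thesis using dil_quotient(2)[OF f, of js j] by simp
  qed
  have "DK (cbx R) (euler j f)" unfolding DK_def
  proof (intro conjI allI impI test_euler f)
    fix x :: "real^'a" assume x: "x \<notin> cbx R"
    have "(\<lambda>n. dl [] (?q f n) x) \<longlonglongrightarrow> dl [] (euler j f) x" by (rule tendsto_uniform_limitI[OF lim]) simp
    then show "euler j f x = 0" using R x by (simp add: DK_def LIMSEQ_const_iff)
  qed
  from MT_conv[OF T bR R this lim, of "[]"]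
  have "(\<lambda>n. dl [] (MT T (?q f n)) y) \<longlonglongrightarrow> dl [] (MT T (euler j f)) y"
    by (rule tendsto_uniform_limitI) simp
  moreover have "MT T (?q f n) = ?q (MT T f) n" for n
    by (simp only: MT_lin[OF T test_fdil[OF f sR] f] MT_fdil[OF T f sR])
  ultimately have l1: "(\<lambda>n. ?q (MT T f) n y) \<longlonglongrightarrow> MT T (euler j f) y" by simp
  have "(\<lambda>n. dl [] (?q (MT T f) n) y) \<longlonglongrightarrow> ?G (MT T f) [] y"
    by (rule tendsto_uniform_limitI[OF dil_quotient(2)[OF MT_spec(1)[OF T f]]]) simp
  then have l2: "(\<lambda>n. ?q (MT T f) n y) \<longlonglongrightarrow> euler j (MT T f) y" by (simp add: euler_def)
  show "MT T (euler j f) y = euler j (MT T f) y" using LIMSEQ_unique[OF l1 l2] .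
qed

lemma MT_euler_adj:
  assumes T: "DH T" and f: "test f"
  shows "MT T (euler_adj j f) = euler_adj j (MT T f)"
  unfolding euler_adj_lin[OF test_smooth[OF f]] euler_adj_lin[OF test_smooth[OF MT_spec(1)[OF T f]]]
  by (simp only: MT_lin[OF T f test_euler[OF f]] MT_euler[OF T f])

lemma euler_adj_list_Nil [simp]: "euler_adj_list [] f = f"
  by (simp add: euler_adj_list_def)
lemma euler_adj_list_Cons: "euler_adj_list (b # bs) f = euler_adj_list bs (euler_adj b f)"
  by (simp add: euler_adj_list_def)

lemma test_euler_adj_list: "test f \<Longrightarrow> test (euler_adj_list bs f)"
  by (induction bs arbitrary: f) (auto simp: euler_adj_list_Cons test_euler_adj)

lemma MT_euler_adj_list:
  assumes T: "DH T" shows "test f \<Longrightarrow> MT T (euler_adj_list bs f) = euler_adj_list bs (MT T f)"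
  by (induction bs arbitrary: f) (auto simp: euler_adj_list_Cons test_euler_adj MT_euler_adj[OF T])

subsection \<open>Flatness on the coordinate hyperplanes\<close>

text \<open>Where the far end of the segment is outside the support, the derivative in direction
  \<open>j\<close> is \<open>- f\<close>, so up to sign this is a primitive. The fixed range of
  integration permits differentiation under the integral in all directions.\<close>

definition segment_integral :: "'d::finite \<Rightarrow> real \<Rightarrow> 'd tfun \<Rightarrow> 'd tfun" where
  "segment_integral j L f = (\<lambda>x. integral {0..L} (\<lambda>s. f (x + s *\<^sub>R axis j 1)))"

lemma smooth_cont_compose:
  "smooth_fun f \<Longrightarrow> continuous_on S g \<Longrightarrow> continuous_on S (\<lambda>x. f (g x))"
  by (rule continuous_on_compose2[OF smooth_cont]) auto

lemma segment_integral_deriv: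
  assumes f: "smooth_fun f"
  shows "((\<lambda>t::real. segment_integral j L f (x + t *\<^sub>R axis i 1)) has_vector_derivative segment_integral j L (pd i f) x) (at 0)"
proof -
  have "((\<lambda>t::real. integral (cbox 0 L) (\<lambda>s. f (x + t *\<^sub>R axis i 1 + s *\<^sub>R axis j 1))) has_vector_derivative
     integral (cbox 0 L) (\<lambda>s. pd i f (x + 0 *\<^sub>R axis i 1 + s *\<^sub>R axis j 1))) (at 0 within UNIV)"
  proof (rule leibniz_rule_vector_derivative)
    fix t s :: real
    have "((\<lambda>t. f ((x + s *\<^sub>R axis j 1) + t *\<^sub>R axis i 1)) has_vector_derivative pd i f ((x + s *\<^sub>R axis j 1) + t *\<^sub>R axis i 1)) (at t)"
      by (rule smooth_deriv[OF f])
    then show "((\<lambda>t. f (x + t *\<^sub>R axis i 1 + s *\<^sub>R axis j 1)) has_vector_derivative pd i f (x + t *\<^sub>R axis i 1 + s *\<^sub>R axis j 1)) (at t within UNIV)"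
      by (simp add: add_ac)
  next
    show "(\<lambda>s. f (x + t *\<^sub>R axis i 1 + s *\<^sub>R axis j 1)) integrable_on cbox 0 L" for t
      by (intro integrable_continuous smooth_cont_compose f continuous_intros)
    show "continuous_on (UNIV \<times> cbox 0 L) (\<lambda>(t, s). pd i f (x + t *\<^sub>R axis i 1 + s *\<^sub>R axis j 1))"
      unfolding case_prod_beta by (intro smooth_cont_compose smooth_pd f continuous_intros)
  qed auto
  then show ?thesis by (simp add: segment_integral_def)
qed

lemma smooth_segment_integral:
  assumes f: "smooth_fun f" shows "smooth_fun (segment_integral j L f)"
proof (rule smooth_coinduct[of _ "{segment_integral j L f | f. smooth_fun f}"])
  fix g i assume "g \<in> {segment_integral j L f | f. smooth_fun f}"
  then obtain f where g: "g = segment_integral j L f" "smooth_fun f" by blast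
  show "\<exists>g'\<in>{segment_integral j L f | f. smooth_fun f}. \<forall>x. ((\<lambda>s. g (x + s *\<^sub>R axis i 1)) has_vector_derivative g' x) (at 0)"
    unfolding g(1) using segment_integral_deriv[OF g(2)] smooth_pd[OF g(2)] by blast
  have "continuous_on UNIV (\<lambda>x. integral (cbox 0 L) (\<lambda>s. f (x + s *\<^sub>R axis j 1)))"
    by (rule integral_continuous_on_param)
      (unfold case_prod_beta, intro smooth_cont_compose g continuous_intros)
  then show "continuous_on UNIV g" by (simp add: g(1) segment_integral_def)
qed (use f in auto)

lemma pd_segment_integral:
  assumes f: "smooth_fun f" and L: "L \<ge> 0"
  shows "pd j (segment_integral j L f) x = f (x + L *\<^sub>R axis j 1) - f x"
proof -
  have "((\<lambda>s. pd j f (x + s *\<^sub>R axis j 1)) has_integral (f (x + L *\<^sub>R axis j 1) - f (x + 0 *\<^sub>R axis j 1))) {0..L}"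
    by (rule fundamental_theorem_of_calculus[OF L])
      (use smooth_deriv[OF f] has_vector_derivative_at_within in blast)
  then have "segment_integral j L (pd j f) x = f (x + L *\<^sub>R axis j 1) - f x"
    unfolding segment_integral_def by (simp add: integral_unique)
  then show ?thesis using pd_eqI[OF segment_integral_deriv[OF f, of j L x j]] by simp
qed

lemma odd_integral_zero:
  fixes k :: "real \<Rightarrow> complex"
  assumes k: "continuous_on UNIV k" "\<And>s. k (2 * m - s) = - k s" and m: "m \<ge> 0"
  shows "integral {0..2*m} k = 0"
proof -
  have "((\<lambda>x. (-1) *\<^sub>R k (2 * m - x)) has_integral (integral {2 * m - 0..2 * m - 2 * m} k - integral {2 * m - 2 * m..2 * m - 0} k)) {0..2*m}"
    by (rule has_integral_substitution_general[where s = "{}" and c = 0 and d = "2*m"])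
      (use m in \<open>auto intro!: derivative_eq_intros continuous_intros continuous_on_subset[OF k(1)]\<close>)
  then have "(k has_integral (integral {2 * m..0} k - integral {0..2 * m} k)) {0..2*m}"
    by (simp add: k(2))
  moreover have "integral {2 * m..0} k = 0" using m by (cases "m = 0") auto
  ultimately have "integral {0..2*m} k = - integral {0..2*m} k" by (metis diff_0 integral_unique)
  then show ?thesis by simp
qed

lemma bump_exists:
  assumes "0 < (a::real)"
  shows "\<exists>X. smooth_real X \<and> (\<forall>s. \<bar>s\<bar> \<le> a \<longrightarrow> X s = 1) \<and> (\<forall>s. \<bar>s\<bar> \<ge> 2 * a \<longrightarrow> X s = 0)"
proof -
  obtain X where X: "smooth_real X" "\<forall>s. \<bar>s\<bar> \<le> (2*a)/2 \<longrightarrow> X s = 0" "\<forall>s. \<bar>s\<bar> \<ge> 2*a \<longrightarrow> X s = 1"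
    using cutoff_exists[of "2*a"] assms by auto
  then show ?thesis
    by (intro exI[of _ "\<lambda>s. 1 + - X s"] conjI smooth_real_add smooth_real_minus) auto
qed

text \<open>Oddness in \<open>x $ j\<close> makes the integral over every line in direction
  \<open>j\<close> vanish, and a nonzero integral is the only obstruction to a primitive with
  compact support.\<close>

lemma test_primitive:
  assumes \<kappa>: "test \<kappa>" and odd: "\<And>x. \<kappa> (dil x (coord_vec j (-1))) = - \<kappa> x"
  shows "\<exists>\<Phi>. test \<Phi> \<and> pd j \<Phi> = \<kappa>"
proof -
  obtain R where R: "R > 0" "\<forall>x. x \<notin> cbx R \<longrightarrow> \<kappa> x = 0" using test_supp[OF \<kappa>] by blast
  have z: "\<kappa> x = 0" if "\<bar>x $ i\<bar> > R" for x i
    using R(2) that by (auto simp: cbx_def not_le)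
  let ?e = "axis j 1 :: real^'a"
  \<comment> \<open>Long enough that for \<open>|x $ j| \<le> 4 R\<close> the segment ends to the
    right of the support of \<open>\<kappa>\<close>.\<close>
  define L where "L = 10 * R"
  define H where "H = segment_integral j L \<kappa>"
  have L: "L \<ge> 0" using R by (simp add: L_def)
  note sm = test_smooth[OF \<kappa>]
  have smH: "smooth_fun H" unfolding H_def by (rule smooth_segment_integral[OF sm])
  \<comment> \<open>To the right of the support the segment misses it; to the left it crosses it
    completely, and the two halves cancel by oddness.\<close>
  have Hz: "H x = 0" if x: "\<bar>x $ j\<bar> > R" "\<bar>x $ j\<bar> \<le> 4 * R" for x
  proof -
    let ?k = "\<lambda>s. \<kappa> (x + s *\<^sub>R ?e)"
    have ck: "continuous_on UNIV ?k" by (intro smooth_cont_compose sm continuous_intros)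
    show ?thesis
    proof (cases "x $ j > 0")
      case True
      have "integral {0..L} ?k = integral {0..L} (\<lambda>_. 0)"
        by (rule integral_cong) (use True x in \<open>auto intro!: z[of _ j] simp: axis_nth_if\<close>)
      then show ?thesis by (simp add: H_def segment_integral_def)
    next
      case False
      define m where "m = - x $ j"
      have m: "m > R" "m \<le> 4 * R" using False x by (auto simp: m_def)
      have "?k (2 * m - s) = - ?k s" for s
      proof -
        have "dil (x + s *\<^sub>R ?e) (coord_vec j (-1)) = x + (2 * m - s) *\<^sub>R ?e"
          by (auto simp: vec_eq_iff axis_nth_if m_def)
        then show ?thesis using odd[of "x + s *\<^sub>R ?e"] by simp
      qed
      then have i1: "integral {0..2*m} ?k = 0" using odd_integral_zero[OF ck] m R by simp
      have "integral {2*m..L} ?k = integral {2*m..L} (\<lambda>_. 0)"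
        by (rule integral_cong) (use m in \<open>auto intro!: z[of _ j] simp: axis_nth_if m_def\<close>)
      then have i2: "integral {2*m..L} ?k = 0" by simp
      have "integral {0..2*m} ?k + integral {2*m..L} ?k = integral {0..L} ?k"
        by (rule Henstock_Kurzweil_Integration.integral_combine)
          (use m R in \<open>auto simp: L_def intro!: integrable_continuous_real continuous_on_subset[OF ck]\<close>)
      then show ?thesis using i1 i2 by (simp add: H_def segment_integral_def)
    qed
  qed
  \<comment> \<open>The segment integral may be nonzero again near \<open>x $ j = - L\<close>, where
    the segment ends inside the support. The cutoff removes that part, and its transition lies where
    \<open>H\<close> is 0.\<close>
  obtain X where X: "smooth_real X" "\<And>s. \<bar>s\<bar> \<le> 2 * R \<Longrightarrow> X s = 1" "\<And>s. \<bar>s\<bar> \<ge> 4 * R \<Longrightarrow> X s = 0"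
    using bump_exists[of "2*R"] R by auto
  let ?X = "\<lambda>x::real^'a. complex_of_real (X (x $ j))"
  have smX: "smooth_fun ?X" by (rule smooth_coordfun[OF X(1)])
  define \<Phi> where "\<Phi> = (\<lambda>x. (- 1) * (?X x * H x))"
  have sm\<Phi>: "smooth_fun \<Phi>" unfolding \<Phi>_def by (intro smooth_cmul smooth_mult smX smH)
  have "\<Phi> x = 0" if out: "x \<notin> cbx (4 * R)" for x
  proof -
    obtain i where i: "\<bar>x $ i\<bar> > 4 * R" using out by (auto simp: cbx_def not_le)
    show ?thesis
    proof (cases "i = j")
      case True then show ?thesis using X(3)[of "x $ j"] i by (simp add: \<Phi>_def)
    next
      case False
      have "integral {0..L} (\<lambda>s. \<kappa> (x + s *\<^sub>R ?e)) = integral {0..L} (\<lambda>_. 0)"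
        by (rule integral_cong) (use False i R in \<open>auto intro!: z[of _ i] simp: axis_nth_if\<close>)
      then have "H x = 0" by (simp add: H_def segment_integral_def)
      then show ?thesis by (simp add: \<Phi>_def)
    qed
  qed
  then have t\<Phi>: "test \<Phi>" using testI[OF sm\<Phi> compact_imp_bounded[OF compact_cbx]] by blast
  have "pd j \<Phi> x = \<kappa> x" for x
  proof -
    have eq: "pd j \<Phi> x = - (pd j ?X x * H x + ?X x * (\<kappa> (x + L *\<^sub>R ?e) - \<kappa> x))"
      unfolding \<Phi>_def by (simp only: pd_cmul smooth_mult smX smH pd_mult) (simp add: H_def pd_segment_integral[OF sm L])
    have cl1: "closed {x::real^'a. \<bar>x $ j\<bar> \<ge> 2 * R}" "closed {x::real^'a. \<bar>x $ j\<bar> \<le> 4 * R}"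
      by (intro closed_Collect_le continuous_intros)+
    consider "\<bar>x $ j\<bar> \<le> R" | "\<bar>x $ j\<bar> > R" "\<bar>x $ j\<bar> \<le> 4 * R" | "\<bar>x $ j\<bar> > 4 * R" by linarith
    then show ?thesis
    proof cases
      case 1
      have "dl [j] (\<lambda>x. ?X x - 1) x = 0"
        by (rule dl_zero_outside[OF cl1(1)]) (use X(2) 1 R in auto)
      then have "pd j ?X x = 0"
        unfolding dl_Cons dl_Nil using pd_add[OF smX smooth_const[of "-1"], of j] by simp
      moreover have "\<kappa> (x + L *\<^sub>R ?e) = 0" using 1 R by (intro z[of _ j]) (auto simp: axis_nth_if L_def)
      ultimately show ?thesis using 1 X(2)[of "x $ j"] R by (simp add: eq)
    next
      case 2
      have "\<kappa> (x + L *\<^sub>R ?e) = 0" using 2 R by (intro z[of _ j]) (auto simp: axis_nth_if L_def)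
      then show ?thesis using Hz[OF 2] z[of x j] 2 by (simp add: eq)
    next
      case 3
      have "dl [j] ?X x = 0"
        by (rule dl_zero_outside[OF cl1(2)]) (use X(3) 3 in auto)
      then show ?thesis using X(3)[of "x $ j"] z[of x j] 3 R by (simp add: eq dl_Cons)
    qed
  qed
  then show ?thesis using t\<Phi> by blast
qed

text \<open>A smooth stand-in for \<open>1 / s\<close>, changed only near 0. It is made odd so that
  multiplication by it changes parity exactly as division by \<open>s\<close> does.\<close>

lemma smooth_reciprocal:
  assumes "\<delta> > 0"
  shows "\<exists>w. smooth_real w \<and> (\<forall>s. w (- s) = - w s) \<and> (\<forall>s. \<bar>s\<bar> \<ge> \<delta> \<longrightarrow> w s = 1 / s)"
proof -
  obtain \<eta> where \<eta>: "smooth_real \<eta>" "\<And>u. u \<le> 0 \<Longrightarrow> \<eta> u = 0" "\<And>u. u \<ge> 1 \<Longrightarrow> \<eta> u = 1" using smooth_step by blast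
  define b where "b s = \<eta> ((2/\<delta>) * s + (-1))" for s
  have b: "smooth_real b" unfolding b_def[abs_def] by (rule smooth_real_affine[OF \<eta>(1)])
  have b0: "b s = 0" if "s < \<delta>/2" for s
  proof -
    have "(2/\<delta>) * s \<le> 1" using that assms by (simp add: field_simps)
    then show ?thesis by (simp add: b_def \<eta>)
  qed
  have b1: "b s = 1" if "s \<ge> \<delta>" for s
  proof -
    have "(2/\<delta>) * s \<ge> 2" using that assms by (simp add: field_simps)
    then show ?thesis by (simp add: b_def \<eta>)
  qed
  define v where "v s = b s / s" for s
  have v: "smooth_real v" unfolding v_def[abs_def] by (rule smooth_real_div[OF b, of "\<delta>/2"]) (use b0 assms in auto)
  define w where "w s = v s + - v ((-1) * s + 0)" for s
  have "smooth_real w" unfolding w_def[abs_def] by (intro smooth_real_add smooth_real_minus v smooth_real_affine)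
  moreover have "w (- s) = - w s" for s by (simp add: w_def)
  moreover have "w s = 1 / s" if "\<bar>s\<bar> \<ge> \<delta>" for s
  proof (cases "s \<ge> 0")
    case True
    then show ?thesis using that b1[of s] b0[of "-s"] assms by (simp add: w_def v_def)
  next
    case False
    then show ?thesis using that b1[of "-s"] b0[of "s"] assms by (simp add: w_def v_def)
  qed
  ultimately show ?thesis by blast
qed

lemma count_list_replicate_same [simp]: "count_list (replicate l j) j = l"
  by (induction l) auto

text \<open>The l-th derivative at \<open>y $ j = 0\<close> turns the Euler operator into multiplication by l.
  The (anti)symmetrization of \<open>\<psi>\<close> lies in the range of \<open>euler j - l\<close>, and reflection only changes the
  l-th derivative by the sign that the symmetrization compensates.\<close>
lemma MT_flat:
  assumes T: "DH T" and \<psi>: "test \<psi>" and \<delta>: "\<delta> > 0" "\<And>x. \<bar>x $ j\<bar> < \<delta> \<Longrightarrow> \<psi> x = 0" and y: "y $ j = 0"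
  shows "dl (replicate l j) (MT T \<psi>) y = 0"
proof -
  let ?D = "dl (replicate l j)"
  let ?r = "coord_vec j (-1) :: real^'a"
  have r: "?r \<in> Rstar" by (rule coord_vec_Rstar) simp
  have yr: "dil y ?r = y" using y by (auto simp: vec_eq_iff)
  \<comment> \<open>This combination has parity \<open>(-1)^l\<close> in direction \<open>j\<close>.
    Dividing it by the power \<open>Suc l\<close> of the coordinate therefore leaves a function
    \<open>\<kappa>\<close> that is odd there, as \<open>test_primitive\<close> requires.\<close>
  define \<psi>s where "\<psi>s = (\<lambda>x. 1 * \<psi> x + (-1)^l * fdil ?r \<psi> x)"
  have ts: "test \<psi>s" unfolding \<psi>s_def by (intro test_lin \<psi> test_fdil r)
  obtain w where w: "smooth_real w" "\<And>s. w (- s) = - w s" "\<And>s. \<bar>s\<bar> \<ge> \<delta> \<Longrightarrow> w s = 1 / s"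
    using smooth_reciprocal[OF \<delta>(1)] by blast
  let ?W = "\<lambda>x::real^'a. \<Prod>i<Suc l. complex_of_real (w (x $ j))"
  define \<kappa> where "\<kappa> = (\<lambda>x. ?W x * \<psi>s x)"
  have t\<kappa>: "test \<kappa>" unfolding \<kappa>_def by (intro test_mult smooth_prod smooth_coordfun w ts)
  have sodd: "\<psi>s (dil x ?r) = (-1)^l * \<psi>s x" for x
  proof -
    have "dil (dil x ?r) ?r = x" by (auto simp: vec_eq_iff)
    moreover have "((-1)::complex)^l * (-1)^l = 1" by (simp flip: power_mult_distrib)
    ultimately show ?thesis by (simp add: \<psi>s_def fdil_def algebra_simps)
  qed
  have sz: "\<psi>s x = 0" if "\<bar>x $ j\<bar> < \<delta>" for x
    using \<delta>(2)[of x] \<delta>(2)[of "dil x ?r"] that by (simp add: \<psi>s_def fdil_def)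
  have k: "complex_of_real (x $ j) ^ Suc l * \<kappa> x = \<psi>s x" for x
  proof (cases "\<bar>x $ j\<bar> < \<delta>")
    case True then show ?thesis by (simp add: \<kappa>_def sz)
  next
    case False
    then have "w (x $ j) = 1 / x $ j" "x $ j \<noteq> 0" using w(3) \<delta>(1) by auto
    then have "complex_of_real (x $ j) ^ Suc l * ?W x = 1"
      by (simp only: prod_constant card_lessThan flip: power_mult_distrib of_real_mult) simp
    then show ?thesis by (simp only: \<kappa>_def mult.assoc[symmetric] mult_1)
  qed
  have "\<kappa> (dil x ?r) = - \<kappa> x" for x
  proof -
    have "?W (dil x ?r) = (-1) ^ Suc l * ?W x"
      by (simp only: prod_constant card_lessThan flip: power_mult_distrib) (simp add: w(2))
    moreover have "((-1)::complex)^l * (-1)^l = 1" by (simp flip: power_mult_distrib)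
    ultimately show ?thesis by (simp add: \<kappa>_def sodd mult_ac)
  qed
  from test_primitive[OF t\<kappa> this] obtain \<Phi> where \<Phi>: "test \<Phi>" "pd j \<Phi> = \<kappa>" by blast
  let ?P = "\<lambda>x::real^'a. \<Prod>i<l. complex_of_real (x $ j)"
  have smP: "smooth_fun ?P" by (intro smooth_prod smooth_coord)
  \<comment> \<open>In \<open>euler j \<phi>\<close> the derivative of the power contributes
    \<open>l * \<phi>\<close>, and the derivative of \<open>\<Phi>\<close> contributes
    \<open>x $ j\<close> to the power \<open>Suc l\<close> times \<open>\<kappa>\<close>, which is
    \<open>\<psi>s\<close>.\<close>
  define \<phi> where "\<phi> = (\<lambda>x. ?P x * \<Phi> x)"
  have t\<phi>: "test \<phi>" unfolding \<phi>_def by (intro test_mult smP \<Phi>)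
  have pdP: "complex_of_real (x $ j) * pd j ?P x = of_nat l * ?P x" for x
  proof -
    have "((\<lambda>s::real. (complex_of_real ((x + s *\<^sub>R axis j 1) $ j)) ^ l) has_vector_derivative of_nat l * complex_of_real (x $ j) ^ (l - 1)) (at 0)"
    proof -
      have "((\<lambda>s::real. (x $ j + s) ^ l) has_real_derivative real l * (x $ j) ^ (l - 1)) (at 0)"
        by (auto intro!: derivative_eq_intros)
      from has_vector_derivative_of_real[OF this]
      show ?thesis by (simp add: axis_nth_if)
    qed
    then have "pd j ?P x = of_nat l * complex_of_real (x $ j) ^ (l - 1)"
      by (intro pd_eqI) simp
    then show ?thesis by (cases l) (auto simp: mult_ac)
  qed
  have "euler j \<phi> x = of_nat l * \<phi> x + \<psi>s x" for x
  proof -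
    have "euler j \<phi> x = (complex_of_real (x $ j) * pd j ?P x) * \<Phi> x + (complex_of_real (x $ j) * ?P x) * \<kappa> x"
      unfolding euler_def \<phi>_def pd_mult[OF smP test_smooth[OF \<Phi>(1)]] \<Phi>(2) by (simp add: algebra_simps)
    also have "(complex_of_real (x $ j) * ?P x) * \<kappa> x = \<psi>s x" using k[of x] by simp
    finally show ?thesis unfolding pdP \<phi>_def by (simp add: mult.assoc)
  qed
  then have eq: "\<psi>s = (\<lambda>x. 1 * euler j \<phi> x + (- of_nat l) * \<phi> x)" by (simp add: fun_eq_iff)
  note tM = MT_spec(1)[OF T]
  have "?D (MT T \<psi>s) y = ?D (euler j (MT T \<phi>)) y + (- of_nat l) * ?D (MT T \<phi>) y"
    unfolding eq MT_lin[OF T test_euler[OF t\<phi>] t\<phi>] MT_euler[OF T t\<phi>]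
    using dl_lin[OF smooth_euler[OF test_smooth[OF tM[OF t\<phi>]], of j] test_smooth[OF tM[OF t\<phi>]], of "replicate l j" 1 "- of_nat l"] by simp
  also have "\<dots> = 0" unfolding dl_euler[OF tM[OF t\<phi>]] using y by simp
  finally have z: "?D (MT T \<psi>s) y = 0" .
  have "?D (MT T \<psi>s) y = ?D (MT T \<psi>) y + (-1)^l * ?D (fdil ?r (MT T \<psi>)) y"
    unfolding \<psi>s_def MT_lin[OF T \<psi> test_fdil[OF \<psi> r]] MT_fdil[OF T \<psi> r]
    using dl_lin[OF test_smooth[OF tM[OF \<psi>]] smooth_fdil[OF test_smooth[OF tM[OF \<psi>]], of ?r], of "replicate l j" 1 "(-1)^l"] by simp
  \<comment> \<open>The \<open>l\<close> derivatives bring out \<open>(-1)^l\<close>, which cancels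
    the sign in \<open>\<psi>s\<close>; the sum is thus twice the derivative in question.\<close>
  also have "?D (fdil ?r (MT T \<psi>)) y = (-1)^l * ?D (MT T \<psi>) y"
    unfolding dl_fdil[OF test_smooth[OF tM[OF \<psi>]]] prod_list_coord_vec yr by simp
  also have "(-1)^l * ((-1)^l * ?D (MT T \<psi>) y) = ?D (MT T \<psi>) y"
    by (simp add: mult.assoc[symmetric] flip: power_mult_distrib)
  finally show ?thesis using z by simp
qed

text \<open>The vanishing of all derivatives in direction \<open>j\<close> is inherited by
  \<open>pd j g\<close>, and a mean value estimate starting from the foot point on the hyperplane
  gains one power of \<open>|y $ j|\<close>.\<close>

lemma flat_bound:
  assumes "test g" "\<And>l y. y $ j = 0 \<Longrightarrow> dl (replicate l j) g y = 0"
  shows "\<exists>C\<ge>0. \<forall>y. cmod (g y) \<le> C * \<bar>y $ j\<bar> ^ k"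
  using assms
proof (induction k arbitrary: g)
  case 0
  then show ?case using test_bounded[of g] by simp
next
  case (Suc k)
  have "dl (replicate l j) (pd j g) y = 0" if "y $ j = 0" for l y
    using Suc.prems(2)[OF that, of "Suc l"] dl_append[of "replicate l j" "[j]" g]
    by (simp add: dl_Cons replicate_append_same)
  then obtain C where C: "C \<ge> 0" "\<And>y. cmod (pd j g y) \<le> C * \<bar>y $ j\<bar> ^ k"
    using Suc.IH[OF test_pd[OF Suc.prems(1)]] by blast
  have "cmod (g y) \<le> C * \<bar>y $ j\<bar> ^ Suc k" for y
  proof -
    define y0 where "y0 = (\<chi> i. if i = j then 0 else y $ i)"
    have y: "y = y0 + (y $ j) *\<^sub>R axis j 1" by (auto simp: y0_def vec_eq_iff axis_nth_if)
    have y0: "y0 $ j = 0" by (simp add: y0_def)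
    have "cmod (g (y0 + (y $ j) *\<^sub>R axis j 1) - g y0) \<le> (C * \<bar>y $ j\<bar> ^ k) * \<bar>y $ j\<bar>"
    proof (rule smooth_mean_value[OF test_smooth[OF Suc.prems(1)]])
      fix t assume t: "t \<in> closed_segment 0 (y $ j)"
      have "cmod (pd j g (y0 + t *\<^sub>R axis j 1)) \<le> C * \<bar>t\<bar> ^ k"
        using C(2)[of "y0 + t *\<^sub>R axis j 1"] y0 by (simp add: axis_nth_if)
      also have "\<dots> \<le> C * \<bar>y $ j\<bar> ^ k"
        using t C(1) by (intro mult_left_mono power_mono) (auto simp: closed_segment_eq_real_ivl split: if_splits)
      finally show "cmod (pd j g (y0 + t *\<^sub>R axis j 1)) \<le> C * \<bar>y $ j\<bar> ^ k" .
    qed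
    moreover have "g y0 = 0" using Suc.prems(2)[OF y0, of 0] by simp
    ultimately show ?thesis using y by (simp add: mult_ac)
  qed
  then show ?case using C(1) by blast
qed

text \<open>Flatness alone gives a constant depending on \<open>f\<close>. Uniform boundedness for
  evaluations weighted by the inverse power of \<open>|y $ j|\<close>, over all pairs
  \<open>(y, j)\<close>, replaces it by a C^m norm, so the decay survives limits in C^m.\<close>

lemma MT_decay:
  fixes T :: "'d::finite distr"
  assumes T: "DH T"
  shows "\<exists>m C. C \<ge> 0 \<and> (\<forall>f B y j. DK half_box f \<longrightarrow> derivs_le m f B \<longrightarrow> y $ j \<noteq> 0 \<longrightarrow> cmod (MT T f y) \<le> C * B * \<bar>y $ j\<bar> ^ k)"
proof -
  let ?I = "{(y::real^'d, j). y $ j \<noteq> 0}"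
  let ?c = "\<lambda>i. complex_of_real (1 / (fst i $ snd i) ^ k)"
  have "\<exists>m C. C \<ge> 0 \<and> (\<forall>i\<in>?I. \<forall>f B. DK half_box f \<longrightarrow> derivs_le m f B \<longrightarrow>
     cmod (?c i * MT T f (fst i)) \<le> C * B)"
  proof (rule uniform_boundedness[OF bounded_half_box])
    fix i
    have "seq_cont_lin half_box (\<lambda>f. ?c i * dl [] (MT T f) (fst i) + 0 * dl [] (MT T f) (fst i))"
      by (rule seq_cont_lin_comb[OF MT_seq_cont_lin[OF T bounded_half_box] MT_seq_cont_lin[OF T bounded_half_box]])
    then show "seq_cont_lin half_box (\<lambda>f. ?c i * MT T f (fst i))" by simp
  next
    fix f :: "'d tfun" assume f: "DK half_box f"
    have "\<forall>j. \<exists>C\<ge>0. \<forall>y. cmod (MT T f y) \<le> C * \<bar>y $ j\<bar> ^ k"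
    proof
      fix j
      have z: "f x = 0" if "\<bar>x $ j\<bar> < 1/2" for x
      proof -
        have "x \<notin> half_box" unfolding half_box_def using that by (auto intro!: exI[of _ j])
        then show ?thesis using f by (simp add: DK_def)
      qed
      show "\<exists>C\<ge>0. \<forall>y. cmod (MT T f y) \<le> C * \<bar>y $ j\<bar> ^ k"
        by (rule flat_bound[OF MT_spec(1)[OF T DK_test[OF f]] MT_flat[OF T DK_test[OF f], of "1/2"]]) (use z in auto)
    qed
    then obtain C where C: "\<And>j. C j \<ge> 0" "\<And>j y. cmod (MT T f y) \<le> C j * \<bar>y $ j\<bar> ^ k" by metis
    have "cmod (?c i * MT T f (fst i)) \<le> (\<Sum>j\<in>UNIV. C j)" if i: "i \<in> ?I" for i
    proof -
      obtain y j where yj: "i = (y, j)" "y $ j \<noteq> 0" using i by auto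
      have "cmod (?c i * MT T f (fst i)) = cmod (MT T f y) / \<bar>y $ j\<bar> ^ k"
        unfolding norm_mult norm_of_real yj by (simp add: abs_divide power_abs)
      also have "\<dots> \<le> C j" using C(2)[of y j] yj(2) by (simp add: divide_le_eq)
      also have "\<dots> \<le> (\<Sum>j\<in>UNIV. C j)" by (rule member_le_sum) (use C in auto)
      finally show ?thesis .
    qed
    then show "\<exists>B. \<forall>i\<in>?I. cmod (?c i * MT T f (fst i)) \<le> B" by blast
  qed
  then obtain m C where C: "C \<ge> 0" "\<And>i f B. i \<in> ?I \<Longrightarrow> DK half_box f \<Longrightarrow> derivs_le m f B \<Longrightarrow> cmod (?c i * MT T f (fst i)) \<le> C * B"
    by blast
  have "cmod (MT T f y) \<le> C * B * \<bar>y $ j\<bar> ^ k" if "DK half_box f" "derivs_le m f B" "y $ j \<noteq> 0" for f B y j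
  proof -
    have "cmod (?c (y, j) * MT T f y) \<le> C * B" using C(2)[of "(y, j)" f B] that by simp
    moreover have "cmod (?c (y, j) * MT T f y) = cmod (MT T f y) / \<bar>y $ j\<bar> ^ k"
      unfolding norm_mult norm_of_real by (simp add: abs_divide power_abs)
    ultimately show ?thesis using that(3) by (simp add: divide_le_eq)
  qed
  then show ?thesis using C(1) by blast
qed

subsection \<open>Integrals of dilations\<close>

lemma integrable_bounded_support:
  fixes g :: "'a::euclidean_space \<Rightarrow> complex"
  assumes g: "g \<in> borel_measurable borel" and B: "\<And>x. cmod (g x) \<le> B" and S: "bounded S" and z: "\<And>x. x \<notin> S \<Longrightarrow> g x = 0"
  shows "integrable lborel g"
proof -
  obtain a where a: "S \<subseteq> cbox (-a) a" using bounded_subset_cbox_symmetric[OF S] by blast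
  show ?thesis
  proof (rule Bochner_Integration.integrable_bound)
    show "integrable lborel (\<lambda>x. B * indicator (cbox (-a) a) x :: real)"
      by (intro integrable_mult_right integrable_real_indicator) (auto simp: emeasure_lborel_cbox_eq)
    show "g \<in> borel_measurable lborel" using g by simp
    have "norm (g x) \<le> norm (B * indicator (cbox (-a) a) x :: real)" for x
    proof (cases "x \<in> S")
      case True
      then have "x \<in> cbox (-a) a" using a by blast
      then show ?thesis using B[of x] by simp
    qed (simp add: z)
    then show "AE x in lborel. norm (g x) \<le> norm (B * indicator (cbox (-a) a) x :: real)" by simp
  qed
qed

lemma test_measurable: "test f \<Longrightarrow> f \<in> borel_measurable borel"
  by (rule borel_measurable_continuous_onI[OF test_cont])

lemma test_integrable: assumes "test f" shows "integrable lborel f"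
proof -
  obtain R where R: "\<forall>x. x \<notin> cbx R \<longrightarrow> f x = 0" using test_supp[OF assms] by blast
  obtain B where "\<forall>x. cmod (f x) \<le> B" using test_bounded[OF assms] by blast
  then show ?thesis
    using integrable_bounded_support[OF test_measurable[OF assms], of B "cbx R"] R compact_imp_bounded[OF compact_cbx] by blast
qed

lemma measurable_vec_lambda [measurable (raw)]:
  assumes "\<And>j. (\<lambda>x. f x j) \<in> borel_measurable M"
  shows "(\<lambda>x. (\<chi> j. f x j) :: real^'d::finite) \<in> borel_measurable M"
proof (rule borel_measurable_euclidean_space[THEN iffD2], rule ballI)
  fix i :: "real^'d" assume "i \<in> Basis"
  then obtain j where "i = axis j 1" by (auto simp: Basis_vec_def)
  then show "(\<lambda>x. (\<chi> j. f x j) \<bullet> i) \<in> borel_measurable M"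
    using assms[of j] by (simp add: inner_axis)
qed

lemma measurable_vec_nth [measurable]: "(\<lambda>x::real^'d::finite. x $ j) \<in> borel_measurable borel"
  by (intro borel_measurable_continuous_onI continuous_intros)

lemma measurable_ivec [measurable]: "(ivec :: real^'d::finite \<Rightarrow> _) \<in> borel_measurable borel"
  unfolding ivec_def[abs_def] by measurable

section \<open>Rounded dilation factors and exchange of \<open>T\<close> with integrals\<close>

lemma finite_vec_set:
  assumes "finite A" shows "finite {v::real^'d::finite. \<forall>j. v $ j \<in> A}"
proof -
  have "{v::real^'d. \<forall>j. v $ j \<in> A} \<subseteq> vec_lambda ` (PiE UNIV (\<lambda>_. A))"
  proof
    fix v :: "real^'d" assume "v \<in> {v. \<forall>j. v $ j \<in> A}"
    then have "vec_nth v \<in> PiE UNIV (\<lambda>_. A)" by auto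
    moreover have "v = vec_lambda (vec_nth v)" by (simp add: vec_nth_inverse)
    ultimately show "v \<in> vec_lambda ` (PiE UNIV (\<lambda>_. A))" by blast
  qed
  moreover have "finite (PiE (UNIV::'d set) (\<lambda>_. A))" by (intro finite_PiE assms) auto
  ultimately show ?thesis using finite_subset by blast
qed

lemma distr_sum:
  assumes T: "distr T" and g: "\<And>i. i \<in> I \<Longrightarrow> test (g i)"
  shows "test (\<lambda>x. \<Sum>i\<in>I. a i * g i x) \<and> T (\<lambda>x. \<Sum>i\<in>I. a i * g i x) = (\<Sum>i\<in>I. a i * T (g i))"
proof -
  have "T (\<lambda>x. 0) = 0" using distr_lin[OF T test_zero test_zero, of 0 0] by simp
  then show ?thesis using g
  proof (induction I rule: infinite_finite_induct)
    case (insert i I)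
    then have t: "test (\<lambda>x. \<Sum>i\<in>I. a i * g i x)" "test (g i)" by auto
    then show ?case using insert distr_lin[OF T t(2,1), of "a i" 1] test_lin[OF t(2,1), of "a i" 1] by simp
  qed auto
qed

lemma dl_sum:
  assumes g: "\<And>i. i \<in> I \<Longrightarrow> smooth_fun (g i)"
  shows "smooth_fun (\<lambda>x. \<Sum>i\<in>I. a i * g i x) \<and> dl js (\<lambda>x. \<Sum>i\<in>I. a i * g i x) = (\<lambda>x. \<Sum>i\<in>I. a i * dl js (g i) x)"
  using g
proof (induction I rule: infinite_finite_induct)
  case (insert i I)
  then have t: "smooth_fun (\<lambda>x. \<Sum>i\<in>I. a i * g i x)" "smooth_fun (g i)" by auto
  then show ?case using insert dl_lin[OF t(2,1), of js "a i" 1] smooth_add[OF smooth_cmul[OF t(2), of "a i"] t(1)] by simp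
qed auto

text \<open>Rounding down to the grid of mesh \<open>1 / n\<close> is measurable and takes finitely
  many values on bounded sets.\<close>

definition rnd :: "nat \<Rightarrow> real^'d::finite \<Rightarrow> real^'d" where
  "rnd n z = (\<chi> j. of_int \<lfloor>real n * z $ j\<rfloor> / real n)"

lemma rnd_close: assumes "n > 0" shows "\<bar>rnd n z $ j - z $ j\<bar> \<le> 1 / real n"
proof -
  have "\<bar>real_of_int \<lfloor>real n * z $ j\<rfloor> - real n * z $ j\<bar> \<le> 1" by linarith
  moreover have "rnd n z $ j - z $ j = (real_of_int \<lfloor>real n * z $ j\<rfloor> - real n * z $ j) / real n"
    using assms by (simp add: rnd_def field_simps)
  ultimately show ?thesis using assms by (simp add: abs_divide divide_right_mono)
qed

lemma finite_rnd_image: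
  assumes "\<And>z j. z \<in> Z \<Longrightarrow> \<bar>z $ j\<bar> \<le> M" and n: "n > 0"
  shows "finite (rnd n ` Z)"
proof -
  let ?A = "(\<lambda>k. of_int k / real n) ` {- \<lceil>real n * M\<rceil> - 1 .. \<lceil>real n * M\<rceil> + 1}"
  have "rnd n ` Z \<subseteq> {v. \<forall>j. v $ j \<in> ?A}"
  proof clarify
    fix z j assume "z \<in> Z"
    then have "\<bar>real n * z $ j\<bar> \<le> real n * M" using assms by (simp add: abs_mult)
    then have "\<lfloor>real n * z $ j\<rfloor> \<in> {- \<lceil>real n * M\<rceil> - 1 .. \<lceil>real n * M\<rceil> + 1}" by (auto simp: abs_le_iff) linarith+
    then show "rnd n z $ j \<in> ?A" unfolding rnd_def vec_lambda_beta by (rule imageI)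
  qed
  moreover have "finite {v::real^'a. \<forall>j. v $ j \<in> ?A}" by (rule finite_vec_set) simp
  ultimately show ?thesis using finite_subset by blast
qed

lemma integral_step_fun:
  fixes c :: "'a \<Rightarrow> complex" and V :: "'a \<Rightarrow> real^'d::finite"
  assumes c: "integrable M c" and V: "V \<in> borel_measurable M"
    and fin: "finite P" and P: "\<And>x. c x \<noteq> 0 \<Longrightarrow> V x \<in> P"
  shows "integrable M (\<lambda>x. c x * \<phi> (V x))"
    and "(\<integral>x. c x * \<phi> (V x) \<partial>M) = (\<Sum>p\<in>P. (\<integral>x. indicator (V -` {p} \<inter> space M) x *\<^sub>R c x \<partial>M) * \<phi> p)"
proof -
  have set: "V -` {p} \<inter> space M \<in> sets M" for p using V by (rule measurable_sets) simp
  have int: "integrable M (\<lambda>x. indicator (V -` {p} \<inter> space M) x *\<^sub>R c x)" for p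
    by (rule integrable_mult_indicator[OF set c])
  have eq: "c x * \<phi> (V x) = (\<Sum>p\<in>P. (indicator (V -` {p} \<inter> space M) x *\<^sub>R c x) * \<phi> p)" if "x \<in> space M" for x
  proof (cases "c x = 0")
    case False
    then have "(\<Sum>p\<in>P. (indicator (V -` {p} \<inter> space M) x *\<^sub>R c x) * \<phi> p) = (\<Sum>p\<in>{V x}. (indicator (V -` {p} \<inter> space M) x *\<^sub>R c x) * \<phi> p)"
      using P[of x] by (intro sum.mono_neutral_right fin) auto
    then show ?thesis using that by simp
  qed simp
  have i2: "integrable M (\<lambda>x. \<Sum>p\<in>P. (indicator (V -` {p} \<inter> space M) x *\<^sub>R c x) * \<phi> p)"
    by (intro Bochner_Integration.integrable_sum integrable_mult_left int)
  then show "integrable M (\<lambda>x. c x * \<phi> (V x))"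
    by (subst Bochner_Integration.integrable_cong[OF refl eq]) auto
  have "(\<integral>x. c x * \<phi> (V x) \<partial>M) = (\<integral>x. (\<Sum>p\<in>P. (indicator (V -` {p} \<inter> space M) x *\<^sub>R c x) * \<phi> p) \<partial>M)"
    by (rule Bochner_Integration.integral_cong[OF refl eq])
  also have "\<dots> = (\<Sum>p\<in>P. (\<integral>x. indicator (V -` {p} \<inter> space M) x *\<^sub>R c x \<partial>M) * \<phi> p)"
    by (subst Bochner_Integration.integral_sum)
      (intro integrable_mult_left int sum.cong refl Bochner_Integration.integral_mult_left)+
  finally show "(\<integral>x. c x * \<phi> (V x) \<partial>M) = (\<Sum>p\<in>P. (\<integral>x. indicator (V -` {p} \<inter> space M) x *\<^sub>R c x \<partial>M) * \<phi> p)" .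
qed

text \<open>Rounding the dilation factor turns the integral into a finite sum; the sums converge
  in the space of test functions.\<close>
lemma distr_integral_exchange:
  fixes v :: "real^'d::finite \<Rightarrow> real^'d"
  assumes T: "DH T" and f: "test f" and c: "integrable lborel c" and v [measurable]: "v \<in> borel_measurable borel"
    and \<eta>: "\<eta> > 0" "\<And>x j. c x \<noteq> 0 \<Longrightarrow> \<eta> \<le> \<bar>v x $ j\<bar> \<and> \<bar>v x $ j\<bar> \<le> M"
  shows "T (\<lambda>\<xi>. LINT x|lborel. c x * f (dil \<xi> (v x))) = (LINT x|lborel. c x * MT T f (v x))"
proof -
  obtain R where R: "R > 0" "\<forall>x. x \<notin> cbx R \<longrightarrow> f x = 0" using test_supp[OF f] by blast
  \<comment> \<open>Mesh at most \<open>\<eta> / 2\<close>: rounding cannot turn a coordinate of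
    modulus at least \<open>\<eta>\<close> into 0, so rounded factors stay in
    \<open>Rstar\<close>.\<close>
  obtain n0 :: nat where n0: "2 / \<eta> < real n0" using reals_Archimedean2 by blast
  have n0pos: "n0 > 0" using n0 \<eta>(1) by (metis gr0I less_asym' of_nat_0 zero_less_divide_iff zero_less_numeral)
  define N where "N n = n0 + n" for n
  have Npos: "N n > 0" for n using n0pos by (simp add: N_def)
  have Ninv: "1 / real (N n) \<le> \<eta> / 2" for n
  proof -
    have "2 / \<eta> \<le> real (N n)" using n0 by (simp add: N_def)
    then show ?thesis using \<eta>(1) Npos[of n] by (simp add: field_simps)
  qed
  define V where "V n x = rnd (N n) (v x)" for n x
  have [measurable]: "V n \<in> borel_measurable borel" for n
    unfolding V_def rnd_def by measurable
  define Z where "Z = {z::real^'d. \<forall>j. \<eta>/2 \<le> \<bar>z $ j\<bar> \<and> \<bar>z $ j\<bar> \<le> M + \<eta>}"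
  have VZ: "V n x \<in> Z" if "c x \<noteq> 0" for n x
  proof -
    have "\<eta>/2 \<le> \<bar>V n x $ j\<bar> \<and> \<bar>V n x $ j\<bar> \<le> M + \<eta>" for j
      using rnd_close[OF Npos, of n "v x" j] Ninv[of n] \<eta>(2)[OF that, of j] \<eta>(1) unfolding V_def by linarith
    then show ?thesis by (simp add: Z_def)
  qed
  have vZ: "v x \<in> Z" if "c x \<noteq> 0" for x
    using \<eta>(2)[OF that] \<eta>(1) unfolding Z_def by (smt (verit) field_sum_of_halves mem_Collect_eq)
  have ZR: "z \<in> Rstar" if "z \<in> Z" for z
  proof -
    have "z $ j \<noteq> 0" for j
    proof -
      have "\<eta>/2 \<le> \<bar>z $ j\<bar>" using that unfolding Z_def by blast
      then show ?thesis using \<eta>(1) by auto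
    qed
    then show ?thesis by (simp add: Rstar_def)
  qed
  have cZ: "compact Z"
  proof -
    have "closed Z" unfolding Z_def
      by (intro closed_Collect_all closed_Collect_conj closed_Collect_le continuous_intros)
    moreover have "Z \<subseteq> cbx (M + \<eta>)" by (auto simp: Z_def cbx_def)
    ultimately show ?thesis using compact_cbx compact_imp_bounded bounded_subset compact_eq_bounded_closed by blast
  qed
  define P where "P n = V n ` {x. c x \<noteq> 0}" for n
  have finP: "finite (P n)" for n
    unfolding P_def V_def image_image[symmetric, of "rnd (N n)" v]
    by (rule finite_rnd_image[where M = M, OF _ Npos]) (use \<eta>(2) in blast)
  have PV: "c x \<noteq> 0 \<Longrightarrow> V n x \<in> P n" for n x by (simp add: P_def)
  have PZ: "p \<in> Z" if "p \<in> P n" for p n using that VZ by (auto simp: P_def)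
  define w where "w n p = (LINT x|lborel. indicator (V n -` {p} \<inter> space lborel) x *\<^sub>R c x)" for n p
  have step: "integrable lborel (\<lambda>x. c x * \<phi> (V n x))"
      "(LINT x|lborel. c x * \<phi> (V n x)) = (\<Sum>p\<in>P n. w n p * \<phi> p)" for n and \<phi> :: "real^'d \<Rightarrow> complex"
    unfolding w_def by (rule integral_step_fun[OF c _ finP PV]; simp)+
  define s where "s n = (\<lambda>\<xi>. \<Sum>p\<in>P n. w n p * fdil p f \<xi>)" for n
  have tp: "test (fdil p f)" if "p \<in> P n" for p n by (rule test_fdil[OF f ZR[OF PZ[OF that]]])
  have s1: "test (s n)" "T (s n) = (\<Sum>p\<in>P n. w n p * T (fdil p f))" for n
    using distr_sum[where I = "P n" and g = "\<lambda>p. fdil p f" and a = "w n", OF DH_distr[OF T] tp] unfolding s_def by auto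
  have dls: "dl js (s n) \<xi> = (LINT x|lborel. c x * dl js (fdil (V n x) f) \<xi>)" for js n \<xi>
    using dl_sum[of "P n" "\<lambda>p. fdil p f" "w n" js] test_smooth[OF tp] step(2)[where n = n and \<phi> = "\<lambda>p. dl js (fdil p f) \<xi>"]
    unfolding s_def by simp
  \<comment> \<open>Factors of modulus at least \<open>\<eta> / 2\<close> confine the supports of
    all dilated copies of \<open>f\<close> to this one cube.\<close>
  define R' where "R' = 2 * R / \<eta>"
  have fz: "fdil z f \<xi> = 0" if z: "z \<in> Z" and \<xi>: "\<xi> \<notin> cbx R'" for z \<xi>
  proof -
    obtain i where i: "\<bar>\<xi> $ i\<bar> > R'" using \<xi> by (auto simp: cbx_def not_le)
    have "R = R' * (\<eta>/2)" using \<eta>(1) by (simp add: R'_def)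
    also have "\<dots> < \<bar>\<xi> $ i\<bar> * (\<eta>/2)" using i \<eta>(1) by simp
    also have "\<dots> \<le> \<bar>\<xi> $ i\<bar> * \<bar>z $ i\<bar>" using z by (intro mult_left_mono) (auto simp: Z_def)
    finally have "dil \<xi> z \<notin> cbx R" by (auto simp: cbx_def abs_mult not_le intro!: exI[of _ i])
    then show ?thesis using R by (simp add: fdil_def)
  qed
  have dfz: "dl js (fdil z f) \<xi> = 0" if "z \<in> Z" "\<xi> \<notin> cbx R'" for z \<xi> js
    by (rule dl_zero_outside[OF closed_cbx fz[OF that(1)] that(2)])
  have DKs: "DK (cbx R') (s n)" for n
    unfolding DK_def using s1(1) fz[OF PZ] by (auto simp: s_def)
  have contA: "continuous_on UNIV (\<lambda>(\<xi>, z). dl js (fdil z f) \<xi>)" for js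
  proof -
    have p: "continuous_on UNIV (\<lambda>q::(real^'d) \<times> (real^'d). complex_of_real (prod_list (map (\<lambda>j. snd q $ j) js)))"
      by (induction js) (auto intro!: continuous_intros)
    show ?thesis unfolding dl_fdil[OF test_smooth[OF f]] case_prod_beta
      by (intro continuous_on_mult p smooth_cont_compose smooth_dl test_smooth f continuous_intros)
  qed
  \<comment> \<open>Uniform continuity on a compact set of pairs; as all derivatives vanish for
    \<open>\<xi>\<close> outside \<open>cbx R'\<close>, the estimate holds for every
    \<open>\<xi>\<close>.\<close>
  have unifA: "\<exists>d>0. \<forall>z\<in>Z. \<forall>z'\<in>Z. dist z z' < d \<longrightarrow> (\<forall>\<xi>. cmod (dl js (fdil z f) \<xi> - dl js (fdil z' f) \<xi>) \<le> e)" if e: "e > 0" for e js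
  proof -
    have "uniformly_continuous_on (cbx R' \<times> Z) (\<lambda>(\<xi>, z). dl js (fdil z f) \<xi>)"
      by (intro compact_uniformly_continuous continuous_on_subset[OF contA] compact_Times compact_cbx cZ) auto
    then obtain d where d: "d > 0" "\<And>q q'. q \<in> cbx R' \<times> Z \<Longrightarrow> q' \<in> cbx R' \<times> Z \<Longrightarrow> dist q' q < d \<Longrightarrow>
        dist ((\<lambda>(\<xi>, z). dl js (fdil z f) \<xi>) q') ((\<lambda>(\<xi>, z). dl js (fdil z f) \<xi>) q) < e"
      using e unfolding uniformly_continuous_on_def by meson
    have "cmod (dl js (fdil z f) \<xi> - dl js (fdil z' f) \<xi>) \<le> e" if "z \<in> Z" "z' \<in> Z" "dist z z' < d" for z z' \<xi>
    proof (cases "\<xi> \<in> cbx R'")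
      case True
      then show ?thesis using d(2)[of "(\<xi>, z')" "(\<xi>, z)"] that by (simp add: dist_Pair_Pair dist_norm less_imp_le)
    next
      case False then show ?thesis using dfz that e by simp
    qed
    then show ?thesis using d(1) by blast
  qed
  have Vd: "dist (V n x) (v x) \<le> real CARD('d) / real (N n)" for n x
  proof -
    have "norm (V n x - v x) \<le> (\<Sum>j\<in>UNIV. \<bar>(V n x - v x) $ j\<bar>)" by (rule norm_le_l1_cart)
    also have "\<dots> \<le> (\<Sum>j\<in>(UNIV::'d set). 1 / real (N n))"
      by (intro sum_mono) (simp add: V_def rnd_close[OF Npos])
    finally show ?thesis by (simp add: dist_norm)
  qed
  have Vlim0: "(\<lambda>n. real CARD('d) / real (N n)) \<longlonglongrightarrow> 0"
  proof -
    have "(\<lambda>n. real CARD('d) * (1 / real (n + n0))) \<longlonglongrightarrow> real CARD('d) * 0"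
      by (intro tendsto_mult tendsto_const LIMSEQ_ignore_initial_segment[OF lim_inverse_n'])
    then show ?thesis by (simp add: N_def add.commute)
  qed
  have Vlim: "(\<lambda>n. V n x) \<longlonglongrightarrow> v x" for x
    by (rule metric_tendsto_imp_tendsto[OF Vlim0]) (use Vd in \<open>auto intro!: always_eventually\<close>)
  define Cc where "Cc = (LINT x|lborel. cmod (c x))"
  have Cc: "Cc \<ge> 0" by (simp add: Cc_def)
  have cauchy: "uniformly_Cauchy_on UNIV (\<lambda>n. dl js (s n))" for js
  proof (rule uniformly_Cauchy_onI)
    fix e :: real assume e: "e > 0"
    define e' where "e' = e / (2 * (Cc + 1))"
    have e': "e' > 0" using e Cc by (simp add: e'_def)
    obtain d where d: "d > 0" "\<And>z z' \<xi>. z \<in> Z \<Longrightarrow> z' \<in> Z \<Longrightarrow> dist z z' < d \<Longrightarrow> cmod (dl js (fdil z f) \<xi> - dl js (fdil z' f) \<xi>) \<le> e'"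
      using unifA[OF e', of js] by blast
    obtain n1 where n1: "\<And>n. n \<ge> n1 \<Longrightarrow> real CARD('d) / real (N n) < d / 2"
      using order_tendstoD(2)[OF Vlim0, of "d/2"] d(1) by (auto simp: eventually_sequentially)
    have "dist (dl js (s m) \<xi>) (dl js (s n) \<xi>) < e" if mn: "m \<ge> n1" "n \<ge> n1" for m n \<xi>
    proof -
      have i: "integrable lborel (\<lambda>x. c x * dl js (fdil (V k x) f) \<xi>)" for k
        using step(1)[where \<phi> = "\<lambda>p. dl js (fdil p f) \<xi>"] .
      have "dl js (s m) \<xi> - dl js (s n) \<xi> = (LINT x|lborel. c x * dl js (fdil (V m x) f) \<xi> - c x * dl js (fdil (V n x) f) \<xi>)"
        unfolding dls by (rule Bochner_Integration.integral_diff[symmetric]) (rule i)+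
      also have "cmod \<dots> \<le> (LINT x|lborel. e' * cmod (c x))"
      proof (rule Bochner_Integration.integral_norm_bound_integral)
        show "integrable lborel (\<lambda>x. c x * dl js (fdil (V m x) f) \<xi> - c x * dl js (fdil (V n x) f) \<xi>)"
          by (intro Bochner_Integration.integrable_diff i)
        show "integrable lborel (\<lambda>x. e' * cmod (c x))" using c by (intro integrable_mult_right integrable_norm)
        fix x
        show "norm (c x * dl js (fdil (V m x) f) \<xi> - c x * dl js (fdil (V n x) f) \<xi>) \<le> e' * cmod (c x)"
        proof (cases "c x = 0")
          case False
          have "dist (V m x) (V n x) < d"
            using Vd[of m x] Vd[of n x] n1[OF mn(1)] n1[OF mn(2)] dist_triangle2[of "V m x" "V n x" "v x"] by linarith
          then have "cmod (dl js (fdil (V m x) f) \<xi> - dl js (fdil (V n x) f) \<xi>) \<le> e'"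
            using d(2) VZ[OF False] by blast
          then have "cmod (c x) * cmod (dl js (fdil (V m x) f) \<xi> - dl js (fdil (V n x) f) \<xi>) \<le> cmod (c x) * e'"
            by (intro mult_left_mono) auto
          then show ?thesis by (simp add: norm_mult[symmetric] right_diff_distrib mult.commute[of e'])
        qed simp
      qed
      also have "\<dots> = e' * Cc" by (simp add: Cc_def)
      also have "\<dots> < e"
      proof -
        have "e' * Cc \<le> e' * (Cc + 1)" using e' by simp
        also have "\<dots> = e / 2" using Cc by (simp add: e'_def field_simps)
        also have "\<dots> < e" using e by simp
        finally show ?thesis .
      qed
      finally show ?thesis by (simp add: dist_norm)
    qed
    then show "\<exists>M. \<forall>\<xi>\<in>UNIV. \<forall>m\<ge>M. \<forall>n\<ge>M. dist (dl js (s m) \<xi>) (dl js (s n) \<xi>) < e" by blast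
  qed
  have bR': "bounded (cbx R' :: (real^'d) set)" by (rule compact_imp_bounded[OF compact_cbx])
  obtain S where S: "DK (cbx R') S" "\<And>js. uniform_limit UNIV (\<lambda>n. dl js (s n)) (dl js S) sequentially"
    using DK_complete_dl[OF bR' DKs cauchy] by blast
  have T1: "(\<lambda>n. T (s n)) \<longlonglongrightarrow> T S"
    by (rule seq_cont_lin_conv[OF distr_seq_cont_lin[OF DH_distr[OF T] bR'] DKs S])
  \<comment> \<open>Needed twice: for \<open>f\<close> at dilated arguments, which identifies the
    limit \<open>S\<close>, and for \<open>MT T f\<close>, which gives the right-hand side.\<close>
  have domlim: "(\<lambda>n. LINT x|lborel. c x * g (V n x)) \<longlonglongrightarrow> (LINT x|lborel. c x * g (v x))"
    if g: "continuous_on UNIV g" and B: "\<And>z. cmod (g z) \<le> B" for g :: "real^'d \<Rightarrow> complex" and B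
  proof (rule integral_dominated_convergence[where w = "\<lambda>x. B * cmod (c x)"])
    have [measurable]: "c \<in> borel_measurable borel" using borel_measurable_integrable[OF c] by simp
    have [measurable]: "g \<in> borel_measurable borel" by (rule borel_measurable_continuous_onI[OF g])
    show "(\<lambda>x. c x * g (v x)) \<in> borel_measurable lborel" "(\<lambda>x. c x * g (V n x)) \<in> borel_measurable lborel" for n
      by measurable
    show "integrable lborel (\<lambda>x. B * cmod (c x))" using c by (intro integrable_mult_right integrable_norm)
    show "AE x in lborel. (\<lambda>n. c x * g (V n x)) \<longlonglongrightarrow> c x * g (v x)"
      by (intro always_eventually allI tendsto_mult tendsto_const continuous_on_tendsto_compose[OF g Vlim]) auto
    show "AE x in lborel. norm (c x * g (V n x)) \<le> B * cmod (c x)" for n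
      using B by (intro always_eventually allI) (simp add: norm_mult mult.commute[of B] mult_left_mono)
  qed
  have "S \<xi> = (LINT x|lborel. c x * f (dil \<xi> (v x)))" for \<xi>
  proof -
    have "(\<lambda>n. dl [] (s n) \<xi>) \<longlonglongrightarrow> dl [] S \<xi>" by (rule tendsto_uniform_limitI[OF S(2)]) simp
    then have "(\<lambda>n. LINT x|lborel. c x * f (dil \<xi> (V n x))) \<longlonglongrightarrow> S \<xi>" unfolding dls by (simp add: fdil_def)
    moreover obtain B where "\<And>x. cmod (f x) \<le> B" using test_bounded[OF f] by blast
    then have "(\<lambda>n. LINT x|lborel. c x * f (dil \<xi> (V n x))) \<longlonglongrightarrow> (LINT x|lborel. c x * f (dil \<xi> (v x)))"
      by (intro domlim[where B = B] smooth_cont_compose test_smooth f continuous_intros) auto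
    ultimately show ?thesis using LIMSEQ_unique by blast
  qed
  then have Seq: "S = (\<lambda>\<xi>. LINT x|lborel. c x * f (dil \<xi> (v x)))" by blast
  obtain B where "\<And>x. cmod (MT T f x) \<le> B" using test_bounded[OF MT_spec(1)[OF T f]] by blast
  then have "(\<lambda>n. LINT x|lborel. c x * MT T f (V n x)) \<longlonglongrightarrow> (LINT x|lborel. c x * MT T f (v x))"
    by (intro domlim[where B = B] test_cont MT_spec T f) auto
  moreover have "(LINT x|lborel. c x * MT T f (V n x)) = T (s n)" for n
    unfolding step(2) s1(2) by (intro sum.cong refl) (simp add: MT_spec(2)[OF T f ZR[OF PZ]])
  ultimately have "(\<lambda>n. T (s n)) \<longlonglongrightarrow> (LINT x|lborel. c x * MT T f (v x))" by simp
  then show ?thesis using T1 LIMSEQ_unique unfolding Seq by blast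
qed

section \<open>Change of variables by dilation and inversion\<close>

lemma lborel_dil:
  fixes g :: "real^'d::finite \<Rightarrow> 'b::{banach, second_countable_topology}"
  assumes y: "y \<in> Rstar" and g [measurable]: "g \<in> borel_measurable borel"
  shows "(LINT x|lborel. g x) = (\<Prod>j\<in>UNIV. \<bar>y $ j\<bar>) *\<^sub>R (LINT x|lborel. g (dil x y))"
    and "integrable lborel g \<Longrightarrow> integrable lborel (\<lambda>x. g (dil x y))"
proof -
  have [measurable]: "(\<lambda>x. dil x y) \<in> borel_measurable borel" unfolding dil_def by measurable
  have bas: "(Basis :: (real^'d) set) = (\<lambda>i. axis i 1) ` UNIV" by (auto simp: Basis_vec_def)
  have inj: "inj (\<lambda>i::'d. axis i (1::real))" by (auto intro!: injI simp: axis_eq_axis)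
  have dileq: "0 + (\<Sum>j\<in>Basis. ((y \<bullet> j) * (x \<bullet> j)) *\<^sub>R j) = dil x y" for x
    unfolding bas by (subst sum.reindex[OF inj]) (simp add: vec_eq_iff inner_axis axis_nth_if if_distrib cong: if_cong)
  have prodeq: "(\<Prod>j\<in>(Basis::(real^'d) set). \<bar>y \<bullet> j\<bar>) = (\<Prod>j\<in>UNIV. \<bar>y $ j\<bar>)"
    unfolding bas by (subst prod.reindex[OF inj]) (simp add: inner_axis)
  have lb: "lborel = density (Measure_Space.distr lborel borel (\<lambda>x. dil x y)) (\<lambda>_. ennreal (\<Prod>j\<in>UNIV. \<bar>y $ j\<bar>))"
  proof -
    have nz: "y \<bullet> b \<noteq> 0" if "b \<in> Basis" for b using that y by (auto simp: bas inner_axis Rstar_def)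
    show ?thesis using lborel_affine_euclidean[of "\<lambda>j. y \<bullet> j" 0, OF nz] unfolding dileq prodeq by simp
  qed
  have nn: "0 \<le> (\<Prod>j\<in>UNIV. \<bar>y $ j\<bar>)" by (simp add: prod_nonneg)
  have "(LINT x|lborel. g x) = (LINT x|density (Measure_Space.distr lborel borel (\<lambda>x. dil x y)) (\<lambda>_. ennreal (\<Prod>j\<in>UNIV. \<bar>y $ j\<bar>)). g x)"
    using lb by simp
  also have "\<dots> = (LINT x|Measure_Space.distr lborel borel (\<lambda>x. dil x y). (\<Prod>j\<in>UNIV. \<bar>y $ j\<bar>) *\<^sub>R g x)"
    by (rule integral_density) (use nn in auto)
  also have "\<dots> = (LINT x|lborel. (\<Prod>j\<in>UNIV. \<bar>y $ j\<bar>) *\<^sub>R g (dil x y))"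
    by (rule integral_distr) auto
  finally show "(LINT x|lborel. g x) = (\<Prod>j\<in>UNIV. \<bar>y $ j\<bar>) *\<^sub>R (LINT x|lborel. g (dil x y))"
    by simp
  assume "integrable lborel g"
  then have "integrable (density (Measure_Space.distr lborel borel (\<lambda>x. dil x y)) (\<lambda>_. ennreal (\<Prod>j\<in>UNIV. \<bar>y $ j\<bar>))) g"
    using lb by simp
  then have "integrable (Measure_Space.distr lborel borel (\<lambda>x. dil x y)) (\<lambda>x. (\<Prod>j\<in>UNIV. \<bar>y $ j\<bar>) *\<^sub>R g x)"
    using nn by (subst (asm) integrable_density) auto
  then have "integrable lborel (\<lambda>x. (\<Prod>j\<in>UNIV. \<bar>y $ j\<bar>) *\<^sub>R g (dil x y))"
    by (subst (asm) integrable_distr_eq) auto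
  then have "integrable lborel (\<lambda>x. (1 / (\<Prod>j\<in>UNIV. \<bar>y $ j\<bar>)) *\<^sub>R ((\<Prod>j\<in>UNIV. \<bar>y $ j\<bar>) *\<^sub>R g (dil x y)))"
    by (rule integrable_scaleR_right)
  moreover have "(\<Prod>j\<in>UNIV. \<bar>y $ j\<bar>) \<noteq> 0" using y by (simp add: Rstar_def)
  ultimately show "integrable lborel (\<lambda>x. g (dil x y))"
    unfolding scaleR_scaleR by (simp del: prod_zero_iff)
qed

text \<open>A zero coordinate is excluded because 1 / 0 = 0 lies below 1/2.\<close>

lemma half_box_ivec:
  assumes "ivec x \<in> half_box" shows "1 \<le> x $ j" "x $ j \<le> 2"
proof -
  have "1/2 \<le> 1 / x $ j" "1 / x $ j \<le> 1" using assms by (auto simp: half_box_def)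
  moreover from this have "x $ j > 0" by (smt (verit) divide_pos_pos zero_less_divide_iff)
  ultimately show "1 \<le> x $ j" "x $ j \<le> 2" by (simp_all add: field_simps)
qed

lemma ivec_half_box: assumes "\<And>j. 1 \<le> x $ j \<and> x $ j \<le> 2" shows "ivec x \<in> half_box"
proof -
  have "1/2 \<le> 1 / x $ j \<and> 1 / x $ j \<le> 1" for j
    using assms[of j] by (auto simp: field_simps)
  then show ?thesis by (simp add: half_box_def)
qed

lemma prod_ge_power:
  fixes x :: "real^'d::finite"
  assumes "a \<ge> 0" "\<And>j. a \<le> \<bar>x $ j\<bar>" shows "a ^ CARD('d) \<le> (\<Prod>j\<in>UNIV. \<bar>x $ j\<bar>)"
proof -
  have "(\<Prod>j\<in>(UNIV::'d set). a) \<le> (\<Prod>j\<in>UNIV. \<bar>x $ j\<bar>)" by (rule prod_mono) (use assms in auto)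
  then show ?thesis by simp
qed

text \<open>If all \<open>|\<xi> $ j|\<close> exceed \<open>\<delta>\<close>, then
  \<open>|\<xi> $ j / x $ j|\<close> exceeds 1, where \<open>\<Psi>\<close> vanishes; so
  \<open>T\<close> does not see the dilated function. This yields the support condition for the
  representing functions.\<close>

lemma MT_ivec_zero:
  assumes T: "DH T" and Z: "\<And>f. test f \<Longrightarrow> (\<And>x. (\<forall>j. \<bar>x $ j\<bar> > \<delta>) \<Longrightarrow> f x = 0) \<Longrightarrow> T f = 0"
    and \<Psi>: "DK half_box \<Psi>" and x: "x \<in> Rstar" "\<bar>x $ j\<bar> \<le> \<delta>"
  shows "MT T \<Psi> (ivec x) = 0"
proof -
  have "T (fdil (ivec x) \<Psi>) = 0"
  proof (rule Z[OF test_fdil[OF DK_test[OF \<Psi>] ivec_Rstar[OF x(1)]]])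
    fix \<xi> :: "real^'a" assume \<xi>: "\<forall>j. \<bar>\<xi> $ j\<bar> > \<delta>"
    have xj: "x $ j \<noteq> 0" using x(1) by (simp add: Rstar_def)
    have "\<bar>\<xi> $ j / x $ j\<bar> > 1"
      using \<xi>[rule_format, of j] x(2) xj by (simp add: abs_divide)
    then have "dil \<xi> (ivec x) \<notin> half_box" unfolding half_box_def by (auto intro!: exI[of _ j])
    then show "fdil (ivec x) \<Psi> \<xi> = 0" using \<Psi> by (simp add: DK_def fdil_def)
  qed
  then show ?thesis using MT_spec(2)[OF T DK_test[OF \<Psi>] ivec_Rstar[OF x(1)]] by simp
qed

text \<open>Write \<open>MT T h x\<close> as \<open>T\<close> acting on
  \<open>\<xi> \<mapsto> h (dil \<xi> x)\<close>, exchange \<open>T\<close> with the integral,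
  substitute \<open>z = dil \<xi> x\<close>, and exchange back: \<open>T\<close> now acts on
  \<open>\<Psi> (dil \<xi> (ivec z))\<close>, which gives
  \<open>MT T \<Psi> (ivec z)\<close>.\<close>

lemma MT_duality:
  fixes T :: "'d::finite distr"
  assumes T: "DH T" and \<delta>: "\<delta> > 0"
    and Z: "\<And>f. test f \<Longrightarrow> (\<And>x. (\<forall>j. \<bar>x $ j\<bar> > \<delta>) \<Longrightarrow> f x = 0) \<Longrightarrow> T f = 0"
    and \<Psi>: "DK half_box \<Psi>" and h: "test h"
  shows "(LINT x|lborel. \<Psi> (ivec x) / complex_of_real (\<Prod>j\<in>UNIV. x $ j) * MT T h x) =
    (LINT x|lborel. MT T \<Psi> (ivec x) / complex_of_real (\<Prod>j\<in>UNIV. \<bar>x $ j\<bar>) * h x)"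
proof -
  obtain X where X: "smooth_real X" "\<And>s. \<bar>s\<bar> \<le> \<delta>/2 \<Longrightarrow> X s = 0" "\<And>s. \<bar>s\<bar> \<ge> \<delta> \<Longrightarrow> X s = 1"
    using cutoff_exists[OF \<delta>] by blast
  \<comment> \<open>The second exchange needs dilation factors \<open>ivec z\<close> that remain
    bounded, so \<open>h\<close> is replaced by a function vanishing near the hyperplanes.
    \<open>T\<close> cannot see the change.\<close>
  define h' where "h' = (\<lambda>x. (\<Prod>j\<in>UNIV. complex_of_real (X (x $ j))) * h x)"
  have th': "test h'" unfolding h'_def by (intro test_mult smooth_prod smooth_coordfun X h)
  have h'eq: "h' x = h x" if "\<And>j. \<bar>x $ j\<bar> \<ge> \<delta>" for x using X(3)[OF that] by (simp add: h'_def)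
  have h'big: "\<bar>x $ j\<bar> \<ge> \<delta>/2" if "h' x \<noteq> 0" for x j
  proof (rule ccontr)
    assume "\<not> \<bar>x $ j\<bar> \<ge> \<delta>/2"
    then have "X (x $ j) = 0" using X(2)[of "x $ j"] by simp
    then have "(\<Prod>j\<in>UNIV. complex_of_real (X (x $ j))) = 0" by (intro prod_zero) auto
    then show False using that by (simp add: h'_def)
  qed
  define E where "E x = \<Psi> (ivec x) / complex_of_real (\<Prod>j\<in>UNIV. x $ j)" for x
  have E_nz: "1 \<le> x $ j \<and> x $ j \<le> 2" if "E x \<noteq> 0" for x j
  proof -
    have "ivec x \<in> half_box" using that \<Psi> by (auto simp: E_def DK_def)
    then show ?thesis using half_box_ivec[of x j] by blast
  qed
  have [measurable]: "\<Psi> \<in> borel_measurable borel" by (rule test_measurable[OF DK_test[OF \<Psi>]])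
  have [measurable]: "h' \<in> borel_measurable borel" by (rule test_measurable[OF th'])
  have bcbx: "bounded (cbx R :: (real^'d) set)" for R by (rule compact_imp_bounded[OF compact_cbx])
  obtain B where B: "B \<ge> 0" "\<And>x. cmod (\<Psi> x) \<le> B" using test_bounded[OF DK_test[OF \<Psi>]] by blast
  obtain B' where B': "B' \<ge> 0" "\<And>x. cmod (h' x) \<le> B'" using test_bounded[OF th'] by blast
  have iE: "integrable lborel E"
  proof (rule integrable_bounded_support[OF _ _ bcbx[of 2]])
    show "E \<in> borel_measurable borel" unfolding E_def[abs_def] by measurable
    show "cmod (E x) \<le> B" for x
    proof (cases "E x = 0")
      case False
      have "(\<Prod>j\<in>UNIV. \<bar>x $ j\<bar>) \<ge> 1 ^ CARD('d)"
        by (rule prod_ge_power) (use E_nz[OF False] in \<open>auto intro: order_trans[OF _ abs_ge_self]\<close>)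
      then have "1 \<le> \<bar>\<Prod>j\<in>UNIV. x $ j\<bar>" by (simp add: abs_prod)
      then have "cmod (\<Psi> (ivec x)) / \<bar>\<Prod>j\<in>UNIV. x $ j\<bar> \<le> B / 1"
        by (intro frac_le B) auto
      then show ?thesis unfolding E_def norm_divide norm_of_real by simp
    qed (use B in simp)
    show "E x = 0" if "x \<notin> cbx 2" for x
    proof (rule ccontr)
      assume "E x \<noteq> 0"
      then have "\<bar>x $ j\<bar> \<le> 2" for j using E_nz[of x j] by simp
      then show False using that by (simp add: cbx_def)
    qed
  qed
  \<comment> \<open>Coordinates of \<open>y\<close> are at least 1 and push points outward, so
    \<open>h\<close> and \<open>h'\<close> agree at \<open>dil \<xi> y\<close> whenever all
    \<open>|\<xi> $ j|\<close> exceed \<open>\<delta>\<close>.\<close>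
  have s1: "MT T h y = MT T h' y" if y: "\<And>j. 1 \<le> y $ j" for y
  proof -
    have "y $ j \<noteq> 0" for j using y[of j] by linarith
    then have yR: "y \<in> Rstar" by (simp add: Rstar_def)
    note t = test_fdil[OF h yR] test_fdil[OF th' yR]
    have "T (\<lambda>\<xi>. fdil y h \<xi> - fdil y h' \<xi>) = 0"
    proof (rule Z[OF test_diff[OF t]])
      fix \<xi> :: "real^'d" assume \<xi>: "\<forall>j. \<bar>\<xi> $ j\<bar> > \<delta>"
      have "\<bar>dil \<xi> y $ j\<bar> \<ge> \<delta>" for j
      proof -
        have "\<delta> * 1 \<le> \<bar>\<xi> $ j\<bar> * \<bar>y $ j\<bar>" using \<xi> y[of j] \<delta> by (intro mult_mono) (auto intro: less_imp_le)
        then show ?thesis by (simp add: abs_mult)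
      qed
      then show "fdil y h \<xi> - fdil y h' \<xi> = 0" using h'eq by (simp add: fdil_def)
    qed
    then show ?thesis using distr_diff[OF DH_distr[OF T] t] MT_spec(2)[OF T h yR] MT_spec(2)[OF T th' yR] by simp
  qed
  define c where "c z = h' z / complex_of_real (\<Prod>j\<in>UNIV. \<bar>z $ j\<bar>)" for z
  obtain R where R: "R > 0" "\<And>x. x \<notin> cbx R \<Longrightarrow> h' x = 0" using test_supp[OF th'] by blast
  have cR: "\<bar>z $ j\<bar> \<le> R" if "c z \<noteq> 0" for z j
    using that R(2)[of z] by (auto simp: c_def cbx_def)
  have c\<delta>: "\<delta>/2 \<le> \<bar>z $ j\<bar>" if "c z \<noteq> 0" for z j
    using that h'big by (auto simp: c_def)
  have ic: "integrable lborel c"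
  proof (rule integrable_bounded_support[OF _ _ bcbx[of R]])
    show "c \<in> borel_measurable borel" unfolding c_def[abs_def] by measurable
    show "cmod (c x) \<le> B' / (\<delta>/2) ^ CARD('d)" for x
    proof (cases "c x = 0")
      case False
      have "(\<Prod>j\<in>UNIV. \<bar>x $ j\<bar>) \<ge> (\<delta>/2) ^ CARD('d)"
        by (rule prod_ge_power) (use c\<delta>[OF False] \<delta> in auto)
      then have "cmod (h' x) / \<bar>\<Prod>j\<in>UNIV. \<bar>x $ j\<bar>\<bar> \<le> B' / (\<delta>/2) ^ CARD('d)"
        using \<delta> by (intro frac_le B') auto
      then show ?thesis unfolding c_def norm_divide norm_of_real .
    qed (use B' \<delta> in simp)
    show "c x = 0" if "x \<notin> cbx R" for x using R(2)[OF that] by (simp add: c_def)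
  qed
  \<comment> \<open>Where \<open>\<Psi> (ivec x)\<close> is nonzero, all coordinates of
    \<open>x\<close> are positive; hence the product in \<open>E\<close> is that of the
    \<open>|z $ j|\<close> divided by that of the \<open>|\<xi> $ j|\<close>, and the Jacobian
    cancels.\<close>
  have s3: "(LINT x|lborel. E x * h' (dil \<xi> x)) = (LINT z|lborel. c z * \<Psi> (dil \<xi> (ivec z)))" for \<xi>
  proof (cases "\<xi> \<in> Rstar")
    case True
    let ?g = "\<lambda>z. c z * \<Psi> (dil \<xi> (ivec z))"
    have [measurable]: "(\<lambda>z. dil \<xi> (ivec z)) \<in> borel_measurable borel" unfolding dil_def ivec_def by measurable
    have [measurable]: "c \<in> borel_measurable borel" using borel_measurable_integrable[OF ic] by simp
    have gm: "?g \<in> borel_measurable borel" by measurable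
    have p0: "(\<Prod>j\<in>UNIV. \<bar>\<xi> $ j\<bar>) \<noteq> 0" using True by (simp add: Rstar_def)
    have "(LINT z|lborel. ?g z) = complex_of_real (\<Prod>j\<in>UNIV. \<bar>\<xi> $ j\<bar>) * (LINT x|lborel. ?g (dil x \<xi>))"
      using lborel_dil(1)[OF True gm] by (simp only: scaleR_conv_of_real)
    also have "\<dots> = (LINT x|lborel. complex_of_real (\<Prod>j\<in>UNIV. \<bar>\<xi> $ j\<bar>) * ?g (dil x \<xi>))" by simp
    also have "(\<lambda>x. complex_of_real (\<Prod>j\<in>UNIV. \<bar>\<xi> $ j\<bar>) * ?g (dil x \<xi>)) = (\<lambda>x. E x * h' (dil \<xi> x))"
    proof
      fix x
      have eq: "dil \<xi> (ivec (dil x \<xi>)) = ivec x" using True by (auto simp: vec_eq_iff Rstar_def)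
      show "complex_of_real (\<Prod>j\<in>UNIV. \<bar>\<xi> $ j\<bar>) * ?g (dil x \<xi>) = E x * h' (dil \<xi> x)"
      proof (cases "E x = 0 \<and> \<Psi> (ivec x) = 0")
        case True then show ?thesis unfolding eq by simp
      next
        case False
        then have iv: "ivec x \<in> half_box" using \<Psi> by (auto simp: E_def DK_def)
        have "\<bar>x $ j\<bar> = x $ j" for j using half_box_ivec(1)[OF iv, of j] by simp
        then have "(\<Prod>j\<in>UNIV. \<bar>dil x \<xi> $ j\<bar>) = (\<Prod>j\<in>UNIV. x $ j) * (\<Prod>j\<in>UNIV. \<bar>\<xi> $ j\<bar>)"
          by (simp add: abs_mult prod.distrib)
        then have ceq: "c (dil x \<xi>) = h' (dil \<xi> x) / (complex_of_real (\<Prod>j\<in>UNIV. x $ j) * complex_of_real (\<Prod>j\<in>UNIV. \<bar>\<xi> $ j\<bar>))"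
          unfolding c_def dil_commute[of \<xi> x] by (simp only: of_real_mult)
        have alg: "p * (a / (q * p) * b) = b / q * a" if "p \<noteq> 0" for p a q b :: complex
          using that by simp
        show ?thesis unfolding eq ceq E_def by (rule alg) (use p0 of_real_eq_0_iff in blast)
      qed
    qed
    finally show ?thesis by simp
  next
    case False
    \<comment> \<open>Both integrands vanish identically: \<open>h'\<close> on the hyperplane,
      \<open>\<Psi>\<close> outside \<open>half_box\<close>.\<close>
    then obtain j where j: "\<xi> $ j = 0" by (auto simp: Rstar_def)
    have "h' (dil \<xi> x) = 0" for x using h'big[of "dil \<xi> x" j] j \<delta> by auto
    moreover have "dil \<xi> (ivec z) \<notin> half_box" for z unfolding half_box_def using j by (auto intro!: exI[of _ j])
    then have "\<Psi> (dil \<xi> (ivec z)) = 0" for z using \<Psi> by (simp add: DK_def)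
    ultimately show ?thesis by simp
  qed
  have "(LINT x|lborel. E x * MT T h x) = (LINT x|lborel. E x * MT T h' x)"
  proof (rule Bochner_Integration.integral_cong[OF refl])
    fix x show "E x * MT T h x = E x * MT T h' x"
      by (cases "E x = 0") (use s1 E_nz in auto)
  qed
  also have "\<dots> = T (\<lambda>\<xi>. LINT x|lborel. E x * h' (dil \<xi> x))"
  proof (rule distr_integral_exchange[OF T th' iE, where v = "\<lambda>x. x" and \<eta> = 1 and M = 2, symmetric])
    show "1 \<le> \<bar>x $ j\<bar> \<and> \<bar>x $ j\<bar> \<le> 2" if "E x \<noteq> 0" for x j
      using E_nz[OF that, of j] by simp
  qed simp_all
  also have "\<dots> = T (\<lambda>\<xi>. LINT z|lborel. c z * \<Psi> (dil \<xi> (ivec z)))" unfolding s3 ..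
  also have "\<dots> = (LINT z|lborel. c z * MT T \<Psi> (ivec z))"
  proof (rule distr_integral_exchange[OF T DK_test[OF \<Psi>] ic, where \<eta> = "1 / R" and M = "2 / \<delta>"])
    fix x j assume cx: "c x \<noteq> 0"
    have "0 < \<bar>x $ j\<bar>" using c\<delta>[OF cx, of j] \<delta> by linarith
    then show "1 / R \<le> \<bar>ivec x $ j\<bar> \<and> \<bar>ivec x $ j\<bar> \<le> 2 / \<delta>"
      using cR[OF cx, of j] c\<delta>[OF cx, of j] \<delta> R(1) by (auto simp: abs_divide field_simps)
  qed (use R in auto)
  also have "\<dots> = (LINT x|lborel. MT T \<Psi> (ivec x) / complex_of_real (\<Prod>j\<in>UNIV. \<bar>x $ j\<bar>) * h x)"
  proof (rule Bochner_Integration.integral_cong[OF refl])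
    fix x
    show "c x * MT T \<Psi> (ivec x) = MT T \<Psi> (ivec x) / complex_of_real (\<Prod>j\<in>UNIV. \<bar>x $ j\<bar>) * h x"
    proof (cases "\<forall>j. \<bar>x $ j\<bar> \<ge> \<delta>")
      case True then show ?thesis by (simp add: c_def h'eq)
    next
      case False
      then obtain j where j: "\<bar>x $ j\<bar> \<le> \<delta>" by (meson less_imp_le not_le)
      show ?thesis
      proof (cases "x \<in> Rstar")
        case True then show ?thesis using MT_ivec_zero[OF T Z \<Psi> True j] by simp
      next
        case False
        \<comment> \<open>On the hyperplanes both sides are 0, because division by 0 yields
          0.\<close>
        then have "(\<Prod>j\<in>UNIV. \<bar>x $ j\<bar>) = 0" by (simp add: Rstar_def)
        then show ?thesis by (simp only: c_def of_real_0 div_by_0 mult_zero_left)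
      qed
    qed
  qed
  finally show ?thesis unfolding E_def .
qed

subsection \<open>A multiplicative parametrix\<close>

text \<open>Read in the variable \<open>s = 1/x\<close>, these factors switch off
  \<open>x > 2\<close>. The class is stable under differentiation and under division by
  \<open>s\<close>, the two operations that integration by parts produces.\<close>

definition cut_at_half :: "(real \<Rightarrow> real) \<Rightarrow> bool" where
  "cut_at_half b \<longleftrightarrow> smooth_real b \<and> (\<forall>s<1/2. b s = 0)"

lemma cut_at_half_half: assumes "cut_at_half b" shows "b (1/2) = 0"
proof -
  have "isCont b (1/2)" using smooth_real_cont[of b UNIV] assms by (simp add: cut_at_half_def continuous_on_eq_continuous_at)
  then have "(b \<longlongrightarrow> b (1/2)) (at_left (1/2))" by (simp add: isCont_def filterlim_at_split)
  moreover have "\<forall>\<^sub>F s in at_left (1/2). b s = 0"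
    using assms by (auto simp: cut_at_half_def eventually_at_filter)
  then have "(b \<longlongrightarrow> 0) (at_left (1/2))" by (rule tendsto_eventually)
  ultimately show ?thesis using tendsto_unique trivial_limit_at_left_real by blast
qed

lemma cut_at_half_deriv: assumes "cut_at_half b" shows "\<exists>b'. cut_at_half b' \<and> (\<forall>s. (b has_real_derivative b' s) (at s))"
proof -
  obtain b' where b': "smooth_real b'" "\<And>s. (b has_real_derivative b' s) (at s)"
    using smooth_real_deriv assms unfolding cut_at_half_def by blast
  have "b' s = 0" if "s < 1/2" for s
    by (rule DERIV_zero_open[of "1/2" b b' s]) (use assms b' that in \<open>auto simp: cut_at_half_def\<close>)
  then show ?thesis using b' by (auto simp: cut_at_half_def)
qed

lemma cut_at_half_div: "cut_at_half b \<Longrightarrow> cut_at_half (\<lambda>s. b s / s)"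
  using smooth_real_div[of b "1/2"] by (auto simp: cut_at_half_def)

lemma cut_at_half_cont_inv: assumes "cut_at_half b" shows "continuous_on {1..2} (\<lambda>x. b (1/x))"
proof (rule continuous_on_compose2[of UNIV b])
  show "continuous_on UNIV b" using assms smooth_real_cont by (simp add: cut_at_half_def)
  show "continuous_on {1..2} (\<lambda>x::real. 1/x)" by (intro continuous_intros) auto
qed simp

text \<open>Each member is the one-variable adjoint Euler operator, minus the derivative of
  \<open>x * g i x\<close>, applied to its predecessor. The chain is abstract so that it can consist
  of functions of several variables restricted to a line.\<close>

definition euler_chain :: "(nat \<Rightarrow> real \<Rightarrow> complex) \<Rightarrow> bool" where
  "euler_chain g \<longleftrightarrow> (\<forall>i. continuous_on UNIV (g i)) \<and>
     (\<forall>i x. ((\<lambda>x. complex_of_real x * g i x) has_vector_derivative - g (Suc i) x) (at x))"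

text \<open>The fundamental theorem on \<open>[1,2]\<close> for the product of \<open>F x\<close>,
  \<open>b (1/x)\<close> and \<open>x * g i x\<close>. It vanishes at 2 because
  \<open>b (1/2) = 0\<close>, so only the endpoint 1 contributes.\<close>

lemma euler_ibp:
  assumes b: "cut_at_half b" "\<And>s. (b has_real_derivative b' s) (at s)" "cut_at_half b'" and g: "euler_chain g"
    and F: "\<And>x. x \<in> {1..2} \<Longrightarrow> (F has_real_derivative F' x) (at x)" "continuous_on {1..2} F'"
  shows "integral {1..2} (\<lambda>x. complex_of_real (F' x * b (1/x) * x) * g i x) =
    - complex_of_real (F 1 * b 1) * g i 1 + (integral {1..2} (\<lambda>x. complex_of_real (F x * b' (1/x) / x) * g i x)
     + integral {1..2} (\<lambda>x. complex_of_real (F x * b (1/x)) * g (Suc i) x))"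
proof -
  have gd: "((\<lambda>x. complex_of_real x * g i x) has_vector_derivative - g (Suc i) x) (at x)" for x
    using g by (simp add: euler_chain_def)
  have gc: "continuous_on {1..2} (g i)" for i
    using g continuous_on_subset unfolding euler_chain_def by blast
  have Fc: "continuous_on {1..2} F" using F(1) DERIV_isCont by (blast intro: continuous_at_imp_continuous_on)
  have bc: "continuous_on {1..2} (\<lambda>x. b (1/x))" "continuous_on {1..2} (\<lambda>x. b' (1/x))"
    by (rule cut_at_half_cont_inv[OF b(1)], rule cut_at_half_cont_inv[OF b(3)])
  let ?H = "\<lambda>x. complex_of_real (F x * b (1/x)) * (complex_of_real x * g i x)"
  let ?I1 = "\<lambda>x. complex_of_real (F' x * b (1/x) * x) * g i x"
  let ?I2 = "\<lambda>x. complex_of_real (F x * b' (1/x) / x) * g i x"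
  let ?I3 = "\<lambda>x. complex_of_real (F x * b (1/x)) * g (Suc i) x"
  have hi: "((\<lambda>x. ?I1 x - (?I2 x + ?I3 x)) has_integral (?H 2 - ?H 1)) {1..2}"
  proof (rule fundamental_theorem_of_calculus)
    fix x :: real assume x: "x \<in> {1..2}"
    have "((\<lambda>x. F x * b (1/x)) has_real_derivative (F' x * b (1/x) + (b' (1/x) * (- 1 / x^2)) * F x)) (at x)"
      by (rule DERIV_mult[OF F(1)[OF x]], rule DERIV_chain2[OF b(2)])
        (use x in \<open>auto intro!: derivative_eq_intros simp: power2_eq_square\<close>)
    from has_vector_derivative_mult[OF has_vector_derivative_of_real[OF this] gd]
    have hd: "(?H has_vector_derivative (complex_of_real (F x * b (1/x)) * - g (Suc i) x +
        complex_of_real (F' x * b (1/x) + (b' (1/x) * (- 1 / x^2)) * F x) * (complex_of_real x * g i x))) (at x)" .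
    have eq: "complex_of_real (F x * b (1/x)) * - g (Suc i) x +
        complex_of_real (F' x * b (1/x) + (b' (1/x) * (- 1 / x^2)) * F x) * (complex_of_real x * g i x) = ?I1 x - (?I2 x + ?I3 x)"
    proof -
      have "(F' x * b (1/x) + (b' (1/x) * (- 1 / x^2)) * F x) * x = F' x * b (1/x) * x - F x * b' (1/x) / x"
        using x by (simp add: power2_eq_square field_simps)
      then have "complex_of_real (F' x * b (1/x) + (b' (1/x) * (- 1 / x^2)) * F x) * complex_of_real x
         = complex_of_real (F' x * b (1/x) * x) - complex_of_real (F x * b' (1/x) / x)"
        by (metis of_real_diff of_real_mult)
      then show ?thesis by (simp only: mult.assoc[symmetric]) (simp add: algebra_simps)
    qed
    show "(?H has_vector_derivative ?I1 x - (?I2 x + ?I3 x)) (at x within {1..2})"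
      using has_vector_derivative_at_within[OF hd] unfolding eq .
  qed simp
  have int: "?I1 integrable_on {1..2}" "?I2 integrable_on {1..2}" "?I3 integrable_on {1..2}"
    by (auto intro!: integrable_continuous_real continuous_intros gc Fc bc F(2))
  have "integral {1..2} ?I1 - (integral {1..2} ?I2 + integral {1..2} ?I3) = ?H 2 - ?H 1"
    by (rule has_integral_unique[OF has_integral_diff[OF integrable_integral[OF int(1)]
          has_integral_add[OF integrable_integral[OF int(2)] integrable_integral[OF int(3)]]] hi])
  moreover have "?H 2 = 0" using cut_at_half_half[OF b(1)] by simp
  ultimately show ?thesis by (simp add: algebra_simps)
qed

text \<open>With respect to \<open>1/x\<close> the factor is a truncated power vanishing to order \<open>K\<close> at \<open>x = 1\<close>, while
  \<open>b\<close> removes the other endpoint \<open>x = 2\<close>.\<close>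
definition kr :: "nat \<Rightarrow> (real \<Rightarrow> real) \<Rightarrow> real \<Rightarrow> real" where
  "kr K b x = b (1/x) * ((1 - 1/x) ^ K / fact K) / x"

text \<open>Integration by parts with \<open>F = 1\<close> represents \<open>g 0 1\<close> as the
  boundary term at 1. Each further integration by parts raises the order of vanishing at 1 without
  new boundary terms, replacing a term \<open>(i, b)\<close> by \<open>(i, b')\<close> and
  \<open>(Suc i, b / s)\<close>; so \<open>K\<close> can be as large as desired at the price of more
  Euler derivatives.\<close>

lemma parametrix_real_henstock:
  "\<exists>L::(nat \<times> (real \<Rightarrow> real)) list. (\<forall>p\<in>set L. cut_at_half (snd p)) \<and>
     (\<forall>g. euler_chain g \<longrightarrow> g 0 1 = (\<Sum>p\<leftarrow>L. integral {1..2} (\<lambda>x. complex_of_real (kr K (snd p) x) * g (fst p) x)))"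
proof (induction K)
  case 0
  obtain \<eta> where \<eta>: "smooth_real \<eta>" "\<And>u. u \<le> 0 \<Longrightarrow> \<eta> u = 0" "\<And>u. u \<ge> 1 \<Longrightarrow> \<eta> u = 1" using smooth_step by blast
  \<comment> \<open>Equal to 1 at \<open>s = 1\<close>, where it picks out \<open>g 0 1\<close>, and
    0 for \<open>s \<le> 1/2\<close>.\<close>
  define b where "b s = \<eta> (2 * s + (-1))" for s
  have b: "cut_at_half b" unfolding cut_at_half_def b_def[abs_def] by (intro conjI smooth_real_affine \<eta>) (auto intro: \<eta>)
  have b1: "b 1 = 1" by (simp add: b_def \<eta>)
  obtain b' where b': "cut_at_half b'" "\<And>s. (b has_real_derivative b' s) (at s)" using cut_at_half_deriv[OF b] by blast
  have "g 0 1 = integral {1..2} (\<lambda>x. complex_of_real (kr 0 b' x) * g 0 x) +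
    integral {1..2} (\<lambda>x. complex_of_real (kr 0 (\<lambda>s. b s / s) x) * g (Suc 0) x)" if g: "euler_chain g" for g
  proof -
    have "integral {1..2} (\<lambda>x. complex_of_real (1 * b (1/x)) * g (Suc 0) x) =
       integral {1..2} (\<lambda>x. complex_of_real (kr 0 (\<lambda>s. b s / s) x) * g (Suc 0) x)"
      by (rule Henstock_Kurzweil_Integration.integral_cong) (auto simp: kr_def)
    then show ?thesis
      using euler_ibp[OF b b'(2,1) g, of "\<lambda>_. 1" "\<lambda>_. 0" 0] b1 by (simp add: kr_def)
  qed
  then show ?case
    by (intro exI[of _ "[(0, b'), (Suc 0, \<lambda>s. b s / s)]"]) (use b b' cut_at_half_div in auto)
next
  case (Suc K)
  then obtain L :: "(nat \<times> (real \<Rightarrow> real)) list" where L: "\<forall>p\<in>set L. cut_at_half (snd p)"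
    "\<And>g. euler_chain g \<Longrightarrow> g 0 1 = (\<Sum>p\<leftarrow>L. integral {1..2} (\<lambda>x. complex_of_real (kr K (snd p) x) * g (fst p) x))"
    by blast
  have "\<exists>D. \<forall>b. cut_at_half b \<longrightarrow> cut_at_half (D b) \<and> (\<forall>s. (b has_real_derivative D b s) (at s))"
    using cut_at_half_deriv by metis
  then obtain D where D: "\<And>b. cut_at_half b \<Longrightarrow> cut_at_half (D b)" "\<And>b s. cut_at_half b \<Longrightarrow> (b has_real_derivative D b s) (at s)" by blast
  define I where "I K g p = integral {1..2} (\<lambda>x. complex_of_real (kr K (snd p) x) * g (fst p) x)"
    for K and g :: "nat \<Rightarrow> real \<Rightarrow> complex" and p :: "nat \<times> (real \<Rightarrow> real)"
  have step: "I K g p = I (Suc K) g (fst p, D (snd p)) + I (Suc K) g (Suc (fst p), \<lambda>s. snd p s / s)"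
    if p: "cut_at_half (snd p)" and g: "euler_chain g" for g p
  proof -
    \<comment> \<open>A primitive of the factor in \<open>kr K\<close>, up to
      \<open>1 / x^2\<close>, that vanishes at 1, so the boundary term disappears.\<close>
    let ?F = "\<lambda>x::real. (1 - 1/x) ^ Suc K / fact (Suc K)"
    let ?F' = "\<lambda>x::real. (1 - 1/x) ^ K / fact K * (1 / x^2)"
    have d: "(?F has_real_derivative ?F' x) (at x)" if "x \<in> {1..2}" for x
    proof -
      have "((\<lambda>x. 1 - 1/x) has_real_derivative (1 / x^2)) (at x)"
        using that by (auto intro!: derivative_eq_intros simp: power2_eq_square)
      then have hd: "(?F has_real_derivative (1 + real K) * ((1 / x^2) * (1 - 1/x) ^ K) / fact (Suc K)) (at x)"
        by (intro DERIV_cdivide DERIV_power_Suc)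
      have eq: "(1 + real K) * ((1 / x^2) * (1 - 1/x) ^ K) / fact (Suc K) = ?F' x"
      proof -
        have nz: "1 + real K \<noteq> 0" by linarith
        have "(1 + real K) * ((1 / x^2) * (1 - 1/x) ^ K) / ((1 + real K) * fact K) = ((1 / x^2) * (1 - 1/x) ^ K) / fact K"
          by (rule mult_divide_mult_cancel_left[OF nz])
        then show ?thesis unfolding fact_Suc of_nat_Suc by simp
      qed
      show ?thesis using hd unfolding eq .
    qed
    have "integral {1..2} (\<lambda>x. complex_of_real (?F' x * snd p (1/x) * x) * g (fst p) x) = I K g p"
      unfolding I_def
      by (rule Henstock_Kurzweil_Integration.integral_cong) (auto simp: kr_def power2_eq_square)
    moreover have "integral {1..2} (\<lambda>x. complex_of_real (?F x * D (snd p) (1/x) / x) * g (fst p) x) = I (Suc K) g (fst p, D (snd p))"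
      unfolding I_def
      by (rule Henstock_Kurzweil_Integration.integral_cong) (simp add: kr_def del: fact_Suc power_Suc)
    moreover have "integral {1..2} (\<lambda>x. complex_of_real (?F x * snd p (1/x)) * g (Suc (fst p)) x) = I (Suc K) g (Suc (fst p), \<lambda>s. snd p s / s)"
      unfolding I_def
      by (rule Henstock_Kurzweil_Integration.integral_cong) (auto simp: kr_def simp del: fact_Suc power_Suc)
    moreover have "continuous_on {1..2} ?F'" by (auto intro!: continuous_intros)
    ultimately show ?thesis using euler_ibp[OF p D(2)[OF p] D(1)[OF p] g d, of "fst p"] by simp
  qed
  define L' where "L' = concat (map (\<lambda>p. [(fst p, D (snd p)), (Suc (fst p), \<lambda>s. snd p s / s)]) L)"
  have okL': "\<forall>p\<in>set L'. cut_at_half (snd p)" using L(1) D(1) cut_at_half_div unfolding L'_def by auto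
  have sums: "(\<Sum>p\<leftarrow>L. I K g p) = (\<Sum>p\<leftarrow>L'. I (Suc K) g p)" if g: "euler_chain g" for g
    unfolding L'_def using L(1) by (induction L) (auto simp: step[OF _ g])
  show ?case by (rule exI[of _ L']) (use okL' L(2) sums in \<open>simp add: I_def\<close>)
qed

definition ker :: "nat \<Rightarrow> (real \<Rightarrow> real) \<Rightarrow> real \<Rightarrow> real" where
  "ker K b x = (if x \<in> {1..2} then kr K b x else 0)"

lemma parametrix_real:
  "\<exists>L::(nat \<times> (real \<Rightarrow> real)) list. (\<forall>p\<in>set L. cut_at_half (snd p)) \<and>
     (\<forall>g. euler_chain g \<longrightarrow> g 0 1 = (\<Sum>p\<leftarrow>L. LINT x|lborel. complex_of_real (ker K (snd p) x) * g (fst p) x))"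
proof -
  have "integral {1..2} (\<lambda>x. complex_of_real (kr K b x) * g i x) = (LINT x|lborel. complex_of_real (ker K b x) * g i x)"
    if b: "cut_at_half b" and g: "euler_chain g" for b g i
  proof -
    have bc: "continuous_on {1..2} (\<lambda>x. b (1/x))"
      by (rule cut_at_half_cont_inv[OF b])
    have gc: "continuous_on {1..2} (g i)"
      using g continuous_on_subset unfolding euler_chain_def by blast
    have "continuous_on {1..2} (\<lambda>x. complex_of_real (kr K b x) * g i x)"
      unfolding kr_def by (auto intro!: continuous_intros bc gc)
    then have "set_integrable lborel {1..2} (\<lambda>x. complex_of_real (kr K b x) * g i x)"
      by (rule borel_integrable_atLeastAtMost')
    from set_borel_integral_eq_integral(2)[OF this]
    have "integral {1..2} (\<lambda>x. complex_of_real (kr K b x) * g i x) = (LINT x:{1..2}|lborel. complex_of_real (kr K b x) * g i x)" by simp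
    also have "\<dots> = (LINT x|lborel. complex_of_real (ker K b x) * g i x)"
      unfolding set_lebesgue_integral_def by (rule Bochner_Integration.integral_cong) (auto simp: ker_def indicator_def)
    finally show ?thesis .
  qed
  note eq = this
  obtain L :: "(nat \<times> (real \<Rightarrow> real)) list" where L: "\<forall>p\<in>set L. cut_at_half (snd p)"
    "\<And>g. euler_chain g \<Longrightarrow> g 0 1 = (\<Sum>p\<leftarrow>L. integral {1..2} (\<lambda>x. complex_of_real (kr K (snd p) x) * g (fst p) x))"
    using parametrix_real_henstock[of K] by blast
  have "g 0 1 = (\<Sum>p\<leftarrow>L. LINT x|lborel. complex_of_real (ker K (snd p) x) * g (fst p) x)" if g: "euler_chain g" for g
    unfolding L(2)[OF g] using L(1) eq[OF _ g] by (intro arg_cong[of _ _ sum_list] map_cong) auto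
  then show ?thesis using L(1) by blast
qed

section \<open>From one variable to all coordinates\<close>

lemma lint_translate:
  fixes g :: "'a::euclidean_space \<Rightarrow> complex"
  assumes "g \<in> borel_measurable borel"
  shows "(LINT x|lborel. g (c + x)) = (LINT x|lborel. g x)"
proof -
  have "(LINT x|lborel. g x) = (LINT x|Measure_Space.distr lborel borel ((+) c). g x)" by (simp add: lborel_distr_plus)
  also have "\<dots> = (LINT x|lborel. g (c + x))" by (rule integral_distr) (use assms in auto)
  finally show ?thesis by simp
qed

lemma lint_indicator_shift: "(LINT r|lborel. complex_of_real (indicator {0..1} (a - r))) = 1" for a :: real
proof -
  have "(LINT r|lborel. complex_of_real (indicator {0..1} (a - r))) = (LINT r|lborel. complex_of_real (indicator {a-1..a} r))"
    by (rule Bochner_Integration.integral_cong) (auto simp: indicator_def)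
  also have "\<dots> = complex_of_real (LINT r|lborel. indicator {a-1..a} r)"
    by (rule integral_of_real) (intro integrable_real_indicator; simp)
  also have "\<dots> = 1" by simp
  finally show ?thesis .
qed

text \<open>One coordinate at a time, an integral over the whole space is an iterated integral, where the
  outer integral carries a unit-mass density in the coordinate that is integrated inside.\<close>
lemma swap_coordinate:
  fixes F :: "real^'d::finite \<Rightarrow> complex" and j :: 'd
  assumes F [measurable]: "F \<in> borel_measurable borel" and B: "\<And>x. cmod (F x) \<le> B" and z: "\<And>x. x \<notin> cbx R \<Longrightarrow> F x = 0"
  defines "G \<equiv> \<lambda>x. complex_of_real (indicator {0..1} (x $ j)) * (LINT s|lborel. F (x + (s - x $ j) *\<^sub>R axis j 1))"
  shows "integrable lborel G" and "(LINT x|lborel. G x) = (LINT x|lborel. F x)"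
proof -
  let ?w = "\<lambda>t::real. complex_of_real (indicator {0..1} t)"
  let ?e = "axis j 1 :: real^'d"
  have R0: "cmod (?w t * F x) \<le> \<bar>B\<bar>" for t x
    using B[of x] by (auto simp: indicator_def norm_mult)
  \<comment> \<open>Large enough for both integrands: each confines \<open>r\<close> to
    \<open>|r| \<le> |R| + 1\<close>, and \<open>x\<close> to the stated cube. The absolute value is
    taken since \<open>R\<close> carries no sign condition.\<close>
  have bb: "bounded (cbx (\<bar>R\<bar> + 2 * (\<bar>R\<bar> + 1)) \<times> {- (\<bar>R\<bar> + 2)..\<bar>R\<bar> + 2} :: ((real^'d) \<times> real) set)"
    by (intro bounded_Times compact_imp_bounded compact_cbx) auto
  let ?S = "cbx (\<bar>R\<bar> + 2 * (\<bar>R\<bar> + 1)) \<times> {- (\<bar>R\<bar> + 2)..\<bar>R\<bar> + 2} :: ((real^'d) \<times> real) set"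
  have i1: "integrable (lborel \<Otimes>\<^sub>M lborel) (\<lambda>(x, r). ?w (x $ j - r) * F x)"
    unfolding lborel_prod
  proof (rule integrable_bounded_support[OF _ _ bb])
    show "(\<lambda>(x, r). ?w (x $ j - r) * F x) \<in> borel_measurable borel"
      unfolding borel_prod[symmetric] by measurable
    show "cmod (case q of (x, r) \<Rightarrow> ?w (x $ j - r) * F x) \<le> \<bar>B\<bar>" for q
      using R0 by (cases q) auto
    fix q :: "(real^'d) \<times> real" assume q: "q \<notin> ?S"
    obtain x r where xr: "q = (x, r)" by (cases q)
    show "(case q of (x, r) \<Rightarrow> ?w (x $ j - r) * F x) = 0"
    proof (rule ccontr)
      assume nz: "\<not> ?thesis"
      then have a: "x \<in> cbx R" "0 \<le> x $ j - r" "x $ j - r \<le> 1" using z xr by (auto simp: indicator_def split: if_splits)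
      then have c: "\<bar>x $ i\<bar> \<le> \<bar>R\<bar>" for i by (metis (mono_tags, lifting) abs_ge_self cbx_def mem_Collect_eq order_trans)
      have "\<bar>x $ i\<bar> \<le> \<bar>R\<bar> + 2 * (\<bar>R\<bar> + 1)" for i
        by (rule order_trans[OF c[of i]]) simp
      then have "x \<in> cbx (\<bar>R\<bar> + 2 * (\<bar>R\<bar> + 1))" unfolding cbx_def by blast
      moreover have "- (\<bar>R\<bar> + 2) \<le> r" "r \<le> \<bar>R\<bar> + 2" using a c[of j] by linarith+
      ultimately show False using q xr by simp
    qed
  qed
  have i2: "integrable (lborel \<Otimes>\<^sub>M lborel) (\<lambda>(x, r). ?w (x $ j) * F (x + r *\<^sub>R ?e))"
    unfolding lborel_prod
  proof (rule integrable_bounded_support[OF _ _ bb])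
    show "(\<lambda>(x, r). ?w (x $ j) * F (x + r *\<^sub>R ?e)) \<in> borel_measurable borel"
      unfolding borel_prod[symmetric] by measurable
    show "cmod (case q of (x, r) \<Rightarrow> ?w (x $ j) * F (x + r *\<^sub>R ?e)) \<le> \<bar>B\<bar>" for q
      using R0 by (cases q) auto
    fix q :: "(real^'d) \<times> real" assume q: "q \<notin> ?S"
    obtain x r where xr: "q = (x, r)" by (cases q)
    show "(case q of (x, r) \<Rightarrow> ?w (x $ j) * F (x + r *\<^sub>R ?e)) = 0"
    proof (rule ccontr)
      assume nz: "\<not> ?thesis"
      then have a: "x + r *\<^sub>R ?e \<in> cbx R" "0 \<le> x $ j" "x $ j \<le> 1" using z xr by (auto simp: indicator_def split: if_splits)
      then have c: "\<bar>(x + r *\<^sub>R ?e) $ i\<bar> \<le> \<bar>R\<bar>" for i by (metis (mono_tags, lifting) abs_ge_self cbx_def mem_Collect_eq order_trans)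
      have r: "\<bar>r\<bar> \<le> \<bar>R\<bar> + 1" using c[of j] a by (auto simp: axis_nth_if)
      have "\<bar>x $ i\<bar> \<le> \<bar>R\<bar> + 2 * (\<bar>R\<bar> + 1)" for i
        using c[of i] r by (cases "i = j") (auto simp: axis_nth_if)
      then have "x \<in> cbx (\<bar>R\<bar> + 2 * (\<bar>R\<bar> + 1))" unfolding cbx_def by blast
      moreover have "- (\<bar>R\<bar> + 2) \<le> r" "r \<le> \<bar>R\<bar> + 2" using r by linarith+
      ultimately show False using q xr by simp
    qed
  qed
  have Geq: "G = (\<lambda>x. LINT r|lborel. ?w (x $ j) * F (x + r *\<^sub>R ?e))"
  proof
    fix x
    have "(LINT s|lborel. F (x + (s - x $ j) *\<^sub>R ?e)) = (LINT r|lborel. F (x + ((x $ j + r) - x $ j) *\<^sub>R ?e))"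
      by (rule lint_translate[symmetric]) measurable
    then show "G x = (LINT r|lborel. ?w (x $ j) * F (x + r *\<^sub>R ?e))" by (simp add: G_def)
  qed
  show "integrable lborel G" unfolding Geq
    by (rule lborel_pair.integrable_fst[OF i2])
  \<comment> \<open>The unit mass of the indicator in \<open>r\<close> is inserted; after Fubini a
    translation of \<open>x\<close> along direction \<open>j\<close> moves the dependence on
    \<open>r\<close> from the indicator into \<open>F\<close>.\<close>
  have "(LINT x|lborel. F x) = (LINT x|lborel. LINT r|lborel. ?w (x $ j - r) * F x)"
    by (simp only: Bochner_Integration.integral_mult_left_zero lint_indicator_shift mult_1)
  also have "\<dots> = (LINT r|lborel. LINT x|lborel. ?w (x $ j - r) * F x)"
    by (rule lborel_pair.Fubini_integral[OF i1, symmetric])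
  also have "\<dots> = (LINT r|lborel. LINT x|lborel. ?w (x $ j) * F (x + r *\<^sub>R ?e))"
  proof (rule Bochner_Integration.integral_cong[OF refl])
    fix r
    have "(LINT x|lborel. ?w (x $ j - r) * F x) = (LINT x|lborel. ?w ((r *\<^sub>R ?e + x) $ j - r) * F (r *\<^sub>R ?e + x))"
      by (rule lint_translate[symmetric]) measurable
    then show "(LINT x|lborel. ?w (x $ j - r) * F x) = (LINT x|lborel. ?w (x $ j) * F (x + r *\<^sub>R ?e))"
      by (simp add: axis_nth_if add.commute)
  qed
  also have "\<dots> = (LINT x|lborel. LINT r|lborel. ?w (x $ j) * F (x + r *\<^sub>R ?e))"
    by (rule lborel_pair.Fubini_integral[OF i2])
  finally show "(LINT x|lborel. G x) = (LINT x|lborel. F x)" by (simp add: Geq)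
qed

lemma ker_measurable: assumes "cut_at_half b" shows "ker K b \<in> borel_measurable borel"
proof -
  have [measurable]: "b \<in> borel_measurable borel"
    using assms smooth_real_cont by (auto simp: cut_at_half_def intro: borel_measurable_continuous_onI)
  show ?thesis unfolding ker_def[abs_def] kr_def by measurable
qed

lemma ker_bounded: assumes "cut_at_half b" shows "\<exists>B\<ge>0. \<forall>x. \<bar>ker K b x\<bar> \<le> B"
proof -
  have "continuous_on {1..2} (kr K b)" unfolding kr_def[abs_def]
    by (intro continuous_intros cut_at_half_cont_inv[OF assms]) auto
  then have "compact (kr K b ` {1..2})" by (rule compact_continuous_image) simp
  then obtain B where "\<forall>y\<in>kr K b ` {1..2}. norm y \<le> B" using compact_imp_bounded bounded_iff by metis
  then show ?thesis by (intro exI[of _ "max B 0"]) (auto simp: ker_def le_max_iff_disj)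
qed

text \<open>Coordinates in \<open>J\<close> carry kernels, the others a density of mass 1. With the
  remaining coordinates of the argument frozen at 1 by \<open>fill_ones\<close>, integrals over the
  whole space interpolate between evaluation at 1, for empty \<open>J\<close>, and the full
  parametrix.\<close>

definition pker :: "nat \<Rightarrow> 'd::finite set \<Rightarrow> ('d \<Rightarrow> real \<Rightarrow> real) \<Rightarrow> real^'d \<Rightarrow> real" where
  "pker K J b x = (\<Prod>j\<in>J. ker K (b j) (x $ j)) * (\<Prod>j\<in>-J. indicator {0..1} (x $ j))"

definition fill_ones :: "'d::finite set \<Rightarrow> real^'d \<Rightarrow> real^'d" where
  "fill_ones J x = (\<chi> k. if k \<in> J then x $ k else 1)"

lemma sum_list_integral:
  fixes f :: "'p \<Rightarrow> 'a \<Rightarrow> complex"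
  assumes "\<And>p. p \<in> set L \<Longrightarrow> integrable M (f p)"
  shows "integrable M (\<lambda>x. \<Sum>p\<leftarrow>L. f p x)" "(\<integral>x. (\<Sum>p\<leftarrow>L. f p x) \<partial>M) = (\<Sum>p\<leftarrow>L. \<integral>x. f p x \<partial>M)"
  using assms by (induction L) auto

lemma euler_adj_list_append: "euler_adj_list (xs @ ys) f = euler_adj_list ys (euler_adj_list xs f)"
  by (induction xs arbitrary: f) (auto simp: euler_adj_list_Cons)

lemma fill_ones_step:
  assumes "j \<notin> J" shows "fill_ones (insert j J) (x + (s - x $ j) *\<^sub>R axis j 1) = fill_ones J x + (s - 1) *\<^sub>R axis j 1"
  using assms by (auto simp: fill_ones_def vec_eq_iff axis_nth_if)

lemma pker_step:
  fixes x :: "real^'d::finite"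
  assumes "j \<notin> J"
  shows "indicator {0..1} (x $ j) * pker K (insert j J) (b(j := c)) (x + (s - x $ j) *\<^sub>R axis j 1) = pker K J b x * ker K c s"
proof -
  let ?x = "x + (s - x $ j) *\<^sub>R axis j 1"
  have 1: "(\<Prod>i\<in>insert j J. ker K ((b(j := c)) i) (?x $ i)) = ker K c s * (\<Prod>i\<in>J. ker K (b i) (x $ i))"
  proof -
    have "(\<Prod>i\<in>J. ker K ((b(j := c)) i) (?x $ i)) = (\<Prod>i\<in>J. ker K (b i) (x $ i))"
      using assms by (intro prod.cong) (auto simp: axis_nth_if)
    then show ?thesis using assms by (simp add: axis_nth_if)
  qed
  have "- J = insert j (- insert j J)" using assms by auto
  then have 2: "(\<Prod>i\<in>-J. indicator {0..1} (x $ i)) = indicator {0..1} (x $ j) * (\<Prod>i\<in>-insert j J. indicator {0..1} (x $ i) :: real)"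
    by (metis ComplD finite insertI1 prod.insert)
  have 3: "(\<Prod>i\<in>-insert j J. indicator {0..1} (?x $ i)) = (\<Prod>i\<in>-insert j J. indicator {0..1} (x $ i) :: real)"
    by (intro prod.cong) (auto simp: axis_nth_if)
  show ?thesis unfolding pker_def 1 2 3 by simp
qed

text \<open>Because \<open>z $ j = 1\<close>, the parameter \<open>s\<close> of the line is the
  coordinate \<open>j\<close> itself, so \<open>euler_adj j\<close> restricts to the one-variable
  adjoint Euler operator.\<close>

lemma euler_chain_line:
  assumes f: "test f" and z: "z $ j = (1::real)"
  shows "euler_chain (\<lambda>i s. euler_adj_list (replicate i j) f (z + (s - 1) *\<^sub>R axis j 1))"
  unfolding euler_chain_def
proof (intro conjI allI)
  fix i and s :: real
  let ?\<psi> = "euler_adj_list (replicate i j) f"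
  have t: "test ?\<psi>" by (rule test_euler_adj_list[OF f])
  show "continuous_on UNIV (\<lambda>s. ?\<psi> (z + (s - 1) *\<^sub>R axis j 1))"
    by (intro smooth_cont_compose test_smooth t continuous_intros)
  let ?G = "\<lambda>y. complex_of_real (y $ j) * ?\<psi> y"
  have smG: "smooth_fun ?G" by (intro smooth_mult smooth_coord test_smooth t)
  have "((\<lambda>s. ?G ((z - axis j 1) + s *\<^sub>R axis j 1)) has_vector_derivative pd j ?G ((z - axis j 1) + s *\<^sub>R axis j 1)) (at s)"
    by (rule smooth_deriv[OF smG])
  moreover have "(z - axis j 1) + s *\<^sub>R axis j 1 = z + (s - 1) *\<^sub>R axis j 1" for s by (simp add: algebra_simps)
  moreover have "(z + (s - 1) *\<^sub>R axis j 1) $ j = s" for s using z by (simp add: axis_nth_if)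
  moreover have "pd j ?G y = - euler_adj_list (replicate (Suc i) j) f y" for y
    using euler_adj_list_append[of "replicate i j" "[j]" f]
    by (simp add: replicate_append_same euler_adj_list_Cons euler_adj_def)
  ultimately show "((\<lambda>s. complex_of_real s * ?\<psi> (z + (s - 1) *\<^sub>R axis j 1)) has_vector_derivative - euler_adj_list (replicate (Suc i) j) f (z + (s - 1) *\<^sub>R axis j 1)) (at s)"
    by simp
qed

lemma pker_fun_props:
  fixes b :: "'d::finite \<Rightarrow> real \<Rightarrow> real" and J :: "'d set" and K :: nat
  assumes b: "\<And>j. cut_at_half (b j)" and f: "test f"
  defines "F \<equiv> \<lambda>x. complex_of_real (pker K J b x) * f (fill_ones J x)"
  shows "F \<in> borel_measurable borel" "\<exists>B. \<forall>x. cmod (F x) \<le> B" "\<And>x. x \<notin> cbx 2 \<Longrightarrow> F x = 0"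
proof -
  have [measurable]: "ker K (b j) \<in> borel_measurable borel" for j by (rule ker_measurable[OF b])
  have [measurable]: "f \<in> borel_measurable borel" by (rule test_measurable[OF f])
  have [measurable]: "fill_ones J \<in> borel_measurable borel"
    unfolding fill_ones_def[abs_def] by measurable
  show "F \<in> borel_measurable borel" unfolding F_def pker_def by measurable
  obtain Bf where Bf: "Bf \<ge> 0" "\<And>x. cmod (f x) \<le> Bf" using test_bounded[OF f] by blast
  have "\<forall>j. \<exists>B\<ge>0. \<forall>x. \<bar>ker K (b j) x\<bar> \<le> B" using ker_bounded[OF b] by blast
  then obtain Bk where Bk: "\<And>j. Bk j \<ge> 0" "\<And>j x. \<bar>ker K (b j) x\<bar> \<le> Bk j" by metis
  have "cmod (F x) \<le> ((\<Prod>j\<in>J. Bk j) * 1) * Bf" for x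
    unfolding F_def norm_mult norm_of_real pker_def abs_mult abs_prod
  proof (intro mult_mono Bf prod_mono conjI)
    show "(\<Prod>j\<in>-J. \<bar>indicator {0..1} (x $ j)::real\<bar>) \<le> 1"
      by (rule prod_le_1) (auto simp: indicator_def)
  qed (auto simp: Bk intro!: prod_nonneg mult_nonneg_nonneg)
  then show "\<exists>B. \<forall>x. cmod (F x) \<le> B" by blast
  fix x :: "real^'d" assume "x \<notin> cbx 2"
  then obtain j where j: "\<bar>x $ j\<bar> > 2" by (auto simp: cbx_def not_le)
  have "pker K J b x = 0"
  proof (cases "j \<in> J")
    case True
    then have "(\<Prod>j\<in>J. ker K (b j) (x $ j)) = 0" using j by (intro prod_zero) (auto simp: ker_def intro!: bexI[of _ j])
    then show ?thesis by (simp add: pker_def)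
  next
    case False
    then have "(\<Prod>j\<in>-J. indicator {0..1} (x $ j) :: real) = 0" using j by (intro prod_zero) (auto simp: indicator_def intro!: bexI[of _ j])
    then show ?thesis unfolding pker_def by (simp only: mult_zero_right)
  qed
  then show "F x = 0" by (simp add: F_def)
qed

text \<open>To add \<open>j\<close>, the one-variable parametrix is applied on the line through
  \<open>fill_ones J x\<close> in direction \<open>j\<close>, where the parameter 1 gives back the
  point. \<open>swap_coordinate\<close> then turns the integral over that line, weighted by the unit
  density in coordinate \<open>j\<close>, into an integral over the whole space.\<close>

lemma parametrix_partial:
  fixes J :: "'d::finite set"
  assumes "finite J"
  shows "\<exists>L::('d list \<times> ('d \<Rightarrow> real \<Rightarrow> real)) list. (\<forall>p\<in>set L. \<forall>j. cut_at_half (snd p j)) \<and>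
    (\<forall>f. test f \<longrightarrow> f 1 = (\<Sum>p\<leftarrow>L. LINT x|lborel. complex_of_real (pker K J (snd p) x) * euler_adj_list (fst p) f (fill_ones J x)))"
  using assms
proof induction
  case empty
  have "(\<Prod>j\<in>UNIV. indicator {0..1} (x $ j) :: real) = indicator (cbox 0 1) x" for x :: "real^'d"
    by (auto simp: indicator_def mem_box_cart intro!: prod.neutral)
  then have "(LINT x|lborel. complex_of_real (pker K {} b x) * f (fill_ones {} x)) = f 1" for b and f :: "'d tfun"
  proof -
    have "fill_ones {} x = 1" for x :: "real^'d" by (simp add: fill_ones_def vec_eq_iff)
    moreover have "pker K {} b x = indicator (cbox 0 1) x" for x :: "real^'d"
      unfolding pker_def using \<open>\<And>x::real^'d. (\<Prod>j\<in>UNIV. indicator {0..1} (x $ j) :: real) = indicator (cbox 0 1) x\<close> by simp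
    moreover have "(LINT x|lborel. complex_of_real (indicator (cbox 0 (1::real^'d)) x)) = 1"
    proof -
      have "(LINT x|lborel. complex_of_real (indicator (cbox 0 (1::real^'d)) x)) = complex_of_real (LINT x|lborel. indicator (cbox 0 (1::real^'d)) x)"
        by (rule integral_of_real) (intro integrable_real_indicator; simp add: emeasure_lborel_cbox_eq)
      also have "(LINT x|lborel. indicator (cbox 0 (1::real^'d)) x :: real) = measure lborel (cbox 0 (1::real^'d))" by simp
      also have "\<dots> = 1" by (subst content_cbox_cart) (auto simp: interval_ne_empty_cart)
      finally show ?thesis by simp
    qed
    ultimately show ?thesis by simp
  qed
  moreover have "cut_at_half (\<lambda>_. 0)" by (simp add: cut_at_half_def)
  \<comment> \<open>The zero functions are placeholders: for empty \<open>J\<close> no kernel enters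
    the integral.\<close>
  ultimately show ?case by (intro exI[of _ "[([], \<lambda>_ _. 0)]"]) auto
next
  case (insert j J)
  then obtain L :: "('d list \<times> ('d \<Rightarrow> real \<Rightarrow> real)) list" where L: "\<And>p j. p \<in> set L \<Longrightarrow> cut_at_half (snd p j)"
    "\<And>f. test f \<Longrightarrow> f 1 = (\<Sum>p\<leftarrow>L. LINT x|lborel. complex_of_real (pker K J (snd p) x) * euler_adj_list (fst p) f (fill_ones J x))"
    by blast
  obtain L1 :: "(nat \<times> (real \<Rightarrow> real)) list" where L1: "\<And>q. q \<in> set L1 \<Longrightarrow> cut_at_half (snd q)"
     "\<And>g. euler_chain g \<Longrightarrow> g 0 1 = (\<Sum>q\<leftarrow>L1. LINT x|lborel. complex_of_real (ker K (snd q) x) * g (fst q) x)"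
    using parametrix_real[of K] by blast
  define I where "I J f p = (LINT x|lborel. complex_of_real (pker K J (snd p) x) * euler_adj_list (fst p) f (fill_ones J x))"
    for J f and p :: "'d list \<times> ('d \<Rightarrow> real \<Rightarrow> real)"
  \<comment> \<open>Appended indices act last, after the Euler adjoints in \<open>fst p\<close>,
    which is how the chain on the line is built.\<close>
  define new where "new p q = (fst p @ replicate (fst q) j, (snd p)(j := snd q))"
    for p :: "'d list \<times> ('d \<Rightarrow> real \<Rightarrow> real)" and q :: "nat \<times> (real \<Rightarrow> real)"
  have step: "I J f p = (\<Sum>q\<leftarrow>L1. I (insert j J) f (new p q))" if p: "p \<in> set L" and f: "test f" for f p
  proof -
    let ?f = "euler_adj_list (fst p) f"
    have tf: "test ?f" by (rule test_euler_adj_list[OF f])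
    define F where "F q x = complex_of_real (pker K (insert j J) (snd (new p q)) x) * euler_adj_list (fst (new p q)) f (fill_ones (insert j J) x)" for q x
    have okn: "cut_at_half (snd (new p q) i)" if "q \<in> set L1" for q i
      using L(1)[OF p] L1(1)[OF that] by (simp add: new_def)
    have F1: "F q \<in> borel_measurable borel" "\<exists>B. \<forall>x. cmod (F q x) \<le> B" "\<And>x. x \<notin> cbx 2 \<Longrightarrow> F q x = 0" if "q \<in> set L1" for q
      using pker_fun_props[OF okn[OF that] test_euler_adj_list[OF f], where K = K and J = "insert j J"] unfolding F_def by auto
    define G where "G q x = complex_of_real (indicator {0..1} (x $ j)) * (LINT s|lborel. F q (x + (s - x $ j) *\<^sub>R axis j 1))" for q x
    have G: "integrable lborel (G q)" "(LINT x|lborel. G q x) = I (insert j J) f (new p q)" if q: "q \<in> set L1" for q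
    proof -
      obtain B where B: "\<And>x. cmod (F q x) \<le> B" using F1(2)[OF q] by blast
      show "integrable lborel (G q)" unfolding G_def[abs_def]
        by (rule swap_coordinate(1)[OF F1(1)[OF q] B F1(3)[OF q]])
      show "(LINT x|lborel. G q x) = I (insert j J) f (new p q)"
        using swap_coordinate(2)[OF F1(1)[OF q] B F1(3)[OF q]] unfolding G_def I_def F_def by simp
    qed
    have "complex_of_real (pker K J (snd p) x) * ?f (fill_ones J x) = (\<Sum>q\<leftarrow>L1. G q x)" for x
    proof -
      let ?z = "fill_ones J x"
      have zj: "?z $ j = 1" using insert(2) by (simp add: fill_ones_def)
      have "?f ?z = (\<Sum>q\<leftarrow>L1. LINT s|lborel. complex_of_real (ker K (snd q) s) * euler_adj_list (replicate (fst q) j) ?f (?z + (s - 1) *\<^sub>R axis j 1))"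
        using L1(2)[OF euler_chain_line[OF tf zj]] by simp
      then have "complex_of_real (pker K J (snd p) x) * ?f ?z = (\<Sum>q\<leftarrow>L1. complex_of_real (pker K J (snd p) x) * (LINT s|lborel. complex_of_real (ker K (snd q) s) * euler_adj_list (replicate (fst q) j) ?f (?z + (s - 1) *\<^sub>R axis j 1)))"
        by (simp add: sum_list_const_mult)
      also have "\<dots> = (\<Sum>q\<leftarrow>L1. G q x)"
      proof (intro arg_cong[of _ _ sum_list] map_cong refl)
        fix q assume "q \<in> set L1"
        have "G q x = (LINT s|lborel. complex_of_real (indicator {0..1} (x $ j)) * F q (x + (s - x $ j) *\<^sub>R axis j 1))"
          by (simp add: G_def)
        also have "\<dots> = (LINT s|lborel. complex_of_real (pker K J (snd p) x) * (complex_of_real (ker K (snd q) s) * euler_adj_list (replicate (fst q) j) ?f (?z + (s - 1) *\<^sub>R axis j 1)))"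
        proof (rule Bochner_Integration.integral_cong[OF refl])
          fix s
          show "complex_of_real (indicator {0..1} (x $ j)) * F q (x + (s - x $ j) *\<^sub>R axis j 1) =
            complex_of_real (pker K J (snd p) x) * (complex_of_real (ker K (snd q) s) * euler_adj_list (replicate (fst q) j) ?f (?z + (s - 1) *\<^sub>R axis j 1))"
            unfolding F_def new_def fst_conv snd_conv fill_ones_step[OF insert(2)] euler_adj_list_append mult.assoc[symmetric] of_real_mult[symmetric] pker_step[OF insert(2)] ..
        qed
        finally show "complex_of_real (pker K J (snd p) x) * (LINT s|lborel. complex_of_real (ker K (snd q) s) * euler_adj_list (replicate (fst q) j) ?f (?z + (s - 1) *\<^sub>R axis j 1)) = G q x"
          by simp
      qed
      finally show ?thesis .
    qed
    then have "I J f p = (LINT x|lborel. (\<Sum>q\<leftarrow>L1. G q x))" by (simp add: I_def)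
    also have "\<dots> = (\<Sum>q\<leftarrow>L1. LINT x|lborel. G q x)" by (rule sum_list_integral(2)) (rule G(1))
    also have "\<dots> = (\<Sum>q\<leftarrow>L1. I (insert j J) f (new p q))"
      by (intro arg_cong[of _ _ sum_list] map_cong refl G(2))
    finally show ?thesis .
  qed
  define L' where "L' = concat (map (\<lambda>p. map (new p) L1) L)"
  have "cut_at_half (snd p i)" if "p \<in> set L'" for p i
    using that L(1) L1(1) unfolding L'_def new_def by auto
  moreover have "f 1 = (\<Sum>p\<leftarrow>L'. I (insert j J) f p)" if f: "test f" for f
  proof -
    have "(\<Sum>p\<leftarrow>M. I J f p) = (\<Sum>p\<leftarrow>concat (map (\<lambda>p. map (new p) L1) M). I (insert j J) f p)" if "set M \<subseteq> set L" for M
      using that by (induction M) (auto simp: step[OF _ f] o_def)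
    then show ?thesis using L(2)[OF f] unfolding L'_def I_def by simp
  qed
  ultimately show ?case unfolding I_def by blast
qed

lemma parametrix:
  "\<exists>L::('d::finite list \<times> ('d \<Rightarrow> real \<Rightarrow> real)) list. (\<forall>p\<in>set L. \<forall>j. cut_at_half (snd p j)) \<and>
    (\<forall>f. test f \<longrightarrow> f 1 = (\<Sum>p\<leftarrow>L. LINT x|lborel. complex_of_real (\<Prod>j\<in>UNIV. ker K (snd p j) (x $ j)) * euler_adj_list (fst p) f x))"
proof -
  have "pker K UNIV b x = (\<Prod>j\<in>UNIV. ker K (b j) (x $ j))" for b and x :: "real^'d" by (simp add: pker_def)
  moreover have "fill_ones UNIV x = x" for x :: "real^'d" by (simp add: fill_ones_def vec_eq_iff)
  ultimately show ?thesis using parametrix_partial[OF finite[of "UNIV::'d set"], of K] by simp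
qed

subsection \<open>Existence of admissible representations\<close>

text \<open>The coordinate of largest modulus controls the norm, and it is at least
  \<open>\<delta>\<close>, so the weight is at most a constant times its \<open>k\<close>-th power.
  This is why decay is required with respect to every single coordinate.\<close>

lemma decay_weight:
  fixes x :: "real^'d::finite"
  assumes \<delta>: "\<delta> > 0" and x: "\<And>j. \<bar>x $ j\<bar> \<ge> \<delta>" and D: "D \<ge> 0" "\<And>j. c \<le> D * \<bar>1 / x $ j\<bar> ^ k"
  shows "(1 + (norm x)\<^sup>2) powr (real k / 2) * c \<le> (1 / \<delta>\<^sup>2 + (real CARD('d))\<^sup>2) powr (real k / 2) * D"
proof -
  obtain j where j: "\<And>i. \<bar>x $ i\<bar> \<le> \<bar>x $ j\<bar>"
  proof -
    have "finite (range (\<lambda>i. \<bar>x $ i\<bar>))" "range (\<lambda>i. \<bar>x $ i\<bar>) \<noteq> {}" by auto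
    then have "Max (range (\<lambda>i. \<bar>x $ i\<bar>)) \<in> range (\<lambda>i. \<bar>x $ i\<bar>)" by (rule Max_in)
    then obtain j where "Max (range (\<lambda>i. \<bar>x $ i\<bar>)) = \<bar>x $ j\<bar>" by blast
    then have "\<bar>x $ i\<bar> \<le> \<bar>x $ j\<bar>" for i using Max_ge[of "range (\<lambda>i. \<bar>x $ i\<bar>)" "\<bar>x $ i\<bar>"] by auto
    then show ?thesis using that by blast
  qed
  let ?a = "\<bar>x $ j\<bar>"
  have a: "?a > 0" using x[of j] \<delta> by linarith
  let ?A = "1 / \<delta>\<^sup>2 + (real CARD('d))\<^sup>2"
  have "norm x \<le> (\<Sum>i\<in>UNIV. \<bar>x $ i\<bar>)" by (rule norm_le_l1_cart)
  also have "\<dots> \<le> (\<Sum>i\<in>(UNIV::'d set). ?a)" by (intro sum_mono j)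
  finally have "norm x \<le> real CARD('d) * ?a" by simp
  then have n2: "(norm x)\<^sup>2 \<le> (real CARD('d))\<^sup>2 * ?a\<^sup>2" by (metis norm_ge_zero power_mono power_mult_distrib)
  have "\<delta>\<^sup>2 \<le> ?a\<^sup>2" using x[of j] \<delta> by (intro power_mono) auto
  then have "1 \<le> 1 / \<delta>\<^sup>2 * ?a\<^sup>2" using \<delta> by (simp add: field_simps)
  with n2 have le: "1 + (norm x)\<^sup>2 \<le> ?A * ?a\<^sup>2" unfolding distrib_right by linarith
  have "(1 + (norm x)\<^sup>2) powr (real k / 2) \<le> (?A * ?a\<^sup>2) powr (real k / 2)"
    by (rule powr_mono2[OF _ _ le]) auto
  also have "\<dots> = ?A powr (real k / 2) * (?a\<^sup>2) powr (real k / 2)" by (rule powr_mult)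
  also have "(?a\<^sup>2) powr (real k / 2) = ?a ^ k"
  proof -
    have e: "?a\<^sup>2 = ?a powr 2" using a by (simp add: powr_numeral)
    show ?thesis unfolding e powr_powr using a by (simp add: powr_realpow)
  qed
  finally have w: "(1 + (norm x)\<^sup>2) powr (real k / 2) \<le> ?A powr (real k / 2) * ?a ^ k" .
  have "(1 + (norm x)\<^sup>2) powr (real k / 2) * c \<le> (1 + (norm x)\<^sup>2) powr (real k / 2) * (D * \<bar>1 / x $ j\<bar> ^ k)"
    by (intro mult_left_mono D) simp
  also have "\<dots> \<le> (?A powr (real k / 2) * ?a ^ k) * (D * \<bar>1 / x $ j\<bar> ^ k)"
    using D(1) by (intro mult_right_mono w) simp
  also have "\<dots> = ?A powr (real k / 2) * D * (?a ^ k * \<bar>1 / x $ j\<bar> ^ k)" by (simp add: mult_ac)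
  also have "?a ^ k * \<bar>1 / x $ j\<bar> ^ k = 1" using a by (simp flip: power_mult_distrib add: abs_divide)
  finally show ?thesis by simp
qed

text \<open>The inverted kernel need not be smooth, so it is approximated by test functions
  \<open>\<Psi> n\<close> that are Cauchy in C^m. The decay estimate of order \<open>m\<close> makes
  \<open>MT T (\<Psi> n) (ivec x)\<close> converge, with bounds uniform in \<open>n\<close>, and
  \<open>MT_duality\<close> passes to the limit by dominated convergence. The power
  \<open>Suc m\<close> is what C^m convergence of the ramps demands.\<close>

lemma kernel_rep:
  fixes T :: "'d::finite distr" and b :: "'d \<Rightarrow> real \<Rightarrow> real"
  assumes T: "DH T" and \<delta>: "\<delta> > 0"
    and Z: "\<And>f. test f \<Longrightarrow> (\<And>x. (\<forall>j. \<bar>x $ j\<bar> > \<delta>) \<Longrightarrow> f x = 0) \<Longrightarrow> T f = 0"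
    and C: "C \<ge> 0" "\<And>f B y j. DK half_box f \<Longrightarrow> derivs_le m f B \<Longrightarrow> y $ j \<noteq> 0 \<Longrightarrow> cmod (MT T f y) \<le> C * B * \<bar>y $ j\<bar> ^ k"
    and b: "\<And>j. cut_at_half (b j)"
  shows "\<exists>t. t \<in> borel_measurable lborel \<and> (\<forall>x. (\<exists>j. \<bar>x $ j\<bar> < \<delta>) \<longrightarrow> t x = 0) \<and>
    (\<exists>D. \<forall>x. (1 + (norm x)\<^sup>2) powr (real k / 2) * cmod (t x) \<le> D) \<and>
    (\<forall>h. test h \<longrightarrow> (LINT x|lborel. complex_of_real (\<Prod>j\<in>UNIV. ker (Suc m) (b j) (x $ j)) * MT T h x) = (LINT x|lborel. t x * h x))"
proof -
  obtain P where P: "ramps P" using ramps_exist by blast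
  \<comment> \<open>For \<open>s = 1/x\<close>, the kernel is \<open>b j s\<close> times a truncated
    power, up to the factor \<open>1/x\<close>; the ramps replace the truncated power by smooth
    functions.\<close>
  define f where "f j n s = b j s * P n (Suc m) (1 - s)" for j n s
  have fa: "unif_cauchy_derivs m (f j)" for j
  proof -
    have "unif_cauchy_derivs m (\<lambda>n s. b j s * (1 * P n (Suc m) (1 - s)))"
      by (intro unif_cauchy_derivs_mult unif_cauchy_derivs_const unif_cauchy_derivs_ramp[OF P]) (use b in \<open>auto simp: cut_at_half_def\<close>)
    then show ?thesis by (simp add: f_def[abs_def])
  qed
  have fz: "f j n s = 0" if "s < 1/2 \<or> s > 1" for j n s
    using that b[of j] P by (auto simp: f_def cut_at_half_def ramps_def)
  define \<Psi> where "\<Psi> n = tensor (\<lambda>j. f j n)" for n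
  have D\<Psi>: "DK half_box (\<Psi> n)" for n unfolding \<Psi>_def by (rule tensor_unif_cauchy_derivs(1)[where f = f, OF fa fz])
  obtain B where B: "\<And>n. derivs_le m (\<Psi> n) B" using tensor_unif_cauchy_derivs(2)[where f = f, OF fa fz] unfolding \<Psi>_def by blast
  have B0: "B \<ge> 0" by (rule derivs_le_ge0[OF B])
  have cau: "\<exists>N. \<forall>n\<ge>N. \<forall>l\<ge>N. derivs_le m (\<lambda>x. \<Psi> n x - \<Psi> l x) e" if "e > 0" for e
    unfolding \<Psi>_def by (rule tensor_unif_cauchy_derivs(3)[where f = f, OF fa fz that])
  define tn where "tn n x = MT T (\<Psi> n) (ivec x) / complex_of_real (\<Prod>j\<in>UNIV. \<bar>x $ j\<bar>)" for n x
  \<comment> \<open>A pointwise limit, since \<open>MT T\<close> cannot be applied to a limit of the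
    \<open>\<Psi> n\<close> that is not smooth.\<close>
  define t where "t x = lim (\<lambda>n. tn n x)" for x
  have tn0: "tn n x = 0" if "\<bar>x $ j\<bar> \<le> \<delta>" for n x j
  proof (cases "x \<in> Rstar")
    case True
    then show ?thesis using MT_ivec_zero[OF T Z D\<Psi> True that] by (simp add: tn_def)
  next
    case False
    then have "(\<Prod>j\<in>UNIV. \<bar>x $ j\<bar>) = 0" by (simp add: Rstar_def)
    then show ?thesis by (simp only: tn_def of_real_0 div_by_0)
  qed
  have conv: "convergent (\<lambda>n. tn n x)" for x
  proof (cases "\<exists>j. \<bar>x $ j\<bar> \<le> \<delta>")
    case True
    then have "(\<lambda>n. tn n x) = (\<lambda>n. 0)" using tn0 by blast
    then show ?thesis by (simp add: convergent_const)
  next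
    case False
    \<comment> \<open>For convergence at a fixed point the estimate in a single coordinate
      suffices.\<close>
    fix j0 :: 'd
    have xpos: "\<bar>x $ j\<bar> > 0" for j using False \<delta> by (meson less_trans not_le)
    have p: "(\<Prod>j\<in>UNIV. \<bar>x $ j\<bar>) > 0" by (rule prod_pos) (use xpos in auto)
    define q where "q = C * \<bar>1 / x $ j0\<bar> ^ k / (\<Prod>j\<in>UNIV. \<bar>x $ j\<bar>)"
    have q: "q \<ge> 0" unfolding q_def using C(1) p by (intro divide_nonneg_pos mult_nonneg_nonneg) auto
    have "Cauchy (\<lambda>n. tn n x)"
    proof (rule metric_CauchyI)
      fix e :: real assume e: "e > 0"
      define e1 where "e1 = e / (2 * (q + 1))"
      have e': "e1 > 0" unfolding e1_def using e q by (intro divide_pos_pos) auto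
      obtain N where N: "\<forall>n\<ge>N. \<forall>l\<ge>N. derivs_le m (\<lambda>x. \<Psi> n x - \<Psi> l x) e1" using cau[OF e'] by blast
      have "dist (tn n x) (tn l x) < e" if "n \<ge> N" "l \<ge> N" for n l
      proof -
        have "cmod (MT T (\<lambda>x. \<Psi> n x - \<Psi> l x) (ivec x)) \<le> C * e1 * \<bar>ivec x $ j0\<bar> ^ k"
          by (rule C(2)[OF DK_diff[OF D\<Psi> D\<Psi>]]) (use N that xpos[of j0] in auto)
        moreover have "tn n x - tn l x = MT T (\<lambda>x. \<Psi> n x - \<Psi> l x) (ivec x) / complex_of_real (\<Prod>j\<in>UNIV. \<bar>x $ j\<bar>)"
          by (simp only: tn_def MT_diff[OF T DK_test[OF D\<Psi>] DK_test[OF D\<Psi>]] diff_divide_distrib)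
        ultimately have "cmod (tn n x - tn l x) \<le> C * e1 * \<bar>1 / x $ j0\<bar> ^ k / (\<Prod>j\<in>UNIV. \<bar>x $ j\<bar>)"
          using p unfolding norm_divide norm_of_real by (simp only: ivec_nth norm_divide norm_of_real abs_of_pos divide_right_mono less_imp_le)
        also have "\<dots> = q * e1" by (simp add: q_def)
        also have "\<dots> < (q + 1) * e1" by (rule mult_strict_right_mono[OF _ e']) simp
        also have "\<dots> = e / 2" using q by (simp add: e1_def field_simps)
        also have "\<dots> < e" using e by simp
        finally show ?thesis by (simp add: dist_norm)
      qed
      then show "\<exists>M. \<forall>m\<ge>M. \<forall>n\<ge>M. dist (tn m x) (tn n x) < e" by blast
    qed
    then show ?thesis by (rule Cauchy_convergent)
  qed
  have lim: "(\<lambda>n. tn n x) \<longlonglongrightarrow> t x" for x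
    using conv[of x] by (simp add: t_def convergent_LIMSEQ_iff)
  define D where "D = C * B / \<delta> ^ CARD('d)"
  have D0: "D \<ge> 0" unfolding D_def using C(1) B0 \<delta> by auto
  have tnb: "cmod (tn n x) \<le> D * \<bar>1 / x $ j\<bar> ^ k" if x: "\<And>j. \<bar>x $ j\<bar> \<ge> \<delta>" for n x j
  proof -
    have "\<bar>x $ j\<bar> > 0" using x[of j] \<delta> by linarith
    then have "cmod (MT T (\<Psi> n) (ivec x)) \<le> C * B * \<bar>ivec x $ j\<bar> ^ k" by (intro C(2)[OF D\<Psi> B]) auto
    moreover have "\<delta> ^ CARD('d) \<le> (\<Prod>j\<in>UNIV. \<bar>x $ j\<bar>)" by (rule prod_ge_power) (use \<delta> x in auto)
    ultimately have "cmod (MT T (\<Psi> n) (ivec x)) / (\<Prod>j\<in>UNIV. \<bar>x $ j\<bar>) \<le> (C * B * \<bar>ivec x $ j\<bar> ^ k) / \<delta> ^ CARD('d)"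
      using C(1) B0 \<delta> by (intro frac_le) auto
    then show ?thesis unfolding tn_def norm_divide norm_of_real D_def by (simp add: prod_nonneg)
  qed
  have tb: "cmod (t x) \<le> D * \<bar>1 / x $ j\<bar> ^ k" if x: "\<And>j. \<bar>x $ j\<bar> \<ge> \<delta>" for x j
    by (rule LIMSEQ_le_const2[OF tendsto_norm[OF lim]]) (use tnb[OF x] in blast)
  have t0: "t x = 0" if "\<bar>x $ j\<bar> \<le> \<delta>" for x j
  proof -
    have "(\<lambda>n. tn n x) = (\<lambda>n. 0)" using tn0[OF that] by blast
    then show ?thesis using lim[of x] by (simp add: LIMSEQ_const_iff)
  qed
  have [measurable]: "tn n \<in> borel_measurable borel" for n
  proof -
    have [measurable]: "MT T (\<Psi> n) \<in> borel_measurable borel"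
      by (rule test_measurable[OF MT_spec(1)[OF T DK_test[OF D\<Psi>]]])
    show ?thesis unfolding tn_def[abs_def] by measurable
  qed
  have tm [measurable]: "t \<in> borel_measurable borel"
    by (rule borel_measurable_LIMSEQ_metric[of tn]) (use lim in auto)
  have weight: "(1 + (norm x)\<^sup>2) powr (real k / 2) * cmod (t x) \<le> (1 / \<delta>\<^sup>2 + (real CARD('d))\<^sup>2) powr (real k / 2) * D" for x
  proof (cases "\<exists>j. \<bar>x $ j\<bar> \<le> \<delta>")
    case True
    then have "t x = 0" using t0 by blast
    then show ?thesis using D0 by simp
  next
    case False
    then have x: "\<bar>x $ j\<bar> \<ge> \<delta>" for j by (meson less_imp_le not_le)
    show ?thesis by (rule decay_weight[OF \<delta> x D0 tb[OF x]])
  qed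
  have main: "(LINT x|lborel. complex_of_real (\<Prod>j\<in>UNIV. ker (Suc m) (b j) (x $ j)) * MT T h x) = (LINT x|lborel. t x * h x)"
    if h: "test h" for h
  proof -
    define E where "E n x = \<Psi> n (ivec x) / complex_of_real (\<Prod>j\<in>UNIV. x $ j)" for n x
    have dual: "(LINT x|lborel. E n x * MT T h x) = (LINT x|lborel. tn n x * h x)" for n
      unfolding E_def tn_def by (rule MT_duality[OF T \<delta> Z D\<Psi> h])
    have hm [measurable]: "h \<in> borel_measurable borel" by (rule test_measurable[OF h])
    have tMh: "test (MT T h)" by (rule MT_spec(1)[OF T h])
    have Mm [measurable]: "MT T h \<in> borel_measurable borel" by (rule test_measurable[OF tMh])
    have r: "(\<lambda>n. LINT x|lborel. tn n x * h x) \<longlonglongrightarrow> (LINT x|lborel. t x * h x)"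
    proof (rule integral_dominated_convergence[where w = "\<lambda>x. (D * (1 / \<delta>) ^ k) * cmod (h x)"])
      show "(\<lambda>x. t x * h x) \<in> borel_measurable lborel" "(\<lambda>x. tn n x * h x) \<in> borel_measurable lborel" for n
        by measurable
      show "integrable lborel (\<lambda>x. (D * (1 / \<delta>) ^ k) * cmod (h x))"
        by (intro integrable_mult_right integrable_norm test_integrable h)
      show "AE x in lborel. (\<lambda>n. tn n x * h x) \<longlonglongrightarrow> t x * h x"
        by (intro always_eventually allI tendsto_mult lim tendsto_const)
      have "norm (tn n x * h x) \<le> (D * (1 / \<delta>) ^ k) * cmod (h x)" for n x
      proof (cases "\<exists>j. \<bar>x $ j\<bar> \<le> \<delta>")
        case True
        then show ?thesis using tn0 D0 \<delta> by auto
      next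
        case False
        fix j0 :: 'd
        have x: "\<bar>x $ j\<bar> \<ge> \<delta>" for j using False by (meson less_imp_le not_le)
        have "\<bar>1 / x $ j0\<bar> \<le> 1 / \<delta>" using x[of j0] \<delta> by (simp add: abs_divide frac_le)
        then have "D * \<bar>1 / x $ j0\<bar> ^ k \<le> D * (1 / \<delta>) ^ k" using D0 by (intro mult_left_mono power_mono) auto
        then have "cmod (tn n x) \<le> D * (1 / \<delta>) ^ k" using tnb[OF x, of n j0] by linarith
        then show ?thesis unfolding norm_mult by (rule mult_right_mono) simp
      qed
      then show "AE x in lborel. norm (tn n x * h x) \<le> (D * (1 / \<delta>) ^ k) * cmod (h x)" for n by simp
    qed
    obtain BM where BM: "BM \<ge> 0" "\<And>x. cmod (MT T h x) \<le> BM" using test_bounded[OF tMh] by blast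
    have Elim: "(\<lambda>n. E n x) \<longlonglongrightarrow> complex_of_real (\<Prod>j\<in>UNIV. ker (Suc m) (b j) (x $ j))" for x
    proof (cases "ivec x \<in> half_box")
      case True
      have xj: "1 \<le> x $ j" "x $ j \<le> 2" for j using half_box_ivec[OF True] by auto
      have "(\<lambda>n. b j (1 / x $ j) * P n (Suc m) (1 - 1 / x $ j) / x $ j) \<longlonglongrightarrow> ker (Suc m) (b j) (x $ j)" for j
      proof -
        let ?u = "1 - 1 / x $ j"
        have u: "0 \<le> ?u" "?u \<le> 1" using xj[of j] by auto
        have "(\<lambda>n. P n (Suc m) ?u) \<longlonglongrightarrow> ?u ^ Suc m / fact (Suc m)"
        proof (rule metric_tendsto_imp_tendsto[OF LIMSEQ_Suc[OF lim_inverse_n']])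
          show "\<forall>\<^sub>F n in sequentially. dist (P n (Suc m) ?u) (?u ^ Suc m / fact (Suc m)) \<le> dist (1 / real (Suc n)) 0"
            using P u unfolding ramps_def dist_real_def by (intro always_eventually allI) simp
        qed
        then have "(\<lambda>n. b j (1 / x $ j) * P n (Suc m) ?u / x $ j) \<longlonglongrightarrow> b j (1 / x $ j) * (?u ^ Suc m / fact (Suc m)) / x $ j"
          using xj(1)[of j] by (intro tendsto_intros) auto
        then show ?thesis using xj[of j] by (simp add: ker_def kr_def del: fact_Suc power_Suc)
      qed
      then have "(\<lambda>n. complex_of_real (\<Prod>j\<in>UNIV. b j (1 / x $ j) * P n (Suc m) (1 - 1 / x $ j) / x $ j)) \<longlonglongrightarrow> complex_of_real (\<Prod>j\<in>UNIV. ker (Suc m) (b j) (x $ j))"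
        by (intro tendsto_of_real tendsto_prod) auto
      moreover have "E n x = complex_of_real (\<Prod>j\<in>UNIV. b j (1 / x $ j) * P n (Suc m) (1 - 1 / x $ j) / x $ j)" for n
        unfolding E_def \<Psi>_def tensor_def f_def ivec_nth prod_dividef by (simp only: of_real_divide)
      ultimately show ?thesis by simp
    next
      case False
      then have "E n x = 0" for n using D\<Psi>[of n] by (simp add: E_def DK_def)
      moreover have "\<exists>j. x $ j \<notin> {1..2}"
        using ivec_half_box[of x] False by auto
      then have "(\<Prod>j\<in>UNIV. ker (Suc m) (b j) (x $ j)) = 0" by (auto intro!: prod_zero simp: ker_def)
      ultimately show ?thesis by (simp only: of_real_0 tendsto_const)
    qed
    have l: "(\<lambda>n. LINT x|lborel. E n x * MT T h x) \<longlonglongrightarrow> (LINT x|lborel. complex_of_real (\<Prod>j\<in>UNIV. ker (Suc m) (b j) (x $ j)) * MT T h x)"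
    proof (rule integral_dominated_convergence[where w = "\<lambda>x. B * cmod (MT T h x)"])
      have [measurable]: "\<Psi> n \<in> borel_measurable borel" for n by (rule test_measurable[OF DK_test[OF D\<Psi>]])
      have [measurable]: "ker (Suc m) (b j) \<in> borel_measurable borel" for j by (rule ker_measurable[OF b])
      show "(\<lambda>x. complex_of_real (\<Prod>j\<in>UNIV. ker (Suc m) (b j) (x $ j)) * MT T h x) \<in> borel_measurable lborel" by measurable
      show "(\<lambda>x. E n x * MT T h x) \<in> borel_measurable lborel" for n unfolding E_def by measurable
      show "integrable lborel (\<lambda>x. B * cmod (MT T h x))"
        by (intro integrable_mult_right integrable_norm test_integrable tMh)
      show "AE x in lborel. (\<lambda>n. E n x * MT T h x) \<longlonglongrightarrow> complex_of_real (\<Prod>j\<in>UNIV. ker (Suc m) (b j) (x $ j)) * MT T h x"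
        by (intro always_eventually allI tendsto_mult Elim tendsto_const)
      have "cmod (E n x) \<le> B" for n x
      proof (cases "ivec x \<in> half_box")
        case True
        have "1 ^ CARD('d) \<le> (\<Prod>j\<in>UNIV. \<bar>x $ j\<bar>)"
          by (rule prod_ge_power) (use half_box_ivec(1)[OF True] in \<open>auto intro: order_trans[OF _ abs_ge_self]\<close>)
        then have "cmod (\<Psi> n (ivec x)) / \<bar>\<Prod>j\<in>UNIV. x $ j\<bar> \<le> B / 1"
          using derivs_leD0[OF B] B0 by (intro frac_le) (auto simp: abs_prod)
        then show ?thesis unfolding E_def norm_divide norm_of_real by simp
      next
        case False
        then show ?thesis using D\<Psi>[of n] B0 by (simp add: E_def DK_def)
      qed
      then show "AE x in lborel. norm (E n x * MT T h x) \<le> B * cmod (MT T h x)" for n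
        by (intro always_eventually allI) (simp add: norm_mult mult_right_mono)
    qed
    show ?thesis using l r unfolding dual by (rule LIMSEQ_unique)
  qed
  show ?thesis using tm t0 weight main by (intro exI[of _ t]) (auto intro: less_imp_le)
qed

lemma admissible_rep_exists:
  fixes T :: "'d::finite distr"
  assumes T: "DH T"
  shows "\<exists>R. admissible_rep T R"
proof -
  let ?k = "CARD('d) + 1"
  obtain \<delta> where \<delta>: "\<delta> > 0" "\<And>f. test f \<Longrightarrow> (\<And>x. (\<forall>j. \<bar>x $ j\<bar> > \<delta>) \<Longrightarrow> f x = 0) \<Longrightarrow> T f = 0"
    using T_zero_near_axes[OF T] by blast
  \<comment> \<open>The decay exponent d + 1 is fixed first, as required by
    \<open>admissible_rep\<close>. It determines \<open>m\<close>, and \<open>m\<close> in turn the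
    smoothness demanded of the parametrix.\<close>
  obtain m C where C: "C \<ge> 0" "\<And>f B y j. DK half_box f \<Longrightarrow> derivs_le m f B \<Longrightarrow> y $ j \<noteq> 0 \<Longrightarrow> cmod (MT T f y) \<le> C * B * \<bar>y $ j\<bar> ^ ?k"
    using MT_decay[OF T, of ?k] by blast
  obtain L :: "('d list \<times> ('d \<Rightarrow> real \<Rightarrow> real)) list" where L: "\<And>p j. p \<in> set L \<Longrightarrow> cut_at_half (snd p j)"
    "\<And>f. test f \<Longrightarrow> f 1 = (\<Sum>p\<leftarrow>L. LINT x|lborel. complex_of_real (\<Prod>j\<in>UNIV. ker (Suc m) (snd p j) (x $ j)) * euler_adj_list (fst p) f x)"
    using parametrix[of "Suc m"] by blast
  define good where "good b t \<longleftrightarrow> t \<in> borel_measurable lborel \<and> (\<forall>x. (\<exists>j. \<bar>x $ j\<bar> < \<delta>) \<longrightarrow> t x = 0) \<and>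
    (\<exists>D. \<forall>x. (1 + (norm x)\<^sup>2) powr (real ?k / 2) * cmod (t x) \<le> D) \<and>
    (\<forall>h. test h \<longrightarrow> (LINT x|lborel. complex_of_real (\<Prod>j\<in>UNIV. ker (Suc m) (b j) (x $ j)) * MT T h x) = (LINT x|lborel. t x * h x))"
    for b :: "'d \<Rightarrow> real \<Rightarrow> real" and t
  have "\<exists>t. good b t" if "\<And>j. cut_at_half (b j)" for b
    unfolding good_def by (rule kernel_rep[OF T \<delta> C that])
  then obtain t where t: "\<And>b. (\<And>j. cut_at_half (b j)) \<Longrightarrow> good b (t b)" by metis
  define R where "R = map (\<lambda>p. (fst p, t (snd p))) L"
  have "T f = sum_list (map (\<lambda>(bs, t). LINT x|lborel. t x * euler_adj_list bs f x) R)" if f: "test f" for f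
  proof -
    note tM = MT_spec(1)[OF T f]
    have "T f = MT T f 1" using MT_spec(2)[OF T f one_Rstar] by simp
    also have "\<dots> = (\<Sum>p\<leftarrow>L. LINT x|lborel. complex_of_real (\<Prod>j\<in>UNIV. ker (Suc m) (snd p j) (x $ j)) * MT T (euler_adj_list (fst p) f) x)"
      unfolding L(2)[OF tM] MT_euler_adj_list[OF T f] ..
    also have "\<dots> = (\<Sum>p\<leftarrow>L. LINT x|lborel. t (snd p) x * euler_adj_list (fst p) f x)"
    proof (intro arg_cong[of _ _ sum_list] map_cong refl)
      fix p assume "p \<in> set L"
      then have "good (snd p) (t (snd p))" by (intro t L(1))
      then show "(LINT x|lborel. complex_of_real (\<Prod>j\<in>UNIV. ker (Suc m) (snd p j) (x $ j)) * MT T (euler_adj_list (fst p) f) x)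
          = (LINT x|lborel. t (snd p) x * euler_adj_list (fst p) f x)"
        using test_euler_adj_list[OF f] unfolding good_def by blast
    qed
    finally show ?thesis by (simp add: R_def o_def)
  qed
  moreover have "\<forall>(bs, t)\<in>set R. t \<in> borel_measurable lborel \<and> (\<forall>x. (\<exists>j. \<bar>x $ j\<bar> < \<delta>) \<longrightarrow> t x = 0) \<and>
        (\<exists>C. \<forall>x. (1 + (norm x)\<^sup>2) powr (real (CARD('d) + 1) / 2) * cmod (t x) \<le> C)"
  proof -
    have "good (snd p) (t (snd p))" if "p \<in> set L" for p by (intro t L(1) that)
    then show ?thesis unfolding R_def set_map good_def by auto
  qed
  ultimately show ?thesis unfolding admissible_rep_def using \<delta>(1) by blast
qed

section \<open>Integrability of the weight\<close>

lemma weight_le_dyadic: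
  fixes n :: nat
  assumes "2 ^ n \<le> r"
  shows "(1 + r\<^sup>2) powr - (real k / 2) \<le> (1 / 2 ^ n) ^ k"
proof -
  have r: "r > 0" using assms by (meson less_le_trans zero_less_numeral zero_less_power)
  have "(1 + r\<^sup>2) powr - (real k / 2) \<le> (r\<^sup>2) powr - (real k / 2)"
    using r by (intro powr_mono2') auto
  also have "(r\<^sup>2) powr - (real k / 2) = (1 / r) ^ k"
  proof -
    have e: "r\<^sup>2 = r powr 2" using r by (simp add: powr_numeral)
    have m: "2 * (real k / 2) = real k" by simp
    show ?thesis unfolding e powr_minus powr_powr m powr_realpow[OF r] power_one_over inverse_eq_divide ..
  qed
  also have "\<dots> \<le> (1 / 2 ^ n) ^ k" using assms r by (intro power_mono) (auto simp: frac_le)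
  finally show ?thesis .
qed

text \<open>Where the norm is at least \<open>2 ^ n\<close>, the weight is at most
  \<open>2 ^ n\<close> to the power -(d + 1), while the ball of radius \<open>2 ^ Suc n\<close> has
  volume proportional to \<open>2 ^ n\<close> to the power d. The products form a geometric series
  with ratio 1/2.\<close>

lemma weight_integrable:
  "integrable lborel (\<lambda>x::real^'d::finite. (1 + (norm x)\<^sup>2) powr - (real (CARD('d) + 1) / 2))"
proof -
  let ?k = "CARD('d) + 1"
  let ?g = "\<lambda>x::real^'d. (1 + (norm x)\<^sup>2) powr - (real ?k / 2)"
  let ?c = "\<lambda>n::nat. (1 / 2 ^ n :: real) ^ ?k"
  let ?B = "\<lambda>n::nat. ball (0::real^'d) (2 ^ Suc n)"
  have meas: "?g \<in> borel_measurable borel" by measurable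
  have pw: "ennreal (?g x) \<le> (\<Sum>n. ennreal (?c n) * indicator (?B n) x)" for x
  proof -
    have "\<exists>n. x \<in> ?B n \<and> ?g x \<le> ?c n"
    proof (cases "norm x < 2")
      case True
      have "?g x \<le> 1 powr - (real ?k / 2)" by (rule powr_mono2') auto
      then have "x \<in> ?B 0 \<and> ?g x \<le> ?c 0" using True by simp
      then show ?thesis by blast
    next
      case False
      obtain N :: nat where N: "norm x < 2 ^ N" using real_arch_pow[of 2 "norm x"] by auto
      define n where "n = (LEAST n. norm x < 2 ^ n)"
      have n1: "norm x < 2 ^ n" unfolding n_def by (rule LeastI[of _ N]) (rule N)
      have "n \<noteq> 0"
      proof
        assume "n = 0" then show False using n1 False by simp
      qed
      then obtain l where l: "n = Suc l" by (cases n) auto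
      have "\<not> norm x < 2 ^ l" using not_less_Least[of l "\<lambda>n. norm x < 2 ^ n"] l n_def by simp
      then have "?g x \<le> ?c l" by (intro weight_le_dyadic) simp
      then show ?thesis using n1 l by auto
    qed
    then obtain n where n: "x \<in> ?B n" "?g x \<le> ?c n" by blast
    have "ennreal (?g x) \<le> (\<Sum>i\<in>{n}. ennreal (?c i) * indicator (?B i) x)" using n by (simp add: ennreal_leI)
    also have "\<dots> \<le> (\<Sum>i. ennreal (?c i) * indicator (?B i) x)" by (rule sum_le_suminf) auto
    finally show ?thesis .
  qed
  have "(\<integral>\<^sup>+ x. ennreal (?g x) \<partial>lborel) \<le> (\<integral>\<^sup>+ x. (\<Sum>n. ennreal (?c n) * indicator (?B n) x) \<partial>lborel)"
    by (intro nn_integral_mono pw)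
  also have "\<dots> = (\<Sum>n. \<integral>\<^sup>+ x. ennreal (?c n) * indicator (?B n) x \<partial>lborel)"
    by (rule nn_integral_suminf) (intro borel_measurable_times_ennreal borel_measurable_const borel_measurable_indicator; simp)
  also have "\<dots> = (\<Sum>n. ennreal (unit_ball_vol (real CARD('d)) * 2 ^ CARD('d) * (1/2) ^ n))"
  proof (rule suminf_cong)
    fix n
    have "(\<integral>\<^sup>+ x. ennreal (?c n) * indicator (?B n) x \<partial>lborel) = ennreal (?c n) * emeasure lborel (?B n)"
      by (rule nn_integral_cmult_indicator) simp
    also have "\<dots> = ennreal (?c n * (unit_ball_vol (real CARD('d)) * (2 ^ Suc n) ^ CARD('d)))"
      by (subst emeasure_ball) (auto simp: ennreal_mult[symmetric])
    also have "?c n * (unit_ball_vol (real CARD('d)) * (2 ^ Suc n) ^ CARD('d)) = unit_ball_vol (real CARD('d)) * 2 ^ CARD('d) * (1/2) ^ n"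
    proof -
      have "(1 / 2 ^ n :: real) ^ CARD('d) * (2 ^ n) ^ CARD('d) = 1" by (simp flip: power_mult_distrib)
      then have "(1 / 2 ^ n :: real) ^ ?k * (2 ^ Suc n) ^ CARD('d) = 2 ^ CARD('d) * (1/2) ^ n"
        by (simp add: power_mult_distrib power_one_over mult_ac)
      then show ?thesis by (simp add: mult_ac)
    qed
    finally show "(\<integral>\<^sup>+ x. ennreal (?c n) * indicator (?B n) x \<partial>lborel) = ennreal (unit_ball_vol (real CARD('d)) * 2 ^ CARD('d) * (1/2) ^ n)" .
  qed
  also have "\<dots> < \<infinity>"
  proof -
    have "(\<Sum>n. ennreal (unit_ball_vol (real CARD('d)) * 2 ^ CARD('d) * (1/2) ^ n)) \<noteq> top"
      by (rule ennreal_suminf_neq_top) (auto intro!: summable_mult summable_geometric)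
    then show ?thesis by (simp add: less_top)
  qed
  finally show ?thesis using meas by (intro integrableI_bounded) auto
qed

subsection \<open>Eigenvalues\<close>

lemma Rstar_AE: "AE x in lborel. x \<in> (Rstar :: (real^'d::finite) set)"
proof -
  have n: "{x::real^'d. x $ j = 0} \<in> null_sets lborel" for j
  proof -
    have "negligible {x::real^'d. x $ j = 0}" by (rule negligible_standard_hyperplane_cart)
    then have "{x::real^'d. x $ j = 0} \<in> null_sets (completion lborel)" by (simp add: negligible_iff_null_sets)
    moreover have "closed {x::real^'d. x $ j = 0}" by (intro closed_Collect_eq continuous_intros)
    then have "{x::real^'d. x $ j = 0} \<in> sets lborel" by (simp add: borel_closed)
    ultimately show ?thesis by (simp add: null_sets_completion_iff)
  qed
  then have "AE x in lborel. (x::real^'d) $ j \<noteq> 0" for j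
    using AE_not_in[OF n[of j]] by simp
  then have "AE x in lborel. \<forall>j. (x::real^'d) $ j \<noteq> 0" by (subst AE_all_countable) blast
  then show ?thesis by (simp add: Rstar_def)
qed

lemma not_cbx: "R < \<bar>x $ i\<bar> \<Longrightarrow> x \<notin> cbx R"
  by (auto simp: cbx_def not_le)

text \<open>Difference quotients have integral 0 by translation invariance, and they converge
  dominatedly: the mean value estimate bounds them on a slightly larger cube, outside of which they
  vanish.\<close>

lemma integral_pd_zero:
  assumes f: "test f" shows "(LINT x|lborel. pd j f x) = 0"
proof -
  let ?h = "\<lambda>n. 1 / real (Suc n)"
  let ?e = "axis j 1 :: real^'a"
  let ?q = "\<lambda>n x. (f (x + ?h n *\<^sub>R ?e) - f x) / complex_of_real (?h n)"
  have [measurable]: "f \<in> borel_measurable borel" "pd j f \<in> borel_measurable borel"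
    by (intro test_measurable f test_pd)+
  obtain R where R: "R > 0" "\<forall>x. x \<notin> cbx R \<longrightarrow> f x = 0" using test_supp[OF f] by blast
  obtain B where B: "B \<ge> 0" "\<And>x. cmod (pd j f x) \<le> B" using test_bounded[OF test_pd[OF f]] by blast
  have l: "(\<lambda>n. LINT x|lborel. ?q n x) \<longlonglongrightarrow> (LINT x|lborel. pd j f x)"
  proof (rule integral_dominated_convergence[where w = "\<lambda>x. B * indicator (cbx (R + 1)) x"])
    show "pd j f \<in> borel_measurable lborel" "?q n \<in> borel_measurable lborel" for n by measurable
    show "integrable lborel (\<lambda>x::real^'a. B * indicator (cbx (R + 1)) x)"
      unfolding cbx_eq by (intro integrable_mult_right integrable_real_indicator) (auto simp: emeasure_lborel_cbox_eq)
    have "(\<lambda>n. ?q n x) \<longlonglongrightarrow> pd j f x" for x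
    proof -
      have "(\<lambda>n. (f (x + (0 + ?h n) *\<^sub>R ?e) - f (x + 0 *\<^sub>R ?e)) / complex_of_real (?h n)) \<longlonglongrightarrow> pd j f x"
        by (rule diff_quotient_LIMSEQ[OF smooth_deriv0[OF test_smooth[OF f]]]) (use LIMSEQ_Suc[OF lim_inverse_n'] in auto)
      then show ?thesis by simp
    qed
    then show "AE x in lborel. (\<lambda>n. ?q n x) \<longlonglongrightarrow> pd j f x" by simp
    have "norm (?q n x) \<le> B * indicator (cbx (R + 1)) x" for n x
    proof (cases "x \<in> cbx (R + 1)")
      case True
      have hp: "\<bar>?h n\<bar> > 0" by simp
      have "norm (?q n x) \<le> B" unfolding norm_divide norm_of_real pos_divide_le_eq[OF hp]
        by (rule smooth_mean_value[OF test_smooth[OF f] B(2)])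
      then show ?thesis using True by simp
    next
      case False
      then obtain i where i: "\<bar>x $ i\<bar> > R + 1" by (auto simp: cbx_def not_le)
      have "\<bar>(x + ?h n *\<^sub>R ?e) $ i - x $ i\<bar> \<le> 1" by (simp add: axis_nth_if)
      then have "\<bar>(x + ?h n *\<^sub>R ?e) $ i\<bar> > R" using i by linarith
      then have "x + ?h n *\<^sub>R ?e \<notin> cbx R" by (rule not_cbx)
      moreover have "x \<notin> cbx R" by (rule not_cbx[of _ x i]) (use i in linarith)
      ultimately show ?thesis using R B(1) by simp
    qed
    then show "AE x in lborel. norm (?q n x) \<le> B * indicator (cbx (R + 1)) x" for n by simp
  qed
  have z: "(LINT x|lborel. ?q n x) = 0" for n
  proof -
    have i: "integrable lborel f" by (rule test_integrable[OF f])
    obtain Bf where Bf: "\<And>x. cmod (f x) \<le> Bf" using test_bounded[OF f] by blast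
    have i2: "integrable lborel (\<lambda>x. f (x + ?h n *\<^sub>R ?e))"
    proof (rule integrable_bounded_support[where S = "cbx (R + 1)" and B = Bf])
      show "cmod (f (x + ?h n *\<^sub>R ?e)) \<le> Bf" for x by (rule Bf)
      fix x :: "real^'a" assume "x \<notin> cbx (R + 1)"
      then obtain i where i: "\<bar>x $ i\<bar> > R + 1" by (auto simp: cbx_def not_le)
      have "\<bar>(x + ?h n *\<^sub>R ?e) $ i - x $ i\<bar> \<le> 1" by (simp add: axis_nth_if)
      then have "\<bar>(x + ?h n *\<^sub>R ?e) $ i\<bar> > R" using i by linarith
      then have "x + ?h n *\<^sub>R ?e \<notin> cbx R" by (rule not_cbx)
      then show "f (x + ?h n *\<^sub>R ?e) = 0" using R by simp
    qed (auto intro: compact_imp_bounded)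
    have "(LINT x|lborel. f (x + ?h n *\<^sub>R ?e)) = (LINT x|lborel. f x)"
      using lint_translate[of f "?h n *\<^sub>R ?e"] by (simp add: add.commute)
    then have "(LINT x|lborel. f (x + ?h n *\<^sub>R ?e) - f x) = 0"
      by (subst Bochner_Integration.integral_diff[OF i2 i]) simp
    then show ?thesis by (simp only: Bochner_Integration.integral_divide_zero div_0)
  qed
  show ?thesis by (rule LIMSEQ_unique[OF l[unfolded z] tendsto_const])
qed

section \<open>Monomials and \<open>sgx\<close> under Euler operators\<close>

definition mon :: "('d::finite \<Rightarrow> nat) \<Rightarrow> 'd tfun" where
  "mon \<alpha> = tensor (\<lambda>j s. s ^ \<alpha> j)"

lemma smooth_real_power: "smooth_real (\<lambda>s. s ^ n)"
  by (induction n) (auto intro: smooth_real_mult)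

lemma smooth_mon: "smooth_fun (mon \<alpha>)"
  unfolding mon_def by (intro smooth_tensor smooth_real_power)

lemma mono_eq: "mono \<alpha> f = (if test f then LINT x|lborel. mon \<alpha> x * f x else 0)"
  by (simp add: mono_def mon_def tensor_def)

lemma pd_mon: "complex_of_real (x $ j) * pd j (mon \<alpha>) x = of_nat (\<alpha> j) * mon \<alpha> x"
proof -
  let ?g = "\<lambda>s::real. real (\<alpha> j) * s ^ (\<alpha> j - 1)"
  have "((\<lambda>s. mon \<alpha> (x + s *\<^sub>R axis j 1)) has_vector_derivative tensor ((\<lambda>j s. s ^ \<alpha> j)(j := ?g)) x) (at 0)"
    unfolding mon_def by (rule tensor_deriv) (auto intro!: derivative_eq_intros)
  then have pd: "pd j (mon \<alpha>) x = tensor ((\<lambda>j s. s ^ \<alpha> j)(j := ?g)) x" by (rule pd_eqI)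
  have "x $ j * (\<Prod>i\<in>UNIV. ((\<lambda>j s. s ^ \<alpha> j)(j := ?g)) i (x $ i)) = real (\<alpha> j) * (\<Prod>i\<in>UNIV. (x $ i) ^ \<alpha> i)"
  proof -
    have 1: "(\<Prod>i\<in>UNIV. ((\<lambda>j s. s ^ \<alpha> j)(j := ?g)) i (x $ i)) = ?g (x $ j) * (\<Prod>i\<in>UNIV - {j}. (x $ i) ^ \<alpha> i)"
      by (subst prod.remove[of UNIV j]) (auto intro!: prod.cong)
    have 2: "(\<Prod>i\<in>UNIV. (x $ i) ^ \<alpha> i) = (x $ j) ^ \<alpha> j * (\<Prod>i\<in>UNIV - {j}. (x $ i) ^ \<alpha> i)"
      by (subst prod.remove[of UNIV j]) auto
    have 3: "x $ j * ?g (x $ j) = real (\<alpha> j) * (x $ j) ^ \<alpha> j" by (cases "\<alpha> j") auto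
    show ?thesis unfolding 1 2 mult.assoc[symmetric, of "x $ j" "?g (x $ j)"] 3 by (simp only: mult.assoc)
  qed
  from arg_cong[OF this, of complex_of_real]
  show ?thesis unfolding pd unfolding mon_def tensor_def by (simp only: of_real_mult of_real_of_nat_eq)
qed

text \<open>Integration by parts moves the operator to the monomial, an eigenfunction of
  \<open>euler j\<close> with eigenvalue \<open>\<alpha> j\<close>.\<close>

lemma integral_mon_euler_adj:
  assumes f: "test f"
  shows "(LINT x|lborel. mon \<alpha> x * euler_adj j f x) = of_nat (\<alpha> j) * (LINT x|lborel. mon \<alpha> x * f x)"
proof -
  let ?xf = "\<lambda>x. complex_of_real (x $ j) * f x"
  have t: "test ?xf" by (intro test_mult smooth_coord f)
  note sm = smooth_mon[of \<alpha>]
  have "0 = (LINT x|lborel. pd j (\<lambda>x. mon \<alpha> x * ?xf x) x)"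
    by (rule integral_pd_zero[OF test_mult[OF sm t], symmetric])
  also have "\<dots> = (LINT x|lborel. of_nat (\<alpha> j) * (mon \<alpha> x * f x) - mon \<alpha> x * euler_adj j f x)"
  proof (rule Bochner_Integration.integral_cong[OF refl])
    fix x
    have "pd j (\<lambda>x. mon \<alpha> x * ?xf x) x = pd j (mon \<alpha>) x * ?xf x + mon \<alpha> x * pd j ?xf x"
      unfolding pd_mult[OF sm test_smooth[OF t]] ..
    also have "pd j (mon \<alpha>) x * ?xf x = (complex_of_real (x $ j) * pd j (mon \<alpha>) x) * f x" by simp
    finally show "pd j (\<lambda>x. mon \<alpha> x * ?xf x) x = of_nat (\<alpha> j) * (mon \<alpha> x * f x) - mon \<alpha> x * euler_adj j f x"
      unfolding pd_mon euler_adj_def by simp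
  qed
  also have "\<dots> = of_nat (\<alpha> j) * (LINT x|lborel. mon \<alpha> x * f x) - (LINT x|lborel. mon \<alpha> x * euler_adj j f x)"
    by (subst Bochner_Integration.integral_diff)
      (auto intro!: integrable_mult_right test_integrable test_mult sm f test_euler_adj)
  finally show ?thesis by simp
qed

definition eigen_weight :: "('d::finite \<Rightarrow> nat) \<Rightarrow> 'd list \<Rightarrow> complex" where
  "eigen_weight \<alpha> bs = prod_list (map (\<lambda>j. of_nat (\<alpha> j)) bs)"

lemma integral_mon_euler_adj_list:
  "test f \<Longrightarrow> (LINT x|lborel. mon \<alpha> x * euler_adj_list bs f x) = eigen_weight \<alpha> bs * (LINT x|lborel. mon \<alpha> x * f x)"
proof (induction bs arbitrary: f)
  case (Cons b bs)
  then show ?case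
    by (simp add: euler_adj_list_Cons eigen_weight_def integral_mon_euler_adj test_euler_adj)
qed (simp add: eigen_weight_def)

text \<open>Near a point of \<open>Rstar\<close> the sign is constant and
  \<open>x $ j * sgx \<alpha> x\<close> depends on coordinate \<open>j\<close> as its power
  \<open>- \<alpha> j\<close>, so minus the derivative reproduces \<open>sgx\<close> with factor
  \<open>\<alpha> j\<close>. Agreement is assumed on \<open>Rstar\<close> only, and up to a
  constant, so that the lemma can be iterated.\<close>

lemma euler_adj_sgx:
  fixes g :: "'d::finite tfun"
  assumes g: "\<And>y. y \<in> Rstar \<Longrightarrow> g y = c * sgx \<alpha> y" and x: "x \<in> Rstar"
  shows "euler_adj j g x = (of_nat (\<alpha> j) * c) * sgx \<alpha> x"
proof -
  let ?e = "axis j 1 :: real^'d"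
  let ?a = "x $ j"
  have a: "?a \<noteq> 0" using x by (simp add: Rstar_def)
  let ?K = "\<Prod>i\<in>UNIV - {j}. sgn (x $ i) / (x $ i) ^ (\<alpha> i + 1)"
  have sx: "sgx \<alpha> x = complex_of_real (sgn ?a / ?a ^ (\<alpha> j + 1) * ?K)"
    unfolding sgx_def by (subst prod.remove[of UNIV j]) auto
  have ev: "\<forall>\<^sub>F s in nhds 0. complex_of_real ((x + s *\<^sub>R ?e) $ j) * g (x + s *\<^sub>R ?e) = c * complex_of_real (sgn ?a / (?a + s) ^ \<alpha> j * ?K)"
  proof -
    have "((\<lambda>s. ?a * (?a + s)) \<longlongrightarrow> ?a * (?a + 0)) (nhds 0)"
      by (intro tendsto_intros) (simp add: filterlim_ident)
    moreover have "?a * (?a + 0) > 0" using a by (simp add: zero_less_mult_iff) linarith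
    ultimately have "\<forall>\<^sub>F s in nhds 0. ?a * (?a + s) > 0" by (rule order_tendstoD(1))
    then show ?thesis
    proof eventually_elim
      case (elim s)
      then have as: "?a + s \<noteq> 0" "sgn (?a + s) = sgn ?a" by (auto simp: zero_less_mult_iff sgn_if)
      have "x + s *\<^sub>R ?e \<in> Rstar" using x as by (auto simp: Rstar_def axis_nth_if)
      then have A: "g (x + s *\<^sub>R ?e) = c * sgx \<alpha> (x + s *\<^sub>R ?e)" by (rule g)
      have B: "sgx \<alpha> (x + s *\<^sub>R ?e) = complex_of_real (sgn ?a / (?a + s) ^ (\<alpha> j + 1) * ?K)"
        unfolding sgx_def
        by (subst prod.remove[of UNIV j]) (auto simp: axis_nth_if as simp del: of_real_mult of_real_prod intro!: arg_cong[of _ _ complex_of_real] prod.cong)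
      have C: "(x + s *\<^sub>R ?e) $ j = ?a + s" by (simp add: axis_nth_if)
      have D: "complex_of_real (?a + s) * complex_of_real (sgn ?a / (?a + s) ^ (\<alpha> j + 1) * ?K) = complex_of_real (sgn ?a / (?a + s) ^ \<alpha> j * ?K)"
        unfolding of_real_mult[symmetric] using as(1) by (intro arg_cong[of _ _ complex_of_real]) simp
      show ?case unfolding A B C D[symmetric] by (rule mult.left_commute)
    qed
  qed
  have "((\<lambda>s. sgn ?a / (?a + s) ^ \<alpha> j * ?K) has_real_derivative - real (\<alpha> j) * (sgn ?a / ?a ^ (\<alpha> j + 1) * ?K)) (at 0)"
  proof -
    have d1: "((\<lambda>s. (?a + s) ^ \<alpha> j) has_real_derivative real (\<alpha> j) * ?a ^ (\<alpha> j - 1)) (at 0)"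
      by (auto intro!: derivative_eq_intros)
    have d2: "((\<lambda>s. sgn ?a / (?a + s) ^ \<alpha> j) has_real_derivative (0 * (?a + 0) ^ \<alpha> j - sgn ?a * (real (\<alpha> j) * ?a ^ (\<alpha> j - 1))) / ((?a + 0) ^ \<alpha> j * (?a + 0) ^ \<alpha> j)) (at 0)"
      by (rule DERIV_divide[OF DERIV_const d1]) (use a in simp)
    have eq: "(0 * (?a + 0) ^ \<alpha> j - sgn ?a * (real (\<alpha> j) * ?a ^ (\<alpha> j - 1))) / ((?a + 0) ^ \<alpha> j * (?a + 0) ^ \<alpha> j) = - real (\<alpha> j) * (sgn ?a / ?a ^ (\<alpha> j + 1))"
      using a by (cases "\<alpha> j") (auto simp: field_simps)
    show ?thesis using DERIV_cmult_right[OF d2[unfolded eq], of ?K] by (simp only: mult.assoc)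
  qed
  from has_vector_derivative_mult_right[OF has_vector_derivative_of_real[OF this], of c]
  have "((\<lambda>s. c * complex_of_real (sgn ?a / (?a + s) ^ \<alpha> j * ?K)) has_vector_derivative c * complex_of_real (- real (\<alpha> j) * (sgn ?a / ?a ^ (\<alpha> j + 1) * ?K))) (at 0)" .
  then have "((\<lambda>s. complex_of_real ((x + s *\<^sub>R ?e) $ j) * g (x + s *\<^sub>R ?e)) has_vector_derivative c * complex_of_real (- real (\<alpha> j) * (sgn ?a / ?a ^ (\<alpha> j + 1) * ?K))) (at 0)"
    using has_vector_derivative_cong_ev[where S = UNIV and f = "\<lambda>s. complex_of_real ((x + s *\<^sub>R ?e) $ j) * g (x + s *\<^sub>R ?e)" and g = "\<lambda>s. c * complex_of_real (sgn ?a / (?a + s) ^ \<alpha> j * ?K)" and x = 0]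
      ev eventually_nhds_x_imp_x[OF ev] by (auto elim: eventually_mono)
  from pd_eqI[OF this] show ?thesis unfolding euler_adj_def sx by simp
qed

lemma euler_adj_list_sgx:
  "(\<And>y. y \<in> Rstar \<Longrightarrow> g y = c * sgx \<alpha> y) \<Longrightarrow> x \<in> Rstar \<Longrightarrow> euler_adj_list bs g x = eigen_weight \<alpha> bs * c * sgx \<alpha> x"
proof (induction bs arbitrary: g c)
  case (Cons b bs)
  have "euler_adj_list bs (euler_adj b g) x = eigen_weight \<alpha> bs * (of_nat (\<alpha> b) * c) * sgx \<alpha> x"
    by (rule Cons.IH[OF euler_adj_sgx[OF Cons.prems(1)] Cons.prems(2)])
  then show ?case by (simp add: euler_adj_list_Cons eigen_weight_def)
qed (simp add: eigen_weight_def)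

lemma euler_fdil: "smooth_fun f \<Longrightarrow> euler j (fdil y f) = fdil y (euler j f)"
proof
  fix x assume f: "smooth_fun f"
  have "pd j (fdil y f) x = complex_of_real (y $ j) * pd j f (dil x y)"
    using pd_eqI[OF pd_fdil_deriv[OF f, of x j y]] by (simp add: fdil_def)
  then show "euler j (fdil y f) x = fdil y (euler j f) x" by (simp add: euler_def fdil_def)
qed

lemma euler_adj_list_fdil: "test f \<Longrightarrow> euler_adj_list bs (fdil y f) = fdil y (euler_adj_list bs f)"
proof (induction bs arbitrary: f)
  case (Cons b bs)
  have "euler_adj b (fdil y f) = fdil y (euler_adj b f)"
    using Cons.prems by (simp add: euler_adj_eq smooth_fdil test_smooth euler_fdil) (simp add: fdil_def)
  then show ?case using Cons by (simp add: euler_adj_list_Cons test_euler_adj)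
qed simp

text \<open>Substituting \<open>z = dil x y\<close> brings out the reciprocals of
  \<open>mon \<alpha> x\<close> and of the Jacobian, the product of the \<open>|x $ j|\<close>.
  Their product is \<open>sgx \<alpha> x\<close>; this is where the function in the eigenvalue
  formula comes from.\<close>

lemma integral_mon_dil:
  assumes x: "x \<in> Rstar" and h: "test h"
  shows "(LINT y|lborel. mon \<alpha> y * h (dil x y)) = sgx \<alpha> x * (LINT z|lborel. mon \<alpha> z * h z)"
    and "(LINT y|lborel. cmod (mon \<alpha> y * h (dil x y))) = cmod (sgx \<alpha> x) * (LINT z|lborel. cmod (mon \<alpha> z * h z))"
    and "integrable lborel (\<lambda>y. mon \<alpha> y * h (dil x y))"
proof -
  let ?g = "\<lambda>z. mon \<alpha> z * h z"
  have tg: "test ?g" by (rule test_mult[OF smooth_mon h])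
  have gm [measurable]: "?g \<in> borel_measurable borel" by (rule test_measurable[OF tg])
  have m: "mon \<alpha> (dil y x) = mon \<alpha> x * mon \<alpha> y" for y
    by (simp add: mon_def tensor_def power_mult_distrib prod.distrib mult.commute)
  have mx: "mon \<alpha> x \<noteq> 0" using x by (simp add: mon_def tensor_def Rstar_def)
  let ?p = "\<Prod>j\<in>UNIV. \<bar>x $ j\<bar>"
  have p: "?p \<noteq> 0" using x by (simp add: Rstar_def)
  have s: "sgx \<alpha> x * (complex_of_real ?p * mon \<alpha> x) = 1"
  proof -
    have "(\<Prod>j\<in>UNIV. sgn (x $ j) / (x $ j) ^ (\<alpha> j + 1)) * (?p * (\<Prod>j\<in>UNIV. (x $ j) ^ \<alpha> j)) = (\<Prod>j\<in>UNIV. sgn (x $ j) / (x $ j) ^ (\<alpha> j + 1) * (\<bar>x $ j\<bar> * (x $ j) ^ \<alpha> j))"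
      by (simp only: prod.distrib)
    also have "\<dots> = 1"
    proof (rule prod.neutral, rule ballI)
      fix j
      have "x $ j \<noteq> 0" using x by (simp add: Rstar_def)
      then show "sgn (x $ j) / (x $ j) ^ (\<alpha> j + 1) * (\<bar>x $ j\<bar> * (x $ j) ^ \<alpha> j) = 1"
        by (simp add: sgn_if abs_if)
    qed
    finally show ?thesis unfolding sgx_def mon_def tensor_def by (simp only: of_real_mult[symmetric] of_real_1)
  qed
  have eq: "?g (dil y x) = mon \<alpha> x * (mon \<alpha> y * h (dil x y))" for y by (simp only: m dil_commute[of x y] mult.assoc)
  have i: "integrable lborel (\<lambda>y. mon \<alpha> x * (mon \<alpha> y * h (dil x y)))"
    using lborel_dil(2)[OF x gm test_integrable[OF tg]] unfolding eq .
  then have "integrable lborel (\<lambda>y. (1 / mon \<alpha> x) * (mon \<alpha> x * (mon \<alpha> y * h (dil x y))))" by (rule integrable_mult_right)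
  then show int: "integrable lborel (\<lambda>y. mon \<alpha> y * h (dil x y))" using mx by simp
  have "(LINT z|lborel. ?g z) = complex_of_real ?p * (mon \<alpha> x * (LINT y|lborel. mon \<alpha> y * h (dil x y)))"
    using lborel_dil(1)[OF x gm] unfolding eq by (simp only: scaleR_conv_of_real Bochner_Integration.integral_mult_right_zero)
  then have "sgx \<alpha> x * (LINT z|lborel. ?g z) = (sgx \<alpha> x * (complex_of_real ?p * mon \<alpha> x)) * (LINT y|lborel. mon \<alpha> y * h (dil x y))"
    by (simp only: mult.assoc)
  then show "(LINT y|lborel. mon \<alpha> y * h (dil x y)) = sgx \<alpha> x * (LINT z|lborel. mon \<alpha> z * h z)"
    by (simp only: s mult_1)
  have "(LINT z|lborel. cmod (?g z)) = ?p * (cmod (mon \<alpha> x) * (LINT y|lborel. cmod (mon \<alpha> y * h (dil x y))))"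
    using lborel_dil(1)[OF x, of "\<lambda>z. cmod (?g z)"] unfolding eq norm_mult[of "mon \<alpha> x"]
    by (simp only: real_scaleR_def Bochner_Integration.integral_mult_right_zero) measurable
  then have "cmod (sgx \<alpha> x) * (LINT z|lborel. cmod (?g z)) = (cmod (sgx \<alpha> x) * (?p * cmod (mon \<alpha> x))) * (LINT y|lborel. cmod (mon \<alpha> y * h (dil x y)))"
    by (simp only: mult.assoc)
  moreover have "cmod (sgx \<alpha> x) * (?p * cmod (mon \<alpha> x)) = 1"
    using arg_cong[OF s, of cmod] unfolding norm_mult norm_of_real by (simp add: prod_nonneg abs_prod)
  ultimately show "(LINT y|lborel. cmod (mon \<alpha> y * h (dil x y))) = cmod (sgx \<alpha> x) * (LINT z|lborel. cmod (mon \<alpha> z * h z))"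
    by simp
qed

lemma decaying_integrable:
  fixes t :: "'d::finite tfun"
  assumes t: "t \<in> borel_measurable lborel" and C: "\<And>x. (1 + (norm x)\<^sup>2) powr (real (CARD('d) + 1) / 2) * cmod (t x) \<le> C"
  shows "integrable lborel t"
proof (rule Bochner_Integration.integrable_bound)
  let ?k = "real (CARD('d) + 1) / 2"
  show "integrable lborel (\<lambda>x::real^'d. C * (1 + (norm x)\<^sup>2) powr - ?k)"
    by (intro integrable_mult_right weight_integrable)
  show "t \<in> borel_measurable lborel" by (rule t)
  have "norm (t x) \<le> C * (1 + (norm x)\<^sup>2) powr - ?k" for x
  proof -
    have "1 + (norm x)\<^sup>2 > 0" by (rule add_pos_nonneg) auto
    then have pos: "(1 + (norm x)\<^sup>2) powr ?k > 0" by simp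
    then have "cmod (t x) \<le> C / (1 + (norm x)\<^sup>2) powr ?k" using C[of x] by (simp add: pos_le_divide_eq mult.commute)
    then show ?thesis by (simp only: powr_minus_divide times_divide_eq_right mult_1_right)
  qed
  then show "AE x in lborel. norm (t x) \<le> norm (C * (1 + (norm x)\<^sup>2) powr - ?k)"
    unfolding real_norm_def by (intro always_eventually allI order_trans[OF _ abs_ge_self])
qed

lemma sgx_bounded:
  assumes \<epsilon>: "\<epsilon> > 0" and x: "\<And>j. \<bar>x $ j\<bar> \<ge> \<epsilon>"
  shows "cmod (sgx \<alpha> x) \<le> (\<Prod>j\<in>UNIV. 1 / \<epsilon> ^ (\<alpha> j + 1))"
  unfolding sgx_def norm_of_real abs_prod
proof (intro prod_mono conjI)
  fix j
  have "\<epsilon> ^ (\<alpha> j + 1) \<le> \<bar>x $ j\<bar> ^ (\<alpha> j + 1)" using x[of j] \<epsilon> by (intro power_mono) auto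
  moreover have "\<bar>sgn (x $ j)\<bar> \<le> 1" by (simp add: sgn_if)
  ultimately show "\<bar>sgn (x $ j) / (x $ j) ^ (\<alpha> j + 1)\<bar> \<le> 1 / \<epsilon> ^ (\<alpha> j + 1)"
    unfolding abs_divide power_abs using \<epsilon> by (intro frac_le) auto
qed auto

text \<open>Fubini, with the inner integral computed by \<open>integral_mon_dil\<close>. Absolute
  convergence holds because \<open>t\<close> is integrable and \<open>sgx \<alpha>\<close> is
  bounded on the set where \<open>t\<close> is nonzero.\<close>

lemma monomial_pairing:
  fixes t :: "'d::finite tfun"
  assumes \<epsilon>: "\<epsilon> > 0" and tm: "t \<in> borel_measurable lborel" and t0: "\<And>x j. \<bar>x $ j\<bar> < \<epsilon> \<Longrightarrow> t x = 0"
    and C: "\<And>x. (1 + (norm x)\<^sup>2) powr (real (CARD('d) + 1) / 2) * cmod (t x) \<le> C" and h: "test h"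
  shows "(LINT y|lborel. mon \<alpha> y * (LINT x|lborel. t x * h (dil x y))) = (LINT x|lborel. t x * sgx \<alpha> x) * (LINT z|lborel. mon \<alpha> z * h z)"
    and "integrable lborel (\<lambda>y. mon \<alpha> y * (LINT x|lborel. t x * h (dil x y)))"
proof -
  have it: "integrable lborel t" by (rule decaying_integrable[OF tm C])
  have [measurable]: "t \<in> borel_measurable borel" using tm by simp
  have [measurable]: "h \<in> borel_measurable borel" by (rule test_measurable[OF h])
  have [measurable]: "mon \<alpha> \<in> borel_measurable borel"
    by (rule borel_measurable_continuous_onI[OF smooth_cont[OF smooth_mon]])
  have [measurable]: "sgx \<alpha> \<in> borel_measurable borel" unfolding sgx_def[abs_def] by measurable
  have tR: "x \<in> Rstar" if "t x \<noteq> 0" for x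
  proof -
    have "\<bar>x $ j\<bar> \<ge> \<epsilon>" for j using t0[of x j] that by force
    then have "x $ j \<noteq> 0" for j using \<epsilon> by (metis abs_zero not_le)
    then show ?thesis by (simp add: Rstar_def)
  qed
  let ?F = "\<lambda>x y. t x * (mon \<alpha> y * h (dil x y))"
  let ?\<kappa> = "LINT z|lborel. cmod (mon \<alpha> z * h z)"
  let ?S = "\<Prod>j\<in>UNIV. 1 / \<epsilon> ^ (\<alpha> j + 1)"
  have Fm: "(\<lambda>(x, y). ?F x y) \<in> borel_measurable (lborel \<Otimes>\<^sub>M lborel)"
  proof -
    have "(\<lambda>q::(real^'d) \<times> (real^'d). dil (fst q) (snd q)) \<in> borel_measurable borel"
      by (intro borel_measurable_continuous_onI continuous_intros)
    then have [measurable]: "(\<lambda>q::(real^'d) \<times> (real^'d). dil (fst q) (snd q)) \<in> borel_measurable (borel \<Otimes>\<^sub>M borel)"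
      by (simp add: borel_prod)
    show ?thesis unfolding lborel_prod case_prod_beta
      by (simp add: borel_prod[symmetric])
  qed
  have F: "integrable (lborel \<Otimes>\<^sub>M lborel) (\<lambda>(x, y). ?F x y)"
  proof (rule lborel_pair.Fubini_integrable[OF Fm])
    have "(LINT y|lborel. norm (case (x, y) of (x, y) \<Rightarrow> ?F x y)) = cmod (t x) * cmod (sgx \<alpha> x) * ?\<kappa>" for x
    proof (cases "t x = 0")
      case False
      show ?thesis using integral_mon_dil(2)[OF tR[OF False] h, of \<alpha>] by (simp add: norm_mult mult.assoc)
    qed simp
    then have eq: "(\<lambda>x. LINT y|lborel. norm (case (x, y) of (x, y) \<Rightarrow> ?F x y)) = (\<lambda>x. cmod (t x) * cmod (sgx \<alpha> x) * ?\<kappa>)" by blast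
    have "integrable lborel (\<lambda>x. cmod (t x) * cmod (sgx \<alpha> x))"
    proof (rule Bochner_Integration.integrable_bound)
      show "integrable lborel (\<lambda>x. ?S * cmod (t x))" by (intro integrable_mult_right integrable_norm it)
      show "(\<lambda>x. cmod (t x) * cmod (sgx \<alpha> x)) \<in> borel_measurable lborel" by measurable
      have S: "?S \<ge> 0" using \<epsilon> by (intro prod_nonneg) auto
      have "norm (cmod (t x) * cmod (sgx \<alpha> x)) \<le> norm (?S * cmod (t x))" for x
      proof (cases "t x = 0")
        case False
        have "\<bar>x $ j\<bar> \<ge> \<epsilon>" for j using t0[of x j] False by force
        from sgx_bounded[OF \<epsilon> this, of \<alpha>]
        have "cmod (sgx \<alpha> x) * cmod (t x) \<le> ?S * cmod (t x)" by (rule mult_right_mono) simp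
        then show ?thesis using S by (simp only: real_norm_def abs_mult abs_norm_cancel abs_of_nonneg mult.commute[of "cmod (t x)" "cmod (sgx \<alpha> x)"])
      qed simp
      then show "AE x in lborel. norm (cmod (t x) * cmod (sgx \<alpha> x)) \<le> norm (?S * cmod (t x))" by blast
    qed
    then show "integrable lborel (\<lambda>x. LINT y|lborel. norm (case (x, y) of (x, y) \<Rightarrow> ?F x y))"
      unfolding eq by (rule integrable_mult_left)
    have "integrable lborel (\<lambda>y. case (x, y) of (x, y) \<Rightarrow> ?F x y)" for x
    proof (cases "t x = 0")
      case False
      show ?thesis using integral_mon_dil(3)[OF tR[OF False] h] by simp
    qed simp
    then show "AE x in lborel. integrable lborel (\<lambda>y. case (x, y) of (x, y) \<Rightarrow> ?F x y)" by simp
  qed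
  have e: "(LINT x|lborel. ?F x y) = mon \<alpha> y * (LINT x|lborel. t x * h (dil x y))" for y
  proof -
    have "(\<lambda>x. ?F x y) = (\<lambda>x. mon \<alpha> y * (t x * h (dil x y)))" by (simp add: mult_ac)
    then show ?thesis by simp
  qed
  show "integrable lborel (\<lambda>y. mon \<alpha> y * (LINT x|lborel. t x * h (dil x y)))"
    using lborel_pair.integrable_snd[OF F] unfolding e .
  have "(LINT y|lborel. mon \<alpha> y * (LINT x|lborel. t x * h (dil x y))) = (LINT y|lborel. LINT x|lborel. ?F x y)"
    unfolding e ..
  also have "\<dots> = (LINT x|lborel. LINT y|lborel. ?F x y)" by (rule lborel_pair.Fubini_integral[OF F])
  also have "\<dots> = (LINT x|lborel. (t x * sgx \<alpha> x) * (LINT z|lborel. mon \<alpha> z * h z))"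
  proof (rule Bochner_Integration.integral_cong[OF refl])
    fix x
    show "(LINT y|lborel. ?F x y) = (t x * sgx \<alpha> x) * (LINT z|lborel. mon \<alpha> z * h z)"
    proof (cases "t x = 0")
      case False
      show ?thesis using integral_mon_dil(1)[OF tR[OF False] h, of \<alpha>] by (simp add: mult.assoc)
    qed simp
  qed
  also have "\<dots> = (LINT x|lborel. t x * sgx \<alpha> x) * (LINT z|lborel. mon \<alpha> z * h z)" by simp
  finally show "(LINT y|lborel. mon \<alpha> y * (LINT x|lborel. t x * h (dil x y))) = (LINT x|lborel. t x * sgx \<alpha> x) * (LINT z|lborel. mon \<alpha> z * h z)" .
qed

text \<open>Euler adjoints commute with dilations, so they can act on \<open>f\<close> before the
  pairing with the monomial. There they yield the factor \<open>eigen_weight\<close>, the same one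
  that they yield on \<open>sgx \<alpha>\<close>; hence the value is
  \<open>rep_val R (sgx \<alpha>)\<close>, for an arbitrary admissible \<open>R\<close>.\<close>

lemma mono_MT:
  fixes T :: "'d::finite distr"
  assumes T: "DH T" and R: "admissible_rep T R" and f: "test f"
  shows "mono \<alpha> (MT T f) = rep_val R (sgx \<alpha>) * mono \<alpha> f"
proof -
  obtain \<epsilon> where \<epsilon>: "\<epsilon> > 0" and Rp: "\<And>p. p \<in> set R \<Longrightarrow> snd p \<in> borel_measurable lborel"
      "\<And>p x j. p \<in> set R \<Longrightarrow> \<bar>x $ j\<bar> < \<epsilon> \<Longrightarrow> snd p x = 0"
      "\<And>p. p \<in> set R \<Longrightarrow> \<exists>C. \<forall>x. (1 + (norm x)\<^sup>2) powr (real (CARD('d) + 1) / 2) * cmod (snd p x) \<le> C"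
  proof -
    obtain \<epsilon> where e: "\<epsilon> > 0" "\<forall>(bs, t)\<in>set R. t \<in> borel_measurable lborel \<and>
        (\<forall>x. (\<exists>j. \<bar>x $ j\<bar> < \<epsilon>) \<longrightarrow> t x = 0) \<and>
        (\<exists>C. \<forall>x. (1 + (norm x)\<^sup>2) powr (real (CARD('d) + 1) / 2) * cmod (t x) \<le> C)"
      using R unfolding admissible_rep_def by blast
    show thesis
    proof (rule that[OF e(1)])
      fix p assume "p \<in> set R"
      from bspec[OF e(2) this]
      show "snd p \<in> borel_measurable lborel" "\<And>x j. \<bar>x $ j\<bar> < \<epsilon> \<Longrightarrow> snd p x = 0"
        "\<exists>C. \<forall>x. (1 + (norm x)\<^sup>2) powr (real (CARD('d) + 1) / 2) * cmod (snd p x) \<le> C"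
        unfolding case_prod_beta by blast+
    qed
  qed
  have Tf: "T g = (\<Sum>p\<leftarrow>R. LINT x|lborel. snd p x * euler_adj_list (fst p) g x)" if "test g" for g
    using R that unfolding admissible_rep_def by (simp add: case_prod_unfold)
  let ?I = "LINT z|lborel. mon \<alpha> z * f z"
  have trm: "(LINT y|lborel. mon \<alpha> y * (LINT x|lborel. snd p x * euler_adj_list (fst p) f (dil x y))) = (LINT x|lborel. snd p x * euler_adj_list (fst p) (sgx \<alpha>) x) * ?I"
      "integrable lborel (\<lambda>y. mon \<alpha> y * (LINT x|lborel. snd p x * euler_adj_list (fst p) f (dil x y)))" if p: "p \<in> set R" for p
  proof -
    obtain C where C: "\<And>x. (1 + (norm x)\<^sup>2) powr (real (CARD('d) + 1) / 2) * cmod (snd p x) \<le> C" using Rp(3)[OF p] by blast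
    have euler: "test (euler_adj_list (fst p) f)" by (rule test_euler_adj_list[OF f])
    have mp1: "(LINT y|lborel. mon \<alpha> y * (LINT x|lborel. snd p x * euler_adj_list (fst p) f (dil x y))) = (LINT x|lborel. snd p x * sgx \<alpha> x) * (LINT z|lborel. mon \<alpha> z * euler_adj_list (fst p) f z)"
      by (rule monomial_pairing(1)[OF \<epsilon> Rp(1)[OF p] _ C euler]) (rule Rp(2)[OF p])
    show "integrable lborel (\<lambda>y. mon \<alpha> y * (LINT x|lborel. snd p x * euler_adj_list (fst p) f (dil x y)))"
      by (rule monomial_pairing(2)[OF \<epsilon> Rp(1)[OF p] _ C euler]) (rule Rp(2)[OF p])
    \<comment> \<open>\<open>euler_adj_list_sgx\<close> holds on \<open>Rstar\<close> only; at the
      other points \<open>snd p\<close> vanishes.\<close>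
    have "(LINT x|lborel. snd p x * euler_adj_list (fst p) (sgx \<alpha>) x) = (LINT x|lborel. eigen_weight \<alpha> (fst p) * (snd p x * sgx \<alpha> x))"
    proof (rule Bochner_Integration.integral_cong[OF refl])
      fix x
      show "snd p x * euler_adj_list (fst p) (sgx \<alpha>) x = eigen_weight \<alpha> (fst p) * (snd p x * sgx \<alpha> x)"
      proof (cases "x \<in> Rstar")
        case True
        then show ?thesis using euler_adj_list_sgx[of "sgx \<alpha>" 1 \<alpha> x "fst p"] by simp
      next
        case False
        then obtain j where "x $ j = 0" by (auto simp: Rstar_def)
        then have "\<bar>x $ j\<bar> < \<epsilon>" using \<epsilon> by simp
        then show ?thesis using Rp(2)[OF p] by simp
      qed
    qed
    then have "(LINT x|lborel. snd p x * euler_adj_list (fst p) (sgx \<alpha>) x) = eigen_weight \<alpha> (fst p) * (LINT x|lborel. snd p x * sgx \<alpha> x)" by simp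
    then show "(LINT y|lborel. mon \<alpha> y * (LINT x|lborel. snd p x * euler_adj_list (fst p) f (dil x y))) = (LINT x|lborel. snd p x * euler_adj_list (fst p) (sgx \<alpha>) x) * ?I"
      unfolding mp1 integral_mon_euler_adj_list[OF f] by (simp add: mult_ac)
  qed
  note tM = MT_spec(1)[OF T f]
  have Mm [measurable]: "MT T f \<in> borel_measurable borel" "mon \<alpha> \<in> borel_measurable borel"
    by (intro test_measurable tM borel_measurable_continuous_onI smooth_cont smooth_mon)+
  let ?Q = "\<lambda>y. \<Sum>p\<leftarrow>R. mon \<alpha> y * (LINT x|lborel. snd p x * euler_adj_list (fst p) f (dil x y))"
  have "mon \<alpha> y * MT T f y = ?Q y" if y: "y \<in> Rstar" for y
  proof -
    have "MT T f y = (\<Sum>p\<leftarrow>R. LINT x|lborel. snd p x * euler_adj_list (fst p) (fdil y f) x)"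
      by (simp only: MT_spec(2)[OF T f y] Tf[OF test_fdil[OF f y]])
    then have "MT T f y = (\<Sum>p\<leftarrow>R. LINT x|lborel. snd p x * fdil y (euler_adj_list (fst p) f) x)"
      by (simp only: euler_adj_list_fdil[OF f])
    then show ?thesis by (simp add: fdil_def sum_list_const_mult)
  qed
  \<comment> \<open>\<open>MT T f\<close> is given by \<open>T\<close> on \<open>Rstar\<close> only,
    but the hyperplanes form a null set.\<close>
  then have ae: "AE y in lborel. mon \<alpha> y * MT T f y = ?Q y" using Rstar_AE by (auto elim: eventually_mono)
  have iQ: "integrable lborel ?Q" by (rule sum_list_integral(1)) (rule trm(2))
  have "mono \<alpha> (MT T f) = (LINT y|lborel. mon \<alpha> y * MT T f y)" by (simp add: mono_eq tM)
  also have "\<dots> = (LINT y|lborel. ?Q y)"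
    by (rule integral_cong_AE) (use ae borel_measurable_integrable[OF iQ] in auto)
  also have "\<dots> = (\<Sum>p\<leftarrow>R. LINT y|lborel. mon \<alpha> y * (LINT x|lborel. snd p x * euler_adj_list (fst p) f (dil x y)))"
    by (rule sum_list_integral(2)) (rule trm(2))
  also have "\<dots> = (\<Sum>p\<leftarrow>R. (LINT x|lborel. snd p x * euler_adj_list (fst p) (sgx \<alpha>) x) * ?I)"
    by (intro arg_cong[of _ _ sum_list] map_cong refl trm(1))
  also have "\<dots> = rep_val R (sgx \<alpha>) * ?I"
    by (simp add: rep_val_def case_prod_unfold sum_list_mult_const)
  also have "\<dots> = rep_val R (sgx \<alpha>) * mono \<alpha> f" by (simp add: mono_eq f)
  finally show ?thesis .
qed

theorem theorem7:
  fixes T :: "'d::finite distr"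
  assumes "DH T"
  shows "hadamard (LT T) \<and>
    (\<forall>\<alpha>. LT T (mono \<alpha>) = (\<lambda>f. hpair T (sgx \<alpha>) * mono \<alpha> f))"
proof -
  have ev: "LT T (mono \<alpha>) = (\<lambda>f. hpair T (sgx \<alpha>) * mono \<alpha> f)" for \<alpha> :: "'d \<Rightarrow> nat"
  proof -
    \<comment> \<open>Existence ensures that the choice in \<open>hpair\<close> returns the value of
      some admissible representation; which one is immaterial, since \<open>mono_MT\<close> applies
      to all of them.\<close>
    have "\<exists>c R. admissible_rep T R \<and> c = rep_val R (sgx \<alpha>)" using admissible_rep_exists[OF assms] by blast
    then have "\<exists>R. admissible_rep T R \<and> hpair T (sgx \<alpha>) = rep_val R (sgx \<alpha>)"
      unfolding hpair_def by (rule someI_ex)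
    then obtain R where R: "admissible_rep T R" "hpair T (sgx \<alpha>) = rep_val R (sgx \<alpha>)" by blast
    show ?thesis
    proof
      fix f
      show "LT T (mono \<alpha>) f = hpair T (sgx \<alpha>) * mono \<alpha> f"
      proof (cases "test f")
        case True
        then show ?thesis using mono_MT[OF assms R(1) True, of \<alpha>] by (simp add: LT_def mconv_def R(2))
      next
        case False
        then show ?thesis by (simp add: LT_def mconv_def mono_def)
      qed
    qed
  qed
  then show ?thesis using hadamard_LT[OF assms] by blast
qed

end
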